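(* Let $n\ge1$ and let $S_n$ act on the quantum Weyl algebra $A_n^q(\mathsf{k})$ by simultaneous permutations of the variables $x_1,\dots,x_n$ and $y_1,\dots,y_n$. Put $h_i=y_ix_i$ for $i=1,\dots,n$. Then $A_n^q(\mathsf{k})^{S_n}$ is a Galois order over $\Gamma=\mathsf{k}[h_1,\dots,h_n]^{S_n}$. Moreover, $A_n^q(\mathsf{k})^{S_n}$ is free as a left $\Gamma$-module and free as a right $\Gamma$-module.
   Context: $\mathsf{k}$ is an algebraically closed field of characteristic $0$; all rings are $\mathsf{k}$-algebras; $q\in\mathsf{k}$ is nonzero and not a root of unity. The first quantum Weyl algebra is $A_1^q(\mathsf{k})=\mathsf{k}\langle x,y\mid yx-qxy=1\rangle$, and $A_n^q(\mathsf{k})=A_1^q(\mathsf{k})^{\otimes n}$ with generators $x_i,y_i$ in the $i$-th factor; $\pi\in S_n$ acts by $x_i\mapsto x_{\pi(i)}$, $y_i\mapsto y_{\pi(i)}$, hence permutes the $h_i$. Galois orders: Let $\Gamma$ be a commutative domain with field of fractions $K$, $L$ a finite Galois extension of $K$ with Galois group $H=\mathrm{Gal}(L/K)$, and $\mathfrak{M}\subset\mathrm{Aut}_{\mathsf{k}}L$ a monoid such that any $m,m'\in\mathfrak{M}$ with the same restriction to $K$ are equal, and on which $H$ acts by conjugation. $L*\mathfrak{M}$ is the skew monoid ring ($m\ell=m(\ell)m$), with $H$ acting by $h(\ell m)=h(\ell)\,(hmh^{-1})$. A finitely generated $\Gamma$-ring $U$ with $\Gamma\subset U\subset(L*\mathfrak{M})^H$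 is a Galois ring over $\Gamma$ if $KU=UK=(L*\mathfrak{M})^H$. It is a right (left) Galois order over $\Gamma$ if moreover for every finite-dimensional right (left) $K$-subspace $W\subset(L*\mathfrak{M})^H$, $W\cap U$ is a finitely generated right (left) $\Gamma$-module; it is a Galois order if it is both a left and a right Galois order. An algebra containing $\Gamma$ is called a Galois order over $\Gamma$ if it is isomorphic, over $\Gamma$, to such a $U$ for some choice of $L$ and $\mathfrak{M}$. *)

theory Defs
  imports "HOL-Algebra.Algebra" "HOL-Combinatorics.Permutations"
begin

text \<open>
  Elements of \<open>L * M\<close> are finitely supported functions; \<open>f\<close> stands for the sum of the \<open>f(m) m\<close>.
  The map \<open>act m\<close> is the endomorphism of \<open>L\<close> by which \<open>m\<close> acts, so \<open>m l = act m l m\<close>.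
\<close>

definition skew_monoid_ring ::
  "('l, 'r) ring_scheme \<Rightarrow> ('m, 's) monoid_scheme \<Rightarrow> ('m \<Rightarrow> 'l \<Rightarrow> 'l) \<Rightarrow> ('m \<Rightarrow> 'l) ring" where
  "skew_monoid_ring L M act = \<lparr>
     carrier = {f. (\<forall>m\<in>carrier M. f m \<in> carrier L) \<and> (\<forall>m. m \<notin> carrier M \<longrightarrow> f m = \<zero>\<^bsub>L\<^esub>) \<and>
                   finite {m. f m \<noteq> \<zero>\<^bsub>L\<^esub>}},
     monoid.mult = (\<lambda>f g m. \<Oplus>\<^bsub>L\<^esub>p\<in>{(a, b). a \<in> carrier M \<and> b \<in> carrier M \<and> f a \<noteq> \<zero>\<^bsub>L\<^esub> \<and> g b \<noteq> \<zero>\<^bsub>L\<^esub> \<and> a \<otimes>\<^bsub>M\<^esub> b = m}.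
                       f (fst p) \<otimes>\<^bsub>L\<^esub> act (fst p) (g (snd p))),
     one = (\<lambda>m. if m = \<one>\<^bsub>M\<^esub> then \<one>\<^bsub>L\<^esub> else \<zero>\<^bsub>L\<^esub>),
     ring.zero = (\<lambda>_. \<zero>\<^bsub>L\<^esub>),
     ring.add = (\<lambda>f g m. f m \<oplus>\<^bsub>L\<^esub> g m)\<rparr>"

definition skew_single :: "('l, 'r) ring_scheme \<Rightarrow> 'l \<Rightarrow> 'm \<Rightarrow> 'm \<Rightarrow> 'l" where
  "skew_single L l m = (\<lambda>m'. if m' = m then l else \<zero>\<^bsub>L\<^esub>)"

abbreviation monoid_algebra ::
  "('k, 'r) ring_scheme \<Rightarrow> ('m, 's) monoid_scheme \<Rightarrow> ('m \<Rightarrow> 'k) ring" where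
  "monoid_algebra k M \<equiv> skew_monoid_ring k M (\<lambda>_ c. c)"

datatype wgen = GenX | GenY

definition free_algebra :: "('k, 'r) ring_scheme \<Rightarrow> (wgen list \<Rightarrow> 'k) ring" where
  "free_algebra k = monoid_algebra k \<lparr>carrier = UNIV, monoid.mult = (@), one = []\<rparr>"

definition weyl1_ideal :: "('k, 'r) ring_scheme \<Rightarrow> 'k \<Rightarrow> (wgen list \<Rightarrow> 'k) set" where
  "weyl1_ideal k q = Idl\<^bsub>free_algebra k\<^esub>
     {skew_single k \<one>\<^bsub>k\<^esub> [GenY, GenX] \<ominus>\<^bsub>free_algebra k\<^esub> skew_single k q [GenX, GenY]
        \<ominus>\<^bsub>free_algebra k\<^esub> \<one>\<^bsub>free_algebra k\<^esub>}"

definition weyl1 :: "('k, 'r) ring_scheme \<Rightarrow> 'k \<Rightarrow> (wgen list \<Rightarrow> 'k) set ring" where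
  "weyl1 k q = free_algebra k Quot weyl1_ideal k q"

definition weyl1_const :: "('k, 'r) ring_scheme \<Rightarrow> 'k \<Rightarrow> 'k \<Rightarrow> (wgen list \<Rightarrow> 'k) set" where
  "weyl1_const k q c = weyl1_ideal k q +>\<^bsub>free_algebra k\<^esub> skew_single k c []"

definition weyl1_gen :: "('k, 'r) ring_scheme \<Rightarrow> 'k \<Rightarrow> wgen \<Rightarrow> (wgen list \<Rightarrow> 'k) set" where
  "weyl1_gen k q g = weyl1_ideal k q +>\<^bsub>free_algebra k\<^esub> skew_single k \<one>\<^bsub>k\<^esub> [g]"

text \<open>
  The \<open>n\<close>-th tensor power over \<open>k\<close> of a \<open>k\<close>-algebra \<open>B\<close> with structure map \<open>\<eta>\<close>. As usual it is the
  free \<open>k\<close>-module on the tuples in \<open>B\<^sup>n\<close> modulo the multilinearity relations. This free module,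
  with componentwise multiplication of tuples, is the monoid algebra of \<open>B\<^sup>n\<close>, in which the
  span of the relations is already a two-sided ideal. A pure tensor is the class of its tuple.
\<close>

abbreviation tuples :: "nat \<Rightarrow> ('b, 's) ring_scheme \<Rightarrow> (nat \<Rightarrow> 'b) monoid" where
  "tuples n B \<equiv> product_group {..<n} (\<lambda>_. B)"

definition tensor_ideal ::
  "('k, 'r) ring_scheme \<Rightarrow> nat \<Rightarrow> ('b, 's) ring_scheme \<Rightarrow> ('k \<Rightarrow> 'b) \<Rightarrow> ((nat \<Rightarrow> 'b) \<Rightarrow> 'k) set" where
  "tensor_ideal k n B \<eta> = (let P = monoid_algebra k (tuples n B) in Idl\<^bsub>P\<^esub>
     ({skew_single k \<one>\<^bsub>k\<^esub> (t(i := a \<oplus>\<^bsub>B\<^esub> b)) \<ominus>\<^bsub>P\<^esub>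
         (skew_single k \<one>\<^bsub>k\<^esub> (t(i := a)) \<oplus>\<^bsub>P\<^esub> skew_single k \<one>\<^bsub>k\<^esub> (t(i := b))) | t i a b.
         t \<in> carrier (tuples n B) \<and> i < n \<and> a \<in> carrier B \<and> b \<in> carrier B} \<union>
      {skew_single k \<one>\<^bsub>k\<^esub> (t(i := \<eta> c \<otimes>\<^bsub>B\<^esub> a)) \<ominus>\<^bsub>P\<^esub> skew_single k c (t(i := a)) | t i a c.
         t \<in> carrier (tuples n B) \<and> i < n \<and> a \<in> carrier B \<and> c \<in> carrier k}))"

definition tensor_power ::
  "('k, 'r) ring_scheme \<Rightarrow> nat \<Rightarrow> ('b, 's) ring_scheme \<Rightarrow> ('k \<Rightarrow> 'b) \<Rightarrow> ((nat \<Rightarrow> 'b) \<Rightarrow> 'k) set ring" where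
  "tensor_power k n B \<eta> = monoid_algebra k (tuples n B) Quot tensor_ideal k n B \<eta>"

definition tensor_single ::
  "('k, 'r) ring_scheme \<Rightarrow> nat \<Rightarrow> ('b, 's) ring_scheme \<Rightarrow> ('k \<Rightarrow> 'b) \<Rightarrow> 'k \<Rightarrow> (nat \<Rightarrow> 'b) \<Rightarrow> ((nat \<Rightarrow> 'b) \<Rightarrow> 'k) set" where
  "tensor_single k n B \<eta> c t =
     tensor_ideal k n B \<eta> +>\<^bsub>monoid_algebra k (tuples n B)\<^esub> skew_single k c t"

type_synonym 'k weyl = "((nat \<Rightarrow> (wgen list \<Rightarrow> 'k) set) \<Rightarrow> 'k) set"

definition weyl :: "('k, 'r) ring_scheme \<Rightarrow> 'k \<Rightarrow> nat \<Rightarrow> 'k weyl ring" where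
  "weyl k q n = tensor_power k n (weyl1 k q) (weyl1_const k q)"

definition weyl_const :: "('k, 'r) ring_scheme \<Rightarrow> 'k \<Rightarrow> nat \<Rightarrow> 'k \<Rightarrow> 'k weyl" where
  "weyl_const k q n c =
     tensor_single k n (weyl1 k q) (weyl1_const k q) c \<one>\<^bsub>tuples n (weyl1 k q)\<^esub>"

text \<open>Tensor factors, and so the variables \<open>x\<^sub>i\<close>, \<open>y\<^sub>i\<close>, are indexed by \<open>i < n\<close> instead of \<open>1, \<dots>, n\<close>.\<close>

definition weyl_gen :: "('k, 'r) ring_scheme \<Rightarrow> 'k \<Rightarrow> nat \<Rightarrow> wgen \<Rightarrow> nat \<Rightarrow> 'k weyl" where
  "weyl_gen k q n g i =
     tensor_single k n (weyl1 k q) (weyl1_const k q) \<one>\<^bsub>k\<^esub>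
       ((\<one>\<^bsub>tuples n (weyl1 k q)\<^esub>)(i := weyl1_gen k q g))"

definition weyl_h :: "('k, 'r) ring_scheme \<Rightarrow> 'k \<Rightarrow> nat \<Rightarrow> nat \<Rightarrow> 'k weyl" where
  "weyl_h k q n i = weyl_gen k q n GenY i \<otimes>\<^bsub>weyl k q n\<^esub> weyl_gen k q n GenX i"

text \<open>
  A permutation \<open>p\<close> moves the \<open>i\<close>-th tensor factor to place \<open>p i\<close>, that is, it sends the tuple
  \<open>t\<close> to \<open>t \<circ> p\<^sup>-\<^sup>1\<close>; hence it sends the function \<open>f\<close> to \<open>\<lambda>t. f (t \<circ> p)\<close>, and acts on
  residue classes by taking images. It is the \<open>k\<close>-algebra automorphism
  with \<open>x\<^sub>i \<mapsto> x\<^bsub>p i\<^esub>\<close> and \<open>y\<^sub>i \<mapsto> y\<^bsub>p i\<^esub>\<close>.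
\<close>

definition weyl_perm :: "(nat \<Rightarrow> nat) \<Rightarrow> 'k weyl \<Rightarrow> 'k weyl" where
  "weyl_perm p a = (\<lambda>f t. f (t \<circ> p)) ` a"

definition weyl_inv :: "('k, 'r) ring_scheme \<Rightarrow> 'k \<Rightarrow> nat \<Rightarrow> 'k weyl set" where
  "weyl_inv k q n = {a \<in> carrier (weyl k q n). \<forall>p. p permutes {..<n} \<longrightarrow> weyl_perm p a = a}"

definition weyl_Gamma :: "('k, 'r) ring_scheme \<Rightarrow> 'k \<Rightarrow> nat \<Rightarrow> 'k weyl set" where
  "weyl_Gamma k q n =
     {a \<in> generate_ring (weyl k q n) (weyl_const k q n ` carrier k \<union> weyl_h k q n ` {..<n}).
        \<forall>p. p permutes {..<n} \<longrightarrow> weyl_perm p a = a}"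

definition left_module :: "('a, 'r) ring_scheme \<Rightarrow> 'a set \<Rightarrow> ('a, 'a) module" where
  "left_module R W = \<lparr>carrier = W, monoid.mult = monoid.mult R, one = monoid.one R, ring.zero = ring.zero R, ring.add = ring.add R,
                      smult = (\<lambda>a w. a \<otimes>\<^bsub>R\<^esub> w)\<rparr>"

text \<open>Scalars will always be commutative, so a right module is a module in the sense of the library.\<close>

definition right_module :: "('a, 'r) ring_scheme \<Rightarrow> 'a set \<Rightarrow> ('a, 'a) module" where
  "right_module R W = \<lparr>carrier = W, monoid.mult = monoid.mult R, one = monoid.one R, ring.zero = ring.zero R, ring.add = ring.add R,
                       smult = (\<lambda>a w. w \<otimes>\<^bsub>R\<^esub> a)\<rparr>"

definition module_span :: "('a, 'r) ring_scheme \<Rightarrow> ('a, 'b, 's) module_scheme \<Rightarrow> 'b set \<Rightarrow> 'b set" where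
  "module_span R V B =
     {\<Oplus>\<^bsub>V\<^esub>v\<in>T. c v \<odot>\<^bsub>V\<^esub> v | T c. finite T \<and> T \<subseteq> B \<and> c \<in> T \<rightarrow> carrier R}"

definition module_indep :: "('a, 'r) ring_scheme \<Rightarrow> ('a, 'b, 's) module_scheme \<Rightarrow> 'b set \<Rightarrow> bool" where
  "module_indep R V B \<longleftrightarrow>
     (\<forall>T c. finite T \<and> T \<subseteq> B \<and> c \<in> T \<rightarrow> carrier R \<and> (\<Oplus>\<^bsub>V\<^esub>v\<in>T. c v \<odot>\<^bsub>V\<^esub> v) = \<zero>\<^bsub>V\<^esub>
        \<longrightarrow> (\<forall>v\<in>T. c v = \<zero>\<^bsub>R\<^esub>))"

definition module_basis :: "('a, 'r) ring_scheme \<Rightarrow> ('a, 'b, 's) module_scheme \<Rightarrow> 'b set \<Rightarrow> bool" where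
  "module_basis R V B \<longleftrightarrow> B \<subseteq> carrier V \<and> module_span R V B = carrier V \<and> module_indep R V B"

definition fg_module :: "('a, 'r) ring_scheme \<Rightarrow> ('a, 'b, 's) module_scheme \<Rightarrow> bool" where
  "fg_module R V \<longleftrightarrow>
     module R V \<and> (\<exists>B. finite B \<and> B \<subseteq> carrier V \<and> module_span R V B = carrier V)"

definition free_module :: "('a, 'r) ring_scheme \<Rightarrow> ('a, 'b, 's) module_scheme \<Rightarrow> bool" where
  "free_module R V \<longleftrightarrow> module R V \<and> (\<exists>B. module_basis R V B)"

definition fin_dim_space :: "('a, 'r) ring_scheme \<Rightarrow> ('a, 'b, 's) module_scheme \<Rightarrow> bool" where
  "fin_dim_space R V \<longleftrightarrow> field R \<and> module R V \<and> (\<exists>B. finite B \<and> module_basis R V B)"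

definition frac_in :: "('l, 'r) ring_scheme \<Rightarrow> 'l set \<Rightarrow> 'l set" where
  "frac_in L \<Gamma> = {a \<otimes>\<^bsub>L\<^esub> inv\<^bsub>L\<^esub> b | a b. a \<in> \<Gamma> \<and> b \<in> \<Gamma> - {\<zero>\<^bsub>L\<^esub>}}"

text \<open>Field automorphisms fixing \<open>F\<close> pointwise: \<open>Gal(L/F)\<close>, or \<open>Aut\<^sub>k L\<close> if \<open>F\<close> is the image of \<open>k\<close>.\<close>

definition aut_over :: "('l, 'r) ring_scheme \<Rightarrow> 'l set \<Rightarrow> ('l \<Rightarrow> 'l) set" where
  "aut_over L F = {s \<in> ring_hom L L \<inter> Bij (carrier L). \<forall>x\<in>F. s x = x}"

text \<open>A finite extension is Galois if \<open>K\<close> is the fixed field of \<open>Gal(L/K)\<close>.\<close>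

definition finite_galois :: "('l, 'r) ring_scheme \<Rightarrow> 'l set \<Rightarrow> bool" where
  "finite_galois L K \<longleftrightarrow> field L \<and> subfield K L \<and> ring.finite_dimension L K (carrier L) \<and>
     {x \<in> carrier L. \<forall>h\<in>aut_over L K. h x = x} = K"

text \<open>Here \<open>C\<close> is the image of the base field in \<open>L\<close>.\<close>

definition galois_setting :: "('l, 'r) ring_scheme \<Rightarrow> 'l set \<Rightarrow> 'l set \<Rightarrow> ('l \<Rightarrow> 'l) set \<Rightarrow> bool" where
  "galois_setting L C \<Gamma> M \<longleftrightarrow>
     field L \<and> subfield C L \<and> subdomain \<Gamma> L \<and> C \<subseteq> \<Gamma> \<and>
     finite_galois L (frac_in L \<Gamma>) \<and>
     M \<subseteq> aut_over L C \<and> submonoid M (BijGroup (carrier L)) \<and>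
     (\<forall>m\<in>M. \<forall>m'\<in>M. (\<forall>x\<in>frac_in L \<Gamma>. m x = m' x) \<longrightarrow> m = m') \<and>
     (\<forall>h\<in>aut_over L (frac_in L \<Gamma>). \<forall>m\<in>M.
        h \<otimes>\<^bsub>BijGroup (carrier L)\<^esub> m \<otimes>\<^bsub>BijGroup (carrier L)\<^esub> inv\<^bsub>BijGroup (carrier L)\<^esub> h \<in> M)"

definition aut_skew_ring :: "('l, 'r) ring_scheme \<Rightarrow> ('l \<Rightarrow> 'l) set \<Rightarrow> (('l \<Rightarrow> 'l) \<Rightarrow> 'l) ring" where
  "aut_skew_ring L M = skew_monoid_ring L ((BijGroup (carrier L))\<lparr>carrier := M\<rparr>) (\<lambda>m. m)"

definition skew_embed :: "('l, 'r) ring_scheme \<Rightarrow> 'l \<Rightarrow> (('l \<Rightarrow> 'l) \<Rightarrow> 'l)" where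
  "skew_embed L l = skew_single L l \<one>\<^bsub>BijGroup (carrier L)\<^esub>"

text \<open>The action \<open>h(l m) = h(l) (h m h\<^sup>-\<^sup>1)\<close>, read off at the coefficient of \<open>m\<close>.\<close>

definition galois_act ::
  "('l, 'r) ring_scheme \<Rightarrow> ('l \<Rightarrow> 'l) set \<Rightarrow> ('l \<Rightarrow> 'l) \<Rightarrow> (('l \<Rightarrow> 'l) \<Rightarrow> 'l) \<Rightarrow> (('l \<Rightarrow> 'l) \<Rightarrow> 'l)" where
  "galois_act L M h f = (\<lambda>m. if m \<in> M
     then h (f (inv\<^bsub>BijGroup (carrier L)\<^esub> h \<otimes>\<^bsub>BijGroup (carrier L)\<^esub> m \<otimes>\<^bsub>BijGroup (carrier L)\<^esub> h))
     else \<zero>\<^bsub>L\<^esub>)"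

definition skew_inv :: "('l, 'r) ring_scheme \<Rightarrow> 'l set \<Rightarrow> ('l \<Rightarrow> 'l) set \<Rightarrow> (('l \<Rightarrow> 'l) \<Rightarrow> 'l) set" where
  "skew_inv L \<Gamma> M =
     {f \<in> carrier (aut_skew_ring L M). \<forall>h\<in>aut_over L (frac_in L \<Gamma>). galois_act L M h f = f}"

text \<open>For \<open>S\<close> or \<open>T\<close> closed under negation this additive subgroup consists of the finite sums of products, the usual \<open>ST\<close>.\<close>

definition prod_span :: "('a, 'r) ring_scheme \<Rightarrow> 'a set \<Rightarrow> 'a set \<Rightarrow> 'a set" where
  "prod_span R S T = generate (add_monoid R) (S <#>\<^bsub>R\<^esub> T)"

text \<open>
  A \<open>\<Gamma>\<close>-ring need not contain \<open>\<Gamma>\<close> in its centre; it is finitely generated if it is generated, as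
  a ring, by \<open>\<Gamma>\<close> and finitely many elements.
\<close>

definition galois_ring ::
  "('l, 'r) ring_scheme \<Rightarrow> 'l set \<Rightarrow> 'l set \<Rightarrow> ('l \<Rightarrow> 'l) set \<Rightarrow> (('l \<Rightarrow> 'l) \<Rightarrow> 'l) set \<Rightarrow> bool" where
  "galois_ring L C \<Gamma> M U \<longleftrightarrow>
     galois_setting L C \<Gamma> M \<and>
     subring U (aut_skew_ring L M) \<and>
     skew_embed L ` \<Gamma> \<subseteq> U \<and> U \<subseteq> skew_inv L \<Gamma> M \<and>
     (\<exists>S. finite S \<and> S \<subseteq> U \<and> generate_ring (aut_skew_ring L M) (skew_embed L ` \<Gamma> \<union> S) = U) \<and>
     prod_span (aut_skew_ring L M) (skew_embed L ` frac_in L \<Gamma>) U = skew_inv L \<Gamma> M \<and>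
     prod_span (aut_skew_ring L M) U (skew_embed L ` frac_in L \<Gamma>) = skew_inv L \<Gamma> M"

definition left_galois_order ::
  "('l, 'r) ring_scheme \<Rightarrow> 'l set \<Rightarrow> 'l set \<Rightarrow> ('l \<Rightarrow> 'l) set \<Rightarrow> (('l \<Rightarrow> 'l) \<Rightarrow> 'l) set \<Rightarrow> bool" where
  "left_galois_order L C \<Gamma> M U \<longleftrightarrow> galois_ring L C \<Gamma> M U \<and>
     (\<forall>W. W \<subseteq> skew_inv L \<Gamma> M \<and>
          fin_dim_space ((aut_skew_ring L M)\<lparr>carrier := skew_embed L ` frac_in L \<Gamma>\<rparr>)
            (left_module (aut_skew_ring L M) W) \<longrightarrow>
          fg_module ((aut_skew_ring L M)\<lparr>carrier := skew_embed L ` \<Gamma>\<rparr>)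
            (left_module (aut_skew_ring L M) (W \<inter> U)))"

definition right_galois_order ::
  "('l, 'r) ring_scheme \<Rightarrow> 'l set \<Rightarrow> 'l set \<Rightarrow> ('l \<Rightarrow> 'l) set \<Rightarrow> (('l \<Rightarrow> 'l) \<Rightarrow> 'l) set \<Rightarrow> bool" where
  "right_galois_order L C \<Gamma> M U \<longleftrightarrow> galois_ring L C \<Gamma> M U \<and>
     (\<forall>W. W \<subseteq> skew_inv L \<Gamma> M \<and>
          fin_dim_space ((aut_skew_ring L M)\<lparr>carrier := skew_embed L ` frac_in L \<Gamma>\<rparr>)
            (right_module (aut_skew_ring L M) W) \<longrightarrow>
          fg_module ((aut_skew_ring L M)\<lparr>carrier := skew_embed L ` \<Gamma>\<rparr>)
            (right_module (aut_skew_ring L M) (W \<inter> U)))"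

definition galois_order ::
  "('l, 'r) ring_scheme \<Rightarrow> 'l set \<Rightarrow> 'l set \<Rightarrow> ('l \<Rightarrow> 'l) set \<Rightarrow> (('l \<Rightarrow> 'l) \<Rightarrow> 'l) set \<Rightarrow> bool" where
  "galois_order L C \<Gamma> M U \<longleftrightarrow> left_galois_order L C \<Gamma> M U \<and> right_galois_order L C \<Gamma> M U"

text \<open>
  The abstract notion, for an algebra \<open>A\<close> over the central subfield \<open>C\<close>, containing \<open>\<Gamma>\<close>. The map
  \<open>\<iota>\<close> embeds \<open>\<Gamma>\<close>, hence its field of fractions, into \<open>L\<close>, and \<open>\<phi>\<close> is an isomorphism over \<open>\<Gamma>\<close>.
  HOL cannot quantify over the type that carries \<open>L\<close>. The type chosen is the one that carries the usual
  construction of fractions by classes of pairs of elements of \<open>A\<close>; for infinite \<open>\<Gamma>\<close> this is no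
  restriction, since a finite extension of the field of fractions of \<open>\<Gamma>\<close> has the cardinality of \<open>\<Gamma>\<close>
  and so can be transported to this type.
\<close>

definition galois_order_over :: "('a, 'r) ring_scheme \<Rightarrow> 'a set \<Rightarrow> 'a set \<Rightarrow> bool" where
  "galois_order_over A C \<Gamma> \<longleftrightarrow>
     ring A \<and> subfield C A \<and> (\<forall>c\<in>C. \<forall>a\<in>carrier A. c \<otimes>\<^bsub>A\<^esub> a = a \<otimes>\<^bsub>A\<^esub> c) \<and>
     subdomain \<Gamma> A \<and> C \<subseteq> \<Gamma> \<and>
     (\<exists>(L :: ('a \<times> 'a) set ring) M U \<iota> \<phi>.
        \<iota> \<in> ring_hom (A\<lparr>carrier := \<Gamma>\<rparr>) L \<and> inj_on \<iota> \<Gamma> \<and>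
        galois_order L (\<iota> ` C) (\<iota> ` \<Gamma>) M U \<and>
        \<phi> \<in> ring_iso A ((aut_skew_ring L M)\<lparr>carrier := U\<rparr>) \<and>
        (\<forall>g\<in>\<Gamma>. \<phi> g = skew_embed L (\<iota> g)))"

end

theory Submission
	imports Defs "HOL-Library.Function_Algebras" "HOL-Library.Product_Plus"
begin

text \<open>
  Put \<open>h0 = 1 / (1 - q)\<close>, the fixed point of \<open>h \<mapsto> 1 + q h\<close>, and \<open>z\<^sub>i = h\<^sub>i - h0\<close>. The defining relation turns
  into \<open>y z = q z y\<close>, \<open>z x = q x z\<close>, so \<open>A\<close> is spanned by the monomials in which each slot carries
  \<open>z\<^sup>a y\<^sup>m\<close> or \<open>z\<^sup>a x\<^sup>m\<close>. A monomial is coded by its exponents, a function to pairs in \<open>nat \<times> int\<close>; the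
  formal combinations of these codes form the ring \<open>P\<close>, polynomials in the \<open>z\<^sub>i\<close> and Laurent polynomials
  in further variables, with subring \<open>Lam\<close> of polynomials in the \<open>z\<^sub>i\<close>. The ring \<open>P\<close> is commutative and is
  used only as a \<open>Lam\<close>-module with an action of the symmetric group. Let \<open>L\<close> be the field of fractions
  of \<open>Lam\<close> and \<open>Mon\<close> the group of the scalings \<open>z\<^sub>i \<mapsto> q\<^bsup>a i\<^esup> z\<^sub>i\<close>. Sending \<open>y\<^sub>i\<close> to the scaling of \<open>z\<^sub>i\<close> by \<open>q\<close>, and
  \<open>x\<^sub>i\<close> to the inverse scaling with coefficient \<open>z\<^sub>i / q + h0\<close>, represents \<open>A\<close> in the skew ring \<open>T = L * Mon\<close>
  (\<open>Ph\<close>). The monomials go to multiples of distinct elements \<open>z\<^sup>a m\<close>, so they are a basis \<open>Ps\<close> of \<open>A\<close> and the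
  representation is faithful; it is equivariant, so the invariants go onto the invariant elements \<open>U\<close>
  of the image.

  Three facts about \<open>P\<close> carry the rest. By \<open>Inv_free\<close>, the symmetric elements of \<open>P\<close> are free over the
  symmetric polynomials \<open>Gam\<close>; the maps \<open>Th s\<close> carry the module structure of \<open>P\<close> to left or right
  multiplication on \<open>T\<close>, whence both freeness claims. By \<open>fg_submodule\<close>, submodules of bounded Laurent degree
  are finitely generated; a finite-dimensional subspace of \<open>T\<close> involves finitely many scalings, whence the
  order conditions. By \<open>norm_exists\<close> every polynomial divides a symmetric one, so that denominators can be
  cleared symmetrically, whence \<open>K U = U K\<close> is the whole invariant skew ring.

  The extension \<open>L / K\<close> is Galois with the symmetric group: the \<open>z\<^sub>i\<close> are the roots of a polynomial over
  \<open>Gam\<close>, and \<open>L\<close> is finite over \<open>K\<close> because \<open>Lam\<close> is finite over \<open>Gam\<close>. A scaling that acts on \<open>K\<close> as the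
  identity would permute the \<open>z\<^sub>i\<close>, hence is trivial as \<open>q\<close> is not a root of unity.

  That \<open>U\<close> is a finitely generated \<open>Gam\<close>-ring uses characteristic \<open>0\<close>. By polarization the invariants are
  generated by the power sums \<open>pw b\<close>. Commutators with symmetric polynomials in the \<open>z\<^sub>i\<close> produce those
  of \<open>z\<^sup>a y\<^sup>m\<close> and \<open>z\<^sup>a x\<^sup>m\<close> from those of \<open>y\<^sup>m\<close> and \<open>x\<^sup>m\<close>, and Newton's identities reduce the latter to the
  finitely many elementary symmetric expressions in the \<open>y\<^sub>i\<close>, or in the \<open>x\<^sub>i\<close>.
\<close>

text \<open>Short names for the facts about ring homomorphisms and for the elements with one coefficient.\<close>

lemmas rhm = ring_hom_mult and rha = ring_hom_add and rh1 = ring_hom_one and rhc = ring_hom_closed and rh0 = ring_hom_zero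

abbreviation "sgl == skew_single"

section \<open>Skew monoid rings\<close>

locale skew_monoid = R?: ring R + M?: monoid M
	for R :: "('l, 'r) ring_scheme" (structure) and M :: "('m, 's) monoid_scheme" and act +
	assumes act_hom: "m:carrier M ==> act m:ring_hom R R"
		and act_one: "r:carrier R ==> act \<one>\<^bsub>M\<^esub> r = r"
		and act_mult: "[|a:carrier M; b:carrier M; r:carrier R|] ==> act (a \<otimes>\<^bsub>M\<^esub> b) r = act a (act b r)"
begin

abbreviation "S == skew_monoid_ring R M act"

abbreviation "supp f == {m. f m ~= \<zero>}"

lemma act_closed: "m:carrier M ==> r:carrier R ==> act m r:carrier R"
	by (rule ring_hom_memE(1)[OF act_hom])

lemma act_mult_dist: "m:carrier M ==> r:carrier R ==> s:carrier R ==> act m (r \<otimes> s) = act m r \<otimes> act m s"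
	by (rule ring_hom_memE(2)[OF act_hom])

lemma act_add: "m:carrier M ==> r:carrier R ==> s:carrier R ==> act m (r \<oplus> s) = act m r \<oplus> act m s"
	by (rule ring_hom_memE(3)[OF act_hom])

lemma act_unit: "m:carrier M ==> act m \<one> = \<one>"
	by (rule ring_hom_memE(4)[OF act_hom])

lemma act_zero: "m:carrier M ==> act m \<zero> = \<zero>"
	by (rule rh0[OF act_hom R.ring_axioms R.ring_axioms])

context
	notes [simp] = act_closed act_zero
begin

lemma carrier_S: "f:carrier S \<longleftrightarrow> (\<forall>m. f m:carrier R) & supp f \<subseteq> carrier M & finite (supp f)"
	unfolding skew_monoid_ring_def by auto

lemma S_closed: "f:carrier S ==> f m:carrier R"
	and S_out: "f:carrier S ==> m \<notin> carrier M ==> f m = \<zero>"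
	and S_finite: "f:carrier S ==> finite (supp f)"
	and S_supp: "f:carrier S ==> supp f \<subseteq> carrier M"
	by (auto simp: carrier_S)

lemma add_S [simp]: "f \<oplus>\<^bsub>S\<^esub> g = (%m. f m \<oplus> g m)"
	and zero_S: "\<zero>\<^bsub>S\<^esub> = (%_. \<zero>)"
	and one_S: "\<one>\<^bsub>S\<^esub> = sgl R \<one> \<one>\<^bsub>M\<^esub>"
	unfolding skew_monoid_ring_def skew_single_def by simp_all

lemma single_closed [simp]: "r:carrier R ==> m:carrier M ==> sgl R r m:carrier S"
	by (auto simp: carrier_S skew_single_def split: if_splits intro: finite_subset[of _ "{m}"])

lemma single_supp: "supp (sgl R r m) \<subseteq> {m}"
	by (auto simp: skew_single_def)

lemma S_add_closed:
	assumes "f:carrier S" "g:carrier S" shows "(%m. f m \<oplus> g m):carrier S"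
proof -
	have sub: "supp (%m. f m \<oplus> g m) \<subseteq> supp f \<union> supp g" by auto
	show ?thesis
		unfolding carrier_S
		using sub S_supp[OF assms(1)] S_supp[OF assms(2)] finite_subset[OF sub] S_finite assms
		by (simp add: S_closed) blast
qed

lemma S_uminus_closed:
	assumes f: "f:carrier S" shows "(%m. \<ominus> f m):carrier S"
	unfolding carrier_S using S_supp[OF f] S_finite[OF f] S_closed[OF f]
	by (auto intro: finite_subset[of _ "supp f"])

lemma S_abelian: "abelian_group S"
proof (rule abelian_groupI, goal_cases)
	case (6 x)
	then show ?case
		by (intro bexI[OF _ S_uminus_closed[OF 6]]) (simp add: zero_S fun_eq_iff R.l_neg S_closed)
qed (simp_all add: S_add_closed zero_S fun_eq_iff R.a_ac S_closed, simp add: carrier_S)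

lemmas [simp] = S_closed S_finite

lemma mult_S:
	assumes f: "f:carrier S" and g: "g:carrier S"
		and A: "finite A" "supp f \<subseteq> A" "A \<subseteq> carrier M" and B: "finite B" "supp g \<subseteq> B" "B \<subseteq> carrier M"
	shows "(f \<otimes>\<^bsub>S\<^esub> g) m = (\<Oplus>p\<in>A \<times> B. if fst p \<otimes>\<^bsub>M\<^esub> snd p = m then f (fst p) \<otimes> act (fst p) (g (snd p)) else \<zero>)"
proof -
	have "(f \<otimes>\<^bsub>S\<^esub> g) m = (\<Oplus>p\<in>{(a, b). a:carrier M & b:carrier M & f a ~= \<zero> & g b ~= \<zero> & a \<otimes>\<^bsub>M\<^esub> b = m}.
											 f (fst p) \<otimes> act (fst p) (g (snd p)))"
		unfolding skew_monoid_ring_def by simp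
	also have "... = (\<Oplus>p\<in>A \<times> B. if fst p \<otimes>\<^bsub>M\<^esub> snd p = m then f (fst p) \<otimes> act (fst p) (g (snd p)) else \<zero>)"
		using assms
		by (intro R.add.finprod_mono_neutral_cong_left) (auto split: if_splits)
	finally show ?thesis .
qed

lemma mult_supp:
	assumes f: "f:carrier S" and g: "g:carrier S" and nz: "(f \<otimes>\<^bsub>S\<^esub> g) m ~= \<zero>"
	obtains a b where "f a ~= \<zero>" "g b ~= \<zero>" "m = a \<otimes>\<^bsub>M\<^esub> b"
proof -
	note m = mult_S[OF f g S_finite[OF f] order_refl S_supp[OF f] S_finite[OF g] order_refl S_supp[OF g]]
	have "\<exists>a b. f a ~= \<zero> & g b ~= \<zero> & m = a \<otimes>\<^bsub>M\<^esub> b"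
	proof (rule ccontr)
		assume no: "\<not> ?thesis"
		have "(f \<otimes>\<^bsub>S\<^esub> g) m = (\<Oplus>p\<in>supp f \<times> supp g. \<zero>)"
			unfolding m
		proof (rule R.finsum_cong')
			fix p assume "p:supp f \<times> supp g"
			then have "f (fst p) ~= \<zero>" "g (snd p) ~= \<zero>" by auto
			then have "fst p \<otimes>\<^bsub>M\<^esub> snd p ~= m" using no by blast
			then show "(if fst p \<otimes>\<^bsub>M\<^esub> snd p = m then f (fst p) \<otimes> act (fst p) (g (snd p)) else \<zero>) = \<zero>" by simp
		qed auto
		then show False using nz by simp
	qed
	then show ?thesis using that by blast
qed

lemma S_mult_closed:
	assumes f: "f:carrier S" and g: "g:carrier S"
	shows "f \<otimes>\<^bsub>S\<^esub> g:carrier S"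
proof -
	note m = mult_S[OF f g S_finite[OF f] order_refl S_supp[OF f] S_finite[OF g] order_refl S_supp[OF g]]
	have cl: "(f \<otimes>\<^bsub>S\<^esub> g) m:carrier R" for m
		unfolding m by (rule R.finsum_closed) (use f g S_supp[OF f] in auto)
	have sub: "supp (f \<otimes>\<^bsub>S\<^esub> g) \<subseteq> (%p. fst p \<otimes>\<^bsub>M\<^esub> snd p) ` (supp f \<times> supp g)"
	proof
		fix m assume "m:supp (f \<otimes>\<^bsub>S\<^esub> g)"
		then obtain a b where "f a ~= \<zero>" "g b ~= \<zero>" "m = a \<otimes>\<^bsub>M\<^esub> b" using mult_supp[OF f g] by blast
		then show "m:(%p. fst p \<otimes>\<^bsub>M\<^esub> snd p) ` (supp f \<times> supp g)"
			by (intro image_eqI[of _ _ "(a, b)"]) simp_all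
	qed
	have "supp (f \<otimes>\<^bsub>S\<^esub> g) \<subseteq> carrier M"
		using sub S_supp[OF f] S_supp[OF g] by fastforce
	moreover have "finite (supp (f \<otimes>\<^bsub>S\<^esub> g))"
		by (rule finite_subset[OF sub]) (use f g in auto)
	ultimately show ?thesis using cl unfolding carrier_S by blast
qed

lemma S_distrib:
	assumes f: "f:carrier S" and g: "g:carrier S" and h: "h:carrier S"
	shows "(f \<oplus>\<^bsub>S\<^esub> g) \<otimes>\<^bsub>S\<^esub> h = (f \<otimes>\<^bsub>S\<^esub> h) \<oplus>\<^bsub>S\<^esub> (g \<otimes>\<^bsub>S\<^esub> h)"
		and "h \<otimes>\<^bsub>S\<^esub> (f \<oplus>\<^bsub>S\<^esub> g) = (h \<otimes>\<^bsub>S\<^esub> f) \<oplus>\<^bsub>S\<^esub> (h \<otimes>\<^bsub>S\<^esub> g)"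
proof -
	define A where "A = supp f \<union> supp g"
	define B where "B = supp h"
	have A: "finite A" "A \<subseteq> carrier M" "supp f \<subseteq> A" "supp g \<subseteq> A" "supp (%m. f m \<oplus> g m) \<subseteq> A"
		and B: "finite B" "B \<subseteq> carrier M" "supp h \<subseteq> B"
		using f g h S_supp[OF f] S_supp[OF g] S_supp[OF h] by (auto simp: A_def B_def)
	note fg = S_add_closed[OF f g]
	show "(f \<oplus>\<^bsub>S\<^esub> g) \<otimes>\<^bsub>S\<^esub> h = (f \<otimes>\<^bsub>S\<^esub> h) \<oplus>\<^bsub>S\<^esub> (g \<otimes>\<^bsub>S\<^esub> h)"
	proof
		fix m
		let ?t = "%f p. if fst p \<otimes>\<^bsub>M\<^esub> snd p = m then f (fst p) \<otimes> act (fst p) (h (snd p)) else \<zero>"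
		have "(\<Oplus>p\<in>A \<times> B. ?t (%m. f m \<oplus> g m) p) = (\<Oplus>p\<in>A \<times> B. ?t f p \<oplus> ?t g p)"
			by (rule R.finsum_cong') (use A B f g h in \<open>auto simp: R.l_distr subsetD\<close>)
		also have "... = (\<Oplus>p\<in>A \<times> B. ?t f p) \<oplus> (\<Oplus>p\<in>A \<times> B. ?t g p)"
			by (rule R.finsum_addf) (use A B f g h in \<open>auto simp: subsetD\<close>)
		finally show "((f \<oplus>\<^bsub>S\<^esub> g) \<otimes>\<^bsub>S\<^esub> h) m = ((f \<otimes>\<^bsub>S\<^esub> h) \<oplus>\<^bsub>S\<^esub> (g \<otimes>\<^bsub>S\<^esub> h)) m"
			using A B f g h fg by (simp add: mult_S[of _ _ A B])
	qed
	show "h \<otimes>\<^bsub>S\<^esub> (f \<oplus>\<^bsub>S\<^esub> g) = (h \<otimes>\<^bsub>S\<^esub> f) \<oplus>\<^bsub>S\<^esub> (h \<otimes>\<^bsub>S\<^esub> g)"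
	proof
		fix m
		let ?t = "%f p. if fst p \<otimes>\<^bsub>M\<^esub> snd p = m then h (fst p) \<otimes> act (fst p) (f (snd p)) else \<zero>"
		have "(\<Oplus>p\<in>B \<times> A. ?t (%m. f m \<oplus> g m) p) = (\<Oplus>p\<in>B \<times> A. ?t f p \<oplus> ?t g p)"
			by (rule R.finsum_cong') (use A B f g h in \<open>auto simp: R.r_distr subsetD act_add\<close>)
		also have "... = (\<Oplus>p\<in>B \<times> A. ?t f p) \<oplus> (\<Oplus>p\<in>B \<times> A. ?t g p)"
			by (rule R.finsum_addf) (use A B f g h in \<open>auto simp: subsetD\<close>)
		finally show "(h \<otimes>\<^bsub>S\<^esub> (f \<oplus>\<^bsub>S\<^esub> g)) m = ((h \<otimes>\<^bsub>S\<^esub> f) \<oplus>\<^bsub>S\<^esub> (h \<otimes>\<^bsub>S\<^esub> g)) m"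
			using A B f g h fg by (simp add: mult_S[of _ _ B A])
	qed
qed

lemma single_mult:
	assumes "r:carrier R" "s:carrier R" "a:carrier M" "b:carrier M"
	shows "sgl R r a \<otimes>\<^bsub>S\<^esub> sgl R s b = sgl R (r \<otimes> act a s) (a \<otimes>\<^bsub>M\<^esub> b)"
proof
	fix m
	have "(sgl R r a \<otimes>\<^bsub>S\<^esub> sgl R s b) m =
		(\<Oplus>p\<in>{a} \<times> {b}. if fst p \<otimes>\<^bsub>M\<^esub> snd p = m then sgl R r a (fst p) \<otimes> act (fst p) (sgl R s b (snd p)) else \<zero>)"
		using assms by (intro mult_S single_supp single_closed) auto
	also have "... = sgl R (r \<otimes> act a s) (a \<otimes>\<^bsub>M\<^esub> b) m"
		using assms by (auto simp: skew_single_def R.finsum_insert R.finsum_empty)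
	finally show "(sgl R r a \<otimes>\<^bsub>S\<^esub> sgl R s b) m = sgl R (r \<otimes> act a s) (a \<otimes>\<^bsub>M\<^esub> b) m" .
qed

lemma S_induct [consumes 1, case_names zero add]:
	assumes f: "f:carrier S" and z: "P \<zero>\<^bsub>S\<^esub>"
		and s: "!!f r m. [|f:carrier S; P f; r:carrier R; m:carrier M|] ==> P (sgl R r m \<oplus>\<^bsub>S\<^esub> f)"
	shows "P f"
proof -
	have "\<forall>f. f:carrier S & supp f \<subseteq> A \<longrightarrow> P f" if "finite A" for A
		using that
	proof (induction A)
		case empty
		show ?case using z by (auto simp: zero_S fun_eq_iff[symmetric])
	next
		case (insert a A)
		show ?case
		proof safe
			fix f assume f: "f:carrier S" and sub: "supp f \<subseteq> insert a A"
			show "P f"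
			proof (cases "f a = \<zero>")
				case True
				then have "supp f \<subseteq> A" using sub by auto
				then show ?thesis using insert f by blast
			next
				case False
				have g: "f(a := \<zero>):carrier S" "supp (f(a := \<zero>)) \<subseteq> A"
					using f sub by (auto simp: carrier_S simp del: S_closed S_finite intro: finite_subset[of _ "supp f"])
				have "f = sgl R (f a) a \<oplus>\<^bsub>S\<^esub> f(a := \<zero>)"
					using f by (auto simp: skew_single_def fun_eq_iff)
				then show ?thesis
					using s[of "f(a := \<zero>)" "f a" a] g insert f False S_out by (metis S_closed)
			qed
		qed
	qed
	then show ?thesis using f S_finite by blast
qed

lemma zero_mult: "f:carrier S ==> \<zero>\<^bsub>S\<^esub> \<otimes>\<^bsub>S\<^esub> f = \<zero>\<^bsub>S\<^esub>" "f:carrier S ==> f \<otimes>\<^bsub>S\<^esub> \<zero>\<^bsub>S\<^esub> = \<zero>\<^bsub>S\<^esub>"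
	unfolding skew_monoid_ring_def by simp_all

lemma S_assoc:
	assumes f: "f:carrier S" and g: "g:carrier S" and h: "h:carrier S"
	shows "f \<otimes>\<^bsub>S\<^esub> g \<otimes>\<^bsub>S\<^esub> h = f \<otimes>\<^bsub>S\<^esub> (g \<otimes>\<^bsub>S\<^esub> h)"
proof -
	interpret SA: abelian_group S by (rule S_abelian)
	note [simp] = S_mult_closed S_distrib zero_mult
	note [simp del] = add_S
	have 1: "sgl R r a \<otimes>\<^bsub>S\<^esub> sgl R s b \<otimes>\<^bsub>S\<^esub> h = sgl R r a \<otimes>\<^bsub>S\<^esub> (sgl R s b \<otimes>\<^bsub>S\<^esub> h)"
		if "r:carrier R" "s:carrier R" "a:carrier M" "b:carrier M" for r s a b
		using h that
		by (induction h rule: S_induct) (simp_all add: single_mult act_mult act_mult_dist R.m_assoc M.m_assoc)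
	have 2: "sgl R r a \<otimes>\<^bsub>S\<^esub> g \<otimes>\<^bsub>S\<^esub> h = sgl R r a \<otimes>\<^bsub>S\<^esub> (g \<otimes>\<^bsub>S\<^esub> h)"
		if "r:carrier R" "a:carrier M" for r a
		using g that h by (induction g rule: S_induct) (simp_all add: 1)
	show ?thesis
		using f g h by (induction f rule: S_induct) (simp_all add: 2)
qed

lemma S_ring: "ring S"
proof (rule ringI[OF S_abelian])
	interpret SA: abelian_group S by (rule S_abelian)
	note [simp] = S_mult_closed S_distrib zero_mult
	have l: "\<one>\<^bsub>S\<^esub> \<otimes>\<^bsub>S\<^esub> f = f" and r: "f \<otimes>\<^bsub>S\<^esub> \<one>\<^bsub>S\<^esub> = f" if "f:carrier S" for f
		using that
		by (induction f rule: S_induct) (simp_all add: one_S single_mult act_one act_unit del: add_S)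
	show "Group.monoid S"
		by (rule monoidI) (simp_all add: S_assoc l r, simp add: one_S)
qed (auto simp: S_distrib simp del: add_S)

end

sublocale S: ring S
	by (rule S_ring)

context
	notes [simp] = act_closed act_zero
begin

lemma finsum_S: "F:I \<rightarrow> carrier S ==> (\<Oplus>\<^bsub>S\<^esub>i\<in>I. F i) m = (\<Oplus>i\<in>I. F i m)"
proof (induction I rule: infinite_finite_induct)
	case (insert i I)
	then show ?case
		by (subst S.finsum_insert) (auto simp: R.finsum_insert Pi_iff)
qed (auto simp: zero_S)

lemma single_add: "r:carrier R ==> s:carrier R ==> sgl R r m \<oplus>\<^bsub>S\<^esub> sgl R s m = sgl R (r \<oplus> s) m"
	by (auto simp: skew_single_def)

lemma single_zero: "sgl R \<zero> m = \<zero>\<^bsub>S\<^esub>"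
	by (auto simp: skew_single_def zero_S)

lemma additive_eqI:
	assumes "abelian_group T" "f:carrier S"
		and "!!f g. f:carrier S ==> g:carrier S ==> F (f \<oplus>\<^bsub>S\<^esub> g) = F f \<oplus>\<^bsub>T\<^esub> F g"
		and "!!f g. f:carrier S ==> g:carrier S ==> G (f \<oplus>\<^bsub>S\<^esub> g) = G f \<oplus>\<^bsub>T\<^esub> G g"
		and "!!r m. r:carrier R ==> m:carrier M ==> F (sgl R r m) = G (sgl R r m)"
	shows "F f = G f"
	using assms(2)
proof (induction f rule: S_induct)
	case zero
	show ?case using assms(5)[of \<zero> "\<one>\<^bsub>M\<^esub>"] by (simp add: single_zero)
qed (simp add: assms(3-5) del: add_S)

lemma multiplicative_from_singles:
	assumes T: "ring T" and cl: "F:carrier S \<rightarrow> carrier T"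
		and add: "!!f g. f:carrier S ==> g:carrier S ==> F (f \<oplus>\<^bsub>S\<^esub> g) = F f \<oplus>\<^bsub>T\<^esub> F g"
		and one: "F (sgl R \<one> \<one>\<^bsub>M\<^esub>) = \<one>\<^bsub>T\<^esub>"
		and mult: "!!r s a b. [|r:carrier R; s:carrier R; a:carrier M; b:carrier M|] ==>
			F (sgl R (r \<otimes> act a s) (a \<otimes>\<^bsub>M\<^esub> b)) = F (sgl R r a) \<otimes>\<^bsub>T\<^esub> F (sgl R s b)"
	shows "F:ring_hom S T"
proof -
	interpret T: ring T by fact
	have Fc [simp]: "f:carrier S ==> F f:carrier T" for f using cl by blast
	have 1: "F (sgl R r a \<otimes>\<^bsub>S\<^esub> g) = F (sgl R r a) \<otimes>\<^bsub>T\<^esub> F g"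
		if "r:carrier R" "a:carrier M" "g:carrier S" for r a g
		by (rule additive_eqI[OF T.abelian_group_axioms that(3)])
			(use that in \<open>simp_all add: S.r_distr T.r_distr add mult single_mult del: add_S\<close>)
	have 2: "F (f \<otimes>\<^bsub>S\<^esub> g) = F f \<otimes>\<^bsub>T\<^esub> F g" if "f:carrier S" "g:carrier S" for f g
		by (rule additive_eqI[OF T.abelian_group_axioms that(1)])
			(use that in \<open>simp_all add: S.l_distr T.l_distr add 1 del: add_S\<close>)
	show ?thesis
		by (rule ring_hom_memI) (use 2 add one in \<open>auto simp: one_S simp del: add_S\<close>)
qed

text \<open>The universal property: a ring homomorphism on the coefficients and a compatible
	multiplicative map on the monoid extend jointly.\<close>

definition extend :: "('t, 'u) ring_scheme => ('l => 't) => ('m => 't) => ('m => 'l) => 't" where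
	"extend T u \<theta> f = (\<Oplus>\<^bsub>T\<^esub>m\<in>supp f. u (f m) \<otimes>\<^bsub>T\<^esub> \<theta> m)"

context
	fixes T :: "('t, 'u) ring_scheme" and u \<theta>
	assumes T: "ring T" and u: "u:carrier R \<rightarrow> carrier T"
		and u_add: "!!r s. r:carrier R ==> s:carrier R ==> u (r \<oplus> s) = u r \<oplus>\<^bsub>T\<^esub> u s"
		and \<theta>: "\<theta>:carrier M \<rightarrow> carrier T"
begin

lemma u_zero: "u \<zero> = \<zero>\<^bsub>T\<^esub>"
proof -
	interpret T: ring T by (rule T)
	have "u \<zero> \<oplus>\<^bsub>T\<^esub> u \<zero> = u \<zero>" using u_add[of \<zero> \<zero>] by simp
	then show ?thesis using u T.add.r_cancel_one by (metis PiE R.zero_closed)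
qed

lemma extend_superset:
	assumes f: "f:carrier S" and A: "finite A" "supp f \<subseteq> A" "A \<subseteq> carrier M"
	shows "extend T u \<theta> f = (\<Oplus>\<^bsub>T\<^esub>m\<in>A. u (f m) \<otimes>\<^bsub>T\<^esub> \<theta> m)"
proof -
	interpret T: ring T by (rule T)
	have c: "(%m. u (f m) \<otimes>\<^bsub>T\<^esub> \<theta> m):A \<rightarrow> carrier T"
		using f A u \<theta> by (auto intro!: T.m_closed simp: Pi_iff)
	show ?thesis unfolding extend_def
		by (rule T.add.finprod_mono_neutral_cong_left) (use A c \<theta> in \<open>auto simp: u_zero Pi_iff subsetD\<close>)
qed

lemma extend_closed: "f:carrier S ==> extend T u \<theta> f:carrier T"
proof -
	interpret T: ring T by (rule T)
	assume f: "f:carrier S"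
	have "(%m. u (f m) \<otimes>\<^bsub>T\<^esub> \<theta> m):supp f \<rightarrow> carrier T"
		using f u \<theta> S_supp[OF f] by (auto intro!: T.m_closed simp: Pi_iff)
	then show "extend T u \<theta> f:carrier T"
		unfolding extend_def by (rule T.finsum_closed)
qed

lemma extend_add:
	assumes f: "f:carrier S" and g: "g:carrier S"
	shows "extend T u \<theta> (f \<oplus>\<^bsub>S\<^esub> g) = extend T u \<theta> f \<oplus>\<^bsub>T\<^esub> extend T u \<theta> g"
proof -
	interpret T: ring T by (rule T)
	define A where "A = supp f \<union> supp g"
	have A: "finite A" "A \<subseteq> carrier M" "supp f \<subseteq> A" "supp g \<subseteq> A" "supp (f \<oplus>\<^bsub>S\<^esub> g) \<subseteq> A"
		using f g S_supp[OF f] S_supp[OF g] by (auto simp: A_def)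
	have m: "!!m. m:A ==> \<theta> m:carrier T" and uc: "!!r. r:carrier R ==> u r:carrier T"
		using \<theta> A u by auto
	have "extend T u \<theta> (f \<oplus>\<^bsub>S\<^esub> g) = (\<Oplus>\<^bsub>T\<^esub>x\<in>A. u (f x) \<otimes>\<^bsub>T\<^esub> \<theta> x \<oplus>\<^bsub>T\<^esub> u (g x) \<otimes>\<^bsub>T\<^esub> \<theta> x)"
		using f g A S.a_closed[OF f g]
		by (subst extend_superset[of _ A], (simp; fail)+)
			 (intro T.finsum_cong', auto simp: u_add T.l_distr m uc)
	also have "... = (\<Oplus>\<^bsub>T\<^esub>x\<in>A. u (f x) \<otimes>\<^bsub>T\<^esub> \<theta> x) \<oplus>\<^bsub>T\<^esub> (\<Oplus>\<^bsub>T\<^esub>x\<in>A. u (g x) \<otimes>\<^bsub>T\<^esub> \<theta> x)"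
		by (rule T.finsum_addf) (use f g m uc in auto)
	finally show ?thesis using A f g by (simp add: extend_superset[of _ A])
qed

lemma extend_single: "r:carrier R ==> m:carrier M ==> extend T u \<theta> (sgl R r m) = u r \<otimes>\<^bsub>T\<^esub> \<theta> m"
proof -
	interpret T: ring T by (rule T)
	assume "r:carrier R" "m:carrier M"
	then have "extend T u \<theta> (sgl R r m) = (\<Oplus>\<^bsub>T\<^esub>x\<in>{m}. u (sgl R r m x) \<otimes>\<^bsub>T\<^esub> \<theta> x)"
		by (intro extend_superset single_supp) auto
	then show ?thesis using \<open>r:carrier R\<close> \<open>m:carrier M\<close> u \<theta>
		by (simp add: skew_single_def T.finsum_insert T.finsum_empty Pi_iff)
qed

end

lemma extend_hom:
	assumes T: "ring T" and u: "u:ring_hom R T"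
		and \<theta>: "\<theta>:carrier M \<rightarrow> carrier T" "\<theta> \<one>\<^bsub>M\<^esub> = \<one>\<^bsub>T\<^esub>"
		"!!a b. a:carrier M ==> b:carrier M ==> \<theta> (a \<otimes>\<^bsub>M\<^esub> b) = \<theta> a \<otimes>\<^bsub>T\<^esub> \<theta> b"
		and comm: "!!a r. a:carrier M ==> r:carrier R ==> \<theta> a \<otimes>\<^bsub>T\<^esub> u r = u (act a r) \<otimes>\<^bsub>T\<^esub> \<theta> a"
	shows "extend T u \<theta>:ring_hom S T"
proof -
	interpret T: ring T by (rule T)
	have u1: "u:carrier R \<rightarrow> carrier T" using ring_hom_memE(1)[OF u] by blast
	have u2: "u (r \<oplus> s) = u r \<oplus>\<^bsub>T\<^esub> u s" if "r:carrier R" "s:carrier R" for r s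
		using ring_hom_memE(3)[OF u] that by blast
	have u3: "u (r \<otimes> s) = u r \<otimes>\<^bsub>T\<^esub> u s" if "r:carrier R" "s:carrier R" for r s
		using ring_hom_memE(2)[OF u] that by blast
	note ctx = T u1 u2 \<theta>(1)
	have mem: "\<theta> a:carrier T" if "a:carrier M" for a using \<theta>(1) that by blast
	have umem: "u a:carrier T" if "a:carrier R" for a using u1 that by blast
	show ?thesis
	proof (rule multiplicative_from_singles[OF T])
		show "extend T u \<theta>:carrier S \<rightarrow> carrier T"
			using extend_closed[OF ctx] by blast
		fix r s a b assume h: "r:carrier R" "s:carrier R" "a:carrier M" "b:carrier M"
		have "u r \<otimes>\<^bsub>T\<^esub> \<theta> a \<otimes>\<^bsub>T\<^esub> (u s \<otimes>\<^bsub>T\<^esub> \<theta> b) = u r \<otimes>\<^bsub>T\<^esub> (\<theta> a \<otimes>\<^bsub>T\<^esub> u s) \<otimes>\<^bsub>T\<^esub> \<theta> b"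
			using h mem umem by (simp add: T.m_assoc)
		also have "... = u r \<otimes>\<^bsub>T\<^esub> u (act a s) \<otimes>\<^bsub>T\<^esub> (\<theta> a \<otimes>\<^bsub>T\<^esub> \<theta> b)"
			using h mem umem by (simp add: T.m_assoc comm)
		finally show "extend T u \<theta> (sgl R (r \<otimes> act a s) (a \<otimes>\<^bsub>M\<^esub> b)) =
				extend T u \<theta> (sgl R r a) \<otimes>\<^bsub>T\<^esub> extend T u \<theta> (sgl R s b)"
			using h by (simp add: extend_single[OF ctx] u3 \<theta>(3))
	next
		show "extend T u \<theta> (sgl R \<one> \<one>\<^bsub>M\<^esub>) = \<one>\<^bsub>T\<^esub>"
			using \<theta>(2) ring_hom_memE(4)[OF u] by (simp add: extend_single[OF ctx])
	qed (rule extend_add[OF ctx])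
qed

end

end

lemma skew_monoid_trivial:
	assumes "ring R" "Group.monoid M"
	shows "skew_monoid R M (%_ c. c)"
	by (intro skew_monoid.intro skew_monoid_axioms.intro assms) (auto simp: ring_hom_def)

section \<open>Polynomials with extra Laurent variables\<close>

abbreviation pinv :: "(nat => nat) => nat => nat" where "pinv p == inv_into UNIV p"

type_synonym expon = "nat => nat \<times> int"

definition expo :: "nat => expon monoid" where
	"expo n = \<lparr>carrier = {d. \<forall>i\<ge>n. d i = 0}, monoid.mult = (+), one = 0\<rparr>"

definition pless :: "nat \<times> int => nat \<times> int => bool" where
	"pless u v \<longleftrightarrow> fst u < fst v \<or> fst u = fst v & snd v < snd u"

definition lexless :: "expon => expon => bool" where
	"lexless d e \<longleftrightarrow> (\<exists>j. pless (d j) (e j) & (\<forall>i<j. d i = e i))"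

lemma expo_simps [simp]: "carrier (expo n) = {d. \<forall>i\<ge>n. d i = 0}" "(\<otimes>\<^bsub>expo n\<^esub>) = (+)" "\<one>\<^bsub>expo n\<^esub> = 0"
	by (simp_all add: expo_def)

lemma expo_monoid: "comm_monoid (expo n)"
	by (rule comm_monoidI) (auto simp: algebra_simps)

lemma pless_irrefl [simp]: "\<not> pless u u"
	and pless_trans: "pless u v ==> pless v w ==> pless u w"
	and pless_total: "u ~= v ==> pless u v \<or> pless v u"
	and pless_add [simp]: "pless (u + w) (v + w) \<longleftrightarrow> pless u v"
	by (auto simp: pless_def prod_eq_iff)

lemma lexless_irrefl [simp]: "\<not> lexless d d"
	by (simp add: lexless_def)

lemma lexless_trans: assumes "lexless d e" "lexless e f" shows "lexless d f"
proof -
	obtain i j where "pless (d i) (e i)" "\<forall>l<i. d l = e l" "pless (e j) (f j)" "\<forall>l<j. e l = f l"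
		using assms unfolding lexless_def by blast
	then show ?thesis
		unfolding lexless_def
		by (cases i j rule: linorder_cases)
			 (metis order_less_trans, metis pless_trans, metis order_less_trans)
qed

lemma lexless_total: assumes "d ~= e" shows "lexless d e \<or> lexless e d"
proof -
	define j where "j = (LEAST j. d j ~= e j)"
	obtain i where "d i ~= e i" using assms by (auto simp: fun_eq_iff)
	then have j: "d j ~= e j" unfolding j_def by (rule LeastI)
	have min: "d i = e i" if "i < j" for i
		using not_less_Least[of i "%j. d j ~= e j"] that by (simp add: j_def)
	consider "pless (d j) (e j)" | "pless (e j) (d j)" using pless_total[OF j] by blast
	then show ?thesis
		by cases (use min in \<open>(force simp: lexless_def)+\<close>)
qed

lemma lexless_add: "lexless (d + f) (e + f) \<longleftrightarrow> lexless d e"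
	by (simp add: lexless_def)

lemma lexless_add_mono:
	assumes "a = d \<or> lexless a d" "b = e \<or> lexless b e"
	shows "a + b = d + e & a = d & b = e \<or> lexless (a + b) (d + e)"
proof -
	have "lexless a d ==> lexless (a + b) (d + b)" by (simp only: lexless_add)
	moreover have "lexless b e ==> lexless (d + b) (d + e)" by (simp only: lexless_add add.commute[of d])
	ultimately show ?thesis using assms lexless_trans[of "a + b" "d + b" "d + e"] by blast
qed

lemma lexless_max:
	assumes "finite A" "A ~= {}" shows "\<exists>d\<in>A. \<forall>e\<in>A. e = d \<or> lexless e d"
	using assms
proof (induction rule: finite_ne_induct)
	case (insert a A)
	then obtain d where d: "d:A" "\<forall>e\<in>A. e = d \<or> lexless e d" by blast
	show ?case
	proof (cases "lexless d a")
		case True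
		then have "lexless e a" if "e:A" for e using d that lexless_trans[of e d a] by (cases "e = d") auto
		then have "\<forall>e\<in>insert a A. e = a \<or> lexless e a" by blast
		then show ?thesis by blast
	next
		case False
		then have "\<forall>e\<in>insert a A. e = d \<or> lexless e d" using d lexless_total[of a d] by blast
		then show ?thesis using d by blast
	qed
qed simp

locale laurent = field k for k :: "('k, 'r) ring_scheme" (structure) + fixes n :: nat
begin

abbreviation "P == monoid_algebra k (expo n)"
abbreviation multP (infixl "\<otimes>P" 70) where "multP == (\<otimes>\<^bsub>P\<^esub>)"
abbreviation addP (infixl "\<oplus>P" 65) where "addP == (\<oplus>\<^bsub>P\<^esub>)"
abbreviation zeroP ("\<zero>P") where "zeroP == \<zero>\<^bsub>P\<^esub>"
abbreviation oneP ("\<one>P") where "oneP == \<one>\<^bsub>P\<^esub>"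
abbreviation negP ("\<ominus>P _" [81] 80) where "negP == a_inv P"
abbreviation subP (infixl "\<ominus>P" 65) where "subP == a_minus P"
abbreviation powP (infixl "[^]P" 75) where "powP x m == x [^]\<^bsub>P\<^esub> (m :: nat)"
abbreviation "cP == carrier P"

abbreviation single :: "'k => expon => expon => 'k" where "single == sgl k"

sublocale P: skew_monoid k "expo n" "%_ c. c"
	by (rule skew_monoid_trivial[OF ring_axioms comm_monoid.axioms(1)[OF expo_monoid]])

lemma P_cring: "cring P"
proof (rule cringI[OF P.S_abelian _ P.S.l_distr])
	have 1: "single r a \<otimes>P g = g \<otimes>P single r a" if "r:carrier k" "a:carrier (expo n)" "g:cP" for r a g
		by (rule P.additive_eqI[OF P.S_abelian that(3)])
			 (use that in \<open>simp_all add: P.S.l_distr P.S.r_distr P.single_mult m_comm add.commute del: P.add_S\<close>)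
	have "f \<otimes>P g = g \<otimes>P f" if "f:cP" "g:cP" for f g
		by (rule P.additive_eqI[OF P.S_abelian that(1)])
			 (use that 1 in \<open>simp_all add: P.S.l_distr P.S.r_distr del: P.add_S\<close>)
	then show "comm_monoid P"
		by (intro monoid.monoid_comm_monoidI P.S.monoid_axioms)
qed auto

sublocale P: cring P by (rule P_cring)

lemma pmult_supp:
	assumes "f:cP" "g:cP" "(f \<otimes>P g) d ~= \<zero>"
	obtains a b where "f a ~= \<zero>" "g b ~= \<zero>" "d = a + b"
	using P.mult_supp[OF assms] by auto

definition is_lead :: "(expon => 'k) => expon => bool" where
	"is_lead f d \<longleftrightarrow> f d ~= \<zero> & (\<forall>e. f e ~= \<zero> \<longrightarrow> e = d \<or> lexless e d)"

lemma ex_lead: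
	assumes "f:cP" "f ~= \<zero>P" obtains d where "is_lead f d"
proof -
	have "{d. f d ~= \<zero>} ~= {}" using assms by (auto simp: P.zero_S)
	then show ?thesis using lexless_max[OF P.S_finite[OF assms(1)]] that by (auto simp: is_lead_def)
qed

lemma lead_mult:
	assumes f: "f:cP" "is_lead f d" and g: "g:cP" "is_lead g e"
	shows "(f \<otimes>P g) (d + e) = f d \<otimes> g e" "is_lead (f \<otimes>P g) (d + e)"
proof -
	let ?A = "{d. f d ~= \<zero>}" and ?B = "{d. g d ~= \<zero>}"
	have eq: "a = d & b = e" if "f a ~= \<zero>" "g b ~= \<zero>" "a + b = d + e" for a b
		using lexless_add_mono[of a d b e] that f g unfolding is_lead_def by auto
	have in_k: "f x:carrier k" "g x:carrier k" for x using f g by auto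
	have "(f \<otimes>P g) (d + e) = (\<Oplus>p\<in>?A \<times> ?B. if fst p \<otimes>\<^bsub>expo n\<^esub> snd p = d + e then f (fst p) \<otimes> g (snd p) else \<zero>)"
		by (rule P.mult_S) (use f g P.S_supp in auto)
	also have "... = (\<Oplus>p\<in>{(d, e)}. f (fst p) \<otimes> g (snd p))"
		by (rule add.finprod_mono_neutral_cong_right) (use f g in_k eq P.S_finite in \<open>auto simp: is_lead_def\<close>)
	also have "... = f d \<otimes> g e"
		using in_k by (simp add: finsum_insert finsum_empty)
	finally show 1: "(f \<otimes>P g) (d + e) = f d \<otimes> g e" .
	show "is_lead (f \<otimes>P g) (d + e)"
		unfolding is_lead_def
	proof (intro conjI allI impI)
		show "(f \<otimes>P g) (d + e) ~= \<zero>"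
			unfolding 1 using f g integral[OF _ in_k(1)[of d] in_k(2)[of e]] by (auto simp: is_lead_def)
		fix c assume "(f \<otimes>P g) c ~= \<zero>"
		then obtain a b where "f a ~= \<zero>" "g b ~= \<zero>" "c = a + b" using pmult_supp f g by metis
		then show "c = d + e \<or> lexless c (d + e)"
			using lexless_add_mono[of a d b e] f g unfolding is_lead_def by auto
	qed
qed

lemma lead_nonzero: "is_lead f d ==> f ~= \<zero>P"
	by (auto simp: is_lead_def P.zero_S)

lemma P_domain: "domain P"
proof (rule domainI[OF P_cring])
	show "\<one>P ~= \<zero>P" by (auto simp: P.one_S P.zero_S skew_single_def dest: fun_cong[of _ _ 0])
	fix f g assume "f \<otimes>P g = \<zero>P" "f:cP" "g:cP"
	then show "f = \<zero>P \<or> g = \<zero>P" using ex_lead lead_mult(2) lead_nonzero by metis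
qed

sublocale P: domain P by (rule P_domain)

text \<open>The polynomials, that is, the elements without Laurent variables.\<close>

definition Lam :: "(expon => 'k) set" where
	"Lam = {f:carrier P. \<forall>d. f d ~= \<zero> \<longrightarrow> (\<forall>i. snd (d i) = 0)}"

definition permP :: "(nat => nat) => (expon => 'k) => expon => 'k" where
	"permP p f = (%d. f (d \<circ> p))"

definition Inv :: "(expon => 'k) set" where
	"Inv = {f:carrier P. \<forall>p. p permutes {..<n} \<longrightarrow> permP p f = f}"

definition Gam :: "(expon => 'k) set" where "Gam = Lam \<inter> Inv"

lemma LamI: "f:cP ==> (!!d i. f d ~= \<zero> ==> snd (d i) = 0) ==> f:Lam"
	and Lam_supp: "f:Lam ==> f d ~= \<zero> ==> snd (d i) = 0"
	by (simp_all add: Lam_def)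
lemma InvI: "f:cP ==> (!!p. p permutes {..<n} ==> permP p f = f) ==> f:Inv"
	and Inv_perm: "f:Inv ==> p permutes {..<n} ==> permP p f = f"
	by (simp_all add: Inv_def)
lemma GamI: "f:Lam ==> f:Inv ==> f:Gam"
	by (simp add: Gam_def)

lemma Lam_P [simp]: "f:Lam ==> f:cP" by (simp add: Lam_def)
lemma Inv_P [simp]: "f:Inv ==> f:cP" by (simp add: Inv_def)
lemma Gam_Lam [simp]: "f:Gam ==> f:Lam" and Gam_Inv [simp]: "f:Gam ==> f:Inv"
	by (simp_all add: Gam_def)

lemma P_neg: "f:cP ==> \<ominus>P f = (%d. \<ominus> f d)"
	by (rule P.S.minus_equality) (auto simp: P.zero_S l_neg P.S_uminus_closed)

lemma Lam_subring: "subring Lam P"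
proof (rule P.S.subringI)
	show "Lam \<subseteq> cP" using Lam_P by blast
	show "\<one>P:Lam"
		by (rule LamI[OF P.S.one_closed]) (auto simp: P.one_S skew_single_def split: if_splits)
	fix f g assume f: "f:Lam" and g: "g:Lam"
	show "f \<otimes>P g:Lam"
	proof (rule LamI)
		fix d i assume "(f \<otimes>P g) d ~= \<zero>"
		then obtain a b where ab: "f a ~= \<zero>" "g b ~= \<zero>" "d = a + b"
			by (rule pmult_supp[OF Lam_P[OF f] Lam_P[OF g]])
		then show "snd (d i) = 0" using Lam_supp[OF f ab(1)] Lam_supp[OF g ab(2)] by simp
	qed (use f g in simp)
	show "f \<oplus>P g:Lam"
	proof (rule LamI[OF P.S.a_closed])
		fix d i assume "(f \<oplus>P g) d ~= \<zero>"
		then have "f d ~= \<zero> \<or> g d ~= \<zero>" by auto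
		then show "snd (d i) = 0" using Lam_supp[OF f, of d i] Lam_supp[OF g, of d i] by blast
	qed (use f g in simp_all)
	show "\<ominus>P f:Lam"
	proof (rule LamI[OF P.S.a_inv_closed])
		fix d i assume "(\<ominus>P f) d ~= \<zero>"
		then have "f d ~= \<zero>" using f by (auto simp: P_neg)
		then show "snd (d i) = 0" by (rule Lam_supp[OF f])
	qed (use f in simp)
qed

lemma comp_expo: "p permutes {..<n} ==> d:carrier (expo n) ==> d \<circ> p:carrier (expo n)"
	by (auto simp: permutes_not_in)

lemma permP_closed: assumes p: "p permutes {..<n}" and f: "f:cP" shows "permP p f:cP"
proof -
	have sub: "{d. permP p f d ~= \<zero>} \<subseteq> (%d. d \<circ> pinv p) ` {d. f d ~= \<zero>}"
	proof
		fix d assume "d:{d. permP p f d ~= \<zero>}"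
		moreover have "d = (d \<circ> p) \<circ> pinv p" using permutes_inv_o(1)[OF p] by (simp add: o_assoc[symmetric])
		ultimately show "d:(%d. d \<circ> pinv p) ` {d. f d ~= \<zero>}" by (auto simp: permP_def)
	qed
	have "d:carrier (expo n)" if "d:{d. permP p f d ~= \<zero>}" for d
		using sub that P.S_supp[OF f] comp_expo[OF permutes_inv[OF p]] by blast
	then show ?thesis
		unfolding P.carrier_S using finite_subset[OF sub] f by (auto simp: permP_def)
qed

lemma permP_single: assumes p: "p permutes {..<n}" shows "permP p (single r a) = single r (a \<circ> pinv p)"
proof -
	have "d \<circ> p = a \<longleftrightarrow> d = a \<circ> pinv p" for d
		using permutes_inv_o[OF p] by (metis comp_assoc comp_id)
	then show ?thesis by (simp add: permP_def skew_single_def)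
qed

lemma permP_add: "permP p (f \<oplus>P g) = permP p f \<oplus>P permP p g"
	by (simp add: permP_def)

lemma permP_hom: assumes p: "p permutes {..<n}" shows "permP p:ring_hom P P"
proof (rule P.multiplicative_from_singles[OF P.S_ring])
	fix r s a b assume *: "r:carrier k" "s:carrier k" "a:carrier (expo n)" "b:carrier (expo n)"
	have "(a + b) \<circ> pinv p = (a \<circ> pinv p) + (b \<circ> pinv p)" by auto
	then show "permP p (single (r \<otimes> s) (a \<otimes>\<^bsub>expo n\<^esub> b)) = permP p (single r a) \<otimes>P permP p (single s b)"
		using * comp_expo[OF permutes_inv[OF p]] by (simp add: permP_single[OF p] P.single_mult)
next
	have "0 \<circ> pinv p = (0 :: expon)" by auto
	then show "permP p (single \<one> \<one>\<^bsub>expo n\<^esub>) = \<one>P" by (simp add: permP_single[OF p] P.one_S)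
qed (auto simp: permP_closed[OF p] permP_add simp del: P.add_S)

lemma permP_comp: "permP p (permP r f) = permP (p \<circ> r) f" and permP_id: "permP id f = f"
	by (simp_all add: permP_def o_assoc)

lemma permP_Lam: assumes p: "p permutes {..<n}" and f: "f:Lam" shows "permP p f:Lam"
proof (rule LamI)
	fix d i assume "permP p f d ~= \<zero>"
	then have "f (d \<circ> p) ~= \<zero>" by (simp add: permP_def)
	then have "snd ((d \<circ> p) (pinv p i)) = 0" by (rule Lam_supp[OF f])
	then show "snd (d i) = 0" by (simp add: permutes_inverses(1)[OF p])
qed (simp add: f permP_closed p)

lemma Inv_subring: "subring Inv P"
proof (rule P.S.subringI)
	show "Inv \<subseteq> cP" using Inv_P by blast
	show "\<one>P:Inv" by (rule InvI[OF P.S.one_closed]) (rule rh1[OF permP_hom])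
	fix f g assume f: "f:Inv" and g: "g:Inv"
	show "f \<otimes>P g:Inv"
		by (rule InvI) (use f g in \<open>simp_all add: rhm[OF permP_hom] Inv_perm\<close>)
	show "f \<oplus>P g:Inv"
		by (rule InvI[OF P.S.a_closed]) (use f g in \<open>simp_all add: permP_add Inv_perm del: P.add_S\<close>)
	show "\<ominus>P f:Inv"
	proof (rule InvI[OF P.S.a_inv_closed])
		fix p assume "p permutes {..<n}"
		from Inv_perm[OF f this] have "f (d \<circ> p) = f d" for d by (simp add: permP_def fun_eq_iff)
		then show "permP p (\<ominus>P f) = \<ominus>P f" using f by (simp add: P_neg permP_def)
	qed (use f in simp)
qed

lemma Gam_subring: "subring Gam P"
	unfolding Gam_def by (rule P.S.subring_inter[OF Lam_subring Inv_subring])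

lemma Gam_Inv_mult: "c:Gam ==> f:Inv ==> c \<otimes>P f:Inv"
	using subringE(6)[OF Inv_subring] by simp

end

section \<open>Modules inside a ring\<close>

lemma (in abelian_monoid) additive_finsum:
	assumes "abelian_monoid H" "!!x. x:carrier G ==> F x:carrier H" "F \<zero> = \<zero>\<^bsub>H\<^esub>"
		"!!x y. x:carrier G ==> y:carrier G ==> F (x \<oplus> y) = F x \<oplus>\<^bsub>H\<^esub> F y"
		and "f:I \<rightarrow> carrier G"
	shows "F (finsum G f I) = finsum H (%i. F (f i)) I"
proof -
	interpret H: abelian_monoid H by fact
	show ?thesis
		using assms(5)
	proof (induction I rule: infinite_finite_induct)
		case (insert i I)
		then have "f i:carrier G" "f:I \<rightarrow> carrier G" by auto
		moreover have "(%i. F (f i)):I \<rightarrow> carrier H" "F (f i):carrier H" using insert assms(2) by auto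
		ultimately show ?case
			using insert by (simp add: finsum_insert H.finsum_insert assms)
	qed (simp_all add: assms(3) finsum_infinite H.finsum_infinite)
qed

lemma left_module_simps [simp]:
	"carrier (left_module T Y) = Y" "(\<oplus>\<^bsub>left_module T Y\<^esub>) = (\<oplus>\<^bsub>T\<^esub>)" "\<zero>\<^bsub>left_module T Y\<^esub> = \<zero>\<^bsub>T\<^esub>"
	"a \<odot>\<^bsub>left_module T Y\<^esub> w = a \<otimes>\<^bsub>T\<^esub> w"
	by (simp_all add: left_module_def)

lemma right_module_simps [simp]:
	"carrier (right_module T Y) = Y" "(\<oplus>\<^bsub>right_module T Y\<^esub>) = (\<oplus>\<^bsub>T\<^esub>)" "\<zero>\<^bsub>right_module T Y\<^esub> = \<zero>\<^bsub>T\<^esub>"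
	"a \<odot>\<^bsub>right_module T Y\<^esub> w = w \<otimes>\<^bsub>T\<^esub> a"
	by (simp_all add: right_module_def)

lemma (in ring) abelian_group_on_subset:
	assumes Y: "Y \<subseteq> carrier R" "\<zero>:Y" "!!x y. x:Y ==> y:Y ==> x \<oplus> y:Y" "!!x. x:Y ==> \<ominus> x:Y"
		and V: "carrier V = Y" "(\<oplus>\<^bsub>V\<^esub>) = (\<oplus>)" "\<zero>\<^bsub>V\<^esub> = \<zero>"
	shows "abelian_group V"
proof (rule abelian_groupI)
	fix x assume "x:carrier V"
	then show "\<exists>y\<in>carrier V. y \<oplus>\<^bsub>V\<^esub> x = \<zero>\<^bsub>V\<^esub>" using assms l_neg by (intro bexI[of _ "\<ominus> x"]) auto
qed (use assms a_assoc a_comm l_zero subsetD[OF Y(1)] in auto)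

lemma (in ring) left_module_module:
	assumes Y: "Y \<subseteq> carrier R" "\<zero>:Y" "!!x y. x:Y ==> y:Y ==> x \<oplus> y:Y" "!!x. x:Y ==> \<ominus> x:Y"
		and G: "G \<subseteq> carrier R" "cring (R\<lparr>carrier := G\<rparr>)" "!!g x. g:G ==> x:Y ==> g \<otimes> x:Y"
	shows "module (R\<lparr>carrier := G\<rparr>) (left_module R Y)"
proof (rule moduleI)
	show "abelian_group (left_module R Y)"
		by (rule abelian_group_on_subset[OF Y]) auto
qed (use assms l_distr r_distr m_assoc l_one subsetD[OF Y(1)] subsetD[OF G(1)] in auto)

lemma (in ring) right_module_module:
	assumes Y: "Y \<subseteq> carrier R" "\<zero>:Y" "!!x y. x:Y ==> y:Y ==> x \<oplus> y:Y" "!!x. x:Y ==> \<ominus> x:Y"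
		and G: "G \<subseteq> carrier R" "cring (R\<lparr>carrier := G\<rparr>)" "!!g x. g:G ==> x:Y ==> x \<otimes> g:Y"
	shows "module (R\<lparr>carrier := G\<rparr>) (right_module R Y)"
proof (rule moduleI)
	show "abelian_group (right_module R Y)"
		by (rule abelian_group_on_subset[OF Y]) auto
	interpret G: cring "R\<lparr>carrier := G\<rparr>" by fact
	fix a b x assume "a:carrier (R\<lparr>carrier := G\<rparr>)" "b:carrier (R\<lparr>carrier := G\<rparr>)" "x:carrier (right_module R Y)"
	then show "(a \<otimes>\<^bsub>R\<lparr>carrier := G\<rparr>\<^esub> b) \<odot>\<^bsub>right_module R Y\<^esub> x = a \<odot>\<^bsub>right_module R Y\<^esub> (b \<odot>\<^bsub>right_module R Y\<^esub> x)"
		using G.m_comm[of a b] m_assoc[of x b a] subsetD[OF Y(1)] subsetD[OF G(1)] by simp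
qed (use assms l_distr r_distr r_one subsetD[OF Y(1)] subsetD[OF G(1)] in auto)

context module
begin

lemma span_zero: "\<zero>\<^bsub>M\<^esub>:module_span R M B"
	unfolding module_span_def by (rule CollectI, rule exI[of _ "{}"]) simp

lemma span_smult: assumes "v:B" "v:carrier M" "c:carrier R" shows "c \<odot>\<^bsub>M\<^esub> v:module_span R M B"
	unfolding module_span_def
	by (rule CollectI, rule exI[of _ "{v}"], rule exI[of _ "%_. c"]) (use assms in \<open>simp add: M.finsum_insert M.finsum_empty\<close>)

lemma span_add:
	assumes B: "B \<subseteq> carrier M" and x: "x:module_span R M B" and y: "y:module_span R M B"
	shows "x \<oplus>\<^bsub>M\<^esub> y:module_span R M B"
proof -
	obtain S c where S: "finite S" "S \<subseteq> B" "c:S \<rightarrow> carrier R" "x = (\<Oplus>\<^bsub>M\<^esub>v\<in>S. c v \<odot>\<^bsub>M\<^esub> v)"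
		using x unfolding module_span_def by blast
	obtain T d where T: "finite T" "T \<subseteq> B" "d:T \<rightarrow> carrier R" "y = (\<Oplus>\<^bsub>M\<^esub>v\<in>T. d v \<odot>\<^bsub>M\<^esub> v)"
		using y unfolding module_span_def by blast
	define c' where "c' v = (if v:S then c v else \<zero>)" for v
	define d' where "d' v = (if v:T then d v else \<zero>)" for v
	have c': "c' v:carrier R" and d': "d' v:carrier R" for v
		using S T by (auto simp: c'_def d'_def)
	have M: "v:carrier M" if "v:S \<union> T" for v using that S T B by blast
	have "x = (\<Oplus>\<^bsub>M\<^esub>v\<in>S \<union> T. c' v \<odot>\<^bsub>M\<^esub> v)"
		unfolding S(4) by (rule M.add.finprod_mono_neutral_cong_left) (use S T M in \<open>auto simp: c'_def Pi_iff\<close>)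
	moreover have "y = (\<Oplus>\<^bsub>M\<^esub>v\<in>S \<union> T. d' v \<odot>\<^bsub>M\<^esub> v)"
		unfolding T(4) by (rule M.add.finprod_mono_neutral_cong_left) (use S T M in \<open>auto simp: d'_def Pi_iff\<close>)
	ultimately have "x \<oplus>\<^bsub>M\<^esub> y = (\<Oplus>\<^bsub>M\<^esub>v\<in>S \<union> T. c' v \<odot>\<^bsub>M\<^esub> v \<oplus>\<^bsub>M\<^esub> d' v \<odot>\<^bsub>M\<^esub> v)"
		using M c' d' by (simp add: M.finsum_addf Pi_iff)
	also have "... = (\<Oplus>\<^bsub>M\<^esub>v\<in>S \<union> T. (c' v \<oplus> d' v) \<odot>\<^bsub>M\<^esub> v)"
		by (rule M.finsum_cong') (use M c' d' in \<open>auto simp: smult_l_distr\<close>)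
	finally have "x \<oplus>\<^bsub>M\<^esub> y = (\<Oplus>\<^bsub>M\<^esub>v\<in>S \<union> T. (c' v \<oplus> d' v) \<odot>\<^bsub>M\<^esub> v)" .
	then show ?thesis
		unfolding module_span_def
		by (intro CollectI exI[of _ "S \<union> T"] exI[of _ "%v. c' v \<oplus> d' v"]) (use S T c' d' in auto)
qed

lemma span_closed: assumes "B \<subseteq> carrier M" shows "module_span R M B \<subseteq> carrier M"
proof
	fix x assume "x:module_span R M B"
	then obtain S c where S: "S \<subseteq> B" "c:S \<rightarrow> carrier R" "x = (\<Oplus>\<^bsub>M\<^esub>v\<in>S. c v \<odot>\<^bsub>M\<^esub> v)"
		unfolding module_span_def by blast
	then show "x:carrier M" using assms by (auto intro!: M.finsum_closed)
qed

end

section \<open>Well-foundedness and finiteness for exponents\<close>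

lemma dickson:
	fixes c :: "'x => nat => nat"
	shows "\<exists>F. finite F & F \<subseteq> A & (\<forall>a\<in>A. \<exists>b\<in>F. \<forall>i<r. c b i \<le> c a i)"
proof (induction r arbitrary: A)
	case 0
	show ?case
	proof (cases "A = {}")
		case False
		then obtain a where "a:A" by blast
		then show ?thesis by (intro exI[of _ "{a}"]) simp
	qed (intro exI[of _ "{}"], simp)
next
	case (Suc r)
	obtain F where F: "finite F" "F \<subseteq> A" "\<forall>a\<in>A. \<exists>b\<in>F. \<forall>i<r. c b i \<le> c a i"
		using Suc.IH[of A] by blast
	have "\<forall>v. \<exists>F. finite F & F \<subseteq> {a:A. c a r = v} & (\<forall>a\<in>{a:A. c a r = v}. \<exists>b\<in>F. \<forall>i<r. c b i \<le> c a i)"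
		using Suc.IH by blast
	from choice[OF this] obtain H where H': "\<forall>v. finite (H v) & H v \<subseteq> {a:A. c a r = v} \<and>
			(\<forall>a\<in>{a:A. c a r = v}. \<exists>b\<in>H v. \<forall>i<r. c b i \<le> c a i)" by blast
	have H: "finite (H v)" "H v \<subseteq> {a:A. c a r = v}"
		"a:A ==> c a r = v ==> \<exists>b\<in>H v. \<forall>i<r. c b i \<le> c a i" for v a
		using H' by simp_all
	define m where "m = Max (insert 0 ((%b. c b r) ` F))"
	have m: "c b r \<le> m" if "b:F" for b using that F(1) by (simp add: m_def)
	let ?F = "F \<union> (\<Union>v<m. H v)"
	have "\<exists>b\<in>?F. \<forall>i<Suc r. c b i \<le> c a i" if a: "a:A" for a
	proof (cases "c a r < m")
		case True
		obtain b where b: "b:H (c a r)" "\<forall>i<r. c b i \<le> c a i" using H(3)[OF a refl] by blast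
		then have "c b r = c a r" using H(2) by blast
		then have "\<forall>i<Suc r. c b i \<le> c a i" using b(2) by (auto simp: less_Suc_eq)
		then show ?thesis using b(1) True by blast
	next
		case False
		obtain b where b: "b:F" "\<forall>i<r. c b i \<le> c a i" using F(3) a by blast
		then have "c b r \<le> c a r" using m False by (meson leI order_trans)
		then have "\<forall>i<Suc r. c b i \<le> c a i" using b(2) by (auto simp: less_Suc_eq)
		then show ?thesis using b(1) by blast
	qed
	moreover have "finite ?F" using F(1) H(1) by blast
	moreover have "?F \<subseteq> A" using F(2) H(2) by blast
	ultimately show ?case by blast
qed

definition bounded_expo :: "nat => int => expon set" where
	"bounded_expo n N = {d. (\<forall>i\<ge>n. d i = 0) & (\<forall>i. \<bar>snd (d i)\<bar> \<le> N)}"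

lemma wf_lexless: "wf {(d, e). lexless d e & d:bounded_expo n N & e:bounded_expo n N}"
proof -
	define r where "r = {(u, v). pless u v & \<bar>snd u\<bar> \<le> N & \<bar>snd v\<bar> \<le> N}"
	have "r \<subseteq> inv_image (less_than <*lex*> less_than) (%u. (fst u, nat (N - snd u)))"
		by (auto simp: r_def pless_def)
	then have "wf r" by (rule wf_subset[rotated]) (intro wf_inv_image wf_lex_prod wf_less_than)
	then have "wf (inv_image (lexn r n) (%d. map d [0..<n]))" by (intro wf_inv_image wf_lexn)
	moreover have "(map d [0..<n], map e [0..<n]):lexn r n"
		if less: "lexless d e" and d: "d:bounded_expo n N" and e: "e:bounded_expo n N" for d e
	proof -
		obtain j where j: "pless (d j) (e j)" "\<forall>i<j. d i = e i" using less unfolding lexless_def by blast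
		have "j < n"
		proof (rule ccontr)
			assume "\<not> j < n"
			then have "d j = e j" using d e by (simp add: bounded_expo_def)
			then show False using j by simp
		qed
		then have "[0..<n] = [0..<j] @ j # [Suc j..<n]"
			using upt_add_eq_append[of 0 j "n - j"] upt_conv_Cons[of j n] by simp
		then have split: "map f [0..<n] = map f [0..<j] @ f j # map f [Suc j..<n]" for f :: expon by simp
		have "map d [0..<j] = map e [0..<j]" using j by simp
		then have "map e [0..<n] = map d [0..<j] @ e j # map e [Suc j..<n]" using split[of e] by simp
		moreover have "(d j, e j):r" using j d e by (simp add: r_def bounded_expo_def)
		ultimately have "\<exists>xys x y xs' ys'. map d [0..<n] = xys @ x # xs' & map e [0..<n] = xys @ y # ys' & (x, y):r"
			using split[of d] by blast
		moreover have "length (map d [0..<n]) = n" "length (map e [0..<n]) = n" by simp_all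
		ultimately show ?thesis unfolding lexn_conv by blast
	qed
	then have "{(d, e). lexless d e & d:bounded_expo n N & e:bounded_expo n N} \<subseteq> inv_image (lexn r n) (%d. map d [0..<n])"
		by (auto simp only: in_inv_image mem_Collect_eq case_prod_conv)
	ultimately show ?thesis by (rule wf_subset)
qed

lemma dominated_difference:
	fixes a b :: "nat => nat"
	assumes "!!i. i < n ==> a (Suc i) + b i \<le> a i + b (Suc i)" "!!i. i \<ge> n ==> a i = 0 & b i = 0"
	shows "b i \<le> a i" "i < n ==> a (Suc i) - b (Suc i) \<le> a i - b i"
proof -
	have le: "b i \<le> a i" for i
	proof (cases "i \<ge> n")
		case False
		then have "i \<le> n" by simp
		then show ?thesis
		proof (induction rule: inc_induct)
			case (step m)
			then show ?case using assms(1)[of m] by simp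
		qed (use assms(2)[of n] in simp)
	qed (use assms(2)[of i] in simp)
	show "b i \<le> a i" by (rule le)
	show "i < n ==> a (Suc i) - b (Suc i) \<le> a i - b i" using assms(1)[of i] le[of i] le[of "Suc i"] by simp
qed

definition sorted_exp :: "nat => expon => bool" where
	"sorted_exp n d \<longleftrightarrow> (\<forall>i j. i < j \<longrightarrow> j < n \<longrightarrow> \<not> pless (d i) (d j))"

lemma sorted_expI:
	assumes "!!i. Suc i < n ==> \<not> pless (d i) (d (Suc i))" shows "sorted_exp n d"
proof -
	have "\<not> pless (d i) (d j)" if "i < j" "j < n" for i j
		using that
	proof (induction j rule: less_induct)
		case (less j)
		then obtain l where l: "j = Suc l" by (cases j) auto
		have 1: "\<not> pless (d l) (d j)" using assms[of l] less l by simp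
		show ?case
		proof (cases "i = l")
			case False
			then have "\<not> pless (d i) (d l)" using less l by simp
			then show ?thesis using 1 by (auto simp: pless_def)
		qed (use 1 in simp)
	qed
	then show ?thesis by (simp add: sorted_exp_def)
qed

definition descents :: "nat => (nat => int) => nat => nat set" where
	"descents n m i = {l. i \<le> l & Suc l < n & m (Suc l) < m l}"

definition base :: "nat => (nat => int) => expon" where
	"base n m = (%i. (card (descents n m i), m i))"

lemma finite_descents: "finite (descents n m i)"
	by (rule finite_subset[of _ "{..<n}"]) (auto simp: descents_def)

lemma card_descents: "Suc i < n ==> card (descents n m i) = card (descents n m (Suc i)) + (if m (Suc i) < m i then 1 else 0)"
proof -
	assume i: "Suc i < n"
	show ?thesis
	proof (cases "m (Suc i) < m i")
		case True
		then have "descents n m i = insert i (descents n m (Suc i))" using i by (auto simp: descents_def Suc_le_eq)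
		moreover have "i \<notin> descents n m (Suc i)" by (simp add: descents_def)
		ultimately show ?thesis using True finite_descents by simp
	next
		case False
		then have "descents n m i = descents n m (Suc i)"
			by (auto simp: descents_def Suc_le_eq) (metis le_neq_implies_less)
		then show ?thesis using False by simp
	qed
qed

lemma descents_empty: "n \<le> Suc i ==> descents n m i = {}"
	by (auto simp: descents_def)

lemma base_sorted: "sorted_exp n (base n m)"
	by (rule sorted_expI) (simp add: base_def pless_def card_descents)

definition shift_expo :: "(nat => nat) => expon" where "shift_expo a = (%i. (a i, 0))"

lemma sorted_difference:
	assumes "!!i. i < n ==> fst (d (Suc i)) + fst (e i) \<le> fst (d i) + fst (e (Suc i))"
		"!!i. i \<ge> n ==> d i = 0 & e i = 0" "!!i. snd (d i) = snd (e i)"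
	obtains a where "!!i. i \<ge> n ==> a i = 0" "sorted_exp n (shift_expo a)" "d = shift_expo a + e"
proof -
	note dd = dominated_difference[of n "%i. fst (d i)" "%i. fst (e i)"]
	define a where "a i = fst (d i) - fst (e i)" for i
	have z: "fst (d i) = 0 & fst (e i) = 0" if "i \<ge> n" for i using assms(2)[OF that] by simp
	show ?thesis
	proof
		show "!!i. i \<ge> n ==> a i = 0" using z by (simp add: a_def)
		show "sorted_exp n (shift_expo a)"
		proof (rule sorted_expI)
			fix i assume "Suc i < n"
			then have "a (Suc i) \<le> a i" unfolding a_def by (intro dd(2)[OF assms(1) z]) auto
			then show "\<not> pless (shift_expo a i) (shift_expo a (Suc i))" by (simp add: shift_expo_def pless_def)
		qed
		show "d = shift_expo a + e"
			using dd(1)[OF assms(1) z] assms(3) by (simp add: fun_eq_iff prod_eq_iff shift_expo_def a_def)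
	qed
qed

lemma base_difference:
	assumes d: "sorted_exp n d" "!!i. i \<ge> n ==> d i = 0"
	obtains a where "!!i. i \<ge> n ==> a i = 0" "sorted_exp n (shift_expo a)" "d = shift_expo a + base n (%i. snd (d i))"
proof (rule sorted_difference[of n d "base n (%i. snd (d i))"])
	fix i assume i: "i < n"
	show "fst (d (Suc i)) + fst (base n (%i. snd (d i)) i) \<le> fst (d i) + fst (base n (%i. snd (d i)) (Suc i))"
	proof (cases "Suc i < n")
		case True
		then have "\<not> pless (d i) (d (Suc i))" using d by (simp add: sorted_exp_def)
		then show ?thesis using True by (auto simp: base_def card_descents pless_def)
	next
		case False
		then show ?thesis using d(2)[of "Suc i"] by (simp add: base_def descents_empty)
	qed
next
	show "i \<ge> n ==> d i = 0 & base n (%i. snd (d i)) i = 0" for i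
		using d(2) by (simp add: base_def descents_empty zero_prod_def)
qed (auto simp: base_def)

section \<open>Symmetric elements as a module over symmetric polynomials\<close>

context laurent
begin

lemma lead_sorted:
	assumes f: "f:Inv" and d: "is_lead f d" shows "sorted_exp n d"
	unfolding sorted_exp_def
proof (intro allI impI notI)
	fix i j assume ij: "i < j" "j < n" and less: "pless (d i) (d j)"
	define t where "t = transpose i j"
	have t: "t permutes {..<n}" unfolding t_def using ij by (intro permutes_swap_id) auto
	have "f (d \<circ> t) = f d" using Inv_perm[OF f t] by (metis permP_def)
	then have "d \<circ> t = d \<or> lexless (d \<circ> t) d" using d unfolding is_lead_def by auto
	moreover have "lexless d (d \<circ> t)"
		unfolding lexless_def using less ij by (intro exI[of _ i]) (auto simp: t_def transpose_def)
	ultimately show False using lexless_trans lexless_irrefl by metis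
qed

definition orb :: "expon => expon => 'k" where
	"orb d = (%e. if \<exists>p. p permutes {..<n} & e = d \<circ> p then \<one> else \<zero>)"

lemma orb_Inv: assumes d: "d:carrier (expo n)" shows "orb d:Inv"
proof (rule InvI)
	have "{e. orb d e ~= \<zero>} = (%p. d \<circ> p) ` {p. p permutes {..<n}}"
		by (auto simp: orb_def)
	then show "orb d:cP"
		unfolding P.carrier_S using d comp_expo finite_permutations[of "{..<n}"]
		by (auto simp: orb_def simp del: expo_simps)
	fix r assume r: "r permutes {..<n}"
	have "(\<exists>p. p permutes {..<n} & e \<circ> r = d \<circ> p) \<longleftrightarrow> (\<exists>p. p permutes {..<n} & e = d \<circ> p)" for e
	proof safe
		fix p assume p: "p permutes {..<n}" "e \<circ> r = d \<circ> p"
		have "e = (e \<circ> r) \<circ> pinv r" using permutes_inv_o(1)[OF r] by (simp add: o_assoc[symmetric])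
		also have "... = d \<circ> (p \<circ> pinv r)" using p by (simp add: o_assoc)
		finally show "\<exists>p. p permutes {..<n} & e = d \<circ> p"
			using permutes_compose[OF permutes_inv[OF r] p(1)] by blast
	next
		fix p assume p: "p permutes {..<n}"
		then show "\<exists>p'. p' permutes {..<n} & d \<circ> p \<circ> r = d \<circ> p'"
			using permutes_compose[OF r p] by (intro exI[of _ "p \<circ> r"]) (simp add: o_assoc)
	qed
	then show "permP r (orb d) = orb d" by (simp add: permP_def orb_def)
qed

lemma orb_lead:
	assumes d: "d:carrier (expo n)" "sorted_exp n d" shows "is_lead (orb d) d" "orb d d = \<one>"
proof -
	have "\<exists>p. p permutes {..<n} & d = d \<circ> p" by (rule exI[of _ id]) (simp add: permutes_id)
	then show 1: "orb d d = \<one>" by (simp add: orb_def)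
	show "is_lead (orb d) d"
		unfolding is_lead_def
	proof (intro conjI allI impI)
		fix e assume "orb d e ~= \<zero>"
		then obtain p where p: "p permutes {..<n}" "e = d \<circ> p" by (auto simp: orb_def split: if_splits)
		have "\<not> lexless d e"
		proof
			assume "lexless d e"
			then obtain j where j: "pless (d j) (d (p j))" "!!i. i < j ==> d (p i) = d i"
				unfolding lexless_def p by auto
			have jn: "j < n" using permutes_not_in[OF p(1), of j] j(1) by (cases "j < n") auto
			define J where "J = {i. i < n & pless (d j) (d i)}"
			define J' where "J' = {i. i < n & pless (d j) (d (p i))}"
			have J: "i < j" if "i:J" for i
				using that d(2) jn unfolding J_def sorted_exp_def by (metis linorder_neqE_nat mem_Collect_eq pless_irrefl)
			have "insert j J \<subseteq> J'" using J j jn by (auto simp: J_def J'_def)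
			then have "card (insert j J) \<le> card J'" by (intro card_mono) (auto simp: J'_def)
			moreover have "j \<notin> J" by (simp add: J_def)
			moreover have "finite J" by (simp add: J_def)
			ultimately have "Suc (card J) \<le> card J'" by simp
			moreover have "p ` J' \<subseteq> J" using permutes_in_image[OF p(1)] by (auto simp: J_def J'_def)
			then have "card J' \<le> card J"
				using card_inj_on_le[of p J' J] permutes_inj_on[OF p(1)] by (simp add: J_def)
			ultimately show False by simp
		qed
		then show "e = d \<or> lexless e d" using lexless_total by blast
	qed (use 1 in simp)
qed

definition const :: "'k => expon => 'k" where "const c = single c 0"

lemma const_closed: "c:carrier k ==> const c:cP"
	by (simp add: const_def)

lemma const_Gam: assumes c: "c:carrier k" shows "const c:Gam"
proof -
	have "const c:Lam" by (rule LamI[OF const_closed[OF c]]) (auto simp: const_def skew_single_def split: if_splits)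
	moreover have "const c:Inv"
	proof (rule InvI[OF const_closed[OF c]])
		fix p assume "p permutes {..<n}"
		moreover have "0 \<circ> pinv p = (0 :: expon)" by auto
		ultimately show "permP p (const c) = const c" by (simp add: const_def permP_single)
	qed
	ultimately show ?thesis by (rule GamI)
qed

lemma const_mult: assumes c: "c:carrier k" and f: "f:cP" shows "const c \<otimes>P f = (%d. c \<otimes> f d)"
proof (rule P.additive_eqI[OF P.S_abelian f])
	fix r a assume "r:carrier k" "a:carrier (expo n)"
	then show "const c \<otimes>P single r a = (%d. c \<otimes> single r a d)"
		using c by (auto simp: const_def P.single_mult) (auto simp: skew_single_def)
qed (use c const_closed[OF c] in \<open>simp_all add: P.S.r_distr r_distr del: P.add_S\<close>, simp add: r_distr)

lemma shift_Gam: assumes "!!i. i \<ge> n ==> a i = 0" shows "orb (shift_expo a):Gam"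
proof -
	have "shift_expo a:carrier (expo n)" using assms by (simp add: shift_expo_def zero_prod_def)
	note inv = orb_Inv[OF this]
	have "orb (shift_expo a):Lam"
		by (rule LamI[OF Inv_P[OF inv]]) (auto simp: orb_def shift_expo_def split: if_splits)
	then show ?thesis using inv by (rule GamI)
qed

lemma cancel_lead:
	assumes f: "f:cP" "is_lead f d" and g: "g:cP" "is_lead g d"
	obtains c where "c:carrier k" "!!e. is_lead (f \<oplus>P const c \<otimes>P g) e ==> lexless e d"
		"f = (f \<oplus>P const c \<otimes>P g) \<oplus>P const (\<ominus> c) \<otimes>P g"
proof -
	have fk: "f x:carrier k" and gk: "g x:carrier k" for x using f g by auto
	have "g d:Units k" using g gk by (auto simp: is_lead_def field_Units)
	note u = Units_inv_closed[OF this] Units_l_inv[OF this]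
	define c where "c = \<ominus> (f d \<otimes> inv (g d))"
	have c: "c:carrier k" using fk u by (simp add: c_def)
	have "f d \<oplus> c \<otimes> g d = \<zero>"
		using fk[of d] gk[of d] u by (simp add: c_def l_minus m_assoc r_neg)
	then have "lexless e d" if "is_lead (f \<oplus>P const c \<otimes>P g) e" for e
	proof -
		have ne: "f e \<oplus> c \<otimes> g e ~= \<zero>" using that c g by (simp add: is_lead_def const_mult)
		then have "f e ~= \<zero> \<or> g e ~= \<zero>" using c by auto
		then have "e = d \<or> lexless e d" using f(2) g(2) unfolding is_lead_def by blast
		then show ?thesis using ne \<open>f d \<oplus> c \<otimes> g d = \<zero>\<close> by auto
	qed
	moreover have "f x = (f x \<oplus> c \<otimes> g x) \<oplus> \<ominus> c \<otimes> g x" for x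
		using fk[of x] gk[of x] c by (simp add: a_assoc l_minus r_neg)
	then have "f = (f \<oplus>P const c \<otimes>P g) \<oplus>P const (\<ominus> c) \<otimes>P g"
		using c g by (simp add: const_mult)
	ultimately show ?thesis using that[of c] c by blast
qed

definition Bdd :: "int => (expon => 'k) set" where
	"Bdd N = {f:carrier P. \<forall>d. f d ~= \<zero> \<longrightarrow> (\<forall>i. \<bar>snd (d i)\<bar> \<le> N)}"

lemma Bdd_lead: assumes "f:Bdd N" "is_lead f d" shows "d:bounded_expo n N"
proof -
	have "f:cP" "f d ~= \<zero>" "\<forall>i. \<bar>snd (d i)\<bar> \<le> N" using assms by (auto simp: Bdd_def is_lead_def)
	then show ?thesis using P.S_supp[of f] by (auto simp: bounded_expo_def)
qed

lemma lead_induct [consumes 2, case_names zero lead]: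
	assumes "f:Y" and Y: "Y \<subseteq> Bdd N" and z: "Q \<zero>P"
		and s: "!!f d. f:Y ==> is_lead f d ==> (!!g. g:Y ==> (!!e. is_lead g e ==> lexless e d) ==> Q g) ==> Q f"
	shows "Q f"
proof -
	have "\<forall>f. f:Y \<longrightarrow> is_lead f d \<longrightarrow> Q f" for d
	proof (induction d rule: wf_induct[OF wf_lexless[of n N]])
		case (1 d)
		show ?case
		proof (intro allI impI)
			fix f assume f: "f:Y" "is_lead f d"
			show "Q f"
			proof (rule s[OF f])
				fix g assume g: "g:Y" and less: "!!e. is_lead g e ==> lexless e d"
				show "Q g"
				proof (cases "g = \<zero>P")
					case False
					have "g:cP" using g Y by (auto simp: Bdd_def)
					then obtain e where e: "is_lead g e" using False by (rule ex_lead)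
					have "e:bounded_expo n N" "d:bounded_expo n N" using Bdd_lead e f g Y by blast+
					then show ?thesis using 1 less[OF e] e g by blast
				qed (simp add: z)
			qed
		qed
	qed
	moreover have "f:cP" using assms(1) Y by (auto simp: Bdd_def)
	ultimately show ?thesis
	proof (cases "f = \<zero>P")
		case False
		obtain d where "is_lead f d" using ex_lead[OF \<open>f:carrier P\<close> False] .
		then show ?thesis using \<open>!!d. \<forall>f. f:Y \<longrightarrow> is_lead f d \<longrightarrow> Q f\<close> assms(1) by blast
	qed (simp add: z)
qed

lemma Bdd_ex: assumes f: "f:cP" obtains N where "f:Bdd N"
proof -
	let ?A = "insert 0 ((%(d, i). \<bar>snd (d i)\<bar>) ` ({d. f d ~= \<zero>} \<times> {..<n}))"
	have fin: "finite ?A" using f by simp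
	have "\<bar>snd (d i)\<bar> \<le> Max ?A" if "f d ~= \<zero>" for d i
	proof (cases "i < n")
		case True
		then show ?thesis using that by (intro Max_ge[OF fin]) auto
	next
		case False
		then have "d i = 0" using that P.S_supp[OF f] by auto
		then show ?thesis using Max_ge[OF fin, of 0] by simp
	qed
	then have "f:Bdd (Max ?A)" using f by (simp add: Bdd_def)
	then show ?thesis by (rule that)
qed

lemma Bdd_add: assumes "f:Bdd N" "g:Bdd N" shows "f \<oplus>P g:Bdd N"
proof -
	have "\<bar>snd (d i)\<bar> \<le> N" if "f d \<oplus> g d ~= \<zero>" for d i
	proof -
		have "f d ~= \<zero> \<or> g d ~= \<zero>" using that by auto
		then show ?thesis using assms by (auto simp: Bdd_def)
	qed
	then show ?thesis using assms P.S.a_closed[of f g] by (simp add: Bdd_def)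
qed

lemma Bdd_mult: assumes c: "c:Lam" and f: "f:Bdd N" shows "c \<otimes>P f:Bdd N"
proof -
	have fP: "f:cP" using f by (simp add: Bdd_def)
	have "\<bar>snd (d i)\<bar> \<le> N" if nz: "(c \<otimes>P f) d ~= \<zero>" for d i
	proof -
		obtain a b where ab: "c a ~= \<zero>" "f b ~= \<zero>" "d = a + b" using nz by (rule pmult_supp[OF Lam_P[OF c] fP])
		then have "\<bar>snd (b i)\<bar> \<le> N" using f by (simp add: Bdd_def)
		then show ?thesis using Lam_supp[OF c ab(1), of i] ab(3) by simp
	qed
	then show ?thesis using c fP by (simp add: Bdd_def)
qed

abbreviation "PGam == P\<lparr>carrier := Gam\<rparr>"

lemma PGam_cring: "cring PGam"
	using P.S.subcring_iff[THEN iffD1, OF _ P.subcringI'[OF Gam_subring]] subringE(1)[OF Gam_subring] by blast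

lemma Inv_module: "module PGam (left_module P Inv)"
	by (rule P.S.left_module_module)
		(use subringE[OF Inv_subring] PGam_cring Gam_Inv_mult in auto)

definition words :: "(nat => int) set" where "words = {m. \<forall>i\<ge>n. m i = 0}"

definition basis :: "(expon => 'k) set" where "basis = (%m. orb (base n m)) ` words"

lemma base_expo: "m:words ==> base n m:carrier (expo n)"
	by (auto simp: base_def descents_empty zero_prod_def words_def)

lemma basis_Inv: "basis \<subseteq> Inv"
	using orb_Inv base_expo by (auto simp: basis_def)

lemma basis_span_step:
	assumes f: "f:Inv" and d: "is_lead f d"
	obtains a m where "m:words" "!!i. i \<ge> n ==> a i = 0" "sorted_exp n (shift_expo a)" "m = (%i. snd (d i))"
		"d = shift_expo a + base n m"
proof -
	have "d:carrier (expo n)" using d P.S_supp[OF Inv_P[OF f]] by (auto simp: is_lead_def)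
	then have z: "d i = 0" if "i \<ge> n" for i using that by simp
	obtain a where a: "!!i. i \<ge> n ==> a i = 0" "sorted_exp n (shift_expo a)" "d = shift_expo a + base n (%i. snd (d i))"
		using base_difference[OF lead_sorted[OF f d] z] by blast
	show ?thesis by (rule that[of "%i. snd (d i)" a]) (use a z in \<open>auto simp: words_def\<close>)
qed

lemma shift_expo_carrier: "(!!i. i \<ge> n ==> a i = 0) ==> shift_expo a:carrier (expo n)"
	by (simp add: shift_expo_def zero_prod_def)

lemma orb_base_Bdd: assumes m: "m:words" "!!i. \<bar>m i\<bar> \<le> N" shows "orb (base n m):Bdd N"
proof -
	have "\<bar>snd (d i)\<bar> \<le> N" if "orb (base n m) d ~= \<zero>" for d i
		using that m(2) by (auto simp: orb_def base_def split: if_splits)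
	then show ?thesis using Inv_P[OF orb_Inv[OF base_expo[OF m(1)]]] by (simp add: Bdd_def)
qed

lemma basis_span: assumes f: "f:Inv" shows "f:module_span PGam (left_module P Inv) basis"
proof -
	interpret V: module PGam "left_module P Inv" by (rule Inv_module)
	let ?S = "module_span PGam (left_module P Inv) basis"
	obtain N where "f:Bdd N" using Bdd_ex[OF Inv_P[OF f]] .
	then have "f:Inv \<inter> Bdd N" using f by simp
	then show ?thesis
		using Int_lower2
	proof (induction f rule: lead_induct)
		case zero
		then show ?case using V.span_zero[of basis] by simp
	next
		case (lead f d)
		then have f: "f:Inv" "f:Bdd N" by auto
		obtain a m where am: "m:words" "!!i. i \<ge> n ==> a i = 0" "sorted_exp n (shift_expo a)" "m = (%i. snd (d i))"
			"d = shift_expo a + base n m"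
			using basis_span_step[OF f(1) lead(2)] by blast
		define u where "u = orb (shift_expo a)"
		define v where "v = orb (base n m)"
		have u: "u:Gam" "is_lead u (shift_expo a)"
			using shift_Gam[OF am(2)] orb_lead[OF shift_expo_carrier[OF am(2)] am(3)] by (simp_all add: u_def)
		have v: "v:Inv" "is_lead v (base n m)" "v:basis"
			using orb_Inv[OF base_expo[OF am(1)]] orb_lead[OF base_expo[OF am(1)] base_sorted] am(1) by (auto simp: v_def basis_def)
		have "\<bar>m i\<bar> \<le> N" for i using f(2) lead(2) am(4) by (simp add: Bdd_def is_lead_def)
		then have vb: "v:Bdd N" unfolding v_def by (rule orb_base_Bdd[OF am(1)])
		have uv: "is_lead (u \<otimes>P v) d" unfolding am(5) using u v by (intro lead_mult) auto
		obtain c where c: "c:carrier k" "!!e. is_lead (f \<oplus>P const c \<otimes>P (u \<otimes>P v)) e ==> lexless e d"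
			and feq: "f = (f \<oplus>P const c \<otimes>P (u \<otimes>P v)) \<oplus>P const (\<ominus> c) \<otimes>P (u \<otimes>P v)"
			using cancel_lead[of f d "u \<otimes>P v"] f u v uv lead(2) by auto
		define h where "h = f \<oplus>P const c \<otimes>P (u \<otimes>P v)"
		have "h:Inv \<inter> Bdd N"
			unfolding h_def using f u v vb c(1) const_Gam[OF c(1)]
			by (intro IntI subringE(7)[OF Inv_subring] Bdd_add Gam_Inv_mult Bdd_mult) auto
		then have h: "h:?S" using lead(3) c(2) by (simp add: h_def)
		have cu: "const (\<ominus> c) \<otimes>P u:Gam" using u(1) const_Gam[of "\<ominus> c"] c(1) subringE(6)[OF Gam_subring] by simp
		then have "const (\<ominus> c) \<otimes>P u \<otimes>P v:?S"
			using V.span_smult[OF v(3), of "const (\<ominus> c) \<otimes>P u"] v(1) by simp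
		then have "h \<oplus>P const (\<ominus> c) \<otimes>P u \<otimes>P v:?S"
			using V.span_add[of basis h "const (\<ominus> c) \<otimes>P u \<otimes>P v"] h basis_Inv by simp
		moreover have "f = h \<oplus>P const (\<ominus> c) \<otimes>P u \<otimes>P v"
			using feq u v c(1) const_closed[of "\<ominus> c"] by (simp add: h_def P.S.m_assoc del: P.add_S)
		ultimately show ?case by simp
	qed
qed

lemma finsum_Inv: assumes "F:I \<rightarrow> Inv" shows "finsum (left_module P Inv) F I = finsum P F I"
proof -
	interpret V: module PGam "left_module P Inv" by (rule Inv_module)
	show ?thesis
		using V.M.additive_finsum[OF P.S.abelian_monoid_axioms, of "%x. x" F I] assms by simp
qed

lemma basis_indep: "module_indep PGam (left_module P Inv) basis"
	unfolding module_indep_def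
proof (intro allI impI, elim conjE)
	fix T c assume T: "finite T" "T \<subseteq> basis" "c:T \<rightarrow> carrier PGam"
		and zero: "(\<Oplus>\<^bsub>left_module P Inv\<^esub>v\<in>T. c v \<odot>\<^bsub>left_module P Inv\<^esub> v) = \<zero>\<^bsub>left_module P Inv\<^esub>"
	have c: "c v:Gam" if "v:T" for v using T that by auto
	have tI: "(%v. c v \<otimes>P v):T \<rightarrow> Inv" using c T basis_Inv by (auto intro!: Gam_Inv_mult)
	have z: "(\<Oplus>\<^bsub>P\<^esub>v\<in>T. c v \<otimes>P v) = \<zero>P" using zero finsum_Inv[OF tI] by simp
	define T' where "T' = {v:T. c v ~= \<zero>P}"
	have "\<exists>e m. is_lead (c v \<otimes>P v) e & v = orb (base n m) & m = (%i. snd (e i))" if v: "v:T'" for v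
	proof -
		have vT: "v:T" "c v ~= \<zero>P" using v by (auto simp: T'_def)
		obtain m where m: "m:words" "v = orb (base n m)" using vT T by (auto simp: basis_def)
		obtain a where a: "is_lead (c v) a" using ex_lead[of "c v"] c vT by auto
		have "snd (a i) = 0" for i using Lam_supp[OF Gam_Lam[OF c[OF vT(1)]]] a by (simp add: is_lead_def)
		then have "m = (%i. snd ((a + base n m) i))" by (simp add: base_def)
		moreover have "is_lead (c v \<otimes>P v) (a + base n m)"
			unfolding m(2)
			by (rule lead_mult) (use a c vT m orb_Inv base_expo base_sorted orb_lead in \<open>auto simp del: expo_simps\<close>)
		ultimately show ?thesis using m by blast
	qed
	then obtain E where E: "!!v. v:T' ==> is_lead (c v \<otimes>P v) (E v) & v = orb (base n (%i. snd (E v i)))"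
		by metis
	have "T' = {}"
	proof (rule ccontr)
		assume "T' ~= {}"
		then have "\<exists>d\<in>E ` T'. \<forall>e\<in>E ` T'. e = d \<or> lexless e d"
			using T(1) by (intro lexless_max) (auto simp: T'_def)
		then obtain w where w: "w:T'" "!!v. v:T' ==> E v = E w \<or> lexless (E v) (E w)" by blast
		have wT: "w:T" using w by (simp add: T'_def)
		have other: "(c v \<otimes>P v) (E w) = \<zero>" if v: "v:T - {w}" for v
		proof (cases "c v = \<zero>P")
			case True
			then show ?thesis using v T basis_Inv by (simp add: subset_iff) (simp add: P.zero_S)
		next
			case False
			then have v': "v:T'" using v by (simp add: T'_def)
			show ?thesis
			proof (rule ccontr)
				assume "(c v \<otimes>P v) (E w) ~= \<zero>"
				then have "E w = E v \<or> lexless (E w) (E v)" using E[OF v'] by (simp add: is_lead_def)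
				then have "E w = E v" using w(2)[OF v'] lexless_trans[of "E w" "E v" "E w"] by auto
				then have "v = w" using E[OF v'] E[OF w(1)] by simp
				then show False using v by simp
			qed
		qed
		have tP: "(c v \<otimes>P v):cP" if "v:T" for v
			using Inv_P[OF funcset_mem[OF tI that]] .
		have "(\<Oplus>\<^bsub>P\<^esub>v\<in>T. c v \<otimes>P v) (E w) = (\<Oplus>v\<in>T. (c v \<otimes>P v) (E w))"
			by (rule P.finsum_S) (use tP in auto)
		also have "... = (\<Oplus>v\<in>{w}. (c v \<otimes>P v) (E w))"
			by (rule add.finprod_mono_neutral_cong_right) (use T(1) wT other tP in \<open>auto simp: P.S_closed\<close>)
		also have "... = (c w \<otimes>P w) (E w)"
			using tP[OF wT] by (simp add: finsum_insert finsum_empty)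
		finally have "(c w \<otimes>P w) (E w) = \<zero>" using z by (simp add: P.zero_S)
		then show False using E[OF w(1)] by (simp add: is_lead_def)
	qed
	then show "\<forall>v\<in>T. c v = \<zero>\<^bsub>PGam\<^esub>" by (auto simp: T'_def)
qed

text \<open>The orbit sum of a sorted exponent has that exponent as its leading one. Division by such orbit sums, with the symmetric polynomials as coefficients, terminates since the order of exponents is well-founded, and distinct leading exponents give independence.\<close>

lemma Inv_free: "module_basis PGam (left_module P Inv) basis"
	unfolding module_basis_def
	using basis_Inv basis_span basis_indep module.span_closed[OF Inv_module, of basis] by auto

text \<open>By Dickson's lemma finitely many leading exponents of elements of the submodule suffice to reduce every other one.\<close>

lemma fg_submodule:
	assumes Y: "Y \<subseteq> Inv" "Y \<subseteq> Bdd N" and zero: "\<zero>P:Y"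
		and add: "!!f g. f:Y ==> g:Y ==> f \<oplus>P g:Y"
		and smult: "!!c f. c:Gam ==> f:Y ==> c \<otimes>P f:Y"
	shows "\<exists>B. finite B & B \<subseteq> Y & module_span PGam (left_module P Y) B = Y"
proof -
	have YP: "f:cP" if "f:Y" for f using that Y by auto
	have neg: "\<ominus>P f:Y" if "f:Y" for f
	proof -
		have "const (\<ominus> \<one>) \<otimes>P f = \<ominus>P f"
			using YP[OF that] by (subst const_mult) (auto simp: P_neg l_minus)
		then show ?thesis using smult[OF const_Gam[of "\<ominus> \<one>"] that] by simp
	qed
	have VM: "module PGam (left_module P Y)"
		by (rule P.S.left_module_module) (use Y YP zero add neg smult PGam_cring in auto)
	interpret V: module PGam "left_module P Y" by (rule VM)
	define A where "A = {d. \<exists>f\<in>Y. is_lead f d}"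
	define cc where "cc d i = (if i < n then fst (d i) - fst (d (Suc i)) else if i < 2 * n then nat (snd (d (i - n)) + N)
			else nat (N - snd (d (i - 2 * n))))" for d :: expon and i
	obtain F where F: "finite F" "F \<subseteq> A" "\<forall>a\<in>A. \<exists>b\<in>F. \<forall>i<3 * n. cc b i \<le> cc a i"
		using dickson[of A "3 * n" cc] by blast
	have A: "sorted_exp n d" "d:bounded_expo n N" if "d:A" for d
		using that Y lead_sorted Bdd_lead by (auto simp: A_def)
	have "\<forall>d\<in>F. \<exists>f\<in>Y. is_lead f d" using F by (auto simp: A_def)
	then obtain G where G: "!!d. d:F ==> G d:Y & is_lead (G d) d" by metis
	let ?B = "G ` F"
	let ?S = "module_span PGam (left_module P Y) ?B"
	have B: "?B \<subseteq> Y" using G by auto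
	have "f:?S" if "f:Y" for f
		using that Y(2)
	proof (induction f rule: lead_induct)
		case zero
		then show ?case using V.span_zero[of ?B] by simp
	next
		case (lead f d)
		have dA: "d:A" using lead by (auto simp: A_def)
		then obtain b where b: "b:F" "\<forall>i<3 * n. cc b i \<le> cc d i" using F(3) by blast
		have bA: "b:A" using b F by blast
		note sd = A[OF dA] and sb = A[OF bA]
		have dec: "fst (e (Suc i)) \<le> fst (e i)" if "sorted_exp n e" "e:bounded_expo n N" "i < n" for e i
		proof (cases "Suc i < n")
			case True
			then have "\<not> pless (e i) (e (Suc i))" using that by (simp add: sorted_exp_def)
			then show ?thesis by (simp add: pless_def)
		next
			case False
			then show ?thesis using that by (simp add: bounded_expo_def)
		qed
		have snd_eq: "snd (d i) = snd (b i)" for i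
		proof (cases "i < n")
			case True
			then have "cc b (n + i) \<le> cc d (n + i)" "cc b (2 * n + i) \<le> cc d (2 * n + i)" using b(2) by auto
			then have "nat (snd (b i) + N) \<le> nat (snd (d i) + N)" "nat (N - snd (b i)) \<le> nat (N - snd (d i))"
				using True by (auto simp: cc_def)
			moreover have "\<bar>snd (b i)\<bar> \<le> N" "\<bar>snd (d i)\<bar> \<le> N" using sd sb by (auto simp: bounded_expo_def)
			ultimately show ?thesis by linarith
		qed (use sd sb in \<open>auto simp: bounded_expo_def\<close>)
		obtain a where a: "!!i. i \<ge> n ==> a i = 0" "sorted_exp n (shift_expo a)" "d = shift_expo a + b"
		proof (rule sorted_difference[of n d b])
			fix i assume i: "i < n"
			then have "cc b i \<le> cc d i" using b(2) by auto
			then have "fst (b i) - fst (b (Suc i)) \<le> fst (d i) - fst (d (Suc i))" using i by (simp add: cc_def)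
			then show "fst (d (Suc i)) + fst (b i) \<le> fst (d i) + fst (b (Suc i))"
				using dec[OF sd i] dec[OF sb i] by linarith
		qed (use sd sb snd_eq that in \<open>auto simp: bounded_expo_def\<close>)
		define u where "u = orb (shift_expo a)"
		define v where "v = G b"
		have u: "u:Gam" "is_lead u (shift_expo a)"
			using shift_Gam[OF a(1)] orb_lead[OF shift_expo_carrier[OF a(1)] a(2)] by (simp_all add: u_def)
		have v: "v:Y" "is_lead v b" "v:?B" using G b by (auto simp: v_def)
		have uv: "is_lead (u \<otimes>P v) d" unfolding a(3) using u v YP by (intro lead_mult) auto
		obtain c where c: "c:carrier k" "!!e. is_lead (f \<oplus>P const c \<otimes>P (u \<otimes>P v)) e ==> lexless e d"
			and feq: "f = (f \<oplus>P const c \<otimes>P (u \<otimes>P v)) \<oplus>P const (\<ominus> c) \<otimes>P (u \<otimes>P v)"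
			using cancel_lead[of f d "u \<otimes>P v"] lead(1,2) YP u v uv by auto
		define h where "h = f \<oplus>P const c \<otimes>P (u \<otimes>P v)"
		have "h:Y" unfolding h_def by (intro add smult lead u v const_Gam c)
		then have h: "h:?S" using lead(3) c(2) by (simp add: h_def)
		have cu: "const (\<ominus> c) \<otimes>P u:Gam" using u(1) const_Gam[of "\<ominus> c"] c(1) subringE(6)[OF Gam_subring] by simp
		then have "const (\<ominus> c) \<otimes>P u \<otimes>P v:?S"
			using V.span_smult[OF v(3), of "const (\<ominus> c) \<otimes>P u"] v(1) by simp
		then have "h \<oplus>P const (\<ominus> c) \<otimes>P u \<otimes>P v:?S"
			using V.span_add[of ?B h "const (\<ominus> c) \<otimes>P u \<otimes>P v"] h B by simp
		moreover have "f = h \<oplus>P const (\<ominus> c) \<otimes>P u \<otimes>P v"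
			using feq u YP[OF v(1)] c(1) const_closed[of "\<ominus> c"] by (simp add: h_def P.S.m_assoc del: P.add_S)
		ultimately show ?case by simp
	qed
	then show ?thesis using V.span_closed[of ?B] B F(1) by (intro exI[of _ ?B]) auto
qed

end

section \<open>Fields of fractions\<close>

context field
begin

lemma frac_closed: "a:carrier R ==> b:carrier R - {\<zero>} ==> a \<otimes> inv b:carrier R"
	by (simp add: field_Units[symmetric])

lemma nz_inv: "b:carrier R - {\<zero>} ==> inv b:carrier R" "b:carrier R - {\<zero>} ==> inv b \<otimes> b = \<one>"
	"b:carrier R - {\<zero>} ==> b \<otimes> inv b = \<one>"
	by (simp_all add: field_Units[symmetric])

lemma nz_mult: "b:carrier R - {\<zero>} ==> d:carrier R - {\<zero>} ==> b \<otimes> d:carrier R - {\<zero>}"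
	using integral by auto

lemma frac_eq_iff:
	assumes "a:carrier R" "b:carrier R - {\<zero>}" "c:carrier R" "d:carrier R - {\<zero>}"
	shows "a \<otimes> inv b = c \<otimes> inv d \<longleftrightarrow> a \<otimes> d = c \<otimes> b"
proof -
	note i = nz_inv[OF assms(2)] nz_inv[OF assms(4)]
	have "a \<otimes> inv b \<otimes> (b \<otimes> d) = a \<otimes> d" "c \<otimes> inv d \<otimes> (b \<otimes> d) = c \<otimes> b"
	proof -
		have "a \<otimes> inv b \<otimes> (b \<otimes> d) = a \<otimes> (inv b \<otimes> b) \<otimes> d" using assms i(1,4) by (simp add: m_assoc)
		then show "a \<otimes> inv b \<otimes> (b \<otimes> d) = a \<otimes> d" using assms i by simp
		have "c \<otimes> inv d \<otimes> (b \<otimes> d) = c \<otimes> (inv d \<otimes> d) \<otimes> b" using assms i(1,4) by (simp add: m_ac)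
		then show "c \<otimes> inv d \<otimes> (b \<otimes> d) = c \<otimes> b" using assms i by simp
	qed
	moreover have "a \<otimes> inv b:carrier R" "c \<otimes> inv d:carrier R" using assms frac_closed by auto
	moreover note bd = nz_mult[OF assms(2,4)]
	ultimately show ?thesis
		using m_rcancel[of "b \<otimes> d" "a \<otimes> inv b" "c \<otimes> inv d"] by auto
qed

lemma frac_mult:
	assumes "a:carrier R" "b:carrier R - {\<zero>}" "c:carrier R" "d:carrier R - {\<zero>}"
	shows "(a \<otimes> inv b) \<otimes> (c \<otimes> inv d) = (a \<otimes> c) \<otimes> inv (b \<otimes> d)"
proof -
	note i = nz_inv[OF assms(2)] nz_inv[OF assms(4)]
	have "(b \<otimes> d) \<otimes> (inv b \<otimes> inv d) = (b \<otimes> inv b) \<otimes> (d \<otimes> inv d)"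
		using assms i(1,4) by (simp add: m_ac)
	then have "(b \<otimes> d) \<otimes> (inv b \<otimes> inv d) = \<one>" using i by simp
	then have "inv (b \<otimes> d) = inv b \<otimes> inv d"
		using assms i(1,4) by (intro comm_inv_char) auto
	then show ?thesis using assms i(1,4) by (simp add: m_ac)
qed

lemma frac_add:
	assumes "a:carrier R" "b:carrier R - {\<zero>}" "c:carrier R" "d:carrier R - {\<zero>}"
	shows "(a \<otimes> inv b) \<oplus> (c \<otimes> inv d) = (a \<otimes> d \<oplus> c \<otimes> b) \<otimes> inv (b \<otimes> d)"
proof -
	have "a \<otimes> inv b = (a \<otimes> d) \<otimes> inv (b \<otimes> d)"
		using assms nz_mult[OF assms(2,4)] by (subst frac_eq_iff) (auto simp: m_ac)
	moreover have "c \<otimes> inv d = (c \<otimes> b) \<otimes> inv (b \<otimes> d)"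
		using assms nz_mult[OF assms(2,4)] by (subst frac_eq_iff) (auto simp: m_ac)
	ultimately show ?thesis using assms nz_inv[OF nz_mult[OF assms(2,4)]] by (simp add: l_distr)
qed

lemma hom_inv:
	assumes h: "h:ring_hom R R" and x: "x:carrier R - {\<zero>}" shows "h (inv x) = inv (h x)"
proof -
	have "h x \<otimes> h (inv x) = \<one>"
		using rhm[OF h, of x "inv x"] rh1[OF h] x nz_inv[OF x] by simp
	then show ?thesis
		using rhc[OF h] x nz_inv(1)[OF x] by (intro comm_inv_char[symmetric]) auto
qed

end

locale fraction_classes = domain R for R :: "('c, 'r) ring_scheme" (structure) +
	fixes j :: "'c => 'a" assumes inj: "inj_on j (carrier R)"
begin

definition cls :: "'c => 'c => ('a \<times> 'a) set" where
	"cls a b = {(j c, j d) | c d. c:carrier R & d:carrier R - {\<zero>} & a \<otimes> d = c \<otimes> b}"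

lemma cls_eq:
	assumes "a:carrier R" "b:carrier R - {\<zero>}" "a':carrier R" "b':carrier R - {\<zero>}"
	shows "cls a b = cls a' b' \<longleftrightarrow> a \<otimes> b' = a' \<otimes> b"
proof
	assume "cls a b = cls a' b'"
	moreover have "(j a, j b):cls a b" using assms by (auto simp: cls_def)
	ultimately have "(j a, j b):cls a' b'" by simp
	then obtain c d where cd: "j a = j c" "j b = j d" "c:carrier R" "d:carrier R" "a' \<otimes> d = c \<otimes> b'"
		unfolding cls_def by blast
	then have "a = c" "b = d" using inj assms by (auto dest: inj_onD)
	then show "a \<otimes> b' = a' \<otimes> b" using cd by simp
next
	assume eq: "a \<otimes> b' = a' \<otimes> b"
	have "a \<otimes> d = c \<otimes> b \<longleftrightarrow> a' \<otimes> d = c \<otimes> b'" if "c:carrier R" "d:carrier R" for c d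
	proof -
		have "a \<otimes> d = c \<otimes> b \<longleftrightarrow> (a \<otimes> d) \<otimes> b' = (c \<otimes> b) \<otimes> b'" using m_rcancel assms that by simp
		also have "(a \<otimes> d) \<otimes> b' = (a \<otimes> b') \<otimes> d" using assms that by (simp add: m_ac)
		also have "... = (a' \<otimes> d) \<otimes> b" unfolding eq using assms that by (simp add: m_ac)
		also have "(c \<otimes> b) \<otimes> b' = (c \<otimes> b') \<otimes> b" using assms that by (simp add: m_ac)
		also have "(a' \<otimes> d) \<otimes> b = (c \<otimes> b') \<otimes> b \<longleftrightarrow> a' \<otimes> d = c \<otimes> b'" using m_rcancel assms that by simp
		finally show ?thesis .
	qed
	then show "cls a b = cls a' b'" unfolding cls_def by auto
qed

definition num :: "('a \<times> 'a) set => 'c" where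
	"num x = (SOME a. a:carrier R & (\<exists>b. b:carrier R - {\<zero>} & x = cls a b))"

definition den :: "('a \<times> 'a) set => 'c" where
	"den x = (SOME b. b:carrier R - {\<zero>} & x = cls (num x) b)"

lemma num_den:
	assumes "a:carrier R" "b:carrier R - {\<zero>}"
	shows "num (cls a b):carrier R" "den (cls a b):carrier R - {\<zero>}"
		"num (cls a b) \<otimes> b = a \<otimes> den (cls a b)"
proof -
	have 1: "num (cls a b):carrier R & (\<exists>b'. b':carrier R - {\<zero>} & cls a b = cls (num (cls a b)) b')"
		unfolding num_def by (rule someI[of _ a]) (use assms in blast)
	then have ex: "\<exists>b'. b':carrier R - {\<zero>} & cls a b = cls (num (cls a b)) b'" by blast
	have 2: "den (cls a b):carrier R - {\<zero>} & cls a b = cls (num (cls a b)) (den (cls a b))"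
		using someI_ex[OF ex] unfolding den_def .
	show "num (cls a b):carrier R" "den (cls a b):carrier R - {\<zero>}" using 1 2 by blast+
	then show "num (cls a b) \<otimes> b = a \<otimes> den (cls a b)" using 2 cls_eq assms by metis
qed

definition FF :: "('a \<times> 'a) set ring" where
	"FF = \<lparr>carrier = {cls a b | a b. a:carrier R & b:carrier R - {\<zero>}},
		 monoid.mult = (%x y. cls (num x \<otimes> num y) (den x \<otimes> den y)), one = cls \<one> \<one>, ring.zero = cls \<zero> \<one>,
		 ring.add = (%x y. cls (num x \<otimes> den y \<oplus> num y \<otimes> den x) (den x \<otimes> den y))\<rparr>"

lemma nonzero_mult: "b:carrier R - {\<zero>} ==> d:carrier R - {\<zero>} ==> b \<otimes> d:carrier R - {\<zero>}"
	using integral by auto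

lemma one_nonzero: "\<one>:carrier R - {\<zero>}"
	by simp

lemma cls_mult:
	assumes "a:carrier R" "b:carrier R - {\<zero>}" "c:carrier R" "d:carrier R - {\<zero>}"
	shows "cls a b \<otimes>\<^bsub>FF\<^esub> cls c d = cls (a \<otimes> c) (b \<otimes> d)"
proof -
	note x = num_den[OF assms(1,2)] and y = num_den[OF assms(3,4)]
	have "(num (cls a b) \<otimes> num (cls c d)) \<otimes> (b \<otimes> d) = (num (cls a b) \<otimes> b) \<otimes> (num (cls c d) \<otimes> d)"
		using x(1) y(1) assms by (simp add: m_ac)
	also have "... = (a \<otimes> c) \<otimes> (den (cls a b) \<otimes> den (cls c d))"
		unfolding x(3) y(3) using x(2) y(2) assms by (simp add: m_ac)
	finally show ?thesis
		unfolding FF_def using x(1,2) y(1,2) assms nonzero_mult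
		by (simp del: Diff_iff) (subst cls_eq, auto)
qed

lemma cls_add:
	assumes "a:carrier R" "b:carrier R - {\<zero>}" "c:carrier R" "d:carrier R - {\<zero>}"
	shows "cls a b \<oplus>\<^bsub>FF\<^esub> cls c d = cls (a \<otimes> d \<oplus> c \<otimes> b) (b \<otimes> d)"
proof -
	note x = num_den[OF assms(1,2)] and y = num_den[OF assms(3,4)]
	let ?n = "num (cls a b)" and ?m = "den (cls a b)" and ?s = "num (cls c d)" and ?t = "den (cls c d)"
	have "(?n \<otimes> ?t \<oplus> ?s \<otimes> ?m) \<otimes> (b \<otimes> d) = (?n \<otimes> b) \<otimes> (?t \<otimes> d) \<oplus> (?s \<otimes> d) \<otimes> (?m \<otimes> b)"
		using x(1,2) y(1,2) assms by (simp add: m_ac l_distr r_distr)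
	also have "... = (a \<otimes> d \<oplus> c \<otimes> b) \<otimes> (?m \<otimes> ?t)"
		unfolding x(3) y(3) using x(2) y(2) assms by (simp add: m_ac l_distr r_distr)
	finally show ?thesis
		unfolding FF_def using x(1,2) y(1,2) assms nonzero_mult
		by (simp del: Diff_iff) (subst cls_eq, auto)
qed

lemma frac_field_simps: "\<one>\<^bsub>FF\<^esub> = cls \<one> \<one>" "\<zero>\<^bsub>FF\<^esub> = cls \<zero> \<one>"
	"x:carrier FF \<longleftrightarrow> (\<exists>a b. a:carrier R & b:carrier R - {\<zero>} & x = cls a b)"
	by (auto simp: FF_def)

lemma frac_fieldE:
	assumes "x:carrier FF" obtains a b where "a:carrier R" "b:carrier R - {\<zero>}" "x = cls a b"
	using assms unfolding frac_field_simps by blast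

lemma cls_in: "a:carrier R ==> b:carrier R - {\<zero>} ==> cls a b:carrier FF"
	unfolding frac_field_simps by blast

lemma frac_field_cring: "cring FF"
proof (rule cringI)
	note [simp del] = Diff_iff
	note S = cls_add cls_mult nonzero_mult one_nonzero frac_field_simps(1,2)
	have R: "b:carrier R" if "b:carrier R - {\<zero>}" for b using that by (rule DiffD1)
	show "abelian_group FF"
	proof (rule abelian_groupI)
		fix x y assume "x:carrier FF" "y:carrier FF"
		then obtain a b c d where *: "a:carrier R" "b:carrier R - {\<zero>}" "x = cls a b" "c:carrier R" "d:carrier R - {\<zero>}" "y = cls c d"
			by (metis frac_fieldE)
		note b = R[OF *(2)] R[OF *(5)]
		show "x \<oplus>\<^bsub>FF\<^esub> y:carrier FF" using * b by (simp add: S cls_in)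
		show "x \<oplus>\<^bsub>FF\<^esub> y = y \<oplus>\<^bsub>FF\<^esub> x" using * b by (simp add: S a_comm m_comm)
		fix z assume "z:carrier FF"
		then obtain e f where ef: "e:carrier R" "f:carrier R - {\<zero>}" "z = cls e f" by (rule frac_fieldE)
		have "(a \<otimes> d \<oplus> c \<otimes> b) \<otimes> f \<oplus> e \<otimes> (b \<otimes> d) = a \<otimes> (d \<otimes> f) \<oplus> (c \<otimes> f \<oplus> e \<otimes> d) \<otimes> b"
			using * b ef(1) R[OF ef(2)] by (simp add: l_distr r_distr m_ac a_ac)
		then show "x \<oplus>\<^bsub>FF\<^esub> y \<oplus>\<^bsub>FF\<^esub> z = x \<oplus>\<^bsub>FF\<^esub> (y \<oplus>\<^bsub>FF\<^esub> z)"
			using * b ef R[OF ef(2)] by (simp add: S m_assoc)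
	next
		fix x assume "x:carrier FF"
		then obtain a b where *: "a:carrier R" "b:carrier R - {\<zero>}" "x = cls a b" by (rule frac_fieldE)
		note b = R[OF *(2)]
		show "\<zero>\<^bsub>FF\<^esub> \<oplus>\<^bsub>FF\<^esub> x = x" using * b by (simp add: S)
		have "\<ominus> a \<otimes> b \<oplus> a \<otimes> b = \<zero>" using * b by (simp add: l_minus l_neg)
		then have "cls (\<ominus> a) b \<oplus>\<^bsub>FF\<^esub> x = cls \<zero> (b \<otimes> b)"
			using * b by (simp add: S)
		also have "... = \<zero>\<^bsub>FF\<^esub>"
			unfolding frac_field_simps using nonzero_mult[OF *(2,2)] R[OF nonzero_mult[OF *(2,2)]] b by (subst cls_eq) (simp_all add: one_nonzero)
		finally have "cls (\<ominus> a) b \<oplus>\<^bsub>FF\<^esub> x = \<zero>\<^bsub>FF\<^esub>" .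
		then show "\<exists>y\<in>carrier FF. y \<oplus>\<^bsub>FF\<^esub> x = \<zero>\<^bsub>FF\<^esub>"
			using * b by (intro bexI[of _ "cls (\<ominus> a) b"]) (simp_all add: cls_in)
	qed (simp add: S cls_in)
	show "Group.comm_monoid FF"
	proof (rule comm_monoidI)
		fix x y assume "x:carrier FF" "y:carrier FF"
		then obtain a b c d where *: "a:carrier R" "b:carrier R - {\<zero>}" "x = cls a b" "c:carrier R" "d:carrier R - {\<zero>}" "y = cls c d"
			by (metis frac_fieldE)
		note b = R[OF *(2)] R[OF *(5)]
		show "x \<otimes>\<^bsub>FF\<^esub> y:carrier FF" using * b by (simp add: S cls_in)
		show "x \<otimes>\<^bsub>FF\<^esub> y = y \<otimes>\<^bsub>FF\<^esub> x" using * b by (simp add: S m_comm)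
		fix z assume "z:carrier FF"
		then obtain e f where ef: "e:carrier R" "f:carrier R - {\<zero>}" "z = cls e f" by (rule frac_fieldE)
		then show "x \<otimes>\<^bsub>FF\<^esub> y \<otimes>\<^bsub>FF\<^esub> z = x \<otimes>\<^bsub>FF\<^esub> (y \<otimes>\<^bsub>FF\<^esub> z)"
			using * b R[OF ef(2)] by (simp add: S m_assoc)
	next
		fix x assume "x:carrier FF"
		then obtain a b where *: "a:carrier R" "b:carrier R - {\<zero>}" "x = cls a b" by (rule frac_fieldE)
		then show "\<one>\<^bsub>FF\<^esub> \<otimes>\<^bsub>FF\<^esub> x = x" using R[OF *(2)] by (simp add: S)
	qed (simp add: S cls_in)
	fix x y z assume "x:carrier FF" "y:carrier FF" "z:carrier FF"
	then obtain a b c d e f where *: "a:carrier R" "b:carrier R - {\<zero>}" "x = cls a b" "c:carrier R" "d:carrier R - {\<zero>}" "y = cls c d"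
		 "e:carrier R" "f:carrier R - {\<zero>}" "z = cls e f"
		by (metis frac_fieldE)
	note b = R[OF *(2)] R[OF *(5)] R[OF *(8)]
	have "((a \<otimes> d \<oplus> c \<otimes> b) \<otimes> e) \<otimes> ((b \<otimes> f) \<otimes> (d \<otimes> f)) = ((a \<otimes> e) \<otimes> (d \<otimes> f) \<oplus> (c \<otimes> e) \<otimes> (b \<otimes> f)) \<otimes> ((b \<otimes> d) \<otimes> f)"
		using * b by (simp add: l_distr r_distr m_ac)
	then have "cls ((a \<otimes> d \<oplus> c \<otimes> b) \<otimes> e) ((b \<otimes> d) \<otimes> f) = cls ((a \<otimes> e) \<otimes> (d \<otimes> f) \<oplus> (c \<otimes> e) \<otimes> (b \<otimes> f)) ((b \<otimes> f) \<otimes> (d \<otimes> f))"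
		using * b nonzero_mult by (subst cls_eq) auto
	then show "(x \<oplus>\<^bsub>FF\<^esub> y) \<otimes>\<^bsub>FF\<^esub> z = x \<otimes>\<^bsub>FF\<^esub> z \<oplus>\<^bsub>FF\<^esub> y \<otimes>\<^bsub>FF\<^esub> z"
		using * b by (simp add: S)
qed

lemma frac_field_field: "field FF"
proof (rule cring.cring_fieldI2[OF frac_field_cring])
	show "\<zero>\<^bsub>FF\<^esub> ~= \<one>\<^bsub>FF\<^esub>" unfolding frac_field_simps by (subst cls_eq) auto
	fix x assume "x:carrier FF" "x ~= \<zero>\<^bsub>FF\<^esub>"
	then obtain a b where *: "a:carrier R" "b:carrier R - {\<zero>}" "x = cls a b" by (metis frac_fieldE)
	have "a ~= \<zero>"
	proof
		assume "a = \<zero>"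
		then have "x = \<zero>\<^bsub>FF\<^esub>" unfolding frac_field_simps *(3) using * by (subst cls_eq) auto
		then show False using \<open>x ~= \<zero>\<^bsub>FF\<^esub>\<close> by simp
	qed
	then have a: "a:carrier R - {\<zero>}" using * by simp
	have bR: "b:carrier R" using *(2) by simp
	have "x \<otimes>\<^bsub>FF\<^esub> cls b a = cls (a \<otimes> b) (b \<otimes> a)"
		unfolding *(3) by (rule cls_mult[OF *(1,2) bR a])
	also have "... = \<one>\<^bsub>FF\<^esub>"
		unfolding frac_field_simps using *(1) bR nonzero_mult[OF *(2) a] one_nonzero by (subst cls_eq) (simp_all add: m_comm)
	finally have "x \<otimes>\<^bsub>FF\<^esub> cls b a = \<one>\<^bsub>FF\<^esub>" .
	then show "\<exists>y\<in>carrier FF. x \<otimes>\<^bsub>FF\<^esub> y = \<one>\<^bsub>FF\<^esub>"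
		using cls_in[of b a] * a by auto
qed

end

text \<open>A domain together with an embedding into its field of fractions.\<close>

locale fractions = R: domain R + L: field L
	for R :: "('c, 'r) ring_scheme" and L :: "('l, 's) ring_scheme" +
	fixes io :: "'c => 'l"
	assumes io_hom: "io:ring_hom R L" and io_inj: "inj_on io (carrier R)"
		and io_frac: "x:carrier L ==> \<exists>a b. a:carrier R & b:carrier R - {\<zero>\<^bsub>R\<^esub>} & x = io a \<otimes>\<^bsub>L\<^esub> inv\<^bsub>L\<^esub> io b"

text \<open>The pairs are taken in the range of an injection \<open>j\<close>, which places the field of fractions in a prescribed type.\<close>

lemma (in fraction_classes) fractions_FF: "fractions R FF (%a. cls a \<one>)"
proof -
	interpret L: field FF by (rule frac_field_field)
	show ?thesis
	proof (intro fractions.intro domain_axioms frac_field_field fractions_axioms.intro)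
		show "(%a. cls a \<one>):ring_hom R FF"
			by (rule ring_hom_memI) (auto simp: cls_in cls_mult cls_add frac_field_simps(1))
		show "inj_on (%a. cls a \<one>) (carrier R)"
			by (rule inj_onI) (auto simp: cls_eq)
		fix x assume "x:carrier FF"
		then obtain a b where *: "a:carrier R" "b:carrier R - {\<zero>}" "x = cls a b" by (rule frac_fieldE)
		have b1: "cls b \<one>:carrier FF - {\<zero>\<^bsub>FF\<^esub>}"
			using * cls_eq[of b \<one> \<zero> \<one>] by (auto simp: cls_in frac_field_simps(2))
		have "x \<otimes>\<^bsub>FF\<^esub> cls b \<one> = cls a \<one>"
			unfolding *(3) using * by (subst cls_mult) (auto simp: cls_eq)
		then have "x = cls a \<one> \<otimes>\<^bsub>FF\<^esub> inv\<^bsub>FF\<^esub> cls b \<one>"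
			using L.nz_inv[OF b1] b1 \<open>x:carrier FF\<close> L.m_assoc[of x "cls b \<one>" "inv\<^bsub>FF\<^esub> cls b \<one>"] by auto
		then show "\<exists>a b. a:carrier R & b:carrier R - {\<zero>} & x = cls a \<one> \<otimes>\<^bsub>FF\<^esub> inv\<^bsub>FF\<^esub> cls b \<one>"
			using * by blast
	qed
qed

context fractions
begin

lemma io_closed: "a:carrier R ==> io a:carrier L"
	by (rule rhc[OF io_hom])

lemma io_mult: "a:carrier R ==> b:carrier R ==> io (a \<otimes>\<^bsub>R\<^esub> b) = io a \<otimes>\<^bsub>L\<^esub> io b"
	and io_add: "a:carrier R ==> b:carrier R ==> io (a \<oplus>\<^bsub>R\<^esub> b) = io a \<oplus>\<^bsub>L\<^esub> io b"
	and io_one: "io \<one>\<^bsub>R\<^esub> = \<one>\<^bsub>L\<^esub>"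
	using rhm[OF io_hom] rha[OF io_hom] rh1[OF io_hom] by auto

lemma io_zero: "io \<zero>\<^bsub>R\<^esub> = \<zero>\<^bsub>L\<^esub>"
	by (rule rh0[OF io_hom R.ring_axioms L.ring_axioms])

lemma io_eq: "a:carrier R ==> b:carrier R ==> io a = io b \<longleftrightarrow> a = b"
	using io_inj by (auto dest: inj_onD)

lemma io_nonzero: "b:carrier R - {\<zero>\<^bsub>R\<^esub>} ==> io b:carrier L - {\<zero>\<^bsub>L\<^esub>}"
	using io_eq[of b "\<zero>\<^bsub>R\<^esub>"] io_closed io_zero by auto

definition auts :: "('c => 'c) set" where
	"auts = {s:ring_hom R R. bij_betw s (carrier R) (carrier R)}"

definition lift :: "('c => 'c) => 'l => 'l" where
	"lift s = (\<lambda>x\<in>carrier L. SOME y. \<exists>a b. a:carrier R & b:carrier R - {\<zero>\<^bsub>R\<^esub>} \<and>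
		 x = io a \<otimes>\<^bsub>L\<^esub> inv\<^bsub>L\<^esub> io b & y = io (s a) \<otimes>\<^bsub>L\<^esub> inv\<^bsub>L\<^esub> io (s b))"

lemma auts_closed: "s:auts ==> a:carrier R ==> s a:carrier R"
	by (rule rhc[of s R R]) (simp_all add: auts_def)

lemma auts_nonzero: assumes s: "s:auts" and b: "b:carrier R - {\<zero>\<^bsub>R\<^esub>}" shows "s b:carrier R - {\<zero>\<^bsub>R\<^esub>}"
proof -
	have h: "s:ring_hom R R" and i: "inj_on s (carrier R)" using s by (auto simp: auts_def bij_betw_def)
	have "s \<zero>\<^bsub>R\<^esub> = \<zero>\<^bsub>R\<^esub>" by (rule rh0[OF h R.ring_axioms R.ring_axioms])
	then show ?thesis using inj_onD[OF i, of b "\<zero>\<^bsub>R\<^esub>"] b auts_closed[OF s] by auto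
qed

lemma lift_frac:
	assumes s: "s:auts" and a: "a:carrier R" and b: "b:carrier R - {\<zero>\<^bsub>R\<^esub>}"
	shows "lift s (io a \<otimes>\<^bsub>L\<^esub> inv\<^bsub>L\<^esub> io b) = io (s a) \<otimes>\<^bsub>L\<^esub> inv\<^bsub>L\<^esub> io (s b)"
proof -
	have h: "s:ring_hom R R" using s by (simp add: auts_def)
	let ?x = "io a \<otimes>\<^bsub>L\<^esub> inv\<^bsub>L\<^esub> io b"
	have x: "?x:carrier L" using a b io_closed io_nonzero by (intro L.frac_closed) auto
	define Q where "Q y \<longleftrightarrow> (\<exists>a b. a:carrier R & b:carrier R - {\<zero>\<^bsub>R\<^esub>} \<and>
		 ?x = io a \<otimes>\<^bsub>L\<^esub> inv\<^bsub>L\<^esub> io b & y = io (s a) \<otimes>\<^bsub>L\<^esub> inv\<^bsub>L\<^esub> io (s b))" for y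
	have "Q (io (s a) \<otimes>\<^bsub>L\<^esub> inv\<^bsub>L\<^esub> io (s b))" unfolding Q_def using a b by blast
	then have "Q (SOME y. Q y)" by (rule someI)
	then obtain c d where cd: "c:carrier R" "d:carrier R - {\<zero>\<^bsub>R\<^esub>}" "?x = io c \<otimes>\<^bsub>L\<^esub> inv\<^bsub>L\<^esub> io d"
		"(SOME y. Q y) = io (s c) \<otimes>\<^bsub>L\<^esub> inv\<^bsub>L\<^esub> io (s d)"
		unfolding Q_def[of "SOME y. Q y"] by (elim exE conjE) (rule that)
	have "io a \<otimes>\<^bsub>L\<^esub> io d = io c \<otimes>\<^bsub>L\<^esub> io b"
		using cd(3) L.frac_eq_iff[of "io a" "io b" "io c" "io d"] a b cd io_closed io_nonzero by blast
	then have "io (a \<otimes>\<^bsub>R\<^esub> d) = io (c \<otimes>\<^bsub>R\<^esub> b)" using a b cd by (simp add: io_mult)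
	then have "a \<otimes>\<^bsub>R\<^esub> d = c \<otimes>\<^bsub>R\<^esub> b" using io_eq a b cd by simp
	then have "s a \<otimes>\<^bsub>R\<^esub> s d = s c \<otimes>\<^bsub>R\<^esub> s b" using rhm[OF h] a b cd by (metis Diff_iff)
	then have "io (s a) \<otimes>\<^bsub>L\<^esub> io (s d) = io (s c) \<otimes>\<^bsub>L\<^esub> io (s b)"
	proof -
		have "s a:carrier R" "s b:carrier R" "s c:carrier R" "s d:carrier R"
			using a b cd by (auto intro: auts_closed[OF s])
		then show ?thesis using \<open>s a \<otimes>\<^bsub>R\<^esub> s d = s c \<otimes>\<^bsub>R\<^esub> s b\<close> by (simp add: io_mult[symmetric])
	qed
	then have "io (s a) \<otimes>\<^bsub>L\<^esub> inv\<^bsub>L\<^esub> io (s b) = io (s c) \<otimes>\<^bsub>L\<^esub> inv\<^bsub>L\<^esub> io (s d)"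
		using a b cd auts_closed[OF s] auts_nonzero[OF s] io_closed io_nonzero by (subst L.frac_eq_iff) blast+
	moreover have "lift s ?x = (SOME y. Q y)" using x by (simp add: lift_def Q_def)
	ultimately show ?thesis using cd(4) by simp
qed

lemma lift_io: assumes s: "s:auts" and a: "a:carrier R" shows "lift s (io a) = io (s a)"
proof -
	have "s \<one>\<^bsub>R\<^esub> = \<one>\<^bsub>R\<^esub>" using s rh1[of s R R] by (simp add: auts_def)
	then show ?thesis
		using lift_frac[OF s a, of "\<one>\<^bsub>R\<^esub>"] a io_closed auts_closed[OF s] by (simp add: io_one)
qed

lemma lift_hom: assumes s: "s:auts" shows "lift s:ring_hom L L"
proof (rule ring_hom_memI)
	have h: "s:ring_hom R R" using s by (simp add: auts_def)
	note cl = io_closed io_nonzero auts_closed[OF s] auts_nonzero[OF s]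
	show "lift s \<one>\<^bsub>L\<^esub> = \<one>\<^bsub>L\<^esub>"
		using lift_io[OF s, of "\<one>\<^bsub>R\<^esub>"] rh1[OF h] by (simp add: io_one)
	fix x assume x: "x:carrier L"
	obtain a b where ab: "a:carrier R" "b:carrier R - {\<zero>\<^bsub>R\<^esub>}" "x = io a \<otimes>\<^bsub>L\<^esub> inv\<^bsub>L\<^esub> io b" using io_frac[OF x] by blast
	show "lift s x:carrier L" unfolding ab(3) using ab cl by (subst lift_frac[OF s]) (auto intro!: L.frac_closed)
	fix y assume y: "y:carrier L"
	obtain c d where cd: "c:carrier R" "d:carrier R - {\<zero>\<^bsub>R\<^esub>}" "y = io c \<otimes>\<^bsub>L\<^esub> inv\<^bsub>L\<^esub> io d" using io_frac[OF y] by blast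
	have bd: "b \<otimes>\<^bsub>R\<^esub> d:carrier R - {\<zero>\<^bsub>R\<^esub>}" using ab cd R.integral by auto
	have S: "s (b \<otimes>\<^bsub>R\<^esub> d) = s b \<otimes>\<^bsub>R\<^esub> s d" "s (a \<otimes>\<^bsub>R\<^esub> c) = s a \<otimes>\<^bsub>R\<^esub> s c" "s (a \<otimes>\<^bsub>R\<^esub> d \<oplus>\<^bsub>R\<^esub> c \<otimes>\<^bsub>R\<^esub> b) = s a \<otimes>\<^bsub>R\<^esub> s d \<oplus>\<^bsub>R\<^esub> s c \<otimes>\<^bsub>R\<^esub> s b"
		using ab cd by (simp_all add: rhm[OF h] rha[OF h])
	have 1: "io a:carrier L" "io b:carrier L - {\<zero>\<^bsub>L\<^esub>}" "io c:carrier L" "io d:carrier L - {\<zero>\<^bsub>L\<^esub>}"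
		using ab cd cl by blast+
	have 2: "io (s a):carrier L" "io (s b):carrier L - {\<zero>\<^bsub>L\<^esub>}" "io (s c):carrier L" "io (s d):carrier L - {\<zero>\<^bsub>L\<^esub>}"
		using ab cd cl by blast+
	have 3: "s a:carrier R" "s b:carrier R" "s c:carrier R" "s d:carrier R" using ab cd cl by blast+
	have "x \<otimes>\<^bsub>L\<^esub> y = io (a \<otimes>\<^bsub>R\<^esub> c) \<otimes>\<^bsub>L\<^esub> inv\<^bsub>L\<^esub> io (b \<otimes>\<^bsub>R\<^esub> d)"
		unfolding ab(3) cd(3) using ab cd by (simp add: L.frac_mult[OF 1] io_mult)
	then have "lift s (x \<otimes>\<^bsub>L\<^esub> y) = io (s (a \<otimes>\<^bsub>R\<^esub> c)) \<otimes>\<^bsub>L\<^esub> inv\<^bsub>L\<^esub> io (s (b \<otimes>\<^bsub>R\<^esub> d))"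
		using lift_frac[OF s _ bd] ab cd by simp
	also have "... = lift s x \<otimes>\<^bsub>L\<^esub> lift s y"
		unfolding ab(3) cd(3) lift_frac[OF s ab(1,2)] lift_frac[OF s cd(1,2)] L.frac_mult[OF 2] S
		using 3 by (simp add: io_mult)
	finally show "lift s (x \<otimes>\<^bsub>L\<^esub> y) = lift s x \<otimes>\<^bsub>L\<^esub> lift s y" .
	have "x \<oplus>\<^bsub>L\<^esub> y = io (a \<otimes>\<^bsub>R\<^esub> d \<oplus>\<^bsub>R\<^esub> c \<otimes>\<^bsub>R\<^esub> b) \<otimes>\<^bsub>L\<^esub> inv\<^bsub>L\<^esub> io (b \<otimes>\<^bsub>R\<^esub> d)"
		unfolding ab(3) cd(3) using ab cd by (simp add: L.frac_add[OF 1] io_mult io_add)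
	then have "lift s (x \<oplus>\<^bsub>L\<^esub> y) = io (s (a \<otimes>\<^bsub>R\<^esub> d \<oplus>\<^bsub>R\<^esub> c \<otimes>\<^bsub>R\<^esub> b)) \<otimes>\<^bsub>L\<^esub> inv\<^bsub>L\<^esub> io (s (b \<otimes>\<^bsub>R\<^esub> d))"
		using lift_frac[OF s _ bd] ab cd by simp
	also have "... = lift s x \<oplus>\<^bsub>L\<^esub> lift s y"
		unfolding ab(3) cd(3) lift_frac[OF s ab(1,2)] lift_frac[OF s cd(1,2)] L.frac_add[OF 2] S
		using 3 by (simp add: io_mult io_add)
	finally show "lift s (x \<oplus>\<^bsub>L\<^esub> y) = lift s x \<oplus>\<^bsub>L\<^esub> lift s y" .
qed

lemma hom_eqI:
	assumes f: "f:ring_hom L L" and g: "g:ring_hom L L"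
		and eq: "!!a. a:carrier R ==> f (io a) = g (io a)" and x: "x:carrier L"
	shows "f x = g x"
proof -
	obtain a b where ab: "a:carrier R" "b:carrier R - {\<zero>\<^bsub>R\<^esub>}" "x = io a \<otimes>\<^bsub>L\<^esub> inv\<^bsub>L\<^esub> io b" using io_frac[OF x] by blast
	note b' = io_nonzero[OF ab(2)]
	show ?thesis
		unfolding ab(3) using ab eq io_closed L.nz_inv(1)[OF b']
		by (simp add: rhm[OF f] rhm[OF g] L.hom_inv[OF f b'] L.hom_inv[OF g b'])
qed

lemma auts_comp: assumes "s:auts" "t:auts" shows "s \<circ> t:auts"
	using assms ring_hom_trans[of t R R s R] bij_betw_trans[of t "carrier R" "carrier R" s "carrier R"]
	by (simp add: auts_def)

lemma lift_comp:
	assumes s: "s:auts" and t: "t:auts" and x: "x:carrier L"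
	shows "lift s (lift t x) = lift (s \<circ> t) x"
proof -
	have "(lift s \<circ> lift t) x = lift (s \<circ> t) x"
		by (rule hom_eqI[OF ring_hom_trans[OF lift_hom[OF t] lift_hom[OF s]] lift_hom[OF auts_comp[OF s t]] _ x])
			(simp add: lift_io s t auts_comp auts_closed)
	then show ?thesis by simp
qed

lemma lift_id: assumes "s:auts" "!!a. a:carrier R ==> s a = a" "x:carrier L" shows "lift s x = x"
	by (rule hom_eqI[of "lift s" "%x. x", OF lift_hom[OF assms(1)] _ _ assms(3)])
		(use assms lift_io in \<open>auto simp: ring_hom_def\<close>)

lemma lift_Bij:
	assumes s: "s:auts" and t: "t:auts" and st: "!!a. a:carrier R ==> s (t a) = a" "!!a. a:carrier R ==> t (s a) = a"
	shows "lift s:Bij (carrier L)"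
proof -
	have 1: "lift s (lift t x) = x" "lift t (lift s x) = x" if "x:carrier L" for x
		using that lift_comp[OF s t] lift_comp[OF t s] lift_id[OF auts_comp[OF s t]] lift_id[OF auts_comp[OF t s]] st by auto
	have "bij_betw (lift s) (carrier L) (carrier L)"
		by (rule bij_betw_byWitness[of _ "lift t"]) (use 1 rhc[OF lift_hom] s t in auto)
	then show ?thesis by (simp add: Bij_def lift_def)
qed

end

section \<open>Scaling automorphisms and coefficient slices\<close>

lemma (in skew_monoid) S_induct_supp [consumes 2, case_names zero add]:
	assumes f: "f:carrier S" "supp f \<subseteq> A" and z: "Q \<zero>\<^bsub>S\<^esub>"
		and s: "!!f r m. [|f:carrier S; supp f \<subseteq> A; Q f; r:carrier R; m:carrier M; m:A|] ==> Q (sgl R r m \<oplus>\<^bsub>S\<^esub> f)"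
	shows "Q f"
proof -
	let ?r = "%f m. if m:A then f m else \<zero>"
	have rc: "?r f:carrier S" if "f:carrier S" for f
	proof -
		have sub: "supp (?r f) \<subseteq> supp f" by auto
		show ?thesis
			unfolding carrier_S using S_closed[OF that] S_supp[OF that] finite_subset[OF sub S_finite[OF that]] by auto
	qed
	have rs: "supp (?r f) \<subseteq> A" for f by auto
	have "Q (?r f)"
		using f(1)
	proof (induction f rule: S_induct)
		case zero
		have "?r \<zero>\<^bsub>S\<^esub> = \<zero>\<^bsub>S\<^esub>" by (auto simp: zero_S)
		then show ?case using z by simp
	next
		case (add f r m)
		show ?case
		proof (cases "m:A")
			case True
			have "?r (sgl R r m \<oplus>\<^bsub>S\<^esub> f) = sgl R r m \<oplus>\<^bsub>S\<^esub> ?r f"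
				using True add(2) by (auto simp: skew_single_def fun_eq_iff)
			then show ?thesis using s[OF rc[OF add(1)] rs add(4,2,3) True] by simp
		next
			case False
			have "?r (sgl R r m \<oplus>\<^bsub>S\<^esub> f) = ?r f"
				using False S_closed[OF add(1)] by (auto simp: skew_single_def fun_eq_iff)
			then show ?thesis using add(4) by simp
		qed
	qed
	moreover have "f m = \<zero>" if "m \<notin> A" for m using f(2) that by blast
	then have "?r f = f" by (auto simp: fun_eq_iff)
	ultimately show ?thesis by simp
qed

context laurent
begin

lemma Lam_induct [consumes 1, case_names zero add]:
	assumes f: "f:Lam" and z: "Q \<zero>P"
		and s: "!!f r e. [|f:Lam; Q f; r:carrier k; e:carrier (expo n); !!i. snd (e i) = 0|] ==> Q (single r e \<oplus>P f)"
	shows "Q f"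
proof -
	have sub: "{d. f d ~= \<zero>} \<subseteq> {d. \<forall>i. snd (d i) = 0}" using Lam_supp[OF f] by blast
	show ?thesis
	proof (rule P.S_induct_supp[OF Lam_P[OF f] sub])
		show "Q \<zero>P" by (rule z)
		fix f r e assume "f:cP" "{d. f d ~= \<zero>} \<subseteq> {d. \<forall>i. snd (d i) = 0}" "Q f" "r:carrier k" "e:carrier (expo n)" "e:{d. \<forall>i. snd (d i) = 0}"
		then show "Q (single r e \<oplus>P f)" using LamI[of f] by (intro s) auto
	qed
qed

lemma single_Lam: "r:carrier k ==> e:carrier (expo n) ==> (!!i. snd (e i) = 0) ==> single r e:Lam"
	by (rule LamI[OF P.single_closed]) (auto simp: skew_single_def split: if_splits)

definition zv :: "nat => expon => 'k" where
	"zv i = single \<one> (%j. if j = i then (1, 0) else 0)"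

lemma zv_Lam: "i < n ==> zv i:Lam"
	unfolding zv_def by (rule single_Lam) auto

lemma permP_zv: assumes p: "p permutes {..<n}" shows "permP p (zv i) = zv (p i)"
proof -
	have "(%j. if j = i then (1, 0) else 0) \<circ> pinv p = (%j. if j = p i then (1, 0) else (0 :: nat \<times> int))"
		using permutes_inverses[OF p] by (auto simp: fun_eq_iff)
	then show ?thesis unfolding zv_def permP_single[OF p] by simp
qed

lemma zv_inj: "zv i = zv j ==> i = j"
proof -
	assume "zv i = zv j"
	then have "zv j (%l. if l = i then (1, 0) else 0) ~= \<zero>" by (metis skew_single_def zv_def one_not_zero)
	then have "(%l. if l = i then (1, 0) else 0) = (%l. if l = j then (1, 0) else (0 :: nat \<times> int))"
		unfolding zv_def skew_single_def by presburger
	then have "(if i = i then (1, 0) else 0) = (if i = j then (1, 0) else (0 :: nat \<times> int))" by (rule fun_cong)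
	then show "i = j" by (simp add: zero_prod_def split: if_splits)
qed

text \<open>The polynomials are generated by the constants and the variables.\<close>

lemma Lam_generated [consumes 1, case_names cst var add mult]:
	assumes f: "f:Lam" and c: "!!c. c:carrier k ==> Q (const c)" and z: "!!i. i < n ==> Q (zv i)"
		and add: "!!f g. f:Lam ==> g:Lam ==> Q f ==> Q g ==> Q (f \<oplus>P g)"
		and mult: "!!f g. f:Lam ==> g:Lam ==> Q f ==> Q g ==> Q (f \<otimes>P g)"
	shows "Q f"
proof -
	have cl: "const c:Lam" if "c:carrier k" for c using const_Gam[OF that] by simp
	have 1: "Q (single \<one> e)" if "e:carrier (expo n)" "!!i. snd (e i) = 0" "(\<Sum>i<n. fst (e i)) = t" for e t
		using that
	proof (induction t arbitrary: e)
		case 0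
		then have "e i = 0" for i by (cases "i < n") (auto simp: prod_eq_iff)
		then have "e = 0" by (simp add: fun_eq_iff)
		then show ?case using c[of \<one>] by (simp only: const_def one_closed)
	next
		case (Suc t)
		then obtain i where i: "i < n" "fst (e i) > 0"
			by (metis (no_types, lifting) Zero_not_Suc gr0I lessThan_iff sum.neutral)
		define e' where "e' = e(i := (fst (e i) - 1, 0))"
		have e': "e':carrier (expo n)" "!!j. snd (e' j) = 0" using Suc(2,3) i by (auto simp: e'_def)
		have eq: "e = (%j. if j = i then (1, 0) else 0) + e'"
			using i Suc(3) by (auto simp: e'_def fun_eq_iff prod_eq_iff)
		have "(\<Sum>j<n. fst (e j)) = (\<Sum>j<n. if j = i then 1 else 0) + (\<Sum>j<n. fst (e' j))"
			unfolding sum.distrib[symmetric] by (rule sum.cong) (use i in \<open>auto simp: e'_def\<close>)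
		then have "(\<Sum>j<n. fst (e' j)) = t" using Suc(4) i by simp
		then have "Q (single \<one> e')" using Suc.IH e' by blast
		then have "Q (zv i \<otimes>P single \<one> e')" using i z zv_Lam e' single_Lam by (intro mult) auto
		moreover have "zv i \<otimes>P single \<one> e' = single \<one> e"
			unfolding zv_def by (subst P.single_mult) (use i e' eq in auto)
		ultimately show ?case by simp
	qed
	show ?thesis
		using f
	proof (induction f rule: Lam_induct)
		case zero
		have "const \<zero> = \<zero>P" by (simp add: const_def P.single_zero)
		then show ?case using c[of \<zero>] by simp
	next
		case (add f r e)
		have "Q (const r \<otimes>P single \<one> e)" using add 1[OF add(3,4) refl] c cl single_Lam by (intro mult) auto
		moreover have "const r \<otimes>P single \<one> e = single r e"
			unfolding const_def by (subst P.single_mult) (use add in auto)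
		ultimately show ?case using add single_Lam by (intro assms(4)) auto
	qed
qed

lemma Bdd_P: "f:Bdd N ==> f:cP"
	unfolding Bdd_def by blast

definition slice :: "(nat => int) => (expon => 'k) => expon => 'k" where
	"slice a g = (%d. if \<forall>i. snd (d i) = 0 then g (%i. (fst (d i), a i)) else \<zero>)"

lemma slice_closed: assumes g: "g:cP" shows "slice a g:Lam"
proof (rule LamI)
	let ?h = "%d :: expon. %i. (fst (d i), 0 :: int)"
	have sub: "{d. slice a g d ~= \<zero>} \<subseteq> ?h ` {d. g d ~= \<zero>}"
	proof
		fix d assume d: "d:{d. slice a g d ~= \<zero>}"
		then have "\<forall>i. snd (d i) = 0" "g (%i. (fst (d i), a i)) ~= \<zero>" by (auto simp: slice_def split: if_splits)
		then show "d:?h ` {d. g d ~= \<zero>}"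
			by (intro image_eqI[of _ _ "%i. (fst (d i), a i)"]) (auto simp: fun_eq_iff prod_eq_iff)
	qed
	have "?h ` {d. g d ~= \<zero>} \<subseteq> carrier (expo n)" using P.S_supp[OF g] by (auto simp: zero_prod_def)
	then show "slice a g:cP"
		unfolding P.carrier_S using finite_subset[OF sub] sub g P.S_closed[OF g] by (auto simp: slice_def)
qed (auto simp: slice_def split: if_splits)

lemma slice_add: "slice a (f \<oplus>P g) = slice a f \<oplus>P slice a g"
	by (auto simp: slice_def)

lemma slice_single: "slice a (single r d) = (if (%i. snd (d i)) = a then single r (%i. (fst (d i), 0)) else \<zero>P)"
	by (auto simp: slice_def skew_single_def P.zero_S fun_eq_iff prod_eq_iff)

lemma slice_mult:
	assumes c: "c:Lam" and g: "g:cP" shows "slice a (c \<otimes>P g) = c \<otimes>P slice a g"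
proof -
	note sc = Lam_P[OF slice_closed]
	have 1: "slice a (single r e \<otimes>P g) = single r e \<otimes>P slice a g"
		if "r:carrier k" "e:carrier (expo n)" "!!i. snd (e i) = 0" for r e
	proof (rule P.additive_eqI[OF P.S_abelian g])
		fix s d assume s: "s:carrier k" "d:carrier (expo n)"
		have "(%i. (fst ((e + d) i), 0)) = e + (%i. (fst (d i), 0 :: int))" "(%i. snd ((e + d) i)) = (%i. snd (d i))"
			using that(3) by (auto simp: fun_eq_iff prod_eq_iff)
		moreover have "(%i. (fst (d i), 0 :: int)):carrier (expo n)" using s by (simp add: zero_prod_def)
		ultimately show "slice a (single r e \<otimes>P single s d) = single r e \<otimes>P slice a (single s d)"
			using that s by (simp add: P.single_mult slice_single)
	qed (use that sc in \<open>simp_all add: P.S.r_distr slice_add del: P.add_S expo_simps\<close>)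
	show ?thesis
		using c
	proof (induction c rule: Lam_induct)
		case zero
		show ?case using sc[OF g] g by (simp) (simp add: slice_def P.zero_S)
	next
		case (add f r e)
		then show ?case using 1 g sc by (simp add: P.S.l_distr slice_add del: P.add_S expo_simps)
	qed
qed

lemma slice_permP: "slice a (permP p g) = permP p (slice (a \<circ> p) g)" if p: "p permutes {..<n}"
proof
	fix d :: expon
	have "(\<forall>i. snd (d i) = 0) \<longleftrightarrow> (\<forall>i. snd (d (p i)) = 0)"
		using permutes_inverses(1)[OF p] by metis
	then show "slice a (permP p g) d = permP p (slice (a \<circ> p) g) d"
		by (auto simp: slice_def permP_def o_def)
qed

text \<open>Polynomials are finitely generated over the symmetric ones: the coefficient of a word with
	pairwise distinct letters in a symmetric element is an arbitrary polynomial.\<close>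

lemma Lam_finite: "\<exists>B. finite B & B \<subseteq> Lam & (\<forall>f\<in>Lam. \<exists>c\<in>B \<rightarrow> Gam. f = (\<Oplus>\<^bsub>P\<^esub>v\<in>B. c v \<otimes>P v))"
proof -
	define w :: "nat => int" where "w i = (if i < n then int i else 0)" for i
	define t where "t = single \<one> (%i. (0, w i))"
	define Y where "Y = Inv \<inter> Bdd (int n)"
	have wE: "(%i. (0, w i)):carrier (expo n)" by (simp add: w_def zero_prod_def)
	have tP: "t:cP" using wE by (simp add: t_def del: expo_simps)
	have "t d ~= \<zero> \<longrightarrow> (\<forall>i. \<bar>snd (d i)\<bar> \<le> int n)" for d by (simp add: t_def skew_single_def w_def)
	then have tB: "t:Bdd (int n)" using tP by (simp add: Bdd_def)
	have Bp: "permP p f:Bdd (int n)" if p: "p permutes {..<n}" and f: "f:Bdd (int n)" for p f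
	proof -
		have "\<bar>snd (d i)\<bar> \<le> int n" if "permP p f d ~= \<zero>" for d i
		proof -
			have "\<bar>snd ((d \<circ> p) (pinv p i))\<bar> \<le> int n" using f that by (simp add: Bdd_def permP_def del: o_apply)
			then show ?thesis by (simp add: permutes_inverses(1)[OF p])
		qed
		moreover have "permP p f:cP" using permP_closed[OF p] f by (simp add: Bdd_def)
		ultimately show ?thesis by (simp add: Bdd_def)
	qed
	have zB: "\<zero>P:Bdd (int n)" using P.S.zero_closed unfolding Bdd_def by (simp add: P.zero_S)
	have "\<exists>B. finite B & B \<subseteq> Y & module_span PGam (left_module P Y) B = Y"
	proof (rule fg_submodule[where N = "int n"])
		show "\<zero>P:Y" using zB subringE(2)[OF Inv_subring] by (simp add: Y_def)
	qed (auto simp: Y_def Gam_Inv_mult intro: Bdd_add Bdd_mult subringE(7)[OF Inv_subring] simp del: P.add_S)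
	then obtain B where B: "finite B" "B \<subseteq> Y" "module_span PGam (left_module P Y) B = Y" by blast
	have YP: "Y \<subseteq> cP" by (auto simp: Y_def)
	let ?Per = "{p. p permutes {..<n}}"
	have fin: "finite ?Per" by (rule finite_permutations) simp
	have "\<exists>c\<in>B \<rightarrow> Gam. f = (\<Oplus>\<^bsub>P\<^esub>v\<in>B. c v \<otimes>P slice w v)" if f: "f:Lam" for f
	proof -
		define g where "g = (\<Oplus>\<^bsub>P\<^esub>p\<in>?Per. permP p (f \<otimes>P t))"
		have ftP: "f \<otimes>P t:cP" using f tP by simp
		have F: "(%p. permP p (f \<otimes>P t)):?Per \<rightarrow> cP" using permP_closed ftP by auto
		have gP: "g:cP" unfolding g_def using F by (rule P.S.finsum_closed)
		have gI: "g:Inv"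
		proof (rule InvI[OF gP])
			fix r assume r: "r permutes {..<n}"
			have "permP r g = (\<Oplus>\<^bsub>P\<^esub>p\<in>?Per. permP r (permP p (f \<otimes>P t)))"
				unfolding g_def
				by (rule P.S.additive_finsum[OF P.S.abelian_monoid_axioms _ _ permP_add F])
					(use permP_closed[OF r] rh0[OF permP_hom[OF r] P.S_ring P.S_ring] in auto)
			also have "... = (\<Oplus>\<^bsub>P\<^esub>p\<in>?Per. permP (r \<circ> p) (f \<otimes>P t))" by (simp add: permP_comp)
			also have "... = (\<Oplus>\<^bsub>P\<^esub>p\<in>(%p. r \<circ> p) ` ?Per. permP p (f \<otimes>P t))"
			proof (rule P.S.finsum_reindex[symmetric])
				show "inj_on (%p. r \<circ> p) ?Per"
					using permutes_inv_o(2)[OF r] by (intro inj_onI) (metis comp_assoc id_comp)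
				show "(%p. permP p (f \<otimes>P t)):(%p. r \<circ> p) ` ?Per \<rightarrow> cP"
					using permP_closed[OF permutes_compose[OF _ r] ftP] by auto
			qed
			also have "(%p. r \<circ> p) ` ?Per = ?Per" using image_compose_permutations_left[OF r] by (simp add: setcompr_eq_image)
			finally show "permP r g = g" by (simp add: g_def)
		qed
		have Bs: "finsum P F I:Bdd (int n)" if "finite I" "F:I \<rightarrow> Bdd (int n)" for F :: "(nat => nat) => expon => 'k" and I
			using that
		proof (induction I)
			case (insert i I)
			have F: "F:I \<rightarrow> Bdd (int n)" "F i:Bdd (int n)" using insert.prems by auto
			then have "F:I \<rightarrow> cP" "F i:cP" using Bdd_P by blast+
			then show ?case using F insert.hyps insert.IH Bdd_add[of "F i" "int n" "finsum P F I"] by (simp add: P.S.finsum_insert del: P.add_S)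
		qed (simp add: zB)
		have "g:Bdd (int n)" unfolding g_def by (rule Bs[OF fin]) (use Bp Bdd_mult[OF f tB] in auto)
		then have "g:module_span PGam (left_module P Y) B" using gI B(3) by (simp add: Y_def)
		then obtain T c where T: "finite T" "T \<subseteq> B" "c:T \<rightarrow> Gam" "g = (\<Oplus>\<^bsub>left_module P Y\<^esub>v\<in>T. c v \<otimes>P v)"
			unfolding module_span_def by auto
		have cY: "c v \<otimes>P v:Y" if "v:T" for v
		proof -
			have "c v:Gam" "v:Inv" "v:Bdd (int n)" using that T B(2) by (auto simp: Y_def)
			then show ?thesis using Gam_Inv_mult Bdd_mult by (simp add: Y_def)
		qed
		have abY: "abelian_monoid (left_module P Y)"
			using P.S.abelian_group_on_subset[of Y "left_module P Y"]
		proof -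
			have "abelian_group (left_module P Y)"
			proof (rule P.S.abelian_group_on_subset[OF YP])
				show "\<zero>P:Y" using zB subringE(2)[OF Inv_subring] by (simp add: Y_def)
				fix x y assume x: "x:Y" and y: "y:Y"
				then show "x \<oplus>P y:Y" using Bdd_add subringE(7)[OF Inv_subring] by (simp add: Y_def del: P.add_S)
				have "x:cP" using x YP by blast
				then have "const (\<ominus> \<one>) \<otimes>P x = \<ominus>P x" by (subst const_mult) (auto simp: P_neg l_minus)
				then show "\<ominus>P x:Y" using x const_Gam[of "\<ominus> \<one>"] Gam_Inv_mult[of "const (\<ominus> \<one>)" x] Bdd_mult[of "const (\<ominus> \<one>)" x] by (simp add: Y_def)
			qed auto
			then show ?thesis by (rule abelian_group.axioms(1))
		qed
		define c' where "c' v = (if v:T then c v else \<zero>P)" for v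
		have c': "c' v:Gam" for v using T subringE(2)[OF Gam_subring] by (auto simp: c'_def)
		have BP: "v:cP" if "v:B" for v using that B(2) YP by blast
		have c'P: "(%v. c' v \<otimes>P v):B \<rightarrow> cP" using c' BP by auto
		have "g = (\<Oplus>\<^bsub>P\<^esub>v\<in>T. c v \<otimes>P v)"
			unfolding T(4)
			using abelian_monoid.additive_finsum[OF abY P.S.abelian_monoid_axioms, of "%x. x" "%v. c v \<otimes>P v" T] cY YP by auto
		also have "... = (\<Oplus>\<^bsub>P\<^esub>v\<in>B. c' v \<otimes>P v)"
			by (rule P.S.add.finprod_mono_neutral_cong_left[OF B(1) T(2) _ _ c'P]) (auto simp: c'_def BP)
		finally have g: "g = (\<Oplus>\<^bsub>P\<^esub>v\<in>B. c' v \<otimes>P v)" .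
		have "slice w g = (\<Oplus>\<^bsub>P\<^esub>v\<in>B. slice w (c' v \<otimes>P v))"
			unfolding g
			by (rule P.S.additive_finsum[OF P.S.abelian_monoid_axioms _ _ slice_add c'P])
				(auto simp: slice_closed, simp add: slice_def P.zero_S)
		also have "... = (\<Oplus>\<^bsub>P\<^esub>v\<in>B. c' v \<otimes>P slice w v)"
			by (rule P.S.finsum_cong') (use c' B(2) YP in \<open>auto simp: slice_mult slice_closed\<close>)
		finally have 1: "slice w g = (\<Oplus>\<^bsub>P\<^esub>v\<in>B. c' v \<otimes>P slice w v)" .
		have coeff: "slice w (permP p (f \<otimes>P t)) = (if p = id then f else \<zero>P)" if p: "p permutes {..<n}" for p
		proof -
			have "slice w (permP p (f \<otimes>P t)) = permP p (f \<otimes>P slice (w \<circ> p) t)"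
				using slice_permP[OF p] slice_mult[OF f tP] by simp
			moreover have "w \<circ> p = w \<longleftrightarrow> p = id"
			proof
				assume "w \<circ> p = w"
				then have e: "w (p i) = w i" for i by (metis comp_apply)
				have "p i = i" for i
				proof (cases "i < n")
					case True
					then have "p i < n" using permutes_in_image[OF p, of i] by simp
					then show ?thesis using e[of i] True by (simp add: w_def)
				next
					case False
					then show ?thesis using permutes_not_in[OF p] by simp
				qed
				then show "p = id" by (simp add: fun_eq_iff)
			qed simp
			then have "slice (w \<circ> p) t = (if p = id then \<one>P else \<zero>P)"
				unfolding t_def slice_single by (auto simp: P.one_S zero_fun_def zero_prod_def)
			moreover have "permP p \<zero>P = \<zero>P" by (simp add: permP_def P.zero_S)
			ultimately show ?thesis using f by (simp add: permP_id)
		qed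
		have "slice w g = (\<Oplus>\<^bsub>P\<^esub>p\<in>?Per. slice w (permP p (f \<otimes>P t)))"
			unfolding g_def
			by (rule P.S.additive_finsum[OF P.S.abelian_monoid_axioms _ _ slice_add F])
				(auto simp: slice_closed, simp add: slice_def P.zero_S)
		also have "... = (\<Oplus>\<^bsub>P\<^esub>p\<in>?Per. if id = p then f else \<zero>P)"
			by (rule P.S.finsum_cong') (use f coeff in auto)
		also have "... = f"
			using P.S.finsum_singleton[of id ?Per "%_. f"] fin permutes_id f by auto
		finally have "slice w g = f" .
		then show ?thesis using 1 c' by auto
	qed
	note main = this
	\<comment> \<open>Different basis elements may share a slice, so the family is turned into a set.\<close>
	have fB: "finite (slice w ` B)" "slice w ` B \<subseteq> Lam" using B(1,2) YP slice_closed by auto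
	have "\<exists>c\<in>slice w ` B \<rightarrow> Gam. f = (\<Oplus>\<^bsub>P\<^esub>v\<in>slice w ` B. c v \<otimes>P v)" if f: "f:Lam" for f
	proof -
		obtain c where c: "c:B \<rightarrow> Gam" "f = (\<Oplus>\<^bsub>P\<^esub>v\<in>B. c v \<otimes>P slice w v)" using main[OF f] by blast
		have sP: "slice w v:cP" if "v:B" for v using that B(2) YP slice_closed by auto
		have cP: "c v:cP" if "v:B" for v using funcset_mem[OF c(1) that] by simp
		define C where "C u = {v:B. slice w v = u}" for u
		have BU: "B = (\<Union>u\<in>slice w ` B. C u)" by (auto simp: C_def)
		have "f = (\<Oplus>\<^bsub>P\<^esub>u\<in>slice w ` B. \<Oplus>\<^bsub>P\<^esub>v\<in>C u. c v \<otimes>P slice w v)"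
			unfolding c(2)
			by (subst BU, rule P.S.add.finprod_UN_disjoint) (use B(1) cP sP in \<open>auto simp: C_def pairwise_def disjnt_def\<close>)
		also have "... = (\<Oplus>\<^bsub>P\<^esub>u\<in>slice w ` B. (\<Oplus>\<^bsub>P\<^esub>v\<in>C u. c v) \<otimes>P u)"
		proof (rule P.S.finsum_cong')
			have cC: "c:C u \<rightarrow> cP" for u using cP by (auto simp: C_def)
			show "(%u. (\<Oplus>\<^bsub>P\<^esub>v\<in>C u. c v) \<otimes>P u):slice w ` B \<rightarrow> cP"
				using sP cC by (auto intro!: P.S.m_closed P.S.finsum_closed)
			fix u assume u: "u:slice w ` B"
			have "(\<Oplus>\<^bsub>P\<^esub>v\<in>C u. c v) \<otimes>P u = (\<Oplus>\<^bsub>P\<^esub>v\<in>C u. c v \<otimes>P u)"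
				using u sP cC B(1) by (intro P.S.finsum_ldistr) (auto simp: C_def)
			also have "... = (\<Oplus>\<^bsub>P\<^esub>v\<in>C u. c v \<otimes>P slice w v)"
				by (rule P.S.finsum_cong') (use cP sP in \<open>auto simp: C_def\<close>)
			finally show "(\<Oplus>\<^bsub>P\<^esub>v\<in>C u. c v \<otimes>P slice w v) = (\<Oplus>\<^bsub>P\<^esub>v\<in>C u. c v) \<otimes>P u" by simp
		qed simp
		finally have feq: "f = (\<Oplus>\<^bsub>P\<^esub>u\<in>slice w ` B. (\<Oplus>\<^bsub>P\<^esub>v\<in>C u. c v) \<otimes>P u)" .
		have "(\<Oplus>\<^bsub>P\<^esub>v\<in>C u. c v):Gam" for u
		proof -
			have cC: "c:C u \<rightarrow> Gam" using c(1) by (auto simp: C_def)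
			have "finsum P c I:Gam" if "finite I" "c:I \<rightarrow> Gam" for I
				using that
			proof (induction I)
				case (insert i I)
				have ci: "c i:Gam" "c:I \<rightarrow> Gam" using insert.prems by auto
				then have "c:I \<rightarrow> cP" "c i:cP" using Gam_Lam Lam_P by blast+
				then show ?case using ci insert.hyps insert.IH subringE(7)[OF Gam_subring, of "c i" "finsum P c I"] by (simp add: P.S.finsum_insert del: P.add_S)
			qed (simp add: subringE(2)[OF Gam_subring])
			then show ?thesis using cC B(1) by (simp add: C_def)
		qed
		then show ?thesis using feq by auto
	qed
	then show ?thesis using fB by blast
qed

end

locale qlaurent = laurent k n for k :: "('k, 'r) ring_scheme" (structure) and n +
	fixes q assumes q: "q:carrier k" "q ~= \<zero>" "\<forall>m::nat. m > 0 \<longrightarrow> q [^] m ~= \<one>"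
begin

definition qz :: "int => 'k" where "qz z = q [^]\<^bsub>units_of k\<^esub> z"

lemma qz_facts: shows qz_closed: "qz a:carrier k" and qz_add: "qz (a + b) = qz a \<otimes> qz b" and qz_0: "qz 0 = \<one>"
	and qz_1: "qz 1 = q" and qz_one_iff: "qz a = \<one> \<longleftrightarrow> a = 0" and qz_nonzero: "qz a ~= \<zero>"
proof -
	interpret U: comm_group "units_of k" by (rule units_comm_group)
	have qU: "q:carrier (units_of k)" using q by (simp add: units_of_carrier field_Units)
	have nat: "q [^]\<^bsub>units_of k\<^esub> (m::nat) = q [^] m" for m
		by (induction m) (simp_all add: units_of_mult units_of_one)
	have U: "qz a:Units k" for a
		using U.int_pow_closed[OF qU, of a] by (simp add: qz_def units_of_carrier)
	then show "qz a:carrier k" "qz a ~= \<zero>" for a by (simp_all add: field_Units)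
	show add: "qz (a + b) = qz a \<otimes> qz b" for a b
		using U.int_pow_mult[OF qU, of a b] by (simp add: qz_def units_of_mult)
	have i: "qz (int m) = q [^] m" for m by (simp add: qz_def int_pow_int nat)
	show z: "qz 0 = \<one>" using i[of 0] by simp
	show "qz 1 = q" using i[of 1] q by simp
	have pos: "qz a ~= \<one>" if "a > 0" for a
		using i[of "nat a"] q(3) that by (metis int_nat_eq nat_0_iff not_le order_less_imp_le zero_less_nat_eq)
	have "qz a ~= \<one>" if "a < 0" for a
	proof
		assume "qz a = \<one>"
		then have "qz (- a) = \<one>" using add[of a "- a"] z U[of "- a"] by (simp add: field_Units)
		then show False using pos[of "- a"] that by simp
	qed
	then show "qz a = \<one> \<longleftrightarrow> a = 0" using pos z by (metis linorder_neqE_linordered_idom)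
qed

definition wt :: "(nat => int) => expon => int" where "wt a d = (\<Sum>i<n. a i * int (fst (d i)))"

lemma wt_add: "wt a (d + e) = wt a d + wt a e" "wt (a + b) d = wt a d + wt b d" "wt 0 d = 0" "wt a 0 = 0"
	by (simp_all add: wt_def algebra_simps sum.distrib)

definition tor :: "(nat => int) => (expon => 'k) => expon => 'k" where
	"tor a f = (%d. qz (wt a d) \<otimes> f d)"

lemma tor_closed: assumes f: "f:cP" shows "tor a f:cP"
proof -
	have sub: "{d. tor a f d ~= \<zero>} \<subseteq> {d. f d ~= \<zero>}" using qz_closed by (auto simp: tor_def)
	show ?thesis
		unfolding P.carrier_S using finite_subset[OF sub P.S_finite[OF f]] sub P.S_supp[OF f] P.S_closed[OF f] qz_closed by (auto simp: tor_def)
qed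

lemma tor_single: "r:carrier k ==> tor a (single r d) = single (qz (wt a d) \<otimes> r) d"
	using qz_closed by (auto simp: tor_def skew_single_def)

lemma tor_add: "f:cP ==> g:cP ==> tor a (f \<oplus>P g) = tor a f \<oplus>P tor a g"
	using qz_closed by (simp add: tor_def r_distr)

lemma tor_hom: "tor a:ring_hom P P"
proof (rule P.multiplicative_from_singles[OF P.S_ring])
	fix r s d e assume *: "r:carrier k" "s:carrier k" "d:carrier (expo n)" "e:carrier (expo n)"
	then show "tor a (single (r \<otimes> s) (d \<otimes>\<^bsub>expo n\<^esub> e)) = tor a (single r d) \<otimes>P tor a (single s e)"
		using qz_closed by (simp add: tor_single P.single_mult wt_add qz_add m_ac)
qed (auto simp: tor_closed tor_add tor_single wt_add qz_0 P.one_S simp del: P.add_S)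

lemma tor_Lam: "f:Lam ==> tor a f:Lam"
	by (rule LamI[OF tor_closed]) (auto simp: tor_def qz_closed intro: Lam_supp)

lemma tor_comp: "f:cP ==> tor a (tor b f) = tor (a + b) f"
	using qz_closed by (simp add: tor_def wt_add qz_add m_assoc)

lemma tor_0: "f:cP ==> tor 0 f = f"
	by (simp add: tor_def wt_add qz_0)

lemma tor_permP: assumes p: "p permutes {..<n}" shows "permP p (tor a f) = tor (a \<circ> pinv p) (permP p f)"
proof -
	have "wt a (d \<circ> p) = wt (a \<circ> pinv p) d" for d
		unfolding wt_def using sum.permute[OF p, of "%i. (a \<circ> pinv p) i * int (fst (d i))"] permutes_inverses(2)[OF p] by (simp add: o_def)
	then show ?thesis by (simp add: tor_def permP_def)
qed

lemma tor_const: "c:carrier k ==> tor a (const c) = const c"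
	by (simp add: const_def tor_single wt_add qz_0)

lemma tor_zv: assumes i: "i < n" shows "tor a (zv i) = const (qz (a i)) \<otimes>P zv i"
proof -
	have "wt a (%j. if j = i then (1, 0) else 0) = (\<Sum>j<n. if j = i then a j else 0)"
		unfolding wt_def by (rule sum.cong) auto
	then have "wt a (%j. if j = i then (1, 0) else 0) = a i" using i by simp
	then show ?thesis
		using i qz_closed unfolding zv_def by (simp add: tor_single const_def P.single_mult)
qed

text \<open>The fixed point of the substitution \<open>h \<mapsto> 1 + q h\<close>.\<close>

definition h0 :: 'k where "h0 = inv (\<one> \<ominus> q)"

lemma q_ne_one: "\<one> \<ominus> q:carrier k - {\<zero>}"
proof -
	have "q ~= \<one>" using q(3)[rule_format, of 1] q(1) by simp
	then show ?thesis using q(1) by simp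
qed

lemma h0_closed: "h0:carrier k" and h0_eq: "h0 = q \<otimes> h0 \<oplus> \<one>"
proof -
	show c: "h0:carrier k" unfolding h0_def using nz_inv(1)[OF q_ne_one] .
	have "(\<one> \<ominus> q) \<otimes> h0 = \<one>" unfolding h0_def using nz_inv(3)[OF q_ne_one] .
	then have "h0 \<oplus> \<ominus> (q \<otimes> h0) = \<one>" using c q(1) by (simp add: a_minus_def l_distr l_minus)
	then have "q \<otimes> h0 \<oplus> (h0 \<oplus> \<ominus> (q \<otimes> h0)) = q \<otimes> h0 \<oplus> \<one>" by simp
	then show "h0 = q \<otimes> h0 \<oplus> \<one>" using c q(1) by (simp add: a_lcomm r_neg)
qed

end

section \<open>Galois theory of the field of rational functions\<close>

lemma (in cring) prod_expand:
	assumes "finite I" "x:carrier R" "w:I \<rightarrow> carrier R"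
	shows "(\<Otimes>i\<in>I. x \<oplus> w i) = (\<Oplus>A\<in>Pow I. (\<Otimes>i\<in>A. w i) \<otimes> x [^] (card I - card A))"
	using assms(1,3)
proof (induction I)
	case empty
	then show ?case by (simp add: finsum_insert finsum_empty)
next
	case (insert i I)
	note x = assms(2)
	have w: "w i:carrier R" "w:I \<rightarrow> carrier R" using insert.prems by auto
	have wA: "(\<Otimes>i\<in>A. w i):carrier R" if "A \<subseteq> I" for A using w that by (intro finprod_closed) auto
	define t where "t A = (\<Otimes>i\<in>A. w i) \<otimes> x [^] (card I - card A)" for A
	define u where "u A = (\<Otimes>i\<in>A. w i) \<otimes> x [^] (card (insert i I) - card A)" for A
	have t: "t:Pow I \<rightarrow> carrier R" using wA x by (auto simp: t_def)
	have finA: "finite A" if "A \<subseteq> I" for A using that insert.hyps finite_subset by blast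
	have 1: "u A = x \<otimes> t A" if A: "A \<subseteq> I" for A
	proof -
		have "card A \<le> card I" using A insert.hyps by (intro card_mono)
		then have "card (insert i I) - card A = Suc (card I - card A)" using insert.hyps by simp
		then show ?thesis using wA[OF A] x by (simp add: m_ac t_def u_def)
	qed
	have 2: "u (insert i A) = w i \<otimes> t A" if A: "A \<subseteq> I" for A
	proof -
		have "i \<notin> A" using A insert.hyps by blast
		then have "(\<Otimes>j\<in>insert i A. w j) = w i \<otimes> (\<Otimes>j\<in>A. w j)"
			using finA[OF A] w A by (intro finprod_insert) auto
		moreover have "card (insert i I) - card (insert i A) = card I - card A"
			using \<open>i \<notin> A\<close> finA[OF A] insert.hyps by simp
		ultimately show ?thesis using wA[OF A] x w by (simp add: m_assoc t_def u_def)
	qed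
	have u: "u A:carrier R" if "A \<subseteq> insert i I" for A
		unfolding u_def using insert.prems that x by (intro m_closed finprod_closed) auto
	have ui: "(%A. u (insert i A)):Pow I \<rightarrow> carrier R"
	proof
		fix A assume "A:Pow I"
		then have "insert i A \<subseteq> insert i I" by blast
		then show "u (insert i A):carrier R" by (rule u)
	qed
	have S: "(\<Oplus>A\<in>Pow I. t A):carrier R" using t by (rule finsum_closed)
	have r: "y \<otimes> (\<Oplus>A\<in>Pow I. t A) = (\<Oplus>A\<in>Pow I. y \<otimes> t A)" if "y:carrier R" for y
		using insert.hyps that t by (intro finsum_rdistr) auto
	have "(\<Otimes>j\<in>insert i I. x \<oplus> w j) = (x \<oplus> w i) \<otimes> (\<Otimes>j\<in>I. x \<oplus> w j)"
		using insert.hyps w x by (intro finprod_insert) auto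
	also have "(\<Otimes>j\<in>I. x \<oplus> w j) = (\<Oplus>A\<in>Pow I. t A)" using insert.IH[OF w(2)] by (simp add: t_def)
	also have "(x \<oplus> w i) \<otimes> (\<Oplus>A\<in>Pow I. t A) = (\<Oplus>A\<in>Pow I. x \<otimes> t A) \<oplus> (\<Oplus>A\<in>Pow I. w i \<otimes> t A)"
		unfolding l_distr[OF x w(1) S] r[OF x] r[OF w(1)] by (rule refl)
	also have "(\<Oplus>A\<in>Pow I. x \<otimes> t A) = (\<Oplus>A\<in>Pow I. u A)"
		by (rule finsum_cong') (use 1[symmetric] u in auto)
	also have "(\<Oplus>A\<in>Pow I. w i \<otimes> t A) = (\<Oplus>A\<in>Pow I. u (insert i A))"
		by (rule finsum_cong'[OF refl ui]) (use 2[symmetric] in simp)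
	also have "... = (\<Oplus>A\<in>insert i ` Pow I. u A)"
	proof (rule finsum_reindex[symmetric])
		show "u:insert i ` Pow I \<rightarrow> carrier R" using ui by auto
		show "inj_on (insert i) (Pow I)"
		proof (rule inj_onI)
			fix A B assume "A:Pow I" "B:Pow I" "insert i A = insert i B"
			then show "A = B" using insert.hyps by (metis PowD insert_ident subsetD)
		qed
	qed
	also have "(\<Oplus>A\<in>Pow I. u A) \<oplus> (\<Oplus>A\<in>insert i ` Pow I. u A) = (\<Oplus>A\<in>Pow I \<union> insert i ` Pow I. u A)"
		by (rule finsum_Un_disjoint[symmetric]) (use u ui insert.hyps in auto)
	also have "Pow I \<union> insert i ` Pow I = Pow (insert i I)" by (simp add: Pow_insert)
	finally show ?case unfolding u_def .
qed

lemma (in cring) prod_expand_by_degree: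
	assumes I: "finite I" and x: "x:carrier R" and w: "w:I \<rightarrow> carrier R"
	shows "(\<Otimes>i\<in>I. x \<oplus> w i) = (\<Oplus>d\<in>{..card I}. (\<Oplus>A\<in>{A. A \<subseteq> I & card A = d}. \<Otimes>i\<in>A. w i) \<otimes> x [^] (card I - d))"
proof -
	let ?C = "%d. {A. A \<subseteq> I & card A = d}"
	have wA: "(\<Otimes>i\<in>A. w i):carrier R" if "A \<subseteq> I" for A using w that by (intro finprod_closed) auto
	have fin: "finite (?C d)" for d by (rule finite_subset[of _ "Pow I"]) (use I in auto)
	have "Pow I = (\<Union>d\<in>{..card I}. ?C d)" using I card_mono by auto
	then have "(\<Otimes>i\<in>I. x \<oplus> w i) = (\<Oplus>A\<in>(\<Union>d\<in>{..card I}. ?C d). (\<Otimes>i\<in>A. w i) \<otimes> x [^] (card I - card A))"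
		using prod_expand[OF assms] by simp
	also have "... = (\<Oplus>d\<in>{..card I}. \<Oplus>A\<in>?C d. (\<Otimes>i\<in>A. w i) \<otimes> x [^] (card I - card A))"
		by (rule add.finprod_UN_disjoint) (use fin wA x in \<open>auto simp: pairwise_def disjnt_def\<close>)
	also have "... = (\<Oplus>d\<in>{..card I}. (\<Oplus>A\<in>?C d. \<Otimes>i\<in>A. w i) \<otimes> x [^] (card I - d))"
	proof (rule finsum_cong')
		fix d
		have c: "(%A. \<Otimes>i\<in>A. w i):?C d \<rightarrow> carrier R" using wA by auto
		have "(\<Oplus>A\<in>?C d. \<Otimes>i\<in>A. w i) \<otimes> x [^] (card I - d) = (\<Oplus>A\<in>?C d. (\<Otimes>i\<in>A. w i) \<otimes> x [^] (card I - d))"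
			by (rule finsum_ldistr[OF fin _ c]) (use x in simp)
		also have "... = (\<Oplus>A\<in>?C d. (\<Otimes>i\<in>A. w i) \<otimes> x [^] (card I - card A))"
			by (rule finsum_cong') (use wA x in auto)
		finally show "(\<Oplus>A\<in>?C d. (\<Otimes>i\<in>A. w i) \<otimes> x [^] (card I - card A)) = (\<Oplus>A\<in>?C d. \<Otimes>i\<in>A. w i) \<otimes> x [^] (card I - d)" by simp
	qed (use wA x in \<open>auto intro!: m_closed finsum_closed\<close>)
	finally show ?thesis .
qed

lemma (in domain) finprod_zero:
	assumes "finite I" "f:I \<rightarrow> carrier R" "(\<Otimes>i\<in>I. f i) = \<zero>" shows "\<exists>i\<in>I. f i = \<zero>"
	using assms
proof (induction I)
	case (insert i I)
	have f: "f i:carrier R" "f:I \<rightarrow> carrier R" using insert.prems by auto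
	have "f i \<otimes> (\<Otimes>i\<in>I. f i) = \<zero>" using insert f by simp
	then have "f i = \<zero> \<or> (\<Otimes>i\<in>I. f i) = \<zero>" using integral f finprod_closed[OF f(2)] by blast
	then show ?case using insert.IH f by blast
qed simp

lemma BijGroup_simps:
	"f:Bij S ==> g:Bij S ==> f \<otimes>\<^bsub>BijGroup S\<^esub> g = compose S f g" "\<one>\<^bsub>BijGroup S\<^esub> = (\<lambda>x\<in>S. x)"
	"carrier (BijGroup S) = Bij S"
	by (simp_all add: BijGroup_def)

locale galois_laurent = qlaurent k n q + F: fractions "monoid_algebra k (expo n)\<lparr>carrier := laurent.Lam k n\<rparr>" L io
	for k :: "('k, 'r) ring_scheme" (structure) and n q and L :: "('l, 's) ring_scheme" and io
begin

abbreviation multL (infixl "\<otimes>L" 70) where "multL == (\<otimes>\<^bsub>L\<^esub>)"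
abbreviation addL (infixl "\<oplus>L" 65) where "addL == (\<oplus>\<^bsub>L\<^esub>)"
abbreviation zeroL ("\<zero>L") where "zeroL == \<zero>\<^bsub>L\<^esub>"
abbreviation oneL ("\<one>L") where "oneL == \<one>\<^bsub>L\<^esub>"
abbreviation negL ("\<ominus>L _" [81] 80) where "negL == a_inv L"
abbreviation subL (infixl "\<ominus>L" 65) where "subL == a_minus L"
abbreviation "cL == carrier L"

lemmas io_simps = F.io_closed[simplified] F.io_mult[simplified] F.io_add[simplified] F.io_one[simplified]
	F.io_zero[simplified]

lemma io_closed: "f:Lam ==> io f:cL"
	and io_mult: "f:Lam ==> g:Lam ==> io (f \<otimes>P g) = io f \<otimes>L io g"
	and io_add: "f:Lam ==> g:Lam ==> io (f \<oplus>P g) = io f \<oplus>L io g"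
	and io_one: "io \<one>P = \<one>L" and io_zero: "io \<zero>P = \<zero>L"
	and io_eq: "f:Lam ==> g:Lam ==> io f = io g \<longleftrightarrow> f = g"
	and io_nonzero: "f:Lam ==> f ~= \<zero>P ==> io f:cL - {\<zero>L}"
	using F.io_closed[of f] F.io_mult[of f g] F.io_add[of f g] F.io_one F.io_zero F.io_eq[of f g] F.io_nonzero[of f]
	by (simp_all del: P.add_S)

lemma io_neg: "f:Lam ==> io (\<ominus>P f) = \<ominus>L io f"
proof -
	assume f: "f:Lam"
	then have f': "\<ominus>P f:Lam" using subringE(5)[OF Lam_subring] by blast
	have "io (\<ominus>P f) \<oplus>L io f = \<zero>L"
		using io_add[OF f' f] f P.S.l_neg[of f] io_zero by simp
	then show ?thesis using F.L.minus_equality f f' io_closed by metis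
qed

lemma Lam_mult: "f:Lam ==> g:Lam ==> f \<otimes>P g:Lam"
	and Lam_add: "f:Lam ==> g:Lam ==> f \<oplus>P g:Lam"
	and Lam_one: "\<one>P:Lam" and Lam_zero: "\<zero>P:Lam"
	by (rule subringE(6)[OF Lam_subring] subringE(7)[OF Lam_subring] subringE(3)[OF Lam_subring] subringE(2)[OF Lam_subring]; assumption)+

lemma Lam_nonzero_mult: "f:Lam ==> g:Lam ==> f ~= \<zero>P ==> g ~= \<zero>P ==> f \<otimes>P g ~= \<zero>P"
	using P.integral Lam_P by blast

lemma io_frac: assumes "x:cL"
	obtains a b where "a:Lam" "b:Lam" "b ~= \<zero>P" "x = io a \<otimes>L inv\<^bsub>L\<^esub> io b"
	using F.io_frac[OF assms] by auto

lemma autsI: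
	assumes s: "s:ring_hom P P" and cl: "!!f. f:Lam ==> s f:Lam" "!!f. f:Lam ==> t f:Lam"
		and inv: "!!f. f:Lam ==> s (t f) = f" "!!f. f:Lam ==> t (s f) = f"
	shows "s:F.auts"
proof -
	have "s:ring_hom (P\<lparr>carrier := Lam\<rparr>) (P\<lparr>carrier := Lam\<rparr>)"
		by (rule ring_hom_memI) (use cl rhm[OF s] rha[OF s] rh1[OF s] in \<open>simp_all del: P.add_S\<close>)
	moreover have "bij_betw s Lam Lam"
		by (rule bij_betw_byWitness[of _ t]) (use cl inv in auto)
	ultimately show ?thesis by (simp add: F.auts_def)
qed

definition Per :: "(nat => nat) set" where "Per = {p. p permutes {..<n}}"

lemma Per_finite: "finite Per"
	unfolding Per_def by (rule finite_permutations) simp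

lemma Per_inv: "p:Per ==> pinv p:Per" and Per_comp: "p:Per ==> r:Per ==> p \<circ> r:Per" and Per_id: "id:Per"
	and Per_o: "p:Per ==> p \<circ> pinv p = id" "p:Per ==> pinv p \<circ> p = id" and Per_perm: "p:Per ==> p permutes {..<n}"
	by (simp_all add: Per_def permutes_inv permutes_compose permutes_id permutes_inv_o)

lemma permP_auts: assumes p: "p:Per" shows "permP p:F.auts"
	by (rule autsI[of _ "permP (pinv p)"])
		(use permP_hom permP_Lam Per_perm[OF p] Per_perm[OF Per_inv[OF p]] in \<open>simp_all add: permP_comp Per_o[OF p] permP_id\<close>)

lemma tor_auts: "tor a:F.auts"
	by (rule autsI[of _ "tor (- a)"]) (simp_all add: tor_hom tor_Lam tor_comp tor_0)

definition gp :: "(nat => nat) => 'l => 'l" where "gp p = F.lift (permP p)"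
definition tr :: "(nat => int) => 'l => 'l" where "tr a = F.lift (tor a)"

lemma gp_io: "p:Per ==> f:Lam ==> gp p (io f) = io (permP p f)"
	unfolding gp_def by (rule F.lift_io[OF permP_auts]) simp_all

lemma tr_io: "f:Lam ==> tr a (io f) = io (tor a f)"
	unfolding tr_def by (rule F.lift_io[OF tor_auts]) simp

lemma gp_hom: "p:Per ==> gp p:ring_hom L L" and tr_hom: "tr a:ring_hom L L"
	unfolding gp_def tr_def by (simp_all add: F.lift_hom permP_auts tor_auts)

lemma gp_Bij: assumes p: "p:Per" shows "gp p:Bij (cL)"
	unfolding gp_def
	by (rule F.lift_Bij[OF permP_auts[OF p] permP_auts[OF Per_inv[OF p]]]) (simp_all add: permP_comp Per_o[OF p] permP_id)

lemma tr_Bij: "tr a:Bij (cL)"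
	unfolding tr_def by (rule F.lift_Bij[OF tor_auts tor_auts[of "- a"]]) (simp_all add: tor_comp tor_0)

lemma hom_eq_on_L:
	assumes "f:ring_hom L L" "g:ring_hom L L" "!!a. a:Lam ==> f (io a) = g (io a)" "x:cL"
	shows "f x = g x"
	by (rule F.hom_eqI[OF assms(1,2) _ assms(4)]) (simp add: assms(3))

lemma gp_closed: "p:Per ==> x:cL ==> gp p x:cL" and tr_closed: "x:cL ==> tr a x:cL"
	using rhc[OF gp_hom] rhc[OF tr_hom] by auto

lemma gp_comp: assumes "p:Per" "r:Per" "x:cL" shows "gp p (gp r x) = gp (p \<circ> r) x"
proof -
	have "(gp p \<circ> gp r) x = gp (p \<circ> r) x"
		by (rule hom_eq_on_L[OF ring_hom_trans[OF gp_hom gp_hom] gp_hom])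
			(use assms permP_Lam Per_perm in \<open>auto simp: gp_io permP_comp Per_comp\<close>)
	then show ?thesis by simp
qed

lemma tr_comp: assumes "x:cL" shows "tr a (tr b x) = tr (a + b) x"
proof -
	have "(tr a \<circ> tr b) x = tr (a + b) x"
		by (rule hom_eq_on_L[OF ring_hom_trans[OF tr_hom tr_hom] tr_hom])
			(use assms in \<open>auto simp: tr_io tor_comp tor_Lam\<close>)
	then show ?thesis by simp
qed

lemma id_hom: "(%x. x):ring_hom L L"
	by (simp add: ring_hom_def)

lemma tr_0: "x:cL ==> tr 0 x = x"
	by (rule hom_eq_on_L[OF tr_hom id_hom]) (auto simp: tr_io tor_0)

lemma gp_id: "x:cL ==> gp id x = x"
	by (rule hom_eq_on_L[OF gp_hom id_hom]) (auto simp: gp_io permP_id Per_id)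

lemma gp_tr: assumes p: "p:Per" and x: "x:cL" shows "gp p (tr a x) = tr (a \<circ> pinv p) (gp p x)"
proof -
	have "(gp p \<circ> tr a) x = (tr (a \<circ> pinv p) \<circ> gp p) x"
		by (rule hom_eq_on_L[OF ring_hom_trans[OF tr_hom gp_hom[OF p]] ring_hom_trans[OF gp_hom[OF p] tr_hom] _ x])
			(simp add: gp_io tr_io p tor_Lam permP_Lam[OF Per_perm[OF p]] tor_permP[OF Per_perm[OF p]])
	then show ?thesis by simp
qed

text \<open>Every polynomial divides a nonzero symmetric one, the product of its conjugates.\<close>

lemma norm_exists:
	assumes b: "b:Lam" "b ~= \<zero>P"
	obtains b' where "b':Lam" "b \<otimes>P b':Gam" "b \<otimes>P b' ~= \<zero>P"
proof -
	have cl: "(%p. permP p b):A \<rightarrow> Lam" if "A \<subseteq> Per" for A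
		using that permP_Lam Per_perm b(1) by blast
	have prodLam: "finprod P f A:Lam" if "f:A \<rightarrow> Lam" for f :: "(nat => nat) => _" and A
		using that
	proof (induction A rule: infinite_finite_induct)
		case (insert a A)
		then have "f:A \<rightarrow> cP" "f a:Lam" "f:A \<rightarrow> Lam" using Lam_P by blast+
		then show ?case using insert by (simp add: Lam_mult)
	qed (simp_all add: Lam_one)
	have clP: "(%p. permP p b):A \<rightarrow> cP" if "A \<subseteq> Per" for A using cl[OF that] Lam_P by blast
	define b' where "b' = finprod P (%p. permP p b) (Per - {id})"
	have b': "b':Lam" unfolding b'_def by (rule prodLam[OF cl]) auto
	have "Per = insert id (Per - {id})" using Per_id by blast
	then have eq: "finprod P (%p. permP p b) Per = b \<otimes>P b'"
		using P.finprod_insert[of "Per - {id}" id "%p. permP p b"] Per_finite clP[of "Per - {id}"] b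
		by (simp add: b'_def permP_id)
	have N: "finprod P (%p. permP p b) Per:Lam" by (rule prodLam[OF cl]) auto
	have "finprod P (%p. permP p b) Per:Inv"
	proof (rule InvI[OF Lam_P[OF N]])
		fix r assume r: "r permutes {..<n}"
		interpret H: ring_hom_cring P P "permP r"
			by (intro ring_hom_cring.intro ring_hom_cring_axioms.intro P_cring permP_hom[OF r])
		have "permP r (finprod P (%p. permP p b) Per) = finprod P (%p. permP (r \<circ> p) b) Per"
			using H.hom_finprod[OF clP[OF order_refl]] by (simp add: o_def permP_comp[unfolded o_def])
		also have "... = finprod P (%p. permP p b) ((%p. r \<circ> p) ` Per)"
		proof (rule P.finprod_reindex[symmetric])
			show "inj_on (%p. r \<circ> p) Per"
				using permutes_inv_o(2)[OF r] by (intro inj_onI) (metis comp_assoc id_comp)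
			show "(%p. permP p b):(%p. r \<circ> p) ` Per \<rightarrow> cP"
				using permP_closed[OF permutes_compose[OF Per_perm r] Lam_P[OF b(1)]] by auto
		qed
		also have "(%p. r \<circ> p) ` Per = Per" using image_compose_permutations_left[OF r] by (simp add: setcompr_eq_image Per_def)
		finally show "permP r (finprod P (%p. permP p b) Per) = finprod P (%p. permP p b) Per" .
	qed
	then have G: "b \<otimes>P b':Gam" using N eq GamI by simp
	have "finprod P (%p. permP p b) Per ~= \<zero>P"
	proof
		assume "finprod P (%p. permP p b) Per = \<zero>P"
		then obtain p where p: "p:Per" "permP p b = \<zero>P"
			using P.finprod_zero[OF Per_finite clP[OF order_refl]] by blast
		have "b = permP (pinv p) (permP p b)" using p(1) by (simp add: permP_comp Per_o permP_id)
		also have "... = \<zero>P" unfolding p(2) by (simp add: permP_def P.zero_S)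
		finally show False using b by simp
	qed
	then show ?thesis using that[OF b' G] eq by simp
qed

lemma frac_Gam:
	assumes x: "x:cL"
	obtains a c where "a:Lam" "c:Gam" "c ~= \<zero>P" "x = io a \<otimes>L inv\<^bsub>L\<^esub> io c"
proof -
	obtain a b where ab: "a:Lam" "b:Lam" "b ~= \<zero>P" "x = io a \<otimes>L inv\<^bsub>L\<^esub> io b" using io_frac[OF x] .
	obtain b' where b': "b':Lam" "b \<otimes>P b':Gam" "b \<otimes>P b' ~= \<zero>P" using norm_exists[OF ab(2,3)] .
	have "x = io (a \<otimes>P b') \<otimes>L inv\<^bsub>L\<^esub> io (b \<otimes>P b')"
		unfolding ab(4) using ab b' io_nonzero[of "b \<otimes>P b'"] io_nonzero[OF ab(2,3)] io_closed
		by (subst F.L.frac_eq_iff) (auto simp: Lam_mult io_mult F.L.m_ac)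
	then show ?thesis using that[of "a \<otimes>P b'" "b \<otimes>P b'"] ab b' Lam_mult by blast
qed

abbreviation "K == frac_in L (io ` Gam)"

lemma K_iff: "x:K \<longleftrightarrow> (\<exists>a c. a:Gam & c:Gam & c ~= \<zero>P & x = io a \<otimes>L inv\<^bsub>L\<^esub> io c)"
proof -
	have "io c ~= \<zero>L \<longleftrightarrow> c ~= \<zero>P" if "c:Gam" for c
		using io_eq[of c "\<zero>P"] that Lam_zero by (simp add: io_zero)
	then show ?thesis unfolding frac_in_def by blast
qed

lemma Gam_K: "c:Gam ==> io c:K"
	unfolding K_iff using subringE(3)[OF Gam_subring] io_closed[of c]
	by (intro exI[of _ c] exI[of _ "\<one>P"]) (simp add: io_one)

lemma K_fixed: "K = {x:carrier L. \<forall>p\<in>Per. gp p x = x}"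
proof safe
	fix x assume "x:K"
	then obtain a c where ac: "a:Gam" "c:Gam" "c ~= \<zero>P" "x = io a \<otimes>L inv\<^bsub>L\<^esub> io c" unfolding K_iff by blast
	note c = io_nonzero[OF Gam_Lam[OF ac(2)] ac(3)]
	show "x:cL" unfolding ac(4) using ac c io_closed by (intro F.L.frac_closed) auto
	fix p assume p: "p:Per"
	have "gp p (io a) = io a" "gp p (io c) = io c" using ac Inv_perm[OF Gam_Inv] Per_perm[OF p] by (simp_all add: gp_io[OF p])
	then show "gp p x = x"
		unfolding ac(4) using ac(1) io_closed F.L.nz_inv[OF c]
		by (simp add: rhm[OF gp_hom[OF p]] F.L.hom_inv[OF gp_hom[OF p] c])
next
	fix x assume x: "x:cL" "\<forall>p\<in>Per. gp p x = x"
	obtain a c where ac: "a:Lam" "c:Gam" "c ~= \<zero>P" "x = io a \<otimes>L inv\<^bsub>L\<^esub> io c" using frac_Gam[OF x(1)] .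
	note c = io_nonzero[OF Gam_Lam[OF ac(2)] ac(3)]
	have "io a = x \<otimes>L io c"
		unfolding ac(4) using ac(1) io_closed F.L.nz_inv[OF c] c by (simp add: F.L.m_assoc)
	moreover have "io c:K" using Gam_K ac by blast
	moreover have "gp p (io c) = io c" if "p:Per" for p
		using ac Inv_perm[OF Gam_Inv] Per_perm[OF that] by (simp add: gp_io[OF that])
	ultimately have "gp p (io a) = io a" if "p:Per" for p
		using x c that by (simp add: rhm[OF gp_hom])
	then have "permP p a = a" if "p:Per" for p
		using io_eq[of "permP p a" a] permP_Lam[OF Per_perm ac(1)] ac(1) that by (simp add: gp_io)
	then have "a:Gam" using ac(1) by (intro GamI InvI) (auto simp: Per_def)
	then show "x:K" unfolding K_iff using ac by blast
qed

lemma K_sub: "K \<subseteq> cL"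
	unfolding K_fixed by blast

lemma K_subfield: "subfield K L"
proof (rule F.L.subfieldI'[OF F.L.subringI])
	have h: "p:Per ==> gp p \<zero>L = \<zero>L" for p
		by (rule rh0[OF gp_hom F.L.ring_axioms F.L.ring_axioms])
	show "\<one>L:K" unfolding K_fixed by (simp add: rh1[OF gp_hom])
	fix x y assume x: "x:K" and y: "y:K"
	then show "x \<otimes>L y:K" "x \<oplus>L y:K" unfolding K_fixed by (auto simp: rhm[OF gp_hom] rha[OF gp_hom])
	have xL: "x:cL" using x K_sub by blast
	have "gp p (\<ominus>L x) = \<ominus>L x" if "p:Per" for p
	proof -
		have "gp p (\<ominus>L x) \<oplus>L x = gp p (\<ominus>L x \<oplus>L x)"
			using x that unfolding K_fixed by (simp add: rha[OF gp_hom])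
		then have "gp p (\<ominus>L x) \<oplus>L x = \<zero>L" using xL h[OF that] by (simp add: F.L.l_neg)
		then show ?thesis using F.L.minus_equality xL gp_closed[OF that] by (metis F.L.a_inv_closed)
	qed
	then show "\<ominus>L x:K" using xL unfolding K_fixed by simp
next
	fix x assume x: "x:K - {\<zero>L}"
	then have "x:cL - {\<zero>L}" using K_sub by blast
	then show "inv\<^bsub>L\<^esub> x:K"
		using x F.L.hom_inv[OF gp_hom] F.L.nz_inv(1) unfolding K_fixed by simp
qed (rule K_sub)

lemma L_finite: "ring.finite_dimension L K (cL)"
proof -
	obtain B where B: "finite B" "B \<subseteq> Lam" "\<forall>f\<in>Lam. \<exists>c\<in>B \<rightarrow> Gam. f = (\<Oplus>\<^bsub>P\<^esub>v\<in>B. c v \<otimes>P v)" using Lam_finite by blast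
	obtain Us where Us: "set Us = io ` B" using finite_list[of "io ` B"] B(1) by blast
	have UsL: "set Us \<subseteq> cL" using Us B io_closed by auto
	let ?S = "F.L.Span K Us"
	have sub: "subgroup ?S (add_monoid L)" by (rule F.L.Span_is_add_subgroup[OF K_subfield UsL])
	have fin: "F.L.finite_dimension K ?S" by (rule F.L.Span_finite_dimension[OF K_subfield UsL])
	have lam: "io f:?S" if f: "f:Lam" for f
	proof -
		obtain c where c: "c:B \<rightarrow> Gam" "f = (\<Oplus>\<^bsub>P\<^esub>v\<in>B. c v \<otimes>P v)" using B(3) f by blast
		have "io (\<Oplus>\<^bsub>P\<^esub>v\<in>A. c v \<otimes>P v):?S & (\<Oplus>\<^bsub>P\<^esub>v\<in>A. c v \<otimes>P v):Lam" if "finite A" "A \<subseteq> B" for A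
			using that
		proof (induction A)
			case empty
			then show ?case using subgroup.one_closed[OF sub] by (simp add: io_zero Lam_zero)
		next
			case (insert v A)
			have v: "v:Lam" "c v:Gam" "v:B" using insert.prems B c by auto
			have cA: "(%v. c v \<otimes>P v):A \<rightarrow> cP"
			proof
				fix x assume "x:A"
				then have "c x:Gam" "x:Lam" using insert.prems B(2) c(1) by auto
				then show "c x \<otimes>P x:cP" by simp
			qed
			have eq: "(\<Oplus>\<^bsub>P\<^esub>v\<in>insert v A. c v \<otimes>P v) = c v \<otimes>P v \<oplus>P (\<Oplus>\<^bsub>P\<^esub>v\<in>A. c v \<otimes>P v)"
				using insert v cA by (subst P.S.finsum_insert) (auto simp del: P.add_S)
			have "io v:?S" using F.L.Span_base_incl[OF K_subfield UsL] Us v by auto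
			then have "io (c v \<otimes>P v):?S" using F.L.Span_smult_closed[OF K_subfield UsL Gam_K[OF v(2)]] v by (simp add: io_mult)
			then show ?case
				unfolding eq using insert v Lam_mult Lam_add subgroup.m_closed[OF sub] by (simp add: io_add del: P.add_S)
		qed
		then show ?thesis using c(2) B(1) by simp
	qed
	have "cL \<subseteq> ?S"
	proof
		fix x assume x: "x:cL"
		obtain a c where ac: "a:Lam" "c:Gam" "c ~= \<zero>P" "x = io a \<otimes>L inv\<^bsub>L\<^esub> io c" using frac_Gam[OF x] .
		note c = io_nonzero[OF Gam_Lam[OF ac(2)] ac(3)]
		have "io c:K - {\<zero>L}" using Gam_K[OF ac(2)] c by blast
		then have "inv\<^bsub>L\<^esub> io c:K" using F.L.subfield_m_inv(1)[OF K_subfield] by blast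
		then have "inv\<^bsub>L\<^esub> io c \<otimes>L io a:?S" using F.L.Span_smult_closed[OF K_subfield UsL] lam[OF ac(1)] by blast
		then show "x:?S" unfolding ac(4) using F.L.m_comm io_closed[OF ac(1)] F.L.nz_inv(1)[OF c] by simp
	qed
	then have "?S = cL" using subgroup.subset[OF sub] by auto
	then show ?thesis using fin by simp
qed

lemma gp_aut: "p:Per ==> gp p:aut_over L K"
	unfolding aut_over_def using gp_hom gp_Bij K_fixed by blast

lemma L_galois: "finite_galois L K"
	unfolding finite_galois_def
proof (intro conjI F.L.field_axioms K_subfield L_finite equalityI subsetI)
	fix x assume "x:{x:carrier L. \<forall>h\<in>aut_over L K. h x = x}"
	then show "x:K" using gp_aut unfolding K_fixed by blast
next
	fix x assume "x:K"
	then show "x:{x:carrier L. \<forall>h\<in>aut_over L K. h x = x}" using K_sub by (auto simp: aut_over_def)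
qed

abbreviation "Z i == io (zv i)"

lemma Z_closed: "i < n ==> Z i:cL"
	by (simp add: zv_Lam io_closed)

lemma Z_inj: "i < n ==> j < n ==> Z i = Z j ==> i = j"
	using io_eq[OF zv_Lam zv_Lam] zv_inj by blast

lemma gp_Z: "p:Per ==> i < n ==> gp p (Z i) = Z (p i)"
	by (simp add: gp_io zv_Lam permP_zv Per_perm)

lemma Per_less: "p:Per ==> i < n ==> p i < n"
	using permutes_in_image[OF Per_perm, of p i] by simp

definition esym :: "nat => 'l" where
	"esym d = (\<Oplus>\<^bsub>L\<^esub>A\<in>{A. A \<subseteq> {..<n} & card A = d}. \<Otimes>\<^bsub>L\<^esub>i\<in>A. \<ominus>L Z i)"

lemma hom_cring: "h:ring_hom L L ==> ring_hom_cring L L h"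
	by (intro ring_hom_cring.intro ring_hom_cring_axioms.intro F.L.is_cring)

lemma esym_K: "esym d:K"
proof -
	let ?C = "{A. A \<subseteq> {..<n} & card A = d}"
	have Zc: "(%i. \<ominus>L Z i):A \<rightarrow> cL" if "A \<subseteq> {..<n}" for A using that Z_closed by blast
	have Pc: "(%A. \<Otimes>\<^bsub>L\<^esub>i\<in>A. \<ominus>L Z i):?C \<rightarrow> cL" using F.L.finprod_closed[OF Zc] by auto
	have "gp p (esym d) = esym d" if p: "p:Per" for p
	proof -
		interpret H: ring_hom_cring L L "gp p" by (rule hom_cring[OF gp_hom[OF p]])
		have inj: "inj_on p A" for A using permutes_inj_on[OF Per_perm[OF p]] .
		have 1: "gp p (\<Otimes>\<^bsub>L\<^esub>i\<in>A. \<ominus>L Z i) = (\<Otimes>\<^bsub>L\<^esub>i\<in>p ` A. \<ominus>L Z i)" if A: "A \<subseteq> {..<n}" for A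
		proof -
			have pA: "p ` A \<subseteq> {..<n}" using A Per_less[OF p] by auto
			have "gp p (\<Otimes>\<^bsub>L\<^esub>i\<in>A. \<ominus>L Z i) = (\<Otimes>\<^bsub>L\<^esub>i\<in>A. (gp p \<circ> (%i. \<ominus>L Z i)) i)" by (rule H.hom_finprod[OF Zc[OF A]])
			also have "... = (\<Otimes>\<^bsub>L\<^esub>i\<in>A. \<ominus>L Z (p i))"
			proof (rule F.L.finprod_cong')
				fix i assume "i:A"
				then have "i < n" using A by blast
				then show "(gp p \<circ> (%i. \<ominus>L Z i)) i = \<ominus>L Z (p i)"
					using H.hom_a_inv[OF Z_closed] gp_Z[OF p] by simp
			qed (use A Z_closed Per_less[OF p] in auto)
			also have "... = (\<Otimes>\<^bsub>L\<^esub>i\<in>p ` A. \<ominus>L Z i)" by (rule F.L.finprod_reindex[OF Zc[OF pA] inj, symmetric])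
			finally show ?thesis .
		qed
		have img: "(`) p ` ?C = ?C"
		proof (intro equalityI subsetI)
			fix B assume "B:(`) p ` ?C"
			then show "B:?C" using Per_less[OF p] card_image[OF inj] by auto
		next
			fix B assume B: "B:?C"
			have "pinv p ` B:?C" using B Per_less[OF Per_inv[OF p]] card_image[OF permutes_inj_on[OF Per_perm[OF Per_inv[OF p]]]] by auto
			moreover have "p ` pinv p ` B = B" using Per_o(1)[OF p] by (simp add: image_comp)
			ultimately show "B:(`) p ` ?C" by (metis image_eqI)
		qed
		have "gp p (esym d) = (\<Oplus>\<^bsub>L\<^esub>A\<in>?C. (gp p \<circ> (%A. \<Otimes>\<^bsub>L\<^esub>i\<in>A. \<ominus>L Z i)) A)" unfolding esym_def by (rule H.hom_finsum[OF Pc])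
		also have "... = (\<Oplus>\<^bsub>L\<^esub>A\<in>?C. \<Otimes>\<^bsub>L\<^esub>i\<in>p ` A. \<ominus>L Z i)"
		proof (rule F.L.finsum_cong')
			show "(%A. \<Otimes>\<^bsub>L\<^esub>i\<in>p ` A. \<ominus>L Z i):?C \<rightarrow> cL"
				using Zc Per_less[OF p] by (auto intro!: F.L.finprod_closed)
		qed (use 1 in auto)
		also have "... = (\<Oplus>\<^bsub>L\<^esub>A\<in>(`) p ` ?C. \<Otimes>\<^bsub>L\<^esub>i\<in>A. \<ominus>L Z i)"
		proof (rule F.L.finsum_reindex[symmetric])
			show "inj_on ((`) p) ?C" using permutes_inj[OF Per_perm[OF p]] by (intro inj_onI) (simp add: inj_image_eq_iff)
		qed (use Pc img in auto)
		finally show ?thesis unfolding img esym_def .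
	qed
	moreover have "esym d:cL" unfolding esym_def by (rule F.L.finsum_closed[OF Pc])
	ultimately show ?thesis unfolding K_fixed by blast
qed

lemma root_product: assumes x: "x:cL"
	shows "(\<Otimes>\<^bsub>L\<^esub>i\<in>{..<n}. x \<oplus>L \<ominus>L Z i) = (\<Oplus>\<^bsub>L\<^esub>d\<in>{..n}. esym d \<otimes>L x [^]\<^bsub>L\<^esub> (n - d))"
proof -
	have "(%i. \<ominus>L Z i):{..<n} \<rightarrow> cL" using Z_closed by blast
	from F.L.prod_expand_by_degree[OF finite_lessThan x this] show ?thesis by (simp add: esym_def)
qed

text \<open>An automorphism over \<open>K\<close> permutes the roots \<open>z\<^sub>i\<close> of the polynomial whose coefficients are elementary symmetric, and is determined by this permutation.\<close>

lemma aut_over_K: "aut_over L K = gp ` Per"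
proof (intro equalityI subsetI)
	fix s assume s: "s:aut_over L K"
	have h: "s:ring_hom L L" and b: "s:Bij (cL)" and fix_K: "!!x. x:K ==> s x = x"
		using s by (auto simp: aut_over_def)
	interpret H: ring_hom_cring L L s by (rule hom_cring[OF h])
	have "\<exists>i. i < n & s (Z j) = Z i" if j: "j < n" for j
	proof -
		have Zj: "Z j:cL" by (rule Z_closed[OF j])
		have sj: "s (Z j):cL" by (rule rhc[OF h Zj])
		have c: "(%i. y \<oplus>L \<ominus>L Z i):A \<rightarrow> cL" if "y:cL" "A \<subseteq> {..<n}" for y A using that Z_closed by blast
		have "{..<n} = insert j ({..<n} - {j})" using j by blast
		then have "(\<Otimes>\<^bsub>L\<^esub>i\<in>{..<n}. Z j \<oplus>L \<ominus>L Z i) = (Z j \<oplus>L \<ominus>L Z j) \<otimes>L (\<Otimes>\<^bsub>L\<^esub>i\<in>{..<n} - {j}. Z j \<oplus>L \<ominus>L Z i)"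
			using F.L.finprod_insert[of "{..<n} - {j}" j "%i. Z j \<oplus>L \<ominus>L Z i"] c[OF Zj, of "{..<n} - {j}"] Zj by auto
		also have "... = \<zero>L" using F.L.finprod_closed[OF c[OF Zj]] Zj by (simp add: F.L.r_neg)
		finally have "(\<Oplus>\<^bsub>L\<^esub>d\<in>{..n}. esym d \<otimes>L Z j [^]\<^bsub>L\<^esub> (n - d)) = \<zero>L" using root_product[OF Zj] by simp
		then have "s (\<Oplus>\<^bsub>L\<^esub>d\<in>{..n}. esym d \<otimes>L Z j [^]\<^bsub>L\<^esub> (n - d)) = \<zero>L" using H.hom_zero by simp
		moreover have ec: "esym d:cL" for d using esym_K K_sub by blast
		moreover have powh: "s (Z j [^]\<^bsub>L\<^esub> (m::nat)) = s (Z j) [^]\<^bsub>L\<^esub> m" for m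
			by (induction m) (use Zj rhm[OF h] rh1[OF h] in auto)
		moreover have "s (\<Oplus>\<^bsub>L\<^esub>d\<in>{..n}. esym d \<otimes>L Z j [^]\<^bsub>L\<^esub> (n - d)) = (\<Oplus>\<^bsub>L\<^esub>d\<in>{..n}. (s \<circ> (%d. esym d \<otimes>L Z j [^]\<^bsub>L\<^esub> (n - d))) d)"
			by (rule H.hom_finsum) (use ec Zj in auto)
		moreover have "(\<Oplus>\<^bsub>L\<^esub>d\<in>{..n}. (s \<circ> (%d. esym d \<otimes>L Z j [^]\<^bsub>L\<^esub> (n - d))) d) = (\<Oplus>\<^bsub>L\<^esub>d\<in>{..n}. esym d \<otimes>L s (Z j) [^]\<^bsub>L\<^esub> (n - d))"
		proof (rule F.L.finsum_cong')
			fix d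
			show "(s \<circ> (%d. esym d \<otimes>L Z j [^]\<^bsub>L\<^esub> (n - d))) d = esym d \<otimes>L s (Z j) [^]\<^bsub>L\<^esub> (n - d)"
				using rhm[OF h ec[of d], of "Z j [^]\<^bsub>L\<^esub> (n - d)"] Zj fix_K[OF esym_K] powh by simp
		qed (use ec sj in auto)
		ultimately have "(\<Otimes>\<^bsub>L\<^esub>i\<in>{..<n}. s (Z j) \<oplus>L \<ominus>L Z i) = \<zero>L" using root_product[OF sj] by simp
		then obtain i where i: "i < n" "s (Z j) \<oplus>L \<ominus>L Z i = \<zero>L"
			using F.L.finprod_zero[OF finite_lessThan c[OF sj order_refl]] by blast
		then have "s (Z j) = Z i" using F.L.r_right_minus_eq[of "s (Z j)" "Z i"] sj Z_closed[OF i(1)] by (simp add: a_minus_def)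
		then show ?thesis using i by blast
	qed
	then obtain r where r: "!!j. j < n ==> r j < n & s (Z j) = Z (r j)" by metis
	define p where "p j = (if j < n then r j else j)" for j
	have inj: "inj_on p {..<n}"
	proof (rule inj_onI)
		fix i j assume ij: "i:{..<n}" "j:{..<n}" "p i = p j"
		then have "s (Z i) = s (Z j)" using r by (simp add: p_def)
		then have "Z i = Z j" using b Z_closed ij by (auto simp: Bij_def bij_betw_def dest: inj_onD)
		then show "i = j" using Z_inj ij by blast
	qed
	have "p ` {..<n} = {..<n}" by (rule endo_inj_surj[OF finite_lessThan _ inj]) (use r in \<open>auto simp: p_def\<close>)
	then have "bij_betw p {..<n} {..<n}" using inj by (simp add: bij_betw_def)
	then have "p permutes {..<n}" by (rule bij_imp_permutes) (simp add: p_def)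
	then have p: "p:Per" unfolding Per_def by simp
	have "s (io f) = gp p (io f)" if "f:Lam" for f
		using that
	proof (induction f rule: Lam_generated)
		case (cst c)
		have "s (io (const c)) = io (const c)" by (rule fix_K[OF Gam_K[OF const_Gam[OF cst]]])
		moreover have "gp p (io (const c)) = io (const c)"
			using gp_io[OF p] Inv_perm[OF Gam_Inv[OF const_Gam[OF cst]] Per_perm[OF p]] const_Gam[OF cst] by simp
		ultimately show ?case by simp
	next
		case (var i)
		then have "p i = r i" by (simp add: p_def)
		then show ?case using r[OF var] gp_Z[OF p var] by simp
	next
		case (add f g)
		then show ?case using io_closed by (simp add: io_add rha[OF h] rha[OF gp_hom[OF p]] del: P.add_S)
	next
		case (mult f g)
		then show ?case using io_closed by (simp add: io_mult rhm[OF h] rhm[OF gp_hom[OF p]])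
	qed
	then have "s x = gp p x" if "x:cL" for x
		using hom_eq_on_L[OF h gp_hom[OF p]] that by blast
	then have "s = gp p" using b gp_Bij[OF p] by (intro extensionalityI[of _ "cL"]) (auto simp: Bij_def)
	then show "s:gp ` Per" using p by blast
qed (use gp_aut in blast)

definition Mon :: "('l => 'l) set" where "Mon = tr ` words"

lemma words_perm: assumes "a:words" "p:Per" shows "a \<circ> p:words"
proof -
	have "p i = i" if "i \<ge> n" for i using permutes_not_in[OF Per_perm[OF assms(2)], of i] that by simp
	then show ?thesis using assms(1) by (simp add: words_def)
qed

lemma words_add: "a:words ==> b:words ==> a + b:words" and words_0: "0:words" and words_neg: "a:words ==> - a:words"
	by (auto simp: words_def)

lemma tr_Z: "i < n ==> tr a (Z i) = io (const (qz (a i)) \<otimes>P zv i)"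
	by (simp add: tr_io zv_Lam tor_zv)

lemma const_zv_Lam: "i < n ==> const (qz c) \<otimes>P zv i:Lam"
	using Lam_mult zv_Lam const_Gam[OF qz_closed] by simp

lemma tr_eq_gp: \<comment> \<open>a scaling that permutes the variables is trivial\<close>
	assumes a: "a:words" and p: "p:Per" and eq: "!!i. i < n ==> tr a (Z i) = gp p (Z i)" shows "a = 0"
proof
	fix i
	show "a i = 0 i"
	proof (cases "i < n")
		case True
		have pi: "p i < n" by (rule Per_less[OF p True])
		have "io (const (qz (a i)) \<otimes>P zv i) = Z (p i)" using eq[OF True] tr_Z[OF True] gp_Z[OF p True] by simp
		then have e: "const (qz (a i)) \<otimes>P zv i = zv (p i)" using io_eq[OF const_zv_Lam[OF True] zv_Lam[OF pi]] by simp
		have v: "const (qz (a i)) \<otimes>P zv i = (%d. qz (a i) \<otimes> zv i d)" by (rule const_mult) (use True zv_Lam qz_closed in auto)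
		let ?d = "%j. if j = i then (1, 0) else 0 :: nat \<times> int"
		have "zv i ?d = \<one>" by (simp add: zv_def skew_single_def)
		then have "zv (p i) ?d = qz (a i)" using e v qz_closed by (metis r_one)
		then have nz: "zv (p i) ?d = qz (a i)" "zv (p i) ?d ~= \<zero>" using qz_nonzero by simp_all
		then have "zv (p i) ?d = \<one>" unfolding zv_def skew_single_def by (simp split: if_splits)
		then show ?thesis using nz qz_one_iff by simp
	qed (use a in \<open>simp add: words_def\<close>)
qed

lemma tr_K_eq:
	assumes a: "a:words" and b: "b:words" and eq: "\<forall>x\<in>K. tr a x = tr b x" shows "a = b"
proof -
	let ?c = "- b + a"
	have "tr ?c x = x" if "x:K" for x
	proof -
		have xL: "x:cL" using that K_sub by blast
		have "tr ?c x = tr (- b) (tr b x)" using eq that tr_comp[OF xL, of "- b" a] by simp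
		also have "... = x" using tr_comp[OF xL, of "- b" b] tr_0[OF xL] by simp
		finally show ?thesis .
	qed
	then have "tr ?c:aut_over L K" using tr_hom tr_Bij by (simp add: aut_over_def)
	then obtain p where p: "p:Per" "tr ?c = gp p" unfolding aut_over_K by blast
	have "?c = 0" by (rule tr_eq_gp[OF words_add[OF words_neg[OF b] a] p(1)]) (simp only: p(2))
	then show ?thesis by (simp add: fun_eq_iff)
qed

lemma tr_inj: "a:words ==> b:words ==> tr a = tr b ==> a = b"
	using tr_K_eq by simp

abbreviation "BG == BijGroup (cL)"

lemma tr_mult: "tr a \<otimes>\<^bsub>BG\<^esub> tr b = tr (a + b)"
proof -
	have "compose (cL) (tr a) (tr b) = tr (a + b)"
		by (rule extensionalityI[of _ "cL"]) (use tr_Bij in \<open>auto simp: Bij_def compose_def tr_comp\<close>)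
	then show ?thesis by (simp add: BijGroup_simps tr_Bij)
qed

lemma tr_one: "\<one>\<^bsub>BG\<^esub> = tr 0"
	unfolding BijGroup_simps
	by (rule extensionalityI[of _ "cL"]) (use tr_Bij in \<open>auto simp: Bij_def tr_0\<close>)

lemma gp_inv: assumes p: "p:Per" shows "inv\<^bsub>BG\<^esub> gp p = gp (pinv p)"
proof (rule group.inv_equality[OF group_BijGroup])
	have "compose (cL) (gp (pinv p)) (gp p) = (\<lambda>x\<in>carrier L. x)"
		by (rule extensionalityI[of _ "cL"]) (auto simp: compose_def gp_comp p Per_inv Per_o gp_id)
	then show "gp (pinv p) \<otimes>\<^bsub>BG\<^esub> gp p = \<one>\<^bsub>BG\<^esub>" by (simp add: BijGroup_simps gp_Bij p Per_inv)
qed (simp_all add: BijGroup_simps gp_Bij p Per_inv)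

lemma gp_conj: assumes p: "p:Per" shows "gp p \<otimes>\<^bsub>BG\<^esub> tr a \<otimes>\<^bsub>BG\<^esub> inv\<^bsub>BG\<^esub> gp p = tr (a \<circ> pinv p)"
proof -
	note i = Per_inv[OF p]
	have "compose (cL) (compose (cL) (gp p) (tr a)) (gp (pinv p)) = tr (a \<circ> pinv p)"
	proof (rule extensionalityI[of _ "cL"])
		fix x assume x: "x:cL"
		have "gp p (tr a (gp (pinv p) x)) = tr (a \<circ> pinv p) (gp p (gp (pinv p) x))" by (rule gp_tr[OF p gp_closed[OF i x]])
		also have "... = tr (a \<circ> pinv p) x" using gp_comp[OF p i x] Per_o[OF p] gp_id[OF x] by simp
		finally show "compose (cL) (compose (cL) (gp p) (tr a)) (gp (pinv p)) x = tr (a \<circ> pinv p) x"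
			using x gp_closed[OF i x] by (simp add: compose_def)
	qed (use tr_Bij in \<open>auto simp: Bij_def\<close>)
	then show ?thesis
		unfolding gp_inv[OF p] using compose_Bij[OF gp_Bij[OF p] tr_Bij[of a]] by (simp add: BijGroup_simps gp_Bij p i tr_Bij)
qed

lemma gp_conj': assumes p: "p:Per" shows "inv\<^bsub>BG\<^esub> gp p \<otimes>\<^bsub>BG\<^esub> tr a \<otimes>\<^bsub>BG\<^esub> gp p = tr (a \<circ> p)"
proof -
	have "pinv (pinv p) = p" using permutes_inv_inv[OF Per_perm[OF p]] .
	then show ?thesis using gp_conj[OF Per_inv[OF p], of a] gp_inv[OF p] gp_inv[OF Per_inv[OF p]] by simp
qed

abbreviation "Cst == io ` const ` carrier k"

lemma const_ring:
	assumes "c:carrier k" "d:carrier k"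
	shows "const c \<otimes>P const d = const (c \<otimes> d)" "const c \<oplus>P const d = const (c \<oplus> d)"
	using assms by (simp_all add: const_def P.single_mult P.single_add del: P.add_S)

lemma Cst_subfield: "subfield Cst L"
proof (rule F.L.subfieldI'[OF F.L.subringI])
	have cL: "const c:Lam" if "c:carrier k" for c using const_Gam[OF that] by simp
	show sub: "Cst \<subseteq> cL" using cL io_closed by auto
	have one: "const \<one> = \<one>P" by (simp add: const_def P.one_S)
	then show "\<one>L:Cst" using io_one by (metis image_eqI one_closed)
	fix x y assume "x:Cst" "y:Cst"
	then obtain c d where cd: "c:carrier k" "d:carrier k" "x = io (const c)" "y = io (const d)" by blast
	have "x \<otimes>L y = io (const (c \<otimes> d))"
		using io_mult[OF cL[OF cd(1)] cL[OF cd(2)]] unfolding cd(3,4) const_ring[OF cd(1,2)] by simp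
	then show "x \<otimes>L y:Cst" using cd by blast
	have "x \<oplus>L y = io (const (c \<oplus> d))"
		using io_add[OF cL[OF cd(1)] cL[OF cd(2)]] unfolding cd(3,4) const_ring[OF cd(1,2)] by simp
	then show "x \<oplus>L y:Cst" using cd by blast
	have "\<ominus>P const c = const (\<ominus> c)" using cd(1) const_closed[OF cd(1)] by (auto simp: P_neg const_def skew_single_def)
	then have "\<ominus>L x = io (const (\<ominus> c))" using cd(3) io_neg[OF cL[OF cd(1)]] by simp
	moreover have "\<ominus> c:carrier k" using cd(1) by simp
	ultimately show "\<ominus>L x:Cst" by blast
next
	have cL: "const c:Lam" if "c:carrier k" for c using const_Gam[OF that] by simp
	fix x assume x: "x:Cst - {\<zero>L}"
	then obtain c where c: "c:carrier k" "x = io (const c)" by blast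
	have "c ~= \<zero>" using x c io_zero by (auto simp: const_def P.single_zero)
	then have cc: "c:carrier k - {\<zero>}" using c by simp
	have "x \<otimes>L io (const (inv c)) = \<one>L"
		using c nz_inv[OF cc] io_mult[OF cL cL, of c "inv c"] const_ring(1)[of c "inv c"] io_one by (simp add: const_def P.one_S)
	then have "inv\<^bsub>L\<^esub> x = io (const (inv c))"
		using c cL nz_inv(1)[OF cc] io_closed by (intro F.L.comm_inv_char) auto
	then show "inv\<^bsub>L\<^esub> x:Cst" using nz_inv(1)[OF cc] by blast
qed

lemma Gam_subdomain: "subdomain (io ` Gam) L"
proof (rule F.L.subdomainI'[OF F.L.subringI])
	show "io ` Gam \<subseteq> cL" using io_closed by auto
	show "\<one>L:io ` Gam" using io_one subringE(3)[OF Gam_subring] by (metis image_eqI)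
	fix x y assume "x:io ` Gam" "y:io ` Gam"
	then obtain f g where fg: "f:Gam" "g:Gam" "x = io f" "y = io g" by blast
	show "x \<otimes>L y:io ` Gam" using fg io_mult[of f g] subringE(6)[OF Gam_subring fg(1,2)] by (metis Gam_Lam image_eqI)
	show "x \<oplus>L y:io ` Gam" using fg io_add[of f g] subringE(7)[OF Gam_subring fg(1,2)] by (metis Gam_Lam image_eqI)
	show "\<ominus>L x:io ` Gam" using fg io_neg[of f] subringE(5)[OF Gam_subring fg(1)] by (metis Gam_Lam image_eqI)
qed

lemma setting: "galois_setting L Cst (io ` Gam) Mon"
	unfolding galois_setting_def
proof (intro conjI F.L.field_axioms Cst_subfield Gam_subdomain L_galois ballI impI)
	show "Cst \<subseteq> io ` Gam" using const_Gam by auto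
	show "Mon \<subseteq> aut_over L Cst"
	proof
		fix m assume "m:Mon"
		then obtain a where "m = tr a" unfolding Mon_def by blast
		moreover have "tr a (io (const c)) = io (const c)" if "c:carrier k" for c
			using tr_io[of "const c" a] const_Gam[OF that] tor_const[OF that] by simp
		ultimately show "m:aut_over L Cst" using tr_hom tr_Bij by (auto simp: aut_over_def)
	qed
	show "submonoid Mon BG"
		by (rule submonoid.intro) (use tr_Bij tr_mult words_add tr_one words_0 in \<open>auto simp: Mon_def BijGroup_simps(3)\<close>)
	fix m m' assume "m:Mon" "m':Mon" "\<forall>x\<in>K. m x = m' x"
	then show "m = m'" using tr_K_eq unfolding Mon_def by blast
next
	fix h m assume "h:aut_over L K" "m:Mon"
	then show "h \<otimes>\<^bsub>BG\<^esub> m \<otimes>\<^bsub>BG\<^esub> inv\<^bsub>BG\<^esub> h:Mon"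
		unfolding aut_over_K Mon_def using gp_conj words_perm Per_inv by auto
qed

end

section \<open>Transport of bases along semilinear maps\<close>

lemma semilinear_span_basis:
	assumes V: "module R V" and V': "module R' V'"
		and F: "!!v. v:carrier V ==> F v:carrier V'" "inj_on F (carrier V)" "F \<zero>\<^bsub>V\<^esub> = \<zero>\<^bsub>V'\<^esub>"
			"!!v w. v:carrier V ==> w:carrier V ==> F (v \<oplus>\<^bsub>V\<^esub> w) = F v \<oplus>\<^bsub>V'\<^esub> F w"
		and j: "j ` carrier R = carrier R'" "!!c. c:carrier R ==> j c = \<zero>\<^bsub>R'\<^esub> \<longleftrightarrow> c = \<zero>\<^bsub>R\<^esub>"
		and lin: "!!c v. c:carrier R ==> v:carrier V ==> F (c \<odot>\<^bsub>V\<^esub> v) = j c \<odot>\<^bsub>V'\<^esub> F v"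
		and B: "B \<subseteq> carrier V"
	shows "module_span R' V' (F ` B) = F ` module_span R V B"
		and "module_indep R V B ==> module_indep R' V' (F ` B)"
proof -
	interpret V: module R V by fact
	interpret V': module R' V' by fact
	have sum: "F (\<Oplus>\<^bsub>V\<^esub>v\<in>T. c v \<odot>\<^bsub>V\<^esub> v) = (\<Oplus>\<^bsub>V'\<^esub>w\<in>F ` T. d w \<odot>\<^bsub>V'\<^esub> w)"
		if T: "T \<subseteq> B" "!!v. v:T ==> c v:carrier R & d (F v) = j (c v)" for T c d
	proof -
		have jc: "j (c v):carrier R'" if "v:T" for v using T(2)[OF that] j(1) by blast
		have TV: "v:carrier V" if "v:T" for v using that T(1) B by blast
		have cl: "(%v. c v \<odot>\<^bsub>V\<^esub> v):T \<rightarrow> carrier V" using T(2) TV by auto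
		have "F (\<Oplus>\<^bsub>V\<^esub>v\<in>T. c v \<odot>\<^bsub>V\<^esub> v) = (\<Oplus>\<^bsub>V'\<^esub>v\<in>T. F (c v \<odot>\<^bsub>V\<^esub> v))"
			by (rule V.M.additive_finsum[OF V'.M.abelian_monoid_axioms F(1,3,4) cl])
		also have "... = (\<Oplus>\<^bsub>V'\<^esub>v\<in>T. d (F v) \<odot>\<^bsub>V'\<^esub> F v)"
			by (rule V'.M.finsum_cong') (use T(2) TV F(1) lin jc in auto)
		also have "... = (\<Oplus>\<^bsub>V'\<^esub>w\<in>F ` T. d w \<odot>\<^bsub>V'\<^esub> w)"
			by (rule V'.M.finsum_reindex[symmetric])
				(use T(2) TV F(1) jc in auto, use inj_on_subset[OF F(2)] TV in blast)
		finally show ?thesis .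
	qed
	have lift: "\<exists>S c. finite S & S \<subseteq> B & c:S \<rightarrow> carrier R & T' = F ` S & (\<forall>v\<in>S. d (F v) = j (c v))"
		if T': "finite T'" "T' \<subseteq> F ` B" "d:T' \<rightarrow> carrier R'" for T' d
	proof -
		obtain S where S: "finite S" "S \<subseteq> B" "T' = F ` S" using finite_subset_image[OF T'(1,2)] by blast
		have "\<forall>v\<in>S. \<exists>c. c:carrier R & d (F v) = j c" using T'(3) S(3) j(1) by blast
		then obtain c where "\<forall>v\<in>S. c v:carrier R & d (F v) = j (c v)" by metis
		then show ?thesis using S by (intro exI[of _ S] exI[of _ c]) auto
	qed
	show "module_span R' V' (F ` B) = F ` module_span R V B"
	proof (intro equalityI subsetI)
		fix x assume "x:module_span R' V' (F ` B)"
		then obtain T' d where T': "finite T'" "T' \<subseteq> F ` B" "d:T' \<rightarrow> carrier R'" "x = (\<Oplus>\<^bsub>V'\<^esub>w\<in>T'. d w \<odot>\<^bsub>V'\<^esub> w)"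
			unfolding module_span_def by blast
		obtain S c where S: "finite S" "S \<subseteq> B" "c:S \<rightarrow> carrier R" "T' = F ` S" "\<forall>v\<in>S. d (F v) = j (c v)"
			using lift[OF T'(1-3)] by blast
		have "x = F (\<Oplus>\<^bsub>V\<^esub>v\<in>S. c v \<odot>\<^bsub>V\<^esub> v)" unfolding T'(4) S(4) by (rule sum[symmetric]) (use S in auto)
		then show "x:F ` module_span R V B" unfolding module_span_def using S by blast
	next
		fix x assume "x:F ` module_span R V B"
		then obtain S c where S: "finite S" "S \<subseteq> B" "c:S \<rightarrow> carrier R" "x = F (\<Oplus>\<^bsub>V\<^esub>v\<in>S. c v \<odot>\<^bsub>V\<^esub> v)"
			unfolding module_span_def by blast
		have SV: "S \<subseteq> carrier V" using S B by blast
		define d where "d w = j (c (inv_into S F w))" for w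
		have d: "d (F v) = j (c v)" if "v:S" for v
			using inv_into_f_f[OF inj_on_subset[OF F(2) SV] that] by (simp add: d_def)
		have "x = (\<Oplus>\<^bsub>V'\<^esub>w\<in>F ` S. d w \<odot>\<^bsub>V'\<^esub> w)" unfolding S(4) by (rule sum) (use S d in auto)
		moreover have "d:F ` S \<rightarrow> carrier R'" using d S(3) j(1) by auto
		ultimately show "x:module_span R' V' (F ` B)" unfolding module_span_def using S(1,2) by blast
	qed
	assume ind: "module_indep R V B"
	show "module_indep R' V' (F ` B)"
		unfolding module_indep_def
	proof (intro allI impI, elim conjE)
		fix T' d assume T': "finite T'" "T' \<subseteq> F ` B" "d:T' \<rightarrow> carrier R'" and z: "(\<Oplus>\<^bsub>V'\<^esub>w\<in>T'. d w \<odot>\<^bsub>V'\<^esub> w) = \<zero>\<^bsub>V'\<^esub>"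
		obtain S c where S: "finite S" "S \<subseteq> B" "c:S \<rightarrow> carrier R" "T' = F ` S" "\<forall>v\<in>S. d (F v) = j (c v)"
			using lift[OF T'] by blast
		have "F (\<Oplus>\<^bsub>V\<^esub>v\<in>S. c v \<odot>\<^bsub>V\<^esub> v) = \<zero>\<^bsub>V'\<^esub>" unfolding z[symmetric] S(4) by (rule sum) (use S in auto)
		moreover have "(%v. c v \<odot>\<^bsub>V\<^esub> v):S \<rightarrow> carrier V" using S(2,3) B by (auto intro!: V.smult_closed)
		then have "(\<Oplus>\<^bsub>V\<^esub>v\<in>S. c v \<odot>\<^bsub>V\<^esub> v):carrier V" by (rule V.M.finsum_closed)
		ultimately have "(\<Oplus>\<^bsub>V\<^esub>v\<in>S. c v \<odot>\<^bsub>V\<^esub> v) = \<zero>\<^bsub>V\<^esub>"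
			by (intro inj_onD[OF F(2)]) (simp_all add: F(3))
		then have "\<forall>v\<in>S. c v = \<zero>\<^bsub>R\<^esub>" using ind S unfolding module_indep_def by blast
		then show "\<forall>w\<in>T'. d w = \<zero>\<^bsub>R'\<^esub>" using S j(2)[of "\<zero>\<^bsub>R\<^esub>"] by auto
	qed
qed

definition sided_module :: "bool => ('a, 'r) ring_scheme => 'a set => ('a, 'a) module" where
	"sided_module s R W = (if s then right_module R W else left_module R W)"

definition sided_mult :: "bool => ('a, 'r) ring_scheme => 'a => 'a => 'a" where
	"sided_mult s R c x = (if s then x \<otimes>\<^bsub>R\<^esub> c else c \<otimes>\<^bsub>R\<^esub> x)"

lemma sided_module_simps [simp]:
	"carrier (sided_module s R W) = W" "(\<oplus>\<^bsub>sided_module s R W\<^esub>) = (\<oplus>\<^bsub>R\<^esub>)" "\<zero>\<^bsub>sided_module s R W\<^esub> = \<zero>\<^bsub>R\<^esub>"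
	"c \<odot>\<^bsub>sided_module s R W\<^esub> x = sided_mult s R c x"
	by (simp_all add: sided_module_def sided_mult_def)

lemma (in ring) sided_module_module:
	assumes "W \<subseteq> carrier R" "\<zero>:W" "!!x y. x:W ==> y:W ==> x \<oplus> y:W" "!!x. x:W ==> \<ominus> x:W"
		"G \<subseteq> carrier R" "cring (R\<lparr>carrier := G\<rparr>)" "!!g x. g:G ==> x:W ==> sided_mult s R g x:W"
	shows "module (R\<lparr>carrier := G\<rparr>) (sided_module s R W)"
proof (cases s)
	case True
	then show ?thesis using right_module_module[OF assms(1-6)] assms(7) by (simp add: sided_module_def sided_mult_def)
next
	case False
	then show ?thesis using left_module_module[OF assms(1-6)] assms(7) by (simp add: sided_module_def sided_mult_def)
qed

section \<open>The skew monoid ring of scalings\<close>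

context galois_laurent
begin

abbreviation "BM == BG\<lparr>carrier := Mon\<rparr>"

lemma Mon_submonoid: "submonoid Mon BG"
	using setting by (simp add: galois_setting_def)

sublocale T: skew_monoid L BM "%m. m"
proof (intro skew_monoid.intro skew_monoid_axioms.intro F.L.ring_axioms)
	interpret BG: group BG by (rule group_BijGroup)
	show "Group.monoid BM" by (rule submonoid.submonoid_is_monoid[OF Mon_submonoid BG.monoid_axioms])
	show "m:carrier BM ==> m:ring_hom L L" for m using tr_hom by (auto simp: Mon_def)
	show "r:cL ==> \<one>\<^bsub>BM\<^esub> r = r" for r by (simp add: tr_one tr_0)
	fix a b r assume "a:carrier BM" "b:carrier BM" "r:cL"
	then show "(a \<otimes>\<^bsub>BM\<^esub> b) r = a (b r)" by (auto simp: Mon_def tr_mult tr_comp)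
qed

abbreviation "T == aut_skew_ring L Mon"
abbreviation multT (infixl "\<otimes>T" 70) where "multT == (\<otimes>\<^bsub>T\<^esub>)"
abbreviation addT (infixl "\<oplus>T" 65) where "addT == (\<oplus>\<^bsub>T\<^esub>)"
abbreviation zeroT ("\<zero>T") where "zeroT == \<zero>\<^bsub>T\<^esub>"
abbreviation oneT ("\<one>T") where "oneT == \<one>\<^bsub>T\<^esub>"
abbreviation negT ("\<ominus>T _" [81] 80) where "negT == a_inv T"
abbreviation subT (infixl "\<ominus>T" 65) where "subT == a_minus T"
abbreviation "cT == carrier T"

lemma T_def: "T = skew_monoid_ring L BM (%m. m)"
	by (simp add: aut_skew_ring_def)

lemma T_ring: "ring T"
	unfolding T_def by (rule T.S_ring)

lemma T_eqI:
	assumes "f:cT" "g:cT" "!!a. a:words ==> f (tr a) = g (tr a)" shows "f = g"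
proof
	fix m show "f m = g m"
	proof (cases "m:Mon")
		case True
		then show ?thesis using assms(3) unfolding Mon_def by blast
	next
		case False
		then show ?thesis using T.S_out[of f m] T.S_out[of g m] assms(1,2) by (simp add: T_def)
	qed
qed

lemma T_closed: "f:cT ==> f m:cL"
	unfolding T_def by (rule T.S_closed)

lemma T_add: "f \<oplus>T g = (%m. f m \<oplus>L g m)" and T_zero: "\<zero>T = (%m. \<zero>L)"
	unfolding T_def by (simp_all add: T.zero_S)

lemma T_neg: assumes f: "f:cT" shows "\<ominus>T f = (%m. \<ominus>L f m)"
proof -
	have "(%m. \<ominus>L f m):cT" using T.S_uminus_closed f unfolding T_def by blast
	then show ?thesis using T.S.minus_equality[of "%m. \<ominus>L f m" f] f T_closed[OF f]
		unfolding T_def by (simp add: T.zero_S F.L.l_neg)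
qed

abbreviation "emb == skew_embed L"

lemma Mon_one: "\<one>\<^bsub>BG\<^esub>:Mon" using submonoid.one_closed[OF Mon_submonoid] .

lemma emb_hom: "emb:ring_hom L T"
proof (rule ring_hom_memI)
	fix x y assume xy: "x:cL" "y:cL"
	show "emb x:cT" unfolding skew_embed_def T_def using xy Mon_one by simp
	show "emb (x \<otimes>L y) = emb x \<otimes>T emb y"
		unfolding skew_embed_def T_def using xy Mon_one T.single_mult[of x y "\<one>\<^bsub>BG\<^esub>" "\<one>\<^bsub>BG\<^esub>"] T.act_one T.M.r_one[of "\<one>\<^bsub>BG\<^esub>"] by simp
	show "emb (x \<oplus>L y) = emb x \<oplus>T emb y"
		unfolding skew_embed_def T_def using xy T.single_add by simp
next
	show "emb \<one>L = \<one>T" unfolding skew_embed_def T_def by (simp add: T.one_S)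
qed

lemma emb_closed: "x:cL ==> emb x:cT"
	by (rule rhc[OF emb_hom])

lemma emb_inj: assumes "emb x = emb y" shows "x = y"
	using fun_cong[OF assms, of "\<one>\<^bsub>BG\<^esub>"] by (simp add: skew_embed_def skew_single_def)

lemma emb_mult_left:
	assumes x: "x:cL" and f: "f:cT" shows "emb x \<otimes>T f = (%m. x \<otimes>L f m)"
proof -
	have e: "sgl L x \<one>\<^bsub>BG\<^esub>:carrier T.S" using x Mon_one by simp
	have "sgl L x \<one>\<^bsub>BG\<^esub> \<otimes>\<^bsub>T.S\<^esub> f = (%m. x \<otimes>L f m)"
	proof (rule T.additive_eqI[OF T.S_abelian, where f = f and F = "%f. sgl L x \<one>\<^bsub>BG\<^esub> \<otimes>\<^bsub>T.S\<^esub> f" and G = "%f m. x \<otimes>L f m"])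
		show "f:carrier T.S" using f unfolding T_def .
	next
		fix g h assume gh: "g:carrier T.S" "h:carrier T.S"
		show "sgl L x \<one>\<^bsub>BG\<^esub> \<otimes>\<^bsub>T.S\<^esub> (g \<oplus>\<^bsub>T.S\<^esub> h) = sgl L x \<one>\<^bsub>BG\<^esub> \<otimes>\<^bsub>T.S\<^esub> g \<oplus>\<^bsub>T.S\<^esub> sgl L x \<one>\<^bsub>BG\<^esub> \<otimes>\<^bsub>T.S\<^esub> h"
			by (rule T.S.r_distr[OF gh e])
		show "(%m. x \<otimes>L (g \<oplus>\<^bsub>T.S\<^esub> h) m) = (%m. x \<otimes>L g m) \<oplus>\<^bsub>T.S\<^esub> (%m. x \<otimes>L h m)"
			using x T.S_closed[OF gh(1)] T.S_closed[OF gh(2)] by (simp add: F.L.r_distr)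
	next
		fix r m assume rm: "r:cL" "m:carrier BM"
		then have "\<one>\<^bsub>BG\<^esub> r = r" "\<one>\<^bsub>BG\<^esub> \<otimes>\<^bsub>BG\<^esub> m = m" using T.act_one[of r] T.M.l_one[of m] by simp_all
		then show "sgl L x \<one>\<^bsub>BG\<^esub> \<otimes>\<^bsub>T.S\<^esub> sgl L r m = (%m'. x \<otimes>L sgl L r m m')"
			using rm x Mon_one T.single_mult[of x r "\<one>\<^bsub>BG\<^esub>" m] by (simp add: skew_single_def fun_eq_iff)
	qed
	then show ?thesis by (simp add: skew_embed_def T_def)
qed

lemma emb_mult_right:
	assumes x: "x:cL" and f: "f:cT" shows "f \<otimes>T emb x = (%m. f m \<otimes>L (if m:Mon then m x else \<zero>L))"
proof -
	have e: "sgl L x \<one>\<^bsub>BG\<^esub>:carrier T.S" using x Mon_one by simp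
	have mx: "(if m:Mon then m x else \<zero>L):cL" for m using T.act_closed[of m x] x by simp
	have "f \<otimes>\<^bsub>T.S\<^esub> sgl L x \<one>\<^bsub>BG\<^esub> = (%m. f m \<otimes>L (if m:Mon then m x else \<zero>L))"
	proof (rule T.additive_eqI[OF T.S_abelian, where f = f and F = "%f. f \<otimes>\<^bsub>T.S\<^esub> sgl L x \<one>\<^bsub>BG\<^esub>" and G = "%f m. f m \<otimes>L (if m:Mon then m x else \<zero>L)"])
		show "f:carrier T.S" using f unfolding T_def .
	next
		fix g h assume gh: "g:carrier T.S" "h:carrier T.S"
		show "(g \<oplus>\<^bsub>T.S\<^esub> h) \<otimes>\<^bsub>T.S\<^esub> sgl L x \<one>\<^bsub>BG\<^esub> = g \<otimes>\<^bsub>T.S\<^esub> sgl L x \<one>\<^bsub>BG\<^esub> \<oplus>\<^bsub>T.S\<^esub> h \<otimes>\<^bsub>T.S\<^esub> sgl L x \<one>\<^bsub>BG\<^esub>"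
			by (rule T.S.l_distr[OF gh e])
		show "(%m. (g \<oplus>\<^bsub>T.S\<^esub> h) m \<otimes>L (if m:Mon then m x else \<zero>L)) = (%m. g m \<otimes>L (if m:Mon then m x else \<zero>L)) \<oplus>\<^bsub>T.S\<^esub> (%m. h m \<otimes>L (if m:Mon then m x else \<zero>L))"
			unfolding T.add_S using F.L.l_distr[OF T.S_closed[OF gh(1)] T.S_closed[OF gh(2)] mx] by (intro ext)
	next
		fix r m assume rm: "r:cL" "m:carrier BM"
		then have "m \<otimes>\<^bsub>BG\<^esub> \<one>\<^bsub>BG\<^esub> = m" using T.M.r_one[of m] by simp
		then show "sgl L r m \<otimes>\<^bsub>T.S\<^esub> sgl L x \<one>\<^bsub>BG\<^esub> = (%m'. sgl L r m m' \<otimes>L (if m':Mon then m' x else \<zero>L))"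
		proof -
			have "sgl L r m \<otimes>\<^bsub>T.S\<^esub> sgl L x \<one>\<^bsub>BG\<^esub> = sgl L (r \<otimes>L m x) m"
				using rm x Mon_one T.single_mult[of r x m "\<one>\<^bsub>BG\<^esub>"] \<open>m \<otimes>\<^bsub>BG\<^esub> \<one>\<^bsub>BG\<^esub> = m\<close> by simp
			moreover have "sgl L (r \<otimes>L m x) m m' = sgl L r m m' \<otimes>L (if m':Mon then m' x else \<zero>L)" for m'
				using rm mx[of m'] by (cases "m' = m") (simp_all add: skew_single_def)
			ultimately show ?thesis by (simp add: fun_eq_iff)
		qed
	qed
	then show ?thesis by (simp add: skew_embed_def T_def)
qed

text \<open>The twist by which a coefficient moves past a monoid element: none on the left, the
	element itself on the right.\<close>

definition tws :: "bool => (nat => int) => nat => int" where "tws s a = (if s then a else 0)"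

lemma sided_emb_closed: "x:cL ==> f:cT ==> sided_mult s T (emb x) f:cT"
proof -
	interpret T': ring T by (rule T_ring)
	show "x:cL ==> f:cT ==> sided_mult s T (emb x) f:cT"
		using emb_closed by (simp add: sided_mult_def)
qed

lemma sided_emb_tr:
	assumes x: "x:cL" and f: "f:cT" and a: "a:words"
	shows "sided_mult s T (emb x) f (tr a) = f (tr a) \<otimes>L tr (tws s a) x"
proof (cases s)
	case True
	have "tr a:Mon" using a by (simp add: Mon_def)
	then show ?thesis using True by (simp add: sided_mult_def emb_mult_right[OF x f] tws_def)
next
	case False
	then show ?thesis using F.L.m_comm[OF x T_closed[OF f]] x by (simp add: sided_mult_def emb_mult_left[OF x f] tws_def tr_0)
qed

abbreviation "SI == skew_inv L (io ` Gam) Mon"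

lemma galois_act_tr:
	assumes r: "r:Per" and a: "a:words" shows "galois_act L Mon (gp r) f (tr a) = gp r (f (tr (a \<circ> r)))"
	using a unfolding galois_act_def by (simp add: Mon_def gp_conj'[OF r])

lemma galois_act_closed:
	assumes r: "r:Per" and f: "f:cT" shows "galois_act L Mon (gp r) f:cT"
proof -
	have z: "gp r \<zero>L = \<zero>L" by (rule rh0[OF gp_hom[OF r] F.L.ring_axioms F.L.ring_axioms])
	have sub: "{m. galois_act L Mon (gp r) f m ~= \<zero>L} \<subseteq> (%m. gp r \<otimes>\<^bsub>BG\<^esub> m \<otimes>\<^bsub>BG\<^esub> inv\<^bsub>BG\<^esub> gp r) ` {m. f m ~= \<zero>L}"
	proof
		fix m assume m: "m:{m. galois_act L Mon (gp r) f m ~= \<zero>L}"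
		then obtain a where a: "a:words" "m = tr a" unfolding galois_act_def Mon_def by (auto split: if_splits)
		then have nz: "f (tr (a \<circ> r)) ~= \<zero>L" using m z by (auto simp: galois_act_tr[OF r])
		have "gp r \<otimes>\<^bsub>BG\<^esub> tr (a \<circ> r) \<otimes>\<^bsub>BG\<^esub> inv\<^bsub>BG\<^esub> gp r = tr a"
			unfolding gp_conj[OF r] by (simp add: comp_assoc Per_o[OF r])
		then show "m:(%m. gp r \<otimes>\<^bsub>BG\<^esub> m \<otimes>\<^bsub>BG\<^esub> inv\<^bsub>BG\<^esub> gp r) ` {m. f m ~= \<zero>L}"
			using nz a(2) by (metis (mono_tags, lifting) image_eqI mem_Collect_eq)
	qed
	have fin: "finite {m. f m ~= \<zero>L}" using f T.S_finite unfolding T_def by blast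
	have "{m. galois_act L Mon (gp r) f m ~= \<zero>L} \<subseteq> carrier BM" by (auto simp: galois_act_def split: if_splits)
	moreover have "galois_act L Mon (gp r) f m:cL" for m
		using gp_closed[OF r T_closed[OF f]] by (simp add: galois_act_def)
	ultimately show ?thesis unfolding T_def T.carrier_S using finite_subset[OF sub] fin by blast
qed

text \<open>Invariance only compares the coefficients along the orbits of the conjugation action, which permutes the exponents of a scaling.\<close>

lemma SI_iff:
	"f:SI \<longleftrightarrow> f:cT & (\<forall>r\<in>Per. \<forall>a\<in>words. gp r (f (tr (a \<circ> r))) = f (tr a))"
proof (cases "f:cT")
	case True
	have "galois_act L Mon (gp r) f = f \<longleftrightarrow> (\<forall>a\<in>words. gp r (f (tr (a \<circ> r))) = f (tr a))" if r: "r:Per" for r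
		using T_eqI[OF galois_act_closed[OF r True] True] galois_act_tr[OF r] by metis
	then show ?thesis using True unfolding skew_inv_def aut_over_K by auto
qed (simp add: skew_inv_def)

lemma SI_closed: "f:SI ==> f:cT"
	by (simp add: SI_iff)

lemma SI_subgroup: "\<zero>T:SI" "f:SI ==> g:SI ==> f \<oplus>T g:SI" "f:SI ==> \<ominus>T f:SI"
proof -
	interpret T': ring T by (rule T_ring)
	have h: "r:Per ==> ring_hom_cring L L (gp r)" for r using hom_cring gp_hom by blast
	show "\<zero>T:SI"
		using ring_hom_cring.hom_zero[OF h] T'.zero_closed unfolding SI_iff by (simp add: T_zero)
	show "f \<oplus>T g:SI" if "f:SI" "g:SI"
	proof -
		have fg: "f:cT" "g:cT" using that SI_closed by auto
		have "gp r (f m \<oplus>L g m) = gp r (f m) \<oplus>L gp r (g m)" if "r:Per" for r m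
			using rha[OF gp_hom[OF that] T_closed[OF fg(1)] T_closed[OF fg(2)]] .
		then show ?thesis using that T'.a_closed[OF fg] unfolding SI_iff by (simp add: T_add)
	qed
	show "\<ominus>T f:SI" if "f:SI"
	proof -
		have f: "f:cT" using that SI_closed by auto
		have "gp r (\<ominus>L f m) = \<ominus>L gp r (f m)" if "r:Per" for r m
			using ring_hom_cring.hom_a_inv[OF h[OF that] T_closed[OF f]] .
		then show ?thesis using that T'.a_inv_closed[OF f] unfolding SI_iff by (simp add: T_neg[OF f])
	qed
qed

lemma SI_sided_mult: assumes x: "x:K" and f: "f:SI" shows "sided_mult s T (emb x) f:SI"
proof -
	have xL: "x:cL" using x K_sub by blast
	have fT: "f:cT" by (rule SI_closed[OF f])
	have "gp r (sided_mult s T (emb x) f (tr (a \<circ> r))) = sided_mult s T (emb x) f (tr a)" if r: "r:Per" and a: "a:words" for r a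
	proof -
		have "tws s (a \<circ> r) \<circ> pinv r = tws s a" by (simp add: tws_def comp_assoc Per_o[OF r]) (auto simp: fun_eq_iff)
		then have "gp r (tr (tws s (a \<circ> r)) x) = tr (tws s a) x"
			using gp_tr[OF r xL] x r unfolding K_fixed by simp
		then show ?thesis
			using sided_emb_tr[OF xL fT] words_perm[OF a r] a f r rhm[OF gp_hom[OF r] T_closed[OF fT] tr_closed[OF xL]]
			unfolding SI_iff by simp
	qed
	then show ?thesis using sided_emb_closed[OF xL fT] unfolding SI_iff by blast
qed

text \<open>The images in the skew ring of the monomials of the Weyl algebra without \<open>z\<close> have the
	coefficients \<open>pc a\<close>.\<close>

definition lf :: "nat => int => expon => 'k" where
	"lf i c = const (qz c) \<otimes>P zv i \<oplus>P const h0"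

definition pc1 :: "nat => int => expon => 'k" where
	"pc1 i c = (\<Otimes>\<^bsub>P\<^esub>s\<in>{..<nat (- c)}. lf i (- 1 - int s))"

definition pc :: "(nat => int) => expon => 'k" where
	"pc a = (\<Otimes>\<^bsub>P\<^esub>i\<in>{..<n}. pc1 i (a i))"

lemma finprod_Lam: "f:A \<rightarrow> Lam ==> finprod P f A:Lam"
proof (induction A rule: infinite_finite_induct)
	case (insert a A)
	then have "f:A \<rightarrow> cP" "f a:Lam" "f:A \<rightarrow> Lam" using Lam_P by blast+
	then show ?case using insert by (simp add: Lam_mult)
qed (simp_all add: Lam_one)

lemma lf_Lam: assumes "i < n" shows "lf i c:Lam"
	unfolding lf_def using const_zv_Lam[OF assms] const_Gam[OF h0_closed] by (intro Lam_add) auto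

lemma lf_nonzero: assumes i: "i < n" shows "lf i c ~= \<zero>P"
proof
	let ?d = "%j. if j = i then (1, 0) else 0 :: nat \<times> int"
	assume "lf i c = \<zero>P"
	then have "lf i c ?d = \<zero>" by (simp add: P.zero_S)
	moreover have "?d ~= 0" by (auto simp: fun_eq_iff zero_prod_def)
	then have "const h0 ?d = \<zero>" unfolding const_def skew_single_def by presburger
	moreover have "zv i ?d = \<one>" by (simp add: zv_def skew_single_def)
	ultimately have "qz c = \<zero>" using i qz_closed by (simp add: lf_def const_mult zv_Lam)
	then show False using qz_nonzero by simp
qed

lemma pc1_Lam: "i < n ==> pc1 i c:Lam"
	unfolding pc1_def by (rule finprod_Lam) (simp add: lf_Lam)

lemma pc1_nonzero: assumes "i < n" shows "pc1 i c ~= \<zero>P"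
proof
	assume z: "pc1 i c = \<zero>P"
	have "(%s. lf i (- 1 - int s)):{..<nat (- c)} \<rightarrow> cP" using lf_Lam[OF assms] by auto
	then show False using P.finprod_zero[OF finite_lessThan _ z[unfolded pc1_def]] lf_nonzero[OF assms] by blast
qed

lemma pc_Lam: "pc a:Lam"
	unfolding pc_def by (rule finprod_Lam) (simp add: pc1_Lam)

lemma pc_nonzero: "pc a ~= \<zero>P"
proof
	assume z: "pc a = \<zero>P"
	have "(%i. pc1 i (a i)):{..<n} \<rightarrow> cP" using pc1_Lam by auto
	then show False using P.finprod_zero[OF finite_lessThan _ z[unfolded pc_def]] pc1_nonzero by blast
qed

lemma permP_lf: assumes r: "r:Per" and i: "i < n" shows "permP r (lf i c) = lf (r i) c"
proof -
	have "permP r (const e) = const e" if "e:carrier k" for e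
		using Inv_perm[OF Gam_Inv[OF const_Gam[OF that]] Per_perm[OF r]] .
	then show ?thesis
		unfolding lf_def using i r qz_closed h0_closed zv_Lam const_closed
		by (simp add: permP_add rhm[OF permP_hom[OF Per_perm[OF r]]] permP_zv[OF Per_perm[OF r]] del: P.add_S)
qed

lemma permP_pc: assumes r: "r:Per" shows "permP r (pc (a \<circ> r)) = pc a"
proof -
	interpret H: ring_hom_cring P P "permP r"
		by (intro ring_hom_cring.intro ring_hom_cring_axioms.intro P_cring permP_hom[OF Per_perm[OF r]])
	have 1: "permP r (pc1 i c) = pc1 (r i) c" if i: "i < n" for i c
	proof -
		have "(%s. lf i (- 1 - int s)):{..<nat (- c)} \<rightarrow> cP" using lf_Lam[OF i] by auto
		from H.hom_finprod[OF this] have "permP r (pc1 i c) = (\<Otimes>\<^bsub>P\<^esub>s\<in>{..<nat (- c)}. (permP r \<circ> (%s. lf i (- 1 - int s))) s)"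
			unfolding pc1_def by simp
		also have "... = pc1 (r i) c"
			unfolding pc1_def by (rule P.finprod_cong') (use lf_Lam[OF Per_less[OF r i]] permP_lf[OF r i] in auto)
		finally show ?thesis .
	qed
	have c: "(%i. pc1 i (b i)):{..<n} \<rightarrow> cP" for b using pc1_Lam by auto
	have "permP r (pc (a \<circ> r)) = (\<Otimes>\<^bsub>P\<^esub>i\<in>{..<n}. (permP r \<circ> (%i. pc1 i ((a \<circ> r) i))) i)"
		unfolding pc_def by (rule H.hom_finprod[OF c])
	also have "... = (\<Otimes>\<^bsub>P\<^esub>i\<in>{..<n}. pc1 (r i) (a (r i)))"
		by (rule P.finprod_cong') (use 1 pc1_Lam Per_less[OF r] in auto)
	also have "... = (\<Otimes>\<^bsub>P\<^esub>i\<in>r ` {..<n}. pc1 i (a i))"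
		by (rule P.finprod_reindex[symmetric]) (use pc1_Lam permutes_image[OF Per_perm[OF r]] permutes_inj_on[OF Per_perm[OF r]] in auto)
	also have "... = pc a" by (simp add: pc_def permutes_image[OF Per_perm[OF r]])
	finally show ?thesis .
qed

definition wd :: "('l => 'l) => nat => int" where "wd = inv_into words tr"

lemma wd_tr: "a:words ==> wd (tr a) = a"
	unfolding wd_def by (rule inv_into_f_f) (auto intro: inj_onI tr_inj)

definition Th :: "bool => (expon => 'k) => ('l => 'l) => 'l" where
	"Th s g = (%m. if m:Mon then io (tor (tws s (wd m)) (slice (wd m) g) \<otimes>P pc (wd m)) else \<zero>L)"

lemma Th_tr: "a:words ==> Th s g (tr a) = io (tor (tws s a) (slice a g) \<otimes>P pc a)"
	by (simp add: Th_def Mon_def wd_tr)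

lemma slice_nonzero: assumes "slice a g ~= \<zero>P" obtains d where "g d ~= \<zero>" "a = (%i. snd (d i))"
proof -
	obtain e where "slice a g e ~= \<zero>" using assms by (auto simp: P.zero_S fun_eq_iff)
	then have "g (%i. (fst (e i), a i)) ~= \<zero>" by (auto simp: slice_def split: if_splits)
	then show ?thesis by (rule that) simp
qed

lemma tor_zero: "tor a \<zero>P = \<zero>P"
	by (rule rh0[OF tor_hom P.S_ring P.S_ring])

lemma Th_closed: assumes g: "g:cP" shows "Th s g:cT"
proof -
	have sub: "{m. Th s g m ~= \<zero>L} \<subseteq> (%d. tr (%i. snd (d i))) ` {d. g d ~= \<zero>}"
	proof
		fix m assume m: "m:{m. Th s g m ~= \<zero>L}"
		then obtain a where a: "a:words" "m = tr a" unfolding Th_def Mon_def by (auto split: if_splits)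
		have "slice a g ~= \<zero>P" using m a pc_Lam by (auto simp: Th_tr tor_zero io_zero)
		then obtain d where "g d ~= \<zero>" "a = (%i. snd (d i))" by (rule slice_nonzero)
		then show "m:(%d. tr (%i. snd (d i))) ` {d. g d ~= \<zero>}" using a by blast
	qed
	have "Th s g m:cL" for m
		using io_closed[OF Lam_mult[OF tor_Lam[OF slice_closed[OF g]] pc_Lam]] by (simp add: Th_def)
	moreover have "{m. Th s g m ~= \<zero>L} \<subseteq> carrier BM" by (auto simp: Th_def split: if_splits)
	ultimately show ?thesis unfolding T_def T.carrier_S using finite_subset[OF sub] P.S_finite[OF g] by blast
qed

lemma Th_add: assumes "f:cP" "g:cP" shows "Th s (f \<oplus>P g) = Th s f \<oplus>T Th s g"
proof (rule T_eqI)
	interpret T': ring T by (rule T_ring)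
	show "Th s (f \<oplus>P g):cT" "Th s f \<oplus>T Th s g:cT"
		using Th_closed assms P.S.a_closed[OF assms] by auto
	fix a assume a: "a:words"
	have L: "tor (tws s a) (slice a f):Lam" "tor (tws s a) (slice a g):Lam" using tor_Lam slice_closed assms by auto
	have "tor (tws s a) (slice a (f \<oplus>P g)) \<otimes>P pc a = tor (tws s a) (slice a f) \<otimes>P pc a \<oplus>P tor (tws s a) (slice a g) \<otimes>P pc a"
		unfolding slice_add using Lam_P[OF slice_closed] assms pc_Lam L by (simp add: tor_add P.S.l_distr del: P.add_S)
	then show "Th s (f \<oplus>P g) (tr a) = (Th s f \<oplus>T Th s g) (tr a)"
		unfolding T_add Th_tr[OF a] using L Lam_mult pc_Lam by (simp add: io_add del: P.add_S)
qed

lemma Th_inj: assumes f: "f:cP" and g: "g:cP" and eq: "Th s f = Th s g" shows "f = g"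
proof
	fix d
	show "f d = g d"
	proof (cases "d:carrier (expo n)")
		case True
		define a where "a = (%i. snd (d i))"
		have a: "a:words" using True by (simp add: a_def words_def)
		have sl: "slice a f:Lam" "slice a g:Lam" using slice_closed f g by auto
		have L: "tor (tws s a) (slice a f):Lam" "tor (tws s a) (slice a g):Lam" using tor_Lam sl by auto
		have "io (tor (tws s a) (slice a f) \<otimes>P pc a) = io (tor (tws s a) (slice a g) \<otimes>P pc a)"
			using eq Th_tr[OF a, of s f] Th_tr[OF a, of s g] by simp
		then have "tor (tws s a) (slice a f) \<otimes>P pc a = tor (tws s a) (slice a g) \<otimes>P pc a"
			using io_eq Lam_mult L pc_Lam by simp
		then have "tor (tws s a) (slice a f) = tor (tws s a) (slice a g)"
			using P.m_rcancel[OF pc_nonzero Lam_P[OF pc_Lam] Lam_P[OF L(1)] Lam_P[OF L(2)]] by simp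
		then have "tor (- tws s a) (tor (tws s a) (slice a f)) = tor (- tws s a) (tor (tws s a) (slice a g))" by simp
		then have "slice a f = slice a g" using sl by (simp add: tor_comp tor_0)
		then have "slice a f (%i. (fst (d i), 0)) = slice a g (%i. (fst (d i), 0))" by simp
		then show ?thesis by (simp add: slice_def a_def)
	next
		case False
		then show ?thesis using P.S_out f g by metis
	qed
qed

lemma Th_smult:
	assumes c: "c:Lam" and g: "g:cP" shows "Th s (c \<otimes>P g) = sided_mult s T (emb (io c)) (Th s g)"
proof (rule T_eqI)
	show "Th s (c \<otimes>P g):cT" "sided_mult s T (emb (io c)) (Th s g):cT"
		using Th_closed sided_emb_closed io_closed c g by auto
	fix a assume a: "a:words"
	let ?t = "tor (tws s a)"
	have L: "?t c:Lam" "?t (slice a g):Lam" "slice a g:Lam" using tor_Lam slice_closed c g by auto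
	have "?t (slice a (c \<otimes>P g)) \<otimes>P pc a = (?t c \<otimes>P ?t (slice a g)) \<otimes>P pc a"
		using slice_mult[OF c g] rhm[OF tor_hom] c L by simp
	also have "... = ?t (slice a g) \<otimes>P pc a \<otimes>P ?t c"
		using L pc_Lam by (simp add: P.m_ac)
	finally show "Th s (c \<otimes>P g) (tr a) = sided_mult s T (emb (io c)) (Th s g) (tr a)"
		using L pc_Lam Lam_mult c by (simp add: Th_tr[OF a] sided_emb_tr[OF io_closed[OF c] Th_closed[OF g] a] io_mult tr_io)
qed

lemma Th_perm:
	assumes r: "r:Per" and g: "g:cP" shows "Th s (permP r g) = galois_act L Mon (gp r) (Th s g)"
proof (rule T_eqI)
	note p = Per_perm[OF r]
	show "Th s (permP r g):cT" "galois_act L Mon (gp r) (Th s g):cT"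
		using Th_closed[OF permP_closed[OF p g]] galois_act_closed[OF r Th_closed[OF g]] by auto
	fix a assume a: "a:words"
	have e: "tws s (a \<circ> r) \<circ> pinv r = tws s a" by (simp add: tws_def comp_assoc Per_o[OF r]) (auto simp: fun_eq_iff)
	have L: "slice (a \<circ> r) g:Lam" "tor (tws s (a \<circ> r)) (slice (a \<circ> r) g):Lam" using slice_closed[OF g] tor_Lam by auto
	have "gp r (Th s g (tr (a \<circ> r))) = io (permP r (tor (tws s (a \<circ> r)) (slice (a \<circ> r) g) \<otimes>P pc (a \<circ> r)))"
		using Th_tr[OF words_perm[OF a r]] gp_io[OF r] Lam_mult L pc_Lam by simp
	also have "permP r (tor (tws s (a \<circ> r)) (slice (a \<circ> r) g) \<otimes>P pc (a \<circ> r)) = tor (tws s a) (permP r (slice (a \<circ> r) g)) \<otimes>P pc a"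
		using rhm[OF permP_hom[OF p]] L pc_Lam permP_pc[OF r] tor_permP[OF p] e by simp
	finally have e2: "gp r (Th s g (tr (a \<circ> r))) = io (tor (tws s a) (permP r (slice (a \<circ> r) g)) \<otimes>P pc a)" .
	show "Th s (permP r g) (tr a) = galois_act L Mon (gp r) (Th s g) (tr a)"
		unfolding galois_act_tr[OF r a] Th_tr[OF a] slice_permP[OF p] e2 ..
qed

lemma Th_SI_iff: assumes g: "g:cP" shows "Th s g:SI \<longleftrightarrow> g:Inv"
proof -
	have "Th s g:SI \<longleftrightarrow> (\<forall>r\<in>Per. galois_act L Mon (gp r) (Th s g) = Th s g)"
		using Th_closed[OF g] unfolding skew_inv_def aut_over_K by auto
	also have "... \<longleftrightarrow> (\<forall>r\<in>Per. permP r g = g)"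
		using Th_perm[OF _ g] Th_inj[OF permP_closed[OF Per_perm g] g] by metis
	also have "... \<longleftrightarrow> g:Inv" using InvI[OF g] Inv_perm[of g] unfolding Per_def by blast
	finally show ?thesis .
qed

text \<open>The coefficient of a scaling \<open>a\<close> in the image is a multiple of \<open>pc a\<close>, and this divisibility is the only condition.\<close>

lemma Th_surj:
	assumes f: "f:cT" and v: "!!a. a:words ==> \<exists>u\<in>Lam. f (tr a) = io (u \<otimes>P pc a)"
	obtains g where "g:cP" "Th s g = f"
proof -
	obtain u where u: "!!a. a:words ==> u a:Lam & f (tr a) = io (u a \<otimes>P pc a)" using v by metis
	define A where "A = {a:words. f (tr a) ~= \<zero>L}"
	have fin: "finite A"
	proof (rule finite_imageD)
		have "tr ` A \<subseteq> {m. f m ~= \<zero>L}" by (auto simp: A_def)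
		then show "finite (tr ` A)" using f T.S_finite finite_subset unfolding T_def by blast
		show "inj_on tr A" by (auto simp: A_def intro: inj_onI tr_inj)
	qed
	define t where "t a = single \<one> (%i. (0, a i))" for a :: "nat => int"
	define w where "w a = tor (- tws s a) (u a)" for a
	have w: "w a:Lam" if "a:A" for a using u that tor_Lam by (auto simp: w_def A_def)
	have t: "t a:cP" if "a:A" for a
		unfolding t_def by (rule P.single_closed) (use that in \<open>auto simp: A_def words_def zero_prod_def\<close>)
	define g where "g = (\<Oplus>\<^bsub>P\<^esub>a\<in>A. w a \<otimes>P t a)"
	have cl: "(%a. w a \<otimes>P t a):A \<rightarrow> cP" using w t by auto
	have g: "g:cP" unfolding g_def by (rule P.S.finsum_closed[OF cl])
	have sl: "slice b g = (if b:A then w b else \<zero>P)" for b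
	proof -
		have "slice b g = (\<Oplus>\<^bsub>P\<^esub>a\<in>A. slice b (w a \<otimes>P t a))"
			unfolding g_def
			by (rule P.S.additive_finsum[OF P.S.abelian_monoid_axioms _ _ slice_add cl])
				(auto simp: slice_closed, simp add: slice_def P.zero_S)
		also have "... = (\<Oplus>\<^bsub>P\<^esub>a\<in>A. if b = a then w a else \<zero>P)"
		proof (rule P.S.finsum_cong')
			fix a assume a: "a:A"
			have "slice b (t a) = (if b = a then \<one>P else \<zero>P)"
				unfolding t_def slice_single by (auto simp: P.one_S zero_fun_def zero_prod_def)
			then show "slice b (w a \<otimes>P t a) = (if b = a then w a else \<zero>P)"
				using slice_mult[OF w[OF a] t[OF a]] w[OF a] by simp
		qed (use w in auto)
		also have "... = (if b:A then w b else \<zero>P)"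
		proof (cases "b:A")
			case True
			then show ?thesis using P.S.finsum_singleton[OF True fin, of w] w by auto
		next
			case False
			then have "(\<Oplus>\<^bsub>P\<^esub>a\<in>A. if b = a then w a else \<zero>P) = (\<Oplus>\<^bsub>P\<^esub>a\<in>A. \<zero>P)" by (intro P.S.finsum_cong') auto
			then show ?thesis using False by simp
		qed
		finally show ?thesis .
	qed
	have "Th s g = f"
	proof (rule T_eqI[OF Th_closed[OF g] f])
		fix a assume a: "a:words"
		show "Th s g (tr a) = f (tr a)"
		proof (cases "a:A")
			case True
			have "tor (tws s a) (w a) = u a" using u[OF a] by (simp add: w_def tor_comp tor_0)
			then show ?thesis using True u[OF a] by (simp add: Th_tr[OF a] sl)
		next
			case False
			then show ?thesis using a pc_Lam by (simp add: Th_tr[OF a] sl tor_zero io_zero A_def)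
		qed
	qed
	then show ?thesis using that g by blast
qed

lemma Th_value: "g:cP ==> a:words ==> \<exists>u\<in>Lam. Th s g (tr a) = io (u \<otimes>P pc a)"
	using Th_tr tor_Lam slice_closed by blast

definition U :: "(('l => 'l) => 'l) set" where "U = Th False ` Inv"

lemma U_iff: "f:U \<longleftrightarrow> f:SI & (\<forall>a\<in>words. \<exists>u\<in>Lam. f (tr a) = io (u \<otimes>P pc a))"
proof
	assume "f:U"
	then show "f:SI & (\<forall>a\<in>words. \<exists>u\<in>Lam. f (tr a) = io (u \<otimes>P pc a))"
		using Th_SI_iff Th_value unfolding U_def by auto
next
	assume f: "f:SI & (\<forall>a\<in>words. \<exists>u\<in>Lam. f (tr a) = io (u \<otimes>P pc a))"
	then obtain g where g: "g:cP" "Th False g = f" using Th_surj[of f False] SI_closed by blast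
	then have "g:Inv" using f Th_SI_iff by blast
	then show "f:U" using g unfolding U_def by blast
qed

text \<open>The condition in \<open>U_iff\<close> does not depend on the side.\<close>

lemma U_Th: "U = Th s ` Inv"
proof (intro equalityI subsetI)
	fix f assume f: "f:U"
	then obtain g where g: "g:cP" "Th s g = f" using Th_surj[of f s] SI_closed U_iff by blast
	then have "g:Inv" using f U_iff Th_SI_iff by blast
	then show "f:Th s ` Inv" using g by blast
next
	fix f assume "f:Th s ` Inv"
	then show "f:U" using Th_SI_iff Th_value unfolding U_iff by auto
qed

lemma common_denominator:
	assumes f: "f:cT"
	obtains c where "c:Gam" "c ~= \<zero>P" "!!a. a:words ==> \<exists>u\<in>Lam. f (tr a) \<otimes>L io (tor (tws s a) c) = io (u \<otimes>P pc a)"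
proof -
	define A where "A = {a:words. f (tr a) ~= \<zero>L}"
	have fin: "finite A"
	proof (rule finite_imageD)
		have "tr ` A \<subseteq> {m. f m ~= \<zero>L}" by (auto simp: A_def)
		then show "finite (tr ` A)" using f T.S_finite finite_subset unfolding T_def by blast
		show "inj_on tr A" by (auto simp: A_def intro: inj_onI tr_inj)
	qed
	have "\<exists>d\<in>Lam. d ~= \<zero>P & (\<forall>a\<in>B. \<exists>u\<in>Lam. f (tr a) \<otimes>L io (tor (tws s a) d) = io (u \<otimes>P pc a))" if "finite B" "B \<subseteq> A" for B
		using that
	proof (induction B)
		case empty
		then show ?case using Lam_one by (intro bexI[of _ "\<one>P"]) auto
	next
		case (insert b B)
		obtain d where d: "d:Lam" "d ~= \<zero>P" "\<forall>a\<in>B. \<exists>u\<in>Lam. f (tr a) \<otimes>L io (tor (tws s a) d) = io (u \<otimes>P pc a)"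
			using insert by blast
		obtain x y where xy: "x:Lam" "y:Lam" "y ~= \<zero>P" "f (tr b) = io x \<otimes>L inv\<^bsub>L\<^esub> io y" using io_frac[OF T_closed[OF f]] .
		note yy = F.L.nz_inv[OF io_nonzero[OF xy(2,3)]]
		define e where "e = tor (- tws s b) (y \<otimes>P pc b)"
		have ypc: "y \<otimes>P pc b:Lam" "y \<otimes>P pc b ~= \<zero>P" using Lam_mult Lam_nonzero_mult xy pc_Lam pc_nonzero by auto
		have te: "tor (tws s b) e = y \<otimes>P pc b" using ypc(1) by (simp add: e_def tor_comp tor_0)
		have e: "e:Lam" "e ~= \<zero>P" using tor_Lam[OF ypc(1)] te tor_zero ypc(2) by (auto simp: e_def)
		have tm: "tor c (d \<otimes>P e) = tor c d \<otimes>P tor c e" for c using rhm[OF tor_hom] d e by simp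
		have "\<exists>u\<in>Lam. f (tr a) \<otimes>L io (tor (tws s a) (d \<otimes>P e)) = io (u \<otimes>P pc a)" if a: "a:insert b B" for a
		proof (cases "a = b")
			case True
			let ?u = "x \<otimes>P tor (tws s b) d"
			have td: "tor (tws s b) d:Lam" by (rule tor_Lam[OF d(1)])
			have "f (tr b) \<otimes>L io (tor (tws s b) (d \<otimes>P e)) = (io x \<otimes>L inv\<^bsub>L\<^esub> io y) \<otimes>L (io (tor (tws s b) d) \<otimes>L (io y \<otimes>L io (pc b)))"
				unfolding xy(4) tm te using td xy pc_Lam Lam_mult by (simp add: io_mult)
			also have "... = (inv\<^bsub>L\<^esub> io y \<otimes>L io y) \<otimes>L (io x \<otimes>L io (tor (tws s b) d) \<otimes>L io (pc b))"
				using yy(1) io_closed td xy(1,2) pc_Lam by (simp add: F.L.m_ac)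
			also have "... = io (?u \<otimes>P pc b)"
				unfolding yy(2) using io_closed td xy(1) pc_Lam Lam_mult by (simp add: io_mult)
			finally show ?thesis using True Lam_mult[OF xy(1) td] by blast
		next
			case False
			then obtain u where u: "u:Lam" "f (tr a) \<otimes>L io (tor (tws s a) d) = io (u \<otimes>P pc a)" using d(3) a by blast
			have te': "tor (tws s a) e:Lam" "tor (tws s a) d:Lam" using tor_Lam e d by auto
			have "f (tr a) \<otimes>L io (tor (tws s a) (d \<otimes>P e)) = io (u \<otimes>P pc a) \<otimes>L io (tor (tws s a) e)"
				unfolding tm using te' io_closed T_closed[OF f] u(2) by (simp add: io_mult F.L.m_assoc[symmetric])
			also have "... = io (u \<otimes>P tor (tws s a) e \<otimes>P pc a)"
				using te' u(1) pc_Lam Lam_mult io_closed by (simp add: io_mult F.L.m_ac)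
			finally show ?thesis using Lam_mult[OF u(1) te'(1)] by blast
		qed
		then show ?case using Lam_mult[OF d(1) e(1)] Lam_nonzero_mult[OF d(1) e(1) d(2) e(2)] by blast
	qed
	then obtain d where d: "d:Lam" "d ~= \<zero>P" "\<forall>a\<in>A. \<exists>u\<in>Lam. f (tr a) \<otimes>L io (tor (tws s a) d) = io (u \<otimes>P pc a)"
		using fin by blast
	obtain b where b: "b:Lam" "d \<otimes>P b:Gam" "d \<otimes>P b ~= \<zero>P" using norm_exists[OF d(1,2)] .
	have "\<exists>u\<in>Lam. f (tr a) \<otimes>L io (tor (tws s a) (d \<otimes>P b)) = io (u \<otimes>P pc a)" if a: "a:words" for a
	proof (cases "a:A")
		case True
		then obtain u where u: "u:Lam" "f (tr a) \<otimes>L io (tor (tws s a) d) = io (u \<otimes>P pc a)" using d(3) by blast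
		have tb: "tor (tws s a) b:Lam" "tor (tws s a) d:Lam" using tor_Lam b d by auto
		have "f (tr a) \<otimes>L io (tor (tws s a) (d \<otimes>P b)) = io (u \<otimes>P pc a) \<otimes>L io (tor (tws s a) b)"
			using rhm[OF tor_hom Lam_P[OF d(1)] Lam_P[OF b(1)]] tb io_closed T_closed[OF f] u(2)
			by (simp add: io_mult F.L.m_assoc[symmetric])
		also have "... = io (u \<otimes>P tor (tws s a) b \<otimes>P pc a)"
			using tb u(1) pc_Lam Lam_mult io_closed by (simp add: io_mult F.L.m_ac)
		finally show ?thesis using Lam_mult[OF u(1) tb(1)] by blast
	next
		case False
		then have "f (tr a) = \<zero>L" using a by (simp add: A_def)
		moreover have "io (tor (tws s a) (d \<otimes>P b)):cL" using io_closed tor_Lam Lam_mult d b by blast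
		moreover have "\<zero>P \<otimes>P pc a = \<zero>P" using pc_Lam by simp
		ultimately show ?thesis using Lam_zero io_zero by (intro bexI[of _ "\<zero>P"]) simp_all
	qed
	then show ?thesis using that b by blast
qed

lemma SI_localized: assumes f: "f:SI" obtains c g where "c:Gam" "c ~= \<zero>P" "g:U" "f = sided_mult s T (emb (inv\<^bsub>L\<^esub> io c)) g"
proof -
	interpret T': ring T by (rule T_ring)
	have fT: "f:cT" by (rule SI_closed[OF f])
	obtain c where c: "c:Gam" "c ~= \<zero>P" "!!a. a:words ==> \<exists>u\<in>Lam. f (tr a) \<otimes>L io (tor (tws s a) c) = io (u \<otimes>P pc a)"
		using common_denominator[OF fT, where s = s] by blast
	note cL = io_closed[OF Gam_Lam[OF c(1)]] and ci = F.L.nz_inv[OF io_nonzero[OF Gam_Lam[OF c(1)] c(2)]]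
	define g where "g = sided_mult s T (emb (io c)) f"
	have "g:SI" unfolding g_def by (rule SI_sided_mult[OF Gam_K[OF c(1)] f])
	moreover have "g (tr a) = f (tr a) \<otimes>L io (tor (tws s a) c)" if "a:words" for a
		unfolding g_def using sided_emb_tr[OF cL fT that] tr_io[OF Gam_Lam[OF c(1)]] by simp
	ultimately have g: "g:U" unfolding U_iff using c(3) by simp
	have "emb (inv\<^bsub>L\<^esub> io c) \<otimes>T emb (io c) = \<one>T" "emb (io c) \<otimes>T emb (inv\<^bsub>L\<^esub> io c) = \<one>T"
		using rhm[OF emb_hom] rh1[OF emb_hom] cL ci by metis+
	then have "f = sided_mult s T (emb (inv\<^bsub>L\<^esub> io c)) g"
		unfolding g_def sided_mult_def using fT emb_closed[OF cL] emb_closed[OF ci(1)]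
		by (auto simp: T'.m_assoc) (simp_all add: T'.m_assoc[symmetric])
	then show ?thesis using that c g by blast
qed

lemma prod_spans: "prod_span T (emb ` K) U = SI" "prod_span T U (emb ` K) = SI"
proof -
	interpret T': ring T by (rule T_ring)
	have sub: "subgroup SI (add_monoid T)"
	proof (rule group.subgroupI[OF T'.a_group])
		show "SI \<subseteq> carrier (add_monoid T)" using SI_closed by auto
		show "SI ~= {}" using SI_subgroup(1) by blast
		show "inv\<^bsub>add_monoid T\<^esub> f:SI" if "f:SI" for f using SI_subgroup(3)[OF that] unfolding a_inv_def .
		show "f \<otimes>\<^bsub>add_monoid T\<^esub> g:SI" if "f:SI" "g:SI" for f g using SI_subgroup(2)[OF that] by simp
	qed
	have US: "U \<subseteq> SI" using U_iff by blast
	have m: "emb x \<otimes>T u:SI" "u \<otimes>T emb x:SI" if "x:K" "u:U" for x u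
		using SI_sided_mult[OF that(1), of u False] SI_sided_mult[OF that(1), of u True] US that(2) by (auto simp: sided_mult_def)
	have iK: "inv\<^bsub>L\<^esub> io c:K" if "c:Gam" "c ~= \<zero>P" for c
		using F.L.subfield_m_inv(1)[OF K_subfield, of "io c"] Gam_K[OF that(1)] io_nonzero[OF Gam_Lam[OF that(1)] that(2)] by blast
	show "prod_span T (emb ` K) U = SI"
	proof (intro equalityI subsetI)
		fix x assume "x:prod_span T (emb ` K) U"
		moreover have "(emb ` K) <#>\<^bsub>T\<^esub> U \<subseteq> SI" using m by (auto simp: set_mult_def)
		ultimately show "x:SI" unfolding prod_span_def using group.generate_subgroup_incl[OF T'.a_group _ sub] by blast
	next
		fix f assume "f:SI"
		then obtain c g where cg: "c:Gam" "c ~= \<zero>P" "g:U" "f = sided_mult False T (emb (inv\<^bsub>L\<^esub> io c)) g" by (rule SI_localized)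
		then have "f:(emb ` K) <#>\<^bsub>T\<^esub> U" using iK unfolding set_mult_def sided_mult_def by auto
		then show "f:prod_span T (emb ` K) U" unfolding prod_span_def by (rule generate.incl)
	qed
	show "prod_span T U (emb ` K) = SI"
	proof (intro equalityI subsetI)
		fix x assume "x:prod_span T U (emb ` K)"
		moreover have "U <#>\<^bsub>T\<^esub> (emb ` K) \<subseteq> SI" using m by (auto simp: set_mult_def)
		ultimately show "x:SI" unfolding prod_span_def using group.generate_subgroup_incl[OF T'.a_group _ sub] by blast
	next
		fix f assume "f:SI"
		then obtain c g where cg: "c:Gam" "c ~= \<zero>P" "g:U" "f = sided_mult True T (emb (inv\<^bsub>L\<^esub> io c)) g" by (rule SI_localized)
		then have "f:U <#>\<^bsub>T\<^esub> (emb ` K)" using iK unfolding set_mult_def sided_mult_def by auto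
		then show "f:prod_span T U (emb ` K)" unfolding prod_span_def by (rule generate.incl)
	qed
qed

lemma emb_Gam_cring: "cring (T\<lparr>carrier := emb ` io ` Gam\<rparr>)"
proof -
	interpret T': ring T by (rule T_ring)
	interpret H: ring_hom_ring L T emb by (rule ring_hom_ringI2[OF F.L.ring_axioms T_ring emb_hom])
	have s: "subring (io ` Gam) L" by (rule subcring.axioms(1)[OF subdomain.axioms(1)[OF Gam_subdomain]])
	have "subring (emb ` io ` Gam) T" by (rule H.img_is_subring[OF s])
	moreover have "x \<otimes>T y = y \<otimes>T x" if xy: "x:emb ` io ` Gam" "y:emb ` io ` Gam" for x y
	proof -
		obtain a b where ab: "a:Gam" "b:Gam" "x = emb (io a)" "y = emb (io b)" using xy by blast
		have "io a:cL" "io b:cL" using ab io_closed by auto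
		then show ?thesis unfolding ab(3,4) using rhm[OF emb_hom] F.L.m_comm by metis
	qed
	ultimately have "subcring (emb ` io ` Gam) T" by (rule T'.subcringI)
	then show ?thesis using T'.subcring_iff subcringE(1) by blast
qed

lemma emb_io_zero: "c:Gam ==> emb (io c) = \<zero>T \<longleftrightarrow> c = \<zero>P"
proof -
	assume c: "c:Gam"
	have "emb \<zero>L = \<zero>T" by (rule rh0[OF emb_hom F.L.ring_axioms T_ring])
	then show ?thesis using emb_inj[of "io c" "\<zero>L"] io_eq[OF Gam_Lam[OF c] Lam_zero] io_zero by metis
qed

text \<open>A finite-dimensional \<open>W\<close> meets only finitely many scalings, so its intersection with \<open>U\<close> comes from elements of \<open>P\<close> of bounded Laurent degree.\<close>

lemma order_condition:
	assumes W: "W \<subseteq> SI" and fd: "fin_dim_space (T\<lparr>carrier := emb ` K\<rparr>) (sided_module s T W)"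
	shows "fg_module (T\<lparr>carrier := emb ` io ` Gam\<rparr>) (sided_module s T (W \<inter> U))"
proof -
	interpret T': ring T by (rule T_ring)
	let ?V = "sided_module s T W" and ?KE = "T\<lparr>carrier := emb ` K\<rparr>"
	have WT: "f:cT" if "f:W" for f using that W SI_closed by blast
	obtain B where mod: "module ?KE ?V" and B: "finite B" "B \<subseteq> W" "module_span ?KE ?V B = W"
		using fd unfolding fin_dim_space_def module_basis_def by auto
	interpret V: module ?KE ?V by (rule mod)
	have W_add: "f \<oplus>T g:W" if "f:W" "g:W" for f g using V.M.a_closed[of f g] that by simp
	have W_zero: "\<zero>T:W" using V.M.zero_closed by simp
	have W_smult: "sided_mult s T (emb x) f:W" if "x:K" "f:W" for x f using V.smult_closed[of "emb x" f] that by simp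
	have W_neg: "\<ominus>T f:W" if f: "f:W" for f
	proof -
		have g: "\<ominus>\<^bsub>?V\<^esub> f:W" "\<ominus>\<^bsub>?V\<^esub> f \<oplus>T f = \<zero>T" using V.M.a_inv_closed[of f] V.M.l_neg[of f] f by simp_all
		have "\<ominus>T f = \<ominus>\<^bsub>?V\<^esub> f" by (rule T'.minus_equality[OF g(2) WT[OF f] WT[OF g(1)]])
		then show ?thesis using g(1) by simp
	qed
	have suppW: "\<exists>b\<in>B. b (tr a) ~= \<zero>L" if f: "f:W" and a: "a:words" "f (tr a) ~= \<zero>L" for f a
	proof (rule ccontr)
		assume no: "\<not> (\<exists>b\<in>B. b (tr a) ~= \<zero>L)"
		have "f:module_span ?KE ?V B" using f B(3) by simp
		then obtain S c where S': "finite S" "S \<subseteq> B" "c:S \<rightarrow> carrier ?KE" "f = (\<Oplus>\<^bsub>?V\<^esub>v\<in>S. c v \<odot>\<^bsub>?V\<^esub> v)"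
			unfolding module_span_def by blast
		have cK: "c:S \<rightarrow> emb ` K" using S'(3) by simp
		note S = S'(1,2) cK S'(4)
		have term_cl: "c v \<odot>\<^bsub>?V\<^esub> v:W" if "v:S" for v using S B(2) that V.smult_closed[of "c v" v] by auto
		have "(%h. h (tr a)) (\<Oplus>\<^bsub>?V\<^esub>v\<in>S. c v \<odot>\<^bsub>?V\<^esub> v) = (\<Oplus>\<^bsub>L\<^esub>v\<in>S. (c v \<odot>\<^bsub>?V\<^esub> v) (tr a))"
			by (rule V.M.additive_finsum[OF F.L.abelian_monoid_axioms]) (use WT T_closed term_cl in \<open>auto simp: T_zero T_add\<close>)
		also have "... = (\<Oplus>\<^bsub>L\<^esub>v\<in>S. \<zero>L)"
		proof (rule F.L.finsum_cong')
			fix v assume v: "v:S"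
			obtain x where x: "x:K" "c v = emb x" using S(3) v by blast
			have vW: "v:W" "v (tr a) = \<zero>L" using v S(2) B(2) no by auto
			show "(c v \<odot>\<^bsub>?V\<^esub> v) (tr a) = \<zero>L"
				using x K_sub vW sided_emb_tr[of x v a s] WT a(1) tr_closed by (simp add: subset_iff)
		qed auto
		finally show False using a(2) S(4) by simp
	qed
	define A where "A = {a:words. \<exists>b\<in>B. b (tr a) ~= \<zero>L}"
	have finA: "finite A"
	proof (rule finite_imageD)
		have "tr ` A \<subseteq> (\<Union>b\<in>B. {m. b m ~= \<zero>L})" by (auto simp: A_def)
		moreover have "finite (\<Union>b\<in>B. {m. b m ~= \<zero>L})"
			using B(1,2) WT T.S_finite unfolding T_def by blast
		ultimately show "finite (tr ` A)" by (rule finite_subset)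
		show "inj_on tr A" by (auto simp: A_def intro: inj_onI tr_inj)
	qed
	define N where "N = Max (insert 0 ((%(a, i). \<bar>a i\<bar>) ` (A \<times> {..<n})))"
	have N: "\<bar>a i\<bar> \<le> N" if "a:A" for a i
	proof -
		have fin: "finite (insert 0 ((%(a, i). \<bar>a i\<bar>) ` (A \<times> {..<n})))" using finA by simp
		show ?thesis
		proof (cases "i < n")
			case True
			then show ?thesis unfolding N_def using that by (intro Max_ge[OF fin]) auto
		next
			case False
			then have "a i = 0" using that by (simp add: A_def words_def)
			then show ?thesis unfolding N_def using Max_ge[OF fin, of 0] by simp
		qed
	qed
	define Y where "Y = {g:Inv. Th s g:W}"
	have Thz: "Th s \<zero>P = \<zero>T"
		using Th_add[of "\<zero>P" "\<zero>P" s] Th_closed[of "\<zero>P" s] T'.add.r_cancel_one by (metis P.S.l_zero P.S.zero_closed)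
	have Y0: "\<zero>P:Y" using Thz W_zero subringE(2)[OF Inv_subring] by (simp add: Y_def)
	have Yadd: "f \<oplus>P g:Y" if "f:Y" "g:Y" for f g
		using that Th_add[of f g s] W_add subringE(7)[OF Inv_subring] by (auto simp: Y_def simp del: P.add_S)
	have Ysmult: "c \<otimes>P f:Y" if "c:Gam" "f:Y" for c f
		using that Th_smult[of c f s] W_smult[OF Gam_K] Gam_Inv_mult by (auto simp: Y_def)
	have YB: "Y \<subseteq> Bdd N"
	proof
		fix g assume g: "g:Y"
		then have gP: "g:cP" by (simp add: Y_def)
		have "\<bar>snd (d i)\<bar> \<le> N" if d: "g d ~= \<zero>" for d i
		proof -
			define a where "a = (%i. snd (d i))"
			have aw: "a:words" using d P.S_supp[OF gP] by (auto simp: a_def words_def)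
			have "slice a g (%i. (fst (d i), 0)) ~= \<zero>" using d by (simp add: slice_def a_def)
			then have s0: "slice a g ~= \<zero>P" by (auto simp: P.zero_S)
			have sl: "slice a g:Lam" by (rule slice_closed[OF gP])
			have "tor (tws s a) (slice a g) ~= \<zero>P"
			proof
				assume "tor (tws s a) (slice a g) = \<zero>P"
				then have "tor (- tws s a) (tor (tws s a) (slice a g)) = \<zero>P" by (simp add: tor_zero)
				then show False using s0 sl by (simp add: tor_comp tor_0)
			qed
			then have "Th s g (tr a) ~= \<zero>L"
				unfolding Th_tr[OF aw] using io_nonzero[OF Lam_mult Lam_nonzero_mult] tor_Lam[OF sl] pc_Lam pc_nonzero by blast
			then have "a:A" using suppW[of "Th s g" a] g aw by (auto simp: Y_def A_def)
			then have "\<bar>a i\<bar> \<le> N" by (rule N)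
			then show ?thesis by (simp add: a_def)
		qed
		then show "g:Bdd N" using gP by (simp add: Bdd_def)
	qed
	have YI: "Y \<subseteq> Inv" by (auto simp: Y_def)
	have YP: "g:cP" if "g:Y" for g using that by (simp add: Y_def)
	obtain B' where B': "finite B'" "B' \<subseteq> Y" "module_span PGam (left_module P Y) B' = Y"
		using fg_submodule[OF YI YB Y0 Yadd Ysmult] by blast
	have Yneg: "\<ominus>P f:Y" if "f:Y" for f
	proof -
		have "const (\<ominus> \<one>) \<otimes>P f = \<ominus>P f" using YP[OF that] by (subst const_mult) (auto simp: P_neg l_minus)
		then show ?thesis using Ysmult[OF const_Gam[of "\<ominus> \<one>"] that] by simp
	qed
	have modY: "module PGam (left_module P Y)"
		by (rule P.S.left_module_module) (use YP Y0 Yadd Yneg Ysmult PGam_cring in auto)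
	have img: "Th s ` Y = W \<inter> U" unfolding U_Th[of s] Y_def by auto
	have modWU: "module (T\<lparr>carrier := emb ` io ` Gam\<rparr>) (sided_module s T (W \<inter> U))"
	proof (rule T'.sided_module_module[OF _ _ _ _ _ emb_Gam_cring])
		show "W \<inter> U \<subseteq> cT" using WT by blast
		show "\<zero>T:W \<inter> U" unfolding img[symmetric] using Thz Y0 by force
		show "x \<oplus>T y:W \<inter> U" if "x:W \<inter> U" "y:W \<inter> U" for x y
		proof -
			obtain f g where fg: "f:Y" "g:Y" "x = Th s f" "y = Th s g" using \<open>x:W \<inter> U\<close> \<open>y:W \<inter> U\<close> unfolding img[symmetric] by blast
			then have "x \<oplus>T y = Th s (f \<oplus>P g)" using Th_add YP by simp
			then show ?thesis unfolding img[symmetric] using Yadd[OF fg(1,2)] by blast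
		qed
		show "\<ominus>T x:W \<inter> U" if xW: "x:W \<inter> U" for x
		proof -
			obtain f where f: "f:Y" "x = Th s f" using xW unfolding img[symmetric] by blast
			have nP: "\<ominus>P f:cP" "f:cP" using YP[OF f(1)] by auto
			have "Th s (\<ominus>P f) \<oplus>T x = \<zero>T" unfolding f(2) Th_add[OF nP, symmetric] P.S.l_neg[OF nP(2)] by (rule Thz)
			then have "\<ominus>T x = Th s (\<ominus>P f)" using T'.minus_equality Th_closed nP f(2) by metis
			then show ?thesis unfolding img[symmetric] using Yneg[OF f(1)] by blast
		qed
		show "emb ` io ` Gam \<subseteq> cT" using emb_closed io_closed by auto
		show "sided_mult s T g x:W \<inter> U" if "g:emb ` io ` Gam" "x:W \<inter> U" for g x
		proof -
			obtain c where c: "c:Gam" "g = emb (io c)" using \<open>g:emb ` io ` Gam\<close> by blast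
			obtain f where f: "f:Y" "x = Th s f" using \<open>x:W \<inter> U\<close> unfolding img[symmetric] by blast
			have "sided_mult s T g x = Th s (c \<otimes>P f)" using c f Th_smult YP by simp
			then show ?thesis unfolding img[symmetric] using Ysmult[OF c(1) f(1)] by blast
		qed
	qed
	have "module_span (T\<lparr>carrier := emb ` io ` Gam\<rparr>) (sided_module s T (W \<inter> U)) (Th s ` B') = Th s ` module_span PGam (left_module P Y) B'"
	proof (rule semilinear_span_basis(1)[OF modY modWU])
		show "inj_on (Th s) (carrier (left_module P Y))" using Th_inj YP by (auto intro!: inj_onI)
		show "(%c. emb (io c)) ` carrier PGam = carrier (T\<lparr>carrier := emb ` io ` Gam\<rparr>)" by auto
	qed (use img Thz Th_add YP Th_smult emb_io_zero B'(2) in \<open>auto simp del: P.add_S\<close>)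
	then have "module_span (T\<lparr>carrier := emb ` io ` Gam\<rparr>) (sided_module s T (W \<inter> U)) (Th s ` B') = W \<inter> U"
		using B'(3) img by simp
	moreover have "Th s ` B' \<subseteq> W \<inter> U" using B'(2) img by blast
	ultimately show ?thesis
		unfolding fg_module_def using modWU B'(1) by (intro conjI exI[of _ "Th s ` B'"]) auto
qed

end

section \<open>Quotient rings and additive closures\<close>

lemma (in ring) genideal_le_kernel:
	assumes S: "ring S" and h: "h:ring_hom R S" and G: "G \<subseteq> carrier R" "!!g. g:G ==> h g = \<zero>\<^bsub>S\<^esub>" and x: "x:Idl G"
	shows "h x = \<zero>\<^bsub>S\<^esub>"
proof -
	interpret H: ring_hom_ring R S h by (rule ring_hom_ringI2[OF ring_axioms S h])
	have "Idl G \<subseteq> a_kernel R S h"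
		by (rule genideal_minimal[OF H.kernel_is_ideal]) (unfold a_kernel_def', use G in blast)
	then have "x:a_kernel R S h" using x by blast
	then show ?thesis unfolding a_kernel_def' by blast
qed

lemma (in ring) quotient_hom:
	assumes I: "ideal I R" and S: "ring S" and h: "h:ring_hom R S" and k: "!!x. x:I ==> h x = \<zero>\<^bsub>S\<^esub>"
	obtains g where "g:ring_hom (R Quot I) S" "!!a. a:carrier R ==> g (I +> a) = h a"
proof -
	interpret S: ring S by fact
	interpret I: ideal I R by fact
	interpret H: ring_hom_ring R S h by (rule ring_hom_ringI2[OF ring_axioms S h])
	have eq: "h a = h b" if "a:carrier R" "b:carrier R" "I +> a = I +> b" for a b
	proof -
		have "a \<ominus> b:I" using quotient_eq_iff_same_a_r_cos[OF I that(1,2)] that(3) by simp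
		then have "h (a \<ominus> b) = \<zero>\<^bsub>S\<^esub>" by (rule k)
		then have "h a \<ominus>\<^bsub>S\<^esub> h b = \<zero>\<^bsub>S\<^esub>" using that by (simp add: a_minus_def)
		then show ?thesis using that by (simp add: S.r_right_minus_eq)
	qed
	define g where "g A = h (SOME a. a:carrier R & A = I +> a)" for A
	have g: "g (I +> a) = h a" if a: "a:carrier R" for a
	proof -
		have "(SOME b. b:carrier R & I +> a = I +> b):carrier R & I +> a = I +> (SOME b. b:carrier R & I +> a = I +> b)"
			by (rule someI[of _ a]) (simp add: a)
		then show ?thesis unfolding g_def using eq[of _ a] a by metis
	qed
	have c: "A:carrier (R Quot I) \<longleftrightarrow> (\<exists>a\<in>carrier R. A = I +> a)" for A
		by (auto simp: FactRing_def A_RCOSETS_def')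
	note q = rhm[OF I.rcos_ring_hom] rha[OF I.rcos_ring_hom] rh1[OF I.rcos_ring_hom]
	have "g:ring_hom (R Quot I) S"
	proof (rule ring_hom_memI)
		fix A assume "A:carrier (R Quot I)"
		then obtain a where a: "a:carrier R" "A = I +> a" using c by blast
		then show "g A:carrier S" by (simp add: g)
		fix B assume "B:carrier (R Quot I)"
		then obtain b where b: "b:carrier R" "B = I +> b" using c by blast
		show "g (A \<otimes>\<^bsub>R Quot I\<^esub> B) = g A \<otimes>\<^bsub>S\<^esub> g B" unfolding a(2) b(2) q(1)[OF a(1) b(1), symmetric] using a b by (simp add: g)
		show "g (A \<oplus>\<^bsub>R Quot I\<^esub> B) = g A \<oplus>\<^bsub>S\<^esub> g B" unfolding a(2) b(2) q(2)[OF a(1) b(1), symmetric] using a b by (simp add: g)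
	next
		show "g \<one>\<^bsub>R Quot I\<^esub> = \<one>\<^bsub>S\<^esub>" unfolding q(3)[symmetric] by (simp add: g)
	qed
	then show ?thesis using that g by blast
qed

lemma (in ring) quotient_zero: "ideal I R ==> x:I ==> I +> x = \<zero>\<^bsub>R Quot I\<^esub>"
proof -
	assume "ideal I R" "x:I"
	then interpret I: ideal I R by simp
	show ?thesis using I.a_rcos_const[OF \<open>x:I\<close>] by (simp add: FactRing_def)
qed

inductive_set add_closure :: "('a, 'r) ring_scheme => 'a set => 'a set" for R and G where
	zero: "\<zero>\<^bsub>R\<^esub>:add_closure R G"
| add: "g:G ==> x:add_closure R G ==> g \<oplus>\<^bsub>R\<^esub> x:add_closure R G"

context abelian_monoid
begin

lemma add_closure_closed: "H \<subseteq> carrier G ==> x:add_closure G H ==> x:carrier G"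
	by (rotate_tac, induction rule: add_closure.induct) auto

lemma add_closure_base: "H \<subseteq> carrier G ==> g:H ==> g:add_closure G H"
	using add_closure.add[OF _ add_closure.zero, of g H G] by (auto simp: subset_iff)

lemma add_closure_add:
	assumes H: "H \<subseteq> carrier G" and x: "x:add_closure G H" and y: "y:add_closure G H" shows "x \<oplus> y:add_closure G H"
	using x
proof (induction rule: add_closure.induct)
	case zero
	show ?case using y add_closure_closed[OF H y] by simp
next
	case (add g x)
	have "g:carrier G" "x:carrier G" "y:carrier G" using add add_closure_closed[OF H] y H by auto
	then show ?case using add_closure.add[OF add(1) add(3)] by (simp add: a_assoc)
qed

lemma add_closure_map:
	assumes H: "H \<subseteq> carrier G" "H' \<subseteq> carrier G'" and G': "abelian_monoid G'"
		and F: "F \<zero> = \<zero>\<^bsub>G'\<^esub>" "!!x y. x:carrier G ==> y:carrier G ==> F (x \<oplus> y) = F x \<oplus>\<^bsub>G'\<^esub> F y"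
			"!!g. g:H ==> F g:add_closure G' H'"
		and x: "x:add_closure G H"
	shows "F x:add_closure G' H'"
	using x
proof (induction rule: add_closure.induct)
	case zero
	show ?case unfolding F(1) by (rule add_closure.zero)
next
	case (add g x)
	have "g:carrier G" "x:carrier G" using add add_closure_closed[OF H(1)] H by auto
	then have "F (g \<oplus> x) = F g \<oplus>\<^bsub>G'\<^esub> F x" by (rule F(2))
	then show ?case using abelian_monoid.add_closure_add[OF G' H(2) F(3)[OF add(1)] add(3)] by simp
qed

end

section \<open>The defining relation of the quantum Weyl algebra\<close>

text \<open>Consequences of the relation for the normal element \<open>z = y x - h0\<close>.\<close>

locale qweyl_relation = qlaurent k n q + B: ring B
	for k :: "('k, 'r) ring_scheme" (structure) and n q and B :: "('b, 's) ring_scheme" +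
	fixes u :: "'k => 'b" and x y :: 'b
	assumes u: "u:ring_hom k B" and central: "c:carrier k ==> b:carrier B ==> u c \<otimes>\<^bsub>B\<^esub> b = b \<otimes>\<^bsub>B\<^esub> u c"
		and xy [simp]: "x:carrier B" "y:carrier B" and rel: "y \<otimes>\<^bsub>B\<^esub> x = u q \<otimes>\<^bsub>B\<^esub> (x \<otimes>\<^bsub>B\<^esub> y) \<oplus>\<^bsub>B\<^esub> \<one>\<^bsub>B\<^esub>"
begin

lemma u_closed [simp]: "c:carrier k ==> u c:carrier B"
	by (rule rhc[OF u])

lemma u_mult: "c:carrier k ==> d:carrier k ==> u (c \<otimes> d) = u c \<otimes>\<^bsub>B\<^esub> u d"
	and u_add: "c:carrier k ==> d:carrier k ==> u (c \<oplus> d) = u c \<oplus>\<^bsub>B\<^esub> u d" and u_one: "u \<one> = \<one>\<^bsub>B\<^esub>"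
	using rhm[OF u] rha[OF u] rh1[OF u] by auto

definition z where "z = y \<otimes>\<^bsub>B\<^esub> x \<ominus>\<^bsub>B\<^esub> u h0"

lemma z_closed [simp]: "z:carrier B"
	unfolding z_def using h0_closed by simp

lemma yx: "y \<otimes>\<^bsub>B\<^esub> x = z \<oplus>\<^bsub>B\<^esub> u h0"
	unfolding z_def using h0_closed by (simp add: a_minus_def B.a_assoc B.l_neg)

lemma q_xy: "u q \<otimes>\<^bsub>B\<^esub> (x \<otimes>\<^bsub>B\<^esub> y) = z \<oplus>\<^bsub>B\<^esub> u (q \<otimes> h0)"
proof -
	have c: "q \<otimes> h0:carrier k" using q(1) h0_closed by simp
	have "u h0 = u (q \<otimes> h0) \<oplus>\<^bsub>B\<^esub> \<one>\<^bsub>B\<^esub>" using u_add[OF c one_closed] u_one h0_eq by simp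
	then have "u q \<otimes>\<^bsub>B\<^esub> (x \<otimes>\<^bsub>B\<^esub> y) \<oplus>\<^bsub>B\<^esub> \<one>\<^bsub>B\<^esub> = (z \<oplus>\<^bsub>B\<^esub> u (q \<otimes> h0)) \<oplus>\<^bsub>B\<^esub> \<one>\<^bsub>B\<^esub>"
		using rel yx c by (simp add: B.a_assoc)
	then show ?thesis using c q(1) by simp
qed

lemma yz: "y \<otimes>\<^bsub>B\<^esub> z = u q \<otimes>\<^bsub>B\<^esub> (z \<otimes>\<^bsub>B\<^esub> y)"
proof -
	have c: "q \<otimes> h0:carrier k" "q:carrier k" using q(1) h0_closed by simp_all
	have "y \<otimes>\<^bsub>B\<^esub> (u q \<otimes>\<^bsub>B\<^esub> (x \<otimes>\<^bsub>B\<^esub> y)) = u q \<otimes>\<^bsub>B\<^esub> ((y \<otimes>\<^bsub>B\<^esub> x) \<otimes>\<^bsub>B\<^esub> y)"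
		using c central[OF c(2), of y] by (simp add: B.m_assoc[symmetric])
	then have "y \<otimes>\<^bsub>B\<^esub> z \<oplus>\<^bsub>B\<^esub> y \<otimes>\<^bsub>B\<^esub> u (q \<otimes> h0) = u q \<otimes>\<^bsub>B\<^esub> (z \<otimes>\<^bsub>B\<^esub> y) \<oplus>\<^bsub>B\<^esub> u q \<otimes>\<^bsub>B\<^esub> (u h0 \<otimes>\<^bsub>B\<^esub> y)"
		unfolding q_xy yx using c h0_closed by (simp add: B.r_distr B.l_distr)
	moreover have "u q \<otimes>\<^bsub>B\<^esub> (u h0 \<otimes>\<^bsub>B\<^esub> y) = y \<otimes>\<^bsub>B\<^esub> u (q \<otimes> h0)"
		using c h0_closed central[OF c(1), of y] by (simp add: u_mult B.m_assoc)
	ultimately show ?thesis using c h0_closed by simp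
qed

lemma zx: "z \<otimes>\<^bsub>B\<^esub> x = u q \<otimes>\<^bsub>B\<^esub> (x \<otimes>\<^bsub>B\<^esub> z)"
proof -
	have c: "q \<otimes> h0:carrier k" "q:carrier k" using q(1) h0_closed by simp_all
	have "(u q \<otimes>\<^bsub>B\<^esub> (x \<otimes>\<^bsub>B\<^esub> y)) \<otimes>\<^bsub>B\<^esub> x = u q \<otimes>\<^bsub>B\<^esub> (x \<otimes>\<^bsub>B\<^esub> (y \<otimes>\<^bsub>B\<^esub> x))"
		using c by (simp add: B.m_assoc)
	then have "z \<otimes>\<^bsub>B\<^esub> x \<oplus>\<^bsub>B\<^esub> u (q \<otimes> h0) \<otimes>\<^bsub>B\<^esub> x = u q \<otimes>\<^bsub>B\<^esub> (x \<otimes>\<^bsub>B\<^esub> z) \<oplus>\<^bsub>B\<^esub> u q \<otimes>\<^bsub>B\<^esub> (x \<otimes>\<^bsub>B\<^esub> u h0)"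
		unfolding q_xy yx using c h0_closed by (simp add: B.r_distr B.l_distr)
	moreover have "u q \<otimes>\<^bsub>B\<^esub> (x \<otimes>\<^bsub>B\<^esub> u h0) = u (q \<otimes> h0) \<otimes>\<^bsub>B\<^esub> x"
		using c h0_closed central[OF h0_closed, of x] by (simp add: u_mult B.m_assoc)
	ultimately show ?thesis using c h0_closed by simp
qed

lemma qz_cancel: "b:carrier B ==> u (qz (- 1)) \<otimes>\<^bsub>B\<^esub> (u q \<otimes>\<^bsub>B\<^esub> b) = b"
proof -
	assume b: "b:carrier B"
	have "qz (- 1) \<otimes> q = \<one>" using qz_add[of "- 1" 1] by (simp add: qz_1 qz_0)
	then have "u (qz (- 1)) \<otimes>\<^bsub>B\<^esub> u q = \<one>\<^bsub>B\<^esub>" using u_mult[OF qz_closed q(1), of "- 1"] by (simp add: u_one)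
	moreover have "u (qz (- 1)) \<otimes>\<^bsub>B\<^esub> (u q \<otimes>\<^bsub>B\<^esub> b) = (u (qz (- 1)) \<otimes>\<^bsub>B\<^esub> u q) \<otimes>\<^bsub>B\<^esub> b"
		using b q(1) qz_closed by (intro B.m_assoc[symmetric]) auto
	ultimately show ?thesis using b by simp
qed

lemma xz: "x \<otimes>\<^bsub>B\<^esub> z = u (qz (- 1)) \<otimes>\<^bsub>B\<^esub> (z \<otimes>\<^bsub>B\<^esub> x)"
	unfolding zx by (rule qz_cancel[symmetric]) simp

lemma xy_eq: "x \<otimes>\<^bsub>B\<^esub> y = u (qz (- 1)) \<otimes>\<^bsub>B\<^esub> z \<oplus>\<^bsub>B\<^esub> u h0"
proof -
	have "x \<otimes>\<^bsub>B\<^esub> y = u (qz (- 1)) \<otimes>\<^bsub>B\<^esub> (z \<oplus>\<^bsub>B\<^esub> u (q \<otimes> h0))" unfolding q_xy[symmetric] by (rule qz_cancel[symmetric]) simp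
	also have "... = u (qz (- 1)) \<otimes>\<^bsub>B\<^esub> z \<oplus>\<^bsub>B\<^esub> u (qz (- 1)) \<otimes>\<^bsub>B\<^esub> (u q \<otimes>\<^bsub>B\<^esub> u h0)"
		using q(1) h0_closed qz_closed by (simp add: B.r_distr u_mult)
	finally show ?thesis using h0_closed by (simp add: qz_cancel)
qed

lemma commute_pow:
	assumes w: "w:carrier B" and e: "w \<otimes>\<^bsub>B\<^esub> z = u (qz e) \<otimes>\<^bsub>B\<^esub> (z \<otimes>\<^bsub>B\<^esub> w)"
	shows "w \<otimes>\<^bsub>B\<^esub> z [^]\<^bsub>B\<^esub> (a::nat) = u (qz (e * int a)) \<otimes>\<^bsub>B\<^esub> (z [^]\<^bsub>B\<^esub> a \<otimes>\<^bsub>B\<^esub> w)"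
proof (induction a)
	case 0
	then show ?case using w by (simp add: qz_0 u_one)
next
	case (Suc a)
	let ?za = "z [^]\<^bsub>B\<^esub> a" and ?c = "qz (e * int a)"
	have "w \<otimes>\<^bsub>B\<^esub> (?za \<otimes>\<^bsub>B\<^esub> z) = u ?c \<otimes>\<^bsub>B\<^esub> (?za \<otimes>\<^bsub>B\<^esub> (w \<otimes>\<^bsub>B\<^esub> z))"
		using Suc w qz_closed by (simp add: B.m_assoc[symmetric])
	also have "... = u ?c \<otimes>\<^bsub>B\<^esub> (u (qz e) \<otimes>\<^bsub>B\<^esub> (?za \<otimes>\<^bsub>B\<^esub> (z \<otimes>\<^bsub>B\<^esub> w)))"
		unfolding e using w qz_closed central[of "qz e" ?za] by (simp add: B.m_assoc[symmetric])
	also have "... = u (?c \<otimes> qz e) \<otimes>\<^bsub>B\<^esub> ((?za \<otimes>\<^bsub>B\<^esub> z) \<otimes>\<^bsub>B\<^esub> w)"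
		using w qz_closed by (simp add: u_mult B.m_assoc)
	also have "?c \<otimes> qz e = qz (e * int (Suc a))" unfolding qz_add[symmetric] by (simp add: algebra_simps)
	finally show ?case by simp
qed

lemma y_pow: "y \<otimes>\<^bsub>B\<^esub> z [^]\<^bsub>B\<^esub> (a::nat) = u (qz (int a)) \<otimes>\<^bsub>B\<^esub> (z [^]\<^bsub>B\<^esub> a \<otimes>\<^bsub>B\<^esub> y)"
	using commute_pow[of y 1 a] yz by (simp add: qz_1)

lemma x_pow: "x \<otimes>\<^bsub>B\<^esub> z [^]\<^bsub>B\<^esub> (a::nat) = u (qz (- int a)) \<otimes>\<^bsub>B\<^esub> (z [^]\<^bsub>B\<^esub> a \<otimes>\<^bsub>B\<^esub> x)"
	using commute_pow[of x "- 1" a] xz by simp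

text \<open>The normal form \<open>z\<^sup>a y\<^sup>m\<close> or \<open>z\<^sup>a x\<^sup>-\<^sup>m\<close>, by the sign of \<open>m\<close>.\<close>

definition xy_pow :: "int => 'b" where
	"xy_pow m = (if 0 \<le> m then y [^]\<^bsub>B\<^esub> nat m else x [^]\<^bsub>B\<^esub> nat (- m))"

definition nf :: "nat => int => 'b" where "nf a m = z [^]\<^bsub>B\<^esub> a \<otimes>\<^bsub>B\<^esub> xy_pow m"

definition NF :: "'b set" where "NF = {u c \<otimes>\<^bsub>B\<^esub> nf a m | c a m. c:carrier k}"

lemma xy_pow_closed [simp]: "xy_pow m:carrier B"
	unfolding xy_pow_def by (cases "0 \<le> m") (simp_all only: if_True if_False B.nat_pow_closed xy)

lemma nf_closed [simp]: "nf a m:carrier B"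
	by (simp add: nf_def)

lemma NF_sub: "NF \<subseteq> carrier B"
	by (auto simp: NF_def)

lemma y_xy_pow: "y \<otimes>\<^bsub>B\<^esub> xy_pow m = (if 0 \<le> m then xy_pow (m + 1) else (z \<oplus>\<^bsub>B\<^esub> u h0) \<otimes>\<^bsub>B\<^esub> xy_pow (m + 1))"
proof (cases "0 \<le> m")
	case True
	then have "nat (m + 1) = Suc (nat m)" by simp
	then show ?thesis using True B.nat_pow_Suc2[of y "nat m"] by (simp add: xy_pow_def)
next
	case False
	then have n1: "nat (- m) = Suc (nat (- (m + 1)))" by simp
	have "y \<otimes>\<^bsub>B\<^esub> xy_pow m = y \<otimes>\<^bsub>B\<^esub> (x \<otimes>\<^bsub>B\<^esub> x [^]\<^bsub>B\<^esub> nat (- (m + 1)))"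
		using False B.nat_pow_Suc2[of x "nat (- (m + 1))"] unfolding xy_pow_def n1 by simp
	also have "... = (z \<oplus>\<^bsub>B\<^esub> u h0) \<otimes>\<^bsub>B\<^esub> x [^]\<^bsub>B\<^esub> nat (- (m + 1))" unfolding yx[symmetric] by (simp add: B.m_assoc)
	also have "x [^]\<^bsub>B\<^esub> nat (- (m + 1)) = xy_pow (m + 1)" using False by (cases "m = - 1") (simp_all add: xy_pow_def)
	finally show ?thesis using False by simp
qed

lemma x_xy_pow: "x \<otimes>\<^bsub>B\<^esub> xy_pow m = (if m \<le> 0 then xy_pow (m - 1) else (u (qz (- 1)) \<otimes>\<^bsub>B\<^esub> z \<oplus>\<^bsub>B\<^esub> u h0) \<otimes>\<^bsub>B\<^esub> xy_pow (m - 1))"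
proof (cases "m \<le> 0")
	case True
	then have "nat (- (m - 1)) = Suc (nat (- m))" by simp
	then show ?thesis using True B.nat_pow_Suc2[of x "nat (- m)"] by (cases "m = 0") (simp_all add: xy_pow_def)
next
	case False
	then have n1: "nat m = Suc (nat (m - 1))" by simp
	have "x \<otimes>\<^bsub>B\<^esub> xy_pow m = x \<otimes>\<^bsub>B\<^esub> (y \<otimes>\<^bsub>B\<^esub> y [^]\<^bsub>B\<^esub> nat (m - 1))"
		using False B.nat_pow_Suc2[of y "nat (m - 1)"] unfolding xy_pow_def n1 by simp
	also have "... = (u (qz (- 1)) \<otimes>\<^bsub>B\<^esub> z \<oplus>\<^bsub>B\<^esub> u h0) \<otimes>\<^bsub>B\<^esub> y [^]\<^bsub>B\<^esub> nat (m - 1)" unfolding xy_eq[symmetric] by (simp add: B.m_assoc)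
	also have "y [^]\<^bsub>B\<^esub> nat (m - 1) = xy_pow (m - 1)" using False by (simp add: xy_pow_def)
	finally show ?thesis using False by simp
qed

abbreviation "NC == add_closure B NF"

lemma NFI: "c:carrier k ==> u c \<otimes>\<^bsub>B\<^esub> nf a m:NC"
	by (rule B.add_closure_base[OF NF_sub]) (auto simp: NF_def)

lemma NC_add: "v:NC ==> w:NC ==> v \<oplus>\<^bsub>B\<^esub> w:NC"
	by (rule B.add_closure_add[OF NF_sub])

lemma generator_nf:
	assumes g: "g:carrier B" and c: "c:carrier k"
		and comm: "g \<otimes>\<^bsub>B\<^esub> z [^]\<^bsub>B\<^esub> a = u e \<otimes>\<^bsub>B\<^esub> (z [^]\<^bsub>B\<^esub> a \<otimes>\<^bsub>B\<^esub> g)" "e:carrier k"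
		and step: "g \<otimes>\<^bsub>B\<^esub> xy_pow m = xy_pow m' \<or> (\<exists>d\<in>carrier k. g \<otimes>\<^bsub>B\<^esub> xy_pow m = (u d \<otimes>\<^bsub>B\<^esub> z \<oplus>\<^bsub>B\<^esub> u h0) \<otimes>\<^bsub>B\<^esub> xy_pow m')"
	shows "g \<otimes>\<^bsub>B\<^esub> (u c \<otimes>\<^bsub>B\<^esub> nf a m):NC"
proof -
	let ?za = "z [^]\<^bsub>B\<^esub> a"
	have "g \<otimes>\<^bsub>B\<^esub> (u c \<otimes>\<^bsub>B\<^esub> nf a m) = u c \<otimes>\<^bsub>B\<^esub> ((g \<otimes>\<^bsub>B\<^esub> ?za) \<otimes>\<^bsub>B\<^esub> xy_pow m)"
		unfolding nf_def using g c central[OF c g] by (simp add: B.m_assoc[symmetric])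
	also have "... = u c \<otimes>\<^bsub>B\<^esub> (u e \<otimes>\<^bsub>B\<^esub> (?za \<otimes>\<^bsub>B\<^esub> (g \<otimes>\<^bsub>B\<^esub> xy_pow m)))"
		unfolding comm(1) using g comm(2) c by (simp add: B.m_assoc)
	also have "... = u (c \<otimes> e) \<otimes>\<^bsub>B\<^esub> (?za \<otimes>\<^bsub>B\<^esub> (g \<otimes>\<^bsub>B\<^esub> xy_pow m))"
		using g c comm(2) by (simp add: u_mult B.m_assoc)
	finally have eq: "g \<otimes>\<^bsub>B\<^esub> (u c \<otimes>\<^bsub>B\<^esub> nf a m) = u (c \<otimes> e) \<otimes>\<^bsub>B\<^esub> (?za \<otimes>\<^bsub>B\<^esub> (g \<otimes>\<^bsub>B\<^esub> xy_pow m))" .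
	have ce: "c \<otimes> e:carrier k" using c comm(2) by simp
	show ?thesis
		using step
	proof
		assume "g \<otimes>\<^bsub>B\<^esub> xy_pow m = xy_pow m'"
		then show ?thesis unfolding eq using NFI[OF ce, of a m'] by (simp add: nf_def)
	next
		assume "\<exists>d\<in>carrier k. g \<otimes>\<^bsub>B\<^esub> xy_pow m = (u d \<otimes>\<^bsub>B\<^esub> z \<oplus>\<^bsub>B\<^esub> u h0) \<otimes>\<^bsub>B\<^esub> xy_pow m'"
		then obtain d where d: "d:carrier k" "g \<otimes>\<^bsub>B\<^esub> xy_pow m = (u d \<otimes>\<^bsub>B\<^esub> z \<oplus>\<^bsub>B\<^esub> u h0) \<otimes>\<^bsub>B\<^esub> xy_pow m'" by blast
		have "?za \<otimes>\<^bsub>B\<^esub> ((u d \<otimes>\<^bsub>B\<^esub> z \<oplus>\<^bsub>B\<^esub> u h0) \<otimes>\<^bsub>B\<^esub> xy_pow m') = u d \<otimes>\<^bsub>B\<^esub> nf (Suc a) m' \<oplus>\<^bsub>B\<^esub> u h0 \<otimes>\<^bsub>B\<^esub> nf a m'"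
			unfolding nf_def using d(1) h0_closed central[OF d(1), of ?za] central[OF h0_closed, of ?za]
			by (simp add: B.l_distr B.r_distr B.m_assoc[symmetric])
		then have "g \<otimes>\<^bsub>B\<^esub> (u c \<otimes>\<^bsub>B\<^esub> nf a m) = u (c \<otimes> e \<otimes> d) \<otimes>\<^bsub>B\<^esub> nf (Suc a) m' \<oplus>\<^bsub>B\<^esub> u (c \<otimes> e \<otimes> h0) \<otimes>\<^bsub>B\<^esub> nf a m'"
			unfolding eq d(2) using ce d(1) h0_closed by (simp add: B.r_distr u_mult B.m_assoc)
		then show ?thesis using NC_add NFI ce d(1) h0_closed by simp
	qed
qed

lemma NC_closed: "b:NC ==> b:carrier B"
	by (rule B.add_closure_closed[OF NF_sub])

lemma NC_left:
	assumes g: "g:carrier B" and G: "!!c a m. c:carrier k ==> g \<otimes>\<^bsub>B\<^esub> (u c \<otimes>\<^bsub>B\<^esub> nf a m):NC" and b: "b:NC"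
	shows "g \<otimes>\<^bsub>B\<^esub> b:NC"
	by (rule B.add_closure_map[OF NF_sub NF_sub B.abelian_monoid_axioms _ _ _ b])
		(use g G in \<open>auto simp: B.r_distr NF_def\<close>)

lemma NC_y: "b:NC ==> y \<otimes>\<^bsub>B\<^esub> b:NC"
proof (rule NC_left)
	fix c a m assume c: "c:carrier k"
	have "y \<otimes>\<^bsub>B\<^esub> xy_pow m = xy_pow (m + 1) \<or> y \<otimes>\<^bsub>B\<^esub> xy_pow m = (u \<one> \<otimes>\<^bsub>B\<^esub> z \<oplus>\<^bsub>B\<^esub> u h0) \<otimes>\<^bsub>B\<^esub> xy_pow (m + 1)"
		using y_xy_pow[of m] u_one by (auto split: if_splits)
	then show "y \<otimes>\<^bsub>B\<^esub> (u c \<otimes>\<^bsub>B\<^esub> nf a m):NC"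
		by (intro generator_nf[OF xy(2) c y_pow qz_closed, of m "m + 1"]) blast
qed simp

lemma NC_x: "b:NC ==> x \<otimes>\<^bsub>B\<^esub> b:NC"
proof (rule NC_left)
	fix c a m assume c: "c:carrier k"
	have "x \<otimes>\<^bsub>B\<^esub> xy_pow m = xy_pow (m - 1) \<or> x \<otimes>\<^bsub>B\<^esub> xy_pow m = (u (qz (- 1)) \<otimes>\<^bsub>B\<^esub> z \<oplus>\<^bsub>B\<^esub> u h0) \<otimes>\<^bsub>B\<^esub> xy_pow (m - 1)"
		using x_xy_pow[of m] by (auto split: if_splits)
	then show "x \<otimes>\<^bsub>B\<^esub> (u c \<otimes>\<^bsub>B\<^esub> nf a m):NC"
		by (intro generator_nf[OF xy(1) c x_pow qz_closed, of m "m - 1"]) (use qz_closed in blast)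
qed simp

lemma NC_scalar: assumes d: "d:carrier k" and b: "b:NC" shows "u d \<otimes>\<^bsub>B\<^esub> b:NC"
proof (rule NC_left[OF _ _ b])
	fix c a m assume c: "c:carrier k"
	have "u d \<otimes>\<^bsub>B\<^esub> (u c \<otimes>\<^bsub>B\<^esub> nf a m) = u (d \<otimes> c) \<otimes>\<^bsub>B\<^esub> nf a m" using c d by (simp add: u_mult B.m_assoc)
	then show "u d \<otimes>\<^bsub>B\<^esub> (u c \<otimes>\<^bsub>B\<^esub> nf a m):NC" using NFI c d by simp
qed (use d in simp)

lemma NC_one: "\<one>\<^bsub>B\<^esub>:NC"
	using NFI[of \<one> 0 0] by (simp add: u_one nf_def xy_pow_def)

end

section \<open>Presentations of the quantum Weyl algebras\<close>

context qlaurent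
begin

abbreviation "WM == \<lparr>carrier = (UNIV :: wgen list set), monoid.mult = (@), one = []\<rparr>"

sublocale W: skew_monoid k WM "%_ c. c"
	by (rule skew_monoid_trivial[OF ring_axioms]) (rule monoidI, auto)

abbreviation "FA == free_algebra k"
abbreviation "cl1 == a_r_coset FA (weyl1_ideal k q)"
abbreviation "B == weyl1 k q"
abbreviation multB (infixl "\<otimes>B" 70) where "multB == (\<otimes>\<^bsub>B\<^esub>)"
abbreviation addB (infixl "\<oplus>B" 65) where "addB == (\<oplus>\<^bsub>B\<^esub>)"
abbreviation zeroB ("\<zero>B") where "zeroB == \<zero>\<^bsub>B\<^esub>"
abbreviation oneB ("\<one>B") where "oneB == \<one>\<^bsub>B\<^esub>"
abbreviation negB ("\<ominus>B _" [81] 80) where "negB == a_inv B"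
abbreviation subB (infixl "\<ominus>B" 65) where "subB == a_minus B"
abbreviation powB (infixl "[^]B" 75) where "powB x m == x [^]\<^bsub>B\<^esub> (m :: nat)"
abbreviation "cB == carrier B"
abbreviation "bc == weyl1_const k q"
abbreviation "bg == weyl1_gen k q"

lemma FA_eq: "FA = monoid_algebra k WM"
	by (simp add: free_algebra_def)

definition "rel1 = sgl k \<one> [GenY, GenX] \<ominus>\<^bsub>FA\<^esub> sgl k q [GenX, GenY] \<ominus>\<^bsub>FA\<^esub> \<one>\<^bsub>FA\<^esub>"

lemma FA_ring: "ring FA"
	unfolding FA_eq by (rule W.S_ring)

lemma FA_single: "c:carrier k ==> sgl k c w:carrier FA"
	unfolding FA_eq by simp

lemma FA_single_mult: "c:carrier k ==> d:carrier k ==> sgl k c v \<otimes>\<^bsub>FA\<^esub> sgl k d w = sgl k (c \<otimes> d) (v @ w)"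
	unfolding FA_eq using W.single_mult[of c d v w] by simp

lemma FA_single_add: "c:carrier k ==> d:carrier k ==> sgl k c w \<oplus>\<^bsub>FA\<^esub> sgl k d w = sgl k (c \<oplus> d) w"
	unfolding FA_eq by (rule W.single_add)

lemma FA_one: "\<one>\<^bsub>FA\<^esub> = sgl k \<one> []"
	unfolding FA_eq by (simp add: W.one_S)

lemma rel1_closed: "rel1:carrier FA"
proof -
	interpret FA: ring FA by (rule FA_ring)
	show ?thesis unfolding rel1_def using q(1) FA_single by simp
qed

lemma I1: "ideal (weyl1_ideal k q) FA" "rel1:weyl1_ideal k q"
proof -
	interpret FA: ring FA by (rule FA_ring)
	show "ideal (weyl1_ideal k q) FA" "rel1:weyl1_ideal k q"
		unfolding weyl1_ideal_def rel1_def[symmetric] using FA.genideal_ideal FA.genideal_self[of "{rel1}"] rel1_closed by auto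
qed

lemma B_ring: "ring B"
	unfolding weyl1_def by (rule ideal.quotient_is_ring[OF I1(1)])

lemma cl1_hom: "cl1:ring_hom FA B"
	unfolding weyl1_def by (rule ideal.rcos_ring_hom[OF I1(1)])

lemma B_rep: assumes "b:cB" obtains f where "f:carrier FA" "b = cl1 f"
	using assms by (auto simp: weyl1_def FactRing_def A_RCOSETS_def')

lemma bc_cl: "bc c = cl1 (sgl k c [])" and bg_cl: "bg g = cl1 (sgl k \<one> [g])"
	by (simp_all add: weyl1_const_def weyl1_gen_def)

lemma bc_hom: "bc:ring_hom k B"
proof (rule ring_hom_memI)
	fix c d assume cd: "c:carrier k" "d:carrier k"
	show "bc c:cB" unfolding bc_cl by (rule rhc[OF cl1_hom FA_single[OF cd(1)]])
	show "bc (c \<otimes> d) = bc c \<otimes>B bc d"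
		unfolding bc_cl using rhm[OF cl1_hom FA_single[OF cd(1), of "[]"] FA_single[OF cd(2), of "[]"]] FA_single_mult[OF cd, of "[]" "[]"] by simp
	show "bc (c \<oplus> d) = bc c \<oplus>B bc d"
		unfolding bc_cl using rha[OF cl1_hom FA_single[OF cd(1), of "[]"] FA_single[OF cd(2), of "[]"]] FA_single_add[OF cd, of "[]"] by simp
next
	show "bc \<one> = \<one>B" unfolding bc_cl FA_one[symmetric] by (rule rh1[OF cl1_hom])
qed

lemma bc_central: assumes c: "c:carrier k" and b: "b:cB" shows "bc c \<otimes>B b = b \<otimes>B bc c"
proof -
	interpret FA: ring FA by (rule FA_ring)
	obtain f where f: "f:carrier FA" "b = cl1 f" using B_rep[OF b] .
	have "sgl k c [] \<otimes>\<^bsub>FA\<^esub> f = f \<otimes>\<^bsub>FA\<^esub> sgl k c []"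
		unfolding FA_eq
	proof (rule W.additive_eqI[OF W.S_abelian, where f = f and F = "%f. sgl k c [] \<otimes>\<^bsub>W.S\<^esub> f" and G = "%f. f \<otimes>\<^bsub>W.S\<^esub> sgl k c []"])
		have s: "sgl k c []:carrier W.S" using c by simp
		show "f:carrier W.S" using f(1) unfolding FA_eq .
		fix g h assume gh: "g:carrier W.S" "h:carrier W.S"
		show "sgl k c [] \<otimes>\<^bsub>W.S\<^esub> (g \<oplus>\<^bsub>W.S\<^esub> h) = sgl k c [] \<otimes>\<^bsub>W.S\<^esub> g \<oplus>\<^bsub>W.S\<^esub> sgl k c [] \<otimes>\<^bsub>W.S\<^esub> h"
			by (rule W.S.r_distr[OF gh s])
		show "(g \<oplus>\<^bsub>W.S\<^esub> h) \<otimes>\<^bsub>W.S\<^esub> sgl k c [] = g \<otimes>\<^bsub>W.S\<^esub> sgl k c [] \<oplus>\<^bsub>W.S\<^esub> h \<otimes>\<^bsub>W.S\<^esub> sgl k c []"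
			by (rule W.S.l_distr[OF gh s])
	next
		fix r m assume "r:carrier k"
		then show "sgl k c [] \<otimes>\<^bsub>W.S\<^esub> sgl k r m = sgl k r m \<otimes>\<^bsub>W.S\<^esub> sgl k c []"
			using c W.single_mult[of c r "[]" m] W.single_mult[of r c m "[]"] by (simp add: m_comm)
	qed
	then show ?thesis unfolding f(2) bc_cl using rhm[OF cl1_hom] f(1) FA_single[OF c] by metis
qed

lemma bg_closed: "bg g:cB"
	unfolding bg_cl by (rule rhc[OF cl1_hom FA_single]) simp

lemma bg_relation: "bg GenY \<otimes>B bg GenX = bc q \<otimes>B (bg GenX \<otimes>B bg GenY) \<oplus>B \<one>B"
proof -
	interpret FA: ring FA by (rule FA_ring)
	interpret B: ring B by (rule B_ring)
	interpret H: ring_hom_ring FA B cl1 by (rule ring_hom_ringI2[OF FA_ring B_ring cl1_hom])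
	note [simp] = FA_single q(1)
	have "cl1 rel1 = \<zero>B" unfolding weyl1_def by (rule FA.quotient_zero[OF I1])
	then have "cl1 (sgl k \<one> [GenY, GenX]) \<ominus>B cl1 (sgl k q [GenX, GenY]) \<ominus>B \<one>B = \<zero>B"
		unfolding rel1_def by (simp add: a_minus_def)
	then have "cl1 (sgl k \<one> [GenY, GenX]) \<ominus>B cl1 (sgl k q [GenX, GenY]) = \<one>B"
		using B.r_right_minus_eq by simp
	moreover have "cl1 (sgl k \<one> [GenY, GenX]) = (cl1 (sgl k \<one> [GenY, GenX]) \<ominus>B cl1 (sgl k q [GenX, GenY])) \<oplus>B cl1 (sgl k q [GenX, GenY])"
		by (simp add: a_minus_def B.a_assoc B.l_neg)
	ultimately have "cl1 (sgl k \<one> [GenY, GenX]) = cl1 (sgl k q [GenX, GenY]) \<oplus>B \<one>B"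
		by (simp add: B.a_comm)
	moreover have "cl1 (sgl k \<one> [GenY, GenX]) = bg GenY \<otimes>B bg GenX"
		unfolding bg_cl H.hom_mult[OF FA_single[OF one_closed] FA_single[OF one_closed], symmetric] by (simp add: FA_single_mult)
	moreover have "cl1 (sgl k q [GenX, GenY]) = bc q \<otimes>B (bg GenX \<otimes>B bg GenY)"
		unfolding bg_cl bc_cl H.hom_mult[OF FA_single[OF one_closed] FA_single[OF one_closed], symmetric]
		by (subst H.hom_mult[symmetric]) (simp_all add: FA_single_mult)
	ultimately show ?thesis by simp
qed

sublocale Q: qweyl_relation k n q B bc "bg GenX" "bg GenY"
	by (intro qweyl_relation.intro qweyl_relation_axioms.intro qlaurent_axioms B_ring bc_hom bc_central bg_closed bg_relation)

text \<open>The span of the normal forms is stable under left multiplication by the generators.\<close>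

lemma B_span: assumes "b:cB" shows "b:Q.NC"
proof -
	interpret H: ring_hom_ring FA B cl1 by (rule ring_hom_ringI2[OF FA_ring B_ring cl1_hom])
	have word: "cl1 (sgl k \<one> w):Q.NC" for w
	proof (induction w)
		case Nil
		then show ?case using Q.NC_one rh1[OF cl1_hom] by (simp add: FA_one)
	next
		case (Cons g w)
		have "cl1 (sgl k \<one> (g # w)) = bg g \<otimes>B cl1 (sgl k \<one> w)"
			unfolding bg_cl H.hom_mult[OF FA_single[OF one_closed] FA_single[OF one_closed], symmetric] by (simp add: FA_single_mult)
		then show ?case using Q.NC_x[OF Cons] Q.NC_y[OF Cons] by (cases g) simp_all
	qed
	obtain f where f: "f:carrier FA" "b = cl1 f" using B_rep[OF assms] .
	have "cl1 f:Q.NC"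
		using f(1) unfolding FA_eq
	proof (induction f rule: W.S_induct)
		case zero
		have "\<zero>B:Q.NC" by (rule add_closure.zero)
		then show ?case using H.hom_zero unfolding FA_eq by simp
	next
		case (add f r w)
		have fF: "f:carrier FA" using add(1) by (simp add: FA_eq)
		have "sgl k r w = sgl k r [] \<otimes>\<^bsub>FA\<^esub> sgl k \<one> w" using add(2) by (simp add: FA_single_mult)
		then have "cl1 (sgl k r w) = bc r \<otimes>B cl1 (sgl k \<one> w)"
			unfolding bc_cl using H.hom_mult[OF FA_single[OF add(2)] FA_single[OF one_closed]] by simp
		then have "cl1 (sgl k r w):Q.NC" using Q.NC_scalar[OF add(2) word] by simp
		moreover have "cl1 (sgl k r w \<oplus>\<^bsub>FA\<^esub> f) = cl1 (sgl k r w) \<oplus>B cl1 f"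
			using H.hom_add[OF FA_single[OF add(2)] fF] .
		ultimately show ?case using Q.NC_add add(4) unfolding FA_eq by simp
	qed
	then show ?thesis using f(2) by simp
qed

abbreviation "TM == tuples n B"
abbreviation "MP == monoid_algebra k TM"
abbreviation "A == weyl k q n"
abbreviation multA (infixl "\<otimes>A" 70) where "multA == (\<otimes>\<^bsub>A\<^esub>)"
abbreviation addA (infixl "\<oplus>A" 65) where "addA == (\<oplus>\<^bsub>A\<^esub>)"
abbreviation zeroA ("\<zero>A") where "zeroA == \<zero>\<^bsub>A\<^esub>"
abbreviation oneA ("\<one>A") where "oneA == \<one>\<^bsub>A\<^esub>"
abbreviation negA ("\<ominus>A _" [81] 80) where "negA == a_inv A"
abbreviation subA (infixl "\<ominus>A" 65) where "subA == a_minus A"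
abbreviation "cA == carrier A"
abbreviation "J == tensor_ideal k n B bc"
abbreviation "clA == a_r_coset MP J"
abbreviation "ts == tensor_single k n B bc"

lemma TM_carrier: "t:carrier TM \<longleftrightarrow> (\<forall>i<n. t i:cB) & (\<forall>i. \<not> i < n \<longrightarrow> t i = undefined)"
	by (auto simp: PiE_iff extensional_def)

lemma TM_upd: "t:carrier TM ==> i < n ==> b:cB ==> t(i := b):carrier TM"
	unfolding TM_carrier by simp

lemma TM_mult: "t:carrier TM ==> s:carrier TM ==> t \<otimes>\<^bsub>TM\<^esub> s:carrier TM"
	unfolding TM_carrier using ring.ring_simprules(5)[OF B_ring] by simp

lemma TM_mult_apply: "i < n ==> (t \<otimes>\<^bsub>TM\<^esub> s) i = t i \<otimes>B s i"
	by simp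

lemma TM_one: "\<one>\<^bsub>TM\<^esub>:carrier TM"
	unfolding TM_carrier using ring.ring_simprules(6)[OF B_ring] by simp

lemma TM_monoid: "Group.monoid TM"
proof (rule monoidI)
	fix r s t assume "r:carrier TM" "s:carrier TM" "t:carrier TM"
	then show "r \<otimes>\<^bsub>TM\<^esub> s \<otimes>\<^bsub>TM\<^esub> t = r \<otimes>\<^bsub>TM\<^esub> (s \<otimes>\<^bsub>TM\<^esub> t)"
		unfolding TM_carrier by (auto simp: fun_eq_iff restrict_def Q.B.m_assoc)
next
	fix t assume "t:carrier TM"
	then show "\<one>\<^bsub>TM\<^esub> \<otimes>\<^bsub>TM\<^esub> t = t" "t \<otimes>\<^bsub>TM\<^esub> \<one>\<^bsub>TM\<^esub> = t"
		unfolding TM_carrier by (auto simp: fun_eq_iff restrict_def)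
qed (rule TM_mult TM_one; assumption)+

sublocale E: skew_monoid k TM "%_ c. c"
	by (rule skew_monoid_trivial[OF ring_axioms TM_monoid])

definition tgens :: "((nat => (wgen list => 'k) set) => 'k) set" where
	"tgens = {sgl k \<one> (t(i := a \<oplus>B b)) \<ominus>\<^bsub>MP\<^esub>
				 (sgl k \<one> (t(i := a)) \<oplus>\<^bsub>MP\<^esub> sgl k \<one> (t(i := b))) | t i a b.
				 t:carrier TM & i < n & a:cB & b:cB} \<union>
			{sgl k \<one> (t(i := bc c \<otimes>B a)) \<ominus>\<^bsub>MP\<^esub> sgl k c (t(i := a)) | t i a c.
				 t:carrier TM & i < n & a:cB & c:carrier k}"

lemma J_eq: "J = Idl\<^bsub>MP\<^esub> tgens"
	by (simp only: tensor_ideal_def tgens_def Let_def)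

lemma MP_single: "c:carrier k ==> t:carrier TM ==> sgl k c t:carrier MP"
	by (rule E.single_closed)

lemma tgens_closed: "tgens \<subseteq> carrier MP"
proof -
	have 1: "bc c:cB" if "c:carrier k" for c using Q.u_closed[OF that] .
	show ?thesis
		unfolding tgens_def
		using MP_single TM_upd Q.B.a_closed Q.B.m_closed 1 by (auto intro!: E.S.minus_closed E.S.a_closed simp del: E.add_S carrier_product_group)
qed

lemma J_ideal: "ideal J MP" and tgens_J: "tgens \<subseteq> J"
	unfolding J_eq using E.S.genideal_ideal[OF tgens_closed] E.S.genideal_self[OF tgens_closed] by auto

lemma A_eq: "A = MP Quot J"
	by (simp add: weyl_def tensor_power_def)

lemma A_ring: "ring A"
	unfolding A_eq by (rule ideal.quotient_is_ring[OF J_ideal])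

lemma clA_hom: "clA:ring_hom MP A"
	unfolding A_eq by (rule ideal.rcos_ring_hom[OF J_ideal])

lemma A_rep: assumes "x:cA" obtains f where "f:carrier MP" "x = clA f"
	using assms by (auto simp: A_eq FactRing_def A_RCOSETS_def')

lemma ts_cl: "ts c t = clA (sgl k c t)"
	by (simp add: tensor_single_def)

lemma ts_closed: "c:carrier k ==> t:carrier TM ==> ts c t:cA"
	unfolding ts_cl by (rule rhc[OF clA_hom MP_single])

lemma ts_mult: "c:carrier k ==> d:carrier k ==> t:carrier TM ==> s:carrier TM ==>
		ts c t \<otimes>A ts d s = ts (c \<otimes> d) (t \<otimes>\<^bsub>TM\<^esub> s)"
	unfolding ts_cl using rhm[OF clA_hom, of "sgl k c t" "sgl k d s"] E.single_mult[of c d t s] MP_single by simp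

lemma ts_plus: "c:carrier k ==> d:carrier k ==> t:carrier TM ==> ts (c \<oplus> d) t = ts c t \<oplus>A ts d t"
	unfolding ts_cl using rha[OF clA_hom, of "sgl k c t" "sgl k d t"] E.single_add[of c d t] MP_single by simp

lemma ts_zero: "ts \<zero> t = \<zero>A"
	unfolding ts_cl E.single_zero by (rule rh0[OF clA_hom E.S_ring A_ring])

lemma A_one: "\<one>A = ts \<one> \<one>\<^bsub>TM\<^esub>"
	unfolding ts_cl E.one_S[symmetric] by (rule rh1[OF clA_hom, symmetric])

abbreviation "wc == weyl_const k q n"

lemma wc_ts: "wc c = ts c \<one>\<^bsub>TM\<^esub>"
	by (simp add: weyl_const_def)

lemma TM_one_mult: "t:carrier TM ==> \<one>\<^bsub>TM\<^esub> \<otimes>\<^bsub>TM\<^esub> t = t" "t:carrier TM ==> t \<otimes>\<^bsub>TM\<^esub> \<one>\<^bsub>TM\<^esub> = t"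
	using monoid.l_one[OF TM_monoid] monoid.r_one[OF TM_monoid] by blast+

lemma wc_mult: "c:carrier k ==> d:carrier k ==> t:carrier TM ==> wc c \<otimes>A ts d t = ts (c \<otimes> d) t"
	"c:carrier k ==> d:carrier k ==> t:carrier TM ==> ts d t \<otimes>A wc c = ts (c \<otimes> d) t"
	unfolding wc_ts using ts_mult[OF _ _ TM_one] ts_mult[OF _ _ _ TM_one] TM_one_mult m_comm by (metis, metis)

lemma wc_hom: "wc:ring_hom k A"
	by (rule ring_hom_memI) (use ts_closed TM_one ts_plus wc_mult(1)[OF _ _ TM_one] A_one in \<open>auto simp: wc_ts simp del: one_product_group\<close>)

lemma ts_coord_add:
	assumes c: "c:carrier k" and t: "t:carrier TM" and i: "i < n" and ab: "a:cB" "b:cB"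
	shows "ts c (t(i := a \<oplus>B b)) = ts c (t(i := a)) \<oplus>A ts c (t(i := b))"
proof -
	interpret A: ring A by (rule A_ring)
	interpret H: ring_hom_ring MP A clA by (rule ring_hom_ringI2[OF E.S_ring A_ring clA_hom])
	have m: "t(i := a \<oplus>B b):carrier TM" "t(i := a):carrier TM" "t(i := b):carrier TM" using TM_upd[OF t i] ab by auto
	let ?s = "%t. sgl k \<one> t"
	have "?s (t(i := a \<oplus>B b)) \<ominus>\<^bsub>MP\<^esub> (?s (t(i := a)) \<oplus>\<^bsub>MP\<^esub> ?s (t(i := b))):J"
		using tgens_J t i ab unfolding tgens_def by blast
	then have "clA (?s (t(i := a \<oplus>B b)) \<ominus>\<^bsub>MP\<^esub> (?s (t(i := a)) \<oplus>\<^bsub>MP\<^esub> ?s (t(i := b)))) = \<zero>A"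
		unfolding A_eq by (rule E.S.quotient_zero[OF J_ideal])
	then have "ts \<one> (t(i := a \<oplus>B b)) \<ominus>A (ts \<one> (t(i := a)) \<oplus>A ts \<one> (t(i := b))) = \<zero>A"
		unfolding ts_cl using m MP_single by (simp add: a_minus_def del: E.add_S carrier_product_group)
	then have one: "ts \<one> (t(i := a \<oplus>B b)) = ts \<one> (t(i := a)) \<oplus>A ts \<one> (t(i := b))"
		by (rule iffD1[OF A.r_right_minus_eq[OF ts_closed[OF one_closed m(1)] A.a_closed[OF ts_closed[OF one_closed m(2)] ts_closed[OF one_closed m(3)]]]])
	have w: "ts c s = wc c \<otimes>A ts \<one> s" if "s:carrier TM" for s using wc_mult(1)[OF c one_closed that] c by simp
	show ?thesis
		unfolding w[OF m(1)] w[OF m(2)] w[OF m(3)] one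
		using rhc[OF wc_hom c] ts_closed[OF one_closed] m by (intro A.r_distr) auto
qed

lemma ts_coord_smult:
	assumes c: "c:carrier k" and d: "d:carrier k" and t: "t:carrier TM" and i: "i < n" and a: "a:cB"
	shows "ts c (t(i := bc d \<otimes>B a)) = ts (c \<otimes> d) (t(i := a))"
proof -
	interpret A: ring A by (rule A_ring)
	interpret H: ring_hom_ring MP A clA by (rule ring_hom_ringI2[OF E.S_ring A_ring clA_hom])
	have m: "t(i := bc d \<otimes>B a):carrier TM" "t(i := a):carrier TM" using TM_upd[OF t i] a Q.u_closed[OF d] by auto
	have "sgl k \<one> (t(i := bc d \<otimes>B a)) \<ominus>\<^bsub>MP\<^esub> sgl k d (t(i := a)):J"
		using tgens_J t i a d unfolding tgens_def by blast
	then have "clA (sgl k \<one> (t(i := bc d \<otimes>B a)) \<ominus>\<^bsub>MP\<^esub> sgl k d (t(i := a))) = \<zero>A"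
		unfolding A_eq by (rule E.S.quotient_zero[OF J_ideal])
	then have "ts \<one> (t(i := bc d \<otimes>B a)) \<ominus>A ts d (t(i := a)) = \<zero>A"
		unfolding ts_cl using m MP_single d by (simp add: a_minus_def del: E.add_S carrier_product_group)
	then have one: "ts \<one> (t(i := bc d \<otimes>B a)) = ts d (t(i := a))"
		by (rule iffD1[OF A.r_right_minus_eq[OF ts_closed[OF one_closed m(1)] ts_closed[OF d m(2)]]])
	have "ts c (t(i := bc d \<otimes>B a)) = wc c \<otimes>A ts \<one> (t(i := bc d \<otimes>B a))" using wc_mult(1)[OF c one_closed m(1)] c by simp
	then show ?thesis unfolding one using wc_mult(1)[OF c d m(2)] by simp
qed

lemma A_induct [consumes 1, case_names zero add]:
	assumes x: "x:cA" and z: "R \<zero>A"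
		and s: "!!c t y. c:carrier k ==> t:carrier TM ==> y:cA ==> R y ==> R (ts c t \<oplus>A y)"
	shows "R x"
proof -
	interpret H: ring_hom_ring MP A clA by (rule ring_hom_ringI2[OF E.S_ring A_ring clA_hom])
	obtain f where f: "f:carrier MP" "x = clA f" using A_rep[OF x] .
	have "R (clA f)"
		using f(1)
	proof (induction f rule: E.S_induct)
		case (add f r t)
		then have "clA (sgl k r t \<oplus>\<^bsub>MP\<^esub> f) = ts r t \<oplus>A clA f"
			unfolding ts_cl using MP_single by (intro H.hom_add) auto
		then show ?case using s add H.hom_closed by simp
	qed (simp add: H.hom_zero z)
	then show ?thesis using f(2) by simp
qed

definition wtup :: "expon => nat => (wgen list => 'k) set" where
	"wtup d = (\<lambda>i\<in>{..<n}. Q.nf (fst (d i)) (snd (d i)))"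

lemma wtup_TM: "wtup d:carrier TM"
	unfolding TM_carrier wtup_def by simp

abbreviation "WS == {ts c (wtup d) | c d. c:carrier k & d:carrier (expo n)}"

lemma WS_sub: "WS \<subseteq> cA"
	using ts_closed wtup_TM by blast

lemma tensors_span:
	assumes "j \<le> n" "t:carrier TM" "!!i. j \<le> i ==> i < n ==> \<exists>a m. t i = Q.nf a m" "c:carrier k"
	shows "ts c t:add_closure A WS"
	using assms
proof (induction j arbitrary: t c)
	case 0
	then obtain a m where am: "!!i. i < n ==> t i = Q.nf (a i) (m i)" by (metis le0)
	define d where "d i = (if i < n then (a i, m i) else 0)" for i
	have "t = wtup d"
		using 0(2) am unfolding TM_carrier wtup_def d_def by (auto simp: fun_eq_iff restrict_def)
	moreover have "d:carrier (expo n)" by (simp add: d_def)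
	ultimately have "ts c t:WS" using 0(4) by blast
	then show ?case by (rule abelian_monoid.add_closure_base[OF ring.axioms(1)[OF A_ring, THEN abelian_group.axioms(1)] WS_sub])
next
	case (Suc j)
	have j: "j < n" using Suc.prems by simp
	interpret A: ring A by (rule A_ring)
	have t: "t(j := t j) = t" by simp
	have tj: "t j:cB" using Suc.prems(2) j unfolding TM_carrier by blast
	have z: "ts c (t(j := \<zero>B)) = \<zero>A" if "c:carrier k" for c
	proof -
		have "ts c (t(j := bc \<zero> \<otimes>B t j)) = ts (c \<otimes> \<zero>) (t(j := t j))" by (rule ts_coord_smult[OF that zero_closed Suc.prems(2) j tj])
		moreover have "bc \<zero> = \<zero>B" by (rule rh0[OF bc_hom ring_axioms B_ring])
		ultimately show ?thesis using that tj ts_zero ring.ring_simprules(24)[OF B_ring] by simp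
	qed
	have "ts c (t(j := b)):add_closure A WS" if "b:Q.NC" for b
		using that
	proof (induction b rule: add_closure.induct)
		case zero
		show ?case unfolding z[OF Suc.prems(4)] by (rule add_closure.zero)
	next
		case (add g b)
		obtain e a m where g: "g = bc e \<otimes>B Q.nf a m" "e:carrier k" using add(1) unfolding Q.NF_def by blast
		have gB: "g:cB" "b:cB" using add Q.NF_sub Q.NC_closed by auto
		have "ts c (t(j := g)) = ts (c \<otimes> e) (t(j := Q.nf a m))"
			unfolding g(1) by (rule ts_coord_smult[OF Suc.prems(4) g(2) Suc.prems(2) j]) simp
		also have "...:add_closure A WS"
		proof (rule Suc.IH)
			show "t(j := Q.nf a m):carrier TM" by (rule TM_upd[OF Suc.prems(2) j]) simp
			fix i assume i: "j \<le> i" "i < n"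
			show "\<exists>a' m'. (t(j := Q.nf a m)) i = Q.nf a' m'"
				using Suc.prems(3)[of i] i by (cases "i = j") auto
		qed (use j g(2) Suc.prems(4) in auto)
		finally have "ts c (t(j := g)):add_closure A WS" .
		then show ?case
			unfolding ts_coord_add[OF Suc.prems(4,2) j gB] using add(3) by (intro A.add_closure_add[OF WS_sub])
	qed
	from this[OF B_span[OF tj]] show ?case by simp
qed

lemma A_span: assumes "x:cA" shows "x:add_closure A WS"
	using assms
proof (induction x rule: A_induct)
	case zero
	show ?case by (rule add_closure.zero)
next
	case (add c t y)
	interpret A: ring A by (rule A_ring)
	have "ts c t:add_closure A WS" by (rule tensors_span[OF order_refl add(2) _ add(1)]) auto
	then show ?case using add(4) by (rule A.add_closure_add[OF WS_sub])
qed

definition Ps :: "(expon => 'k) => 'k weyl" where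
	"Ps = P.extend A wc (%d. ts \<one> (wtup d))"

lemma Ps_closed: "g:cP ==> Ps g:cA"
	and Ps_add: "f:cP ==> g:cP ==> Ps (f \<oplus>P g) = Ps f \<oplus>A Ps g"
	and Ps_single: "c:carrier k ==> d:carrier (expo n) ==> Ps (single c d) = ts c (wtup d)"
proof -
	have u1: "wc:carrier k \<rightarrow> cA" using rhc[OF wc_hom] by blast
	have t1: "(%d. ts \<one> (wtup d)):carrier (expo n) \<rightarrow> cA" using ts_closed wtup_TM by blast
	note ctx = A_ring u1 rha[OF wc_hom] t1
	show "g:cP ==> Ps g:cA" unfolding Ps_def by (rule P.extend_closed[OF ctx])
	show "f:cP ==> g:cP ==> Ps (f \<oplus>P g) = Ps f \<oplus>A Ps g" unfolding Ps_def by (rule P.extend_add[OF ctx])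
	show "c:carrier k ==> d:carrier (expo n) ==> Ps (single c d) = ts c (wtup d)"
		unfolding Ps_def using P.extend_single[OF ctx, of c d] wc_mult(1)[OF _ one_closed wtup_TM] by simp
qed

lemma Ps_surj: assumes "x:cA" obtains g where "g:cP" "Ps g = x"
proof -
	have "\<exists>g\<in>carrier P. Ps g = x"
		using A_span[OF assms]
	proof (induction x rule: add_closure.induct)
		case zero
		have "Ps (single \<zero> 0) = \<zero>A" using Ps_single[of \<zero> 0] ts_zero by simp
		then show ?case by (intro bexI[of _ "single \<zero> 0"]) simp_all
	next
		case (add g x)
		then obtain f c d where "f:cP" "Ps f = x" "g = ts c (wtup d)" "c:carrier k" "d:carrier (expo n)" by blast
		then show ?case using Ps_add[of "single c d" f] Ps_single P.S.a_closed[of "single c d" f] P.single_closed by (intro bexI[of _ "single c d \<oplus>P f"]) auto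
	qed
	then show ?thesis using that by blast
qed

abbreviation "mp == %p f t. f (t \<circ> p)"

lemma TM_perm: "p permutes {..<n} ==> t:carrier TM ==> t \<circ> p:carrier TM"
	unfolding TM_carrier using permutes_in_image[of p "{..<n}"] permutes_not_in[of p "{..<n}"] by auto

lemma mp_single: assumes p: "p permutes {..<n}" shows "mp p (sgl k c t) = sgl k c (t \<circ> pinv p)"
proof -
	have "s \<circ> p = t \<longleftrightarrow> s = t \<circ> pinv p" for s
		using permutes_inv_o[OF p] by (metis comp_assoc comp_id)
	then show ?thesis by (simp add: skew_single_def)
qed

lemma mp_closed: assumes p: "p permutes {..<n}" and f: "f:carrier MP" shows "mp p f:carrier MP"
proof -
	have sub: "{t. mp p f t ~= \<zero>} \<subseteq> (%t. t \<circ> pinv p) ` {t. f t ~= \<zero>}"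
	proof
		fix t assume "t:{t. mp p f t ~= \<zero>}"
		moreover have "t = (t \<circ> p) \<circ> pinv p" using permutes_inv_o(1)[OF p] by (simp add: o_assoc[symmetric])
		ultimately show "t:(%t. t \<circ> pinv p) ` {t. f t ~= \<zero>}" by blast
	qed
	have "t:carrier TM" if "t:{t. mp p f t ~= \<zero>}" for t
		using sub that E.S_supp[OF f] TM_perm[OF permutes_inv[OF p]] by blast
	then show ?thesis
		unfolding E.carrier_S using finite_subset[OF sub finite_imageI[OF E.S_finite[OF f]]] E.S_closed[OF f] by blast
qed

lemma TM_mult_perm: assumes p: "p permutes {..<n}" shows "(s \<otimes>\<^bsub>TM\<^esub> t) \<circ> p = (s \<circ> p) \<otimes>\<^bsub>TM\<^esub> (t \<circ> p)" "\<one>\<^bsub>TM\<^esub> \<circ> p = \<one>\<^bsub>TM\<^esub>"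
	using permutes_in_image[OF p] by (auto simp: fun_eq_iff restrict_def)

lemma mp_hom: assumes p: "p permutes {..<n}" shows "mp p:ring_hom MP MP"
proof (rule E.multiplicative_from_singles[OF E.S_ring])
	fix r s a b assume *: "r:carrier k" "s:carrier k" "a:carrier TM" "b:carrier TM"
	show "mp p (sgl k (r \<otimes> s) (a \<otimes>\<^bsub>TM\<^esub> b)) = mp p (sgl k r a) \<otimes>\<^bsub>MP\<^esub> mp p (sgl k s b)"
		unfolding mp_single[OF p] TM_mult_perm[OF permutes_inv[OF p]]
		using * TM_perm[OF permutes_inv[OF p]] by (intro E.single_mult[symmetric]) auto
next
	show "mp p (sgl k \<one> \<one>\<^bsub>TM\<^esub>) = \<one>\<^bsub>MP\<^esub>" unfolding mp_single[OF p] TM_mult_perm(2)[OF permutes_inv[OF p]] by (simp only: E.one_S)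
qed (use mp_closed[OF p] in auto)

text \<open>A permutation sends the multilinearity relations at slot \<open>i\<close> to those at slot \<open>p i\<close>.\<close>

lemma mp_J: assumes p: "p permutes {..<n}" and f: "f:J" shows "mp p f:J"
proof -
	interpret A: ring A by (rule A_ring)
	interpret H: ring_hom_ring MP A "clA \<circ> mp p"
		by (rule ring_hom_ringI2[OF E.S_ring A_ring ring_hom_trans[OF mp_hom[OF p] clA_hom]])
	have upd: "(t(i := a)) \<circ> pinv p = (t \<circ> pinv p)(p i := a)" for t :: "nat => (wgen list => 'k) set" and i a
		using permutes_inverses[OF p] by (auto simp: fun_eq_iff)
	have S: "(clA \<circ> mp p) (sgl k c t) = ts c (t \<circ> pinv p)" for c t by (simp add: mp_single[OF p] ts_cl)
	have "(clA \<circ> mp p) f = \<zero>A"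
	proof (rule E.S.genideal_le_kernel[OF A_ring H.homh tgens_closed])
		show "f:Idl\<^bsub>MP\<^esub> tgens" using f J_eq by simp
		fix g assume "g:tgens"
		then consider (add) t i a b where "t:carrier TM" "i < n" "a:cB" "b:cB"
				"g = sgl k \<one> (t(i := a \<oplus>B b)) \<ominus>\<^bsub>MP\<^esub> (sgl k \<one> (t(i := a)) \<oplus>\<^bsub>MP\<^esub> sgl k \<one> (t(i := b)))"
			| (smult) t i a c where "t:carrier TM" "i < n" "a:cB" "c:carrier k"
				"g = sgl k \<one> (t(i := bc c \<otimes>B a)) \<ominus>\<^bsub>MP\<^esub> sgl k c (t(i := a))"
			unfolding tgens_def by blast
		then show "(clA \<circ> mp p) g = \<zero>A"
		proof cases
			case add
			have pi: "p i < n" using permutes_in_image[OF p, of i] add(2) by simp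
			have t': "t \<circ> pinv p:carrier TM" by (rule TM_perm[OF permutes_inv[OF p] add(1)])
			have ab: "a \<oplus>B b:cB" using ring.ring_simprules(1)[OF B_ring add(3,4)] .
			have m: "sgl k \<one> (t(i := x)):carrier MP" if "x:cB" for x using MP_single TM_upd[OF add(1,2) that] by blast
			have "(clA \<circ> mp p) g = ts \<one> ((t \<circ> pinv p)(p i := a \<oplus>B b)) \<ominus>A (ts \<one> ((t \<circ> pinv p)(p i := a)) \<oplus>A ts \<one> ((t \<circ> pinv p)(p i := b)))"
				unfolding add(5) a_minus_def upd[symmetric] S[symmetric]
				using m[OF add(3)] m[OF add(4)] m[OF ab] H.hom_add H.hom_a_inv E.S.a_closed E.S.a_inv_closed by presburger
			then show ?thesis
				unfolding ts_coord_add[OF one_closed t' pi add(3,4)]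
				using A.r_neg ts_closed[OF one_closed TM_upd[OF t' pi]] add(3,4) by (simp add: a_minus_def)
		next
			case smult
			have pi: "p i < n" using permutes_in_image[OF p, of i] smult(2) by simp
			have t': "t \<circ> pinv p:carrier TM" by (rule TM_perm[OF permutes_inv[OF p] smult(1)])
			have ca: "bc c \<otimes>B a:cB" using ring.ring_simprules(5)[OF B_ring Q.u_closed[OF smult(4)] smult(3)] .
			have m: "sgl k d (t(i := x)):carrier MP" if "x:cB" "d:carrier k" for x d using MP_single TM_upd[OF smult(1,2) that(1)] that(2) by blast
			have "(clA \<circ> mp p) g = ts \<one> ((t \<circ> pinv p)(p i := bc c \<otimes>B a)) \<ominus>A ts c ((t \<circ> pinv p)(p i := a))"
				unfolding smult(5) a_minus_def upd[symmetric] S[symmetric]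
				using m[OF ca one_closed] m[OF smult(3,4)] H.hom_add H.hom_a_inv E.S.a_inv_closed by presburger
			then show ?thesis
				unfolding ts_coord_smult[OF one_closed smult(4) t' pi smult(3)]
				using A.r_neg ts_closed[OF smult(4) TM_upd[OF t' pi smult(3)]] smult(4) by (simp add: a_minus_def)
		qed
	qed
	moreover have fM: "mp p f:carrier MP" using mp_closed[OF p] ideal.Icarr[OF J_ideal f] by blast
	ultimately have "J +>\<^bsub>MP\<^esub> mp p f = J" by (simp add: A_eq FactRing_def)
	then show ?thesis using ideal.rcos_const_imp_mem[OF J_ideal fM] by simp
qed

lemma weyl_perm_cl: assumes p: "p permutes {..<n}" and f: "f:carrier MP" shows "weyl_perm p (clA f) = clA (mp p f)"
proof -
	have e: "mp p (mp (pinv p) h) = h" for h :: "(nat => (wgen list => 'k) set) => 'k"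
		using permutes_inv_o(1)[OF p] by (simp add: comp_assoc)
	have im: "mp p ` J = J"
	proof (intro equalityI subsetI)
		fix h assume "h:J"
		then have "mp (pinv p) h:J" by (rule mp_J[OF permutes_inv[OF p]])
		with e[of h, symmetric] show "h:mp p ` J" by (rule image_eqI)
	qed (use mp_J[OF p] in auto)
	have "weyl_perm p (clA f) = {mp p h \<oplus>\<^bsub>MP\<^esub> mp p f | h. h:J}"
		unfolding weyl_perm_def a_r_coset_def' by auto
	also have "... = {h \<oplus>\<^bsub>MP\<^esub> mp p f | h. h:mp p ` J}" by blast
	also have "... = clA (mp p f)" unfolding im a_r_coset_def' by auto
	finally show ?thesis .
qed

lemma weyl_perm_ts: assumes p: "p permutes {..<n}" and c: "c:carrier k" "t:carrier TM" shows "weyl_perm p (ts c t) = ts c (t \<circ> pinv p)"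
	unfolding ts_cl weyl_perm_cl[OF p MP_single[OF c]] mp_single[OF p] ..

lemma weyl_perm_hom: assumes p: "p permutes {..<n}" shows "weyl_perm p:ring_hom A A"
proof (rule ring_hom_memI)
	fix x y assume "x:cA" "y:cA"
	then obtain f g where fg: "f:carrier MP" "x = clA f" "g:carrier MP" "y = clA g" using A_rep by metis
	note m = mp_closed[OF p fg(1)] mp_closed[OF p fg(3)]
	show "weyl_perm p x:cA" unfolding fg(2) weyl_perm_cl[OF p fg(1)] by (rule rhc[OF clA_hom m(1)])
	have "x \<otimes>A y = clA (f \<otimes>\<^bsub>MP\<^esub> g)" unfolding fg(2,4) using rhm[OF clA_hom fg(1,3)] by simp
	then show "weyl_perm p (x \<otimes>A y) = weyl_perm p x \<otimes>A weyl_perm p y"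
		unfolding fg(2,4) using weyl_perm_cl[OF p] fg E.S.m_closed rhm[OF mp_hom[OF p] fg(1,3)] rhm[OF clA_hom m] by simp
	have "x \<oplus>A y = clA (f \<oplus>\<^bsub>MP\<^esub> g)" unfolding fg(2,4) using rha[OF clA_hom fg(1,3)] by simp
	then show "weyl_perm p (x \<oplus>A y) = weyl_perm p x \<oplus>A weyl_perm p y"
		unfolding fg(2,4) using weyl_perm_cl[OF p fg(1)] weyl_perm_cl[OF p fg(3)] weyl_perm_cl[OF p E.S.a_closed[OF fg(1,3)]]
			rha[OF mp_hom[OF p] fg(1,3)] rha[OF clA_hom m] by simp
next
	show "weyl_perm p \<one>A = \<one>A"
		unfolding A_one weyl_perm_ts[OF p one_closed TM_one] TM_mult_perm(2)[OF permutes_inv[OF p]] ..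
qed

lemma weyl_perm_Ps: assumes p: "p permutes {..<n}" and g: "g:cP" shows "weyl_perm p (Ps g) = Ps (permP p g)"
proof (rule P.additive_eqI[OF ring.is_abelian_group[OF A_ring] g, where F = "%g. weyl_perm p (Ps g)" and G = "%g. Ps (permP p g)"])
	fix r d assume rd: "r:carrier k" "d:carrier (expo n)"
	have "wtup d \<circ> pinv p = wtup (d \<circ> pinv p)"
		using permutes_in_image[OF permutes_inv[OF p]] by (auto simp: wtup_def fun_eq_iff restrict_def)
	then show "weyl_perm p (Ps (single r d)) = Ps (permP p (single r d))"
		using rd comp_expo[OF permutes_inv[OF p] rd(2)] by (simp add: Ps_single permP_single[OF p] weyl_perm_ts[OF p] wtup_TM del: expo_simps carrier_product_group)
qed (simp_all add: Ps_add Ps_closed rha[OF weyl_perm_hom[OF p]] permP_add permP_closed[OF p] del: P.add_S)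

end

section \<open>The representation by skew operators\<close>

context galois_laurent
begin

definition mi :: "(expon => 'k) => (nat => int) => ('l => 'l) => 'l" where
	"mi f a = sgl L (io f) (tr a)"

lemma mi_closed: "f:Lam ==> a:words ==> mi f a:cT"
	unfolding mi_def T_def by (rule T.single_closed) (simp_all add: io_closed Mon_def)

lemma mi_mult: assumes "f:Lam" "g:Lam" "a:words" "b:words" shows "mi f a \<otimes>T mi g b = mi (f \<otimes>P tor a g) (a + b)"
proof -
	have m: "tr a:carrier BM" "tr b:carrier BM" using assms by (simp_all add: Mon_def)
	have e: "tr a \<otimes>\<^bsub>BM\<^esub> tr b = tr (a + b)" by (simp add: tr_mult)
	have "io f \<otimes>L tr a (io g) = io (f \<otimes>P tor a g)" using assms by (simp add: tr_io io_mult tor_Lam)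
	then show ?thesis
		unfolding mi_def T_def using T.single_mult[of "io f" "io g" "tr a" "tr b"] m assms(1,2) io_closed unfolding e by simp
qed

lemma mi_add: "f:Lam ==> g:Lam ==> mi f a \<oplus>T mi g a = mi (f \<oplus>P g) a"
	unfolding mi_def T_def using T.single_add[of "io f" "io g" "tr a"] by (simp add: io_closed io_add del: T.add_S P.add_S)

lemma mi_emb: "emb (io f) = mi f 0"
	by (simp add: skew_embed_def mi_def tr_one)

lemma mi_one: "mi \<one>P 0 = \<one>T"
	unfolding mi_emb[symmetric] io_one by (rule rh1[OF emb_hom])

lemma const_Lam: "c:carrier k ==> const c:Lam"
	using const_Gam by simp

lemma const_one: "const \<one> = \<one>P"
	by (simp add: const_def P.one_S)

abbreviation uT :: "'k => ('l => 'l) => 'l" where "uT == %c. mi (const c) 0"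

lemma uT_closed: "c:carrier k ==> uT c:cT"
	by (rule mi_closed[OF const_Lam words_0])

lemma uT_mult: "c:carrier k ==> f:Lam ==> a:words ==> uT c \<otimes>T mi f a = mi (const c \<otimes>P f) a"
	using mi_mult[OF const_Lam _ words_0, of c f a] by (simp add: tor_0)

lemma uT_hom: "uT:ring_hom k T"
proof (rule ring_hom_memI)
	fix c d assume cd: "c:carrier k" "d:carrier k"
	show "uT c:cT" by (rule uT_closed[OF cd(1)])
	show "uT (c \<otimes> d) = uT c \<otimes>T uT d" unfolding uT_mult[OF cd(1) const_Lam[OF cd(2)] words_0] const_ring[OF cd] ..
	show "uT (c \<oplus> d) = uT c \<oplus>T uT d" unfolding mi_add[OF const_Lam[OF cd(1)] const_Lam[OF cd(2)]] const_ring[OF cd] ..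
qed (simp add: const_one mi_one)

lemma uT_central: assumes c: "c:carrier k" and x: "x:cT" shows "uT c \<otimes>T x = x \<otimes>T uT c"
proof -
	have cL: "io (const c):cL" using io_closed const_Lam[OF c] by blast
	have "io (const c) \<otimes>L x m = x m \<otimes>L (if m:Mon then m (io (const c)) else \<zero>L)" for m
	proof (cases "m:Mon")
		case True
		then obtain a where "m = tr a" unfolding Mon_def by blast
		then have "m (io (const c)) = io (const c)" using tr_io[OF const_Lam[OF c]] tor_const[OF c] by simp
		then show ?thesis using True F.L.m_comm[OF cL T_closed[OF x]] by simp
	next
		case False
		then have "x m = \<zero>L" using x T.S_out[of x m] unfolding T_def by simp
		then show ?thesis using False cL by simp
	qed
	then show ?thesis unfolding mi_emb[symmetric] emb_mult_left[OF cL x] emb_mult_right[OF cL x] by blast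
qed

definition uv :: "nat => int => nat => int" where "uv i m = (%j. if j = i then m else 0)"

lemma uv_words: "i < n ==> uv i m:words"
	by (simp add: uv_def words_def)

lemma uv_add: "uv i a + uv i b = uv i (a + b)" and uv_0: "uv i 0 = 0"
	by (simp_all add: uv_def fun_eq_iff)

lemma tor_lf: assumes i: "i < n" shows "tor a (lf i c) = lf i (c + a i)"
proof -
	have c: "const (qz e):cP" for e using const_closed[OF qz_closed] .
	have z: "zv i:cP" using zv_Lam[OF i] by simp
	have "tor a (lf i c) = const (qz c) \<otimes>P (const (qz (a i)) \<otimes>P zv i) \<oplus>P const h0"
		unfolding lf_def using c z const_closed[OF h0_closed]
		by (simp add: tor_add rhm[OF tor_hom] tor_const qz_closed h0_closed tor_zv[OF i] del: P.add_S)
	also have "const (qz c) \<otimes>P (const (qz (a i)) \<otimes>P zv i) = const (qz (c + a i)) \<otimes>P zv i"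
		using c z const_ring(1)[OF qz_closed qz_closed] by (simp add: P.S.m_assoc[symmetric] qz_add)
	finally show ?thesis by (simp only: lf_def)
qed

lemma pc1_nonneg: "0 \<le> m ==> pc1 i m = \<one>P"
	by (simp add: pc1_def)

lemma pc1_Suc: assumes i: "i < n" shows "pc1 i (- int (Suc m)) = pc1 i (- int m) \<otimes>P lf i (- 1 - int m)"
proof -
	have e: "nat (- (- int (Suc m))) = Suc m" "nat (- (- int m)) = m" by simp_all
	have c: "(%s. lf i (- 1 - int s)):I \<rightarrow> cP" for I using lf_Lam[OF i] by auto
	have ins: "(\<Otimes>\<^bsub>P\<^esub>s\<in>insert m {..<m}. lf i (- 1 - int s)) = lf i (- 1 - int m) \<otimes>P (\<Otimes>\<^bsub>P\<^esub>s\<in>{..<m}. lf i (- 1 - int s))"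
		by (rule P.finprod_insert) (use lf_Lam[OF i] in auto)
	show ?thesis
		unfolding pc1_def e lessThan_Suc ins by (rule P.m_comm[OF Lam_P[OF lf_Lam[OF i]] P.finprod_closed[OF c]])
qed

definition gi :: "nat => wgen => ('l => 'l) => 'l" where
	"gi i g = (case g of GenX => mi (lf i (- 1)) (uv i (- 1)) | GenY => mi \<one>P (uv i 1))"

lemma gi_closed: "i < n ==> gi i g:cT"
	using mi_closed[OF lf_Lam uv_words] mi_closed[OF Lam_one uv_words] by (cases g) (simp_all add: gi_def)

definition wv :: "nat => wgen list => ('l => 'l) => 'l" where "wv i w = foldr (%g x. gi i g \<otimes>T x) w \<one>T"

lemma wv_closed: assumes "i < n" shows "wv i w:cT"
proof -
	interpret T': ring T by (rule T_ring)
	show ?thesis by (induction w) (simp_all add: wv_def gi_closed[OF assms])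
qed

lemma wv_append: assumes i: "i < n" shows "wv i (v @ w) = wv i v \<otimes>T wv i w"
proof -
	interpret T': ring T by (rule T_ring)
	show ?thesis
		using wv_closed[OF i] gi_closed[OF i] by (induction v) (simp_all add: wv_def T'.m_assoc)
qed

definition E1 :: "nat => (wgen list => 'k) => ('l => 'l) => 'l" where "E1 i = W.extend T uT (wv i)"

lemma E1_hom: assumes i: "i < n" shows "E1 i:ring_hom FA T"
	unfolding FA_eq E1_def
proof (rule W.extend_hom[OF T_ring uT_hom])
	show "wv i \<one>\<^bsub>WM\<^esub> = \<one>T" by (simp add: wv_def)
	show "wv i (a \<otimes>\<^bsub>WM\<^esub> b) = wv i a \<otimes>T wv i b" for a b using wv_append[OF i] by simp
	show "wv i:carrier WM \<rightarrow> cT" using wv_closed[OF i] by simp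
	show "wv i a \<otimes>T uT r = uT r \<otimes>T wv i a" if "r:carrier k" for a r using uT_central[OF that wv_closed[OF i]] by simp
qed

lemma E1_single: assumes i: "i < n" and c: "c:carrier k" shows "E1 i (sgl k c w) = uT c \<otimes>T wv i w"
proof -
	have 1: "uT:carrier k \<rightarrow> cT" "wv i:carrier WM \<rightarrow> cT" using uT_closed wv_closed[OF i] by auto
	show ?thesis unfolding E1_def by (rule W.extend_single[OF T_ring 1(1) rha[OF uT_hom] 1(2) c]) simp_all
qed

lemma gi_YX: assumes i: "i < n" shows "gi i GenY \<otimes>T gi i GenX = mi (lf i 0) 0"
proof -
	have "gi i GenY \<otimes>T gi i GenX = mi (\<one>P \<otimes>P tor (uv i 1) (lf i (- 1))) (uv i 1 + uv i (- 1))"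
		unfolding gi_def by (simp add: mi_mult[OF Lam_one lf_Lam[OF i] uv_words[OF i] uv_words[OF i]])
	moreover have "tor (uv i 1) (lf i (- 1)) = lf i 0" unfolding tor_lf[OF i] by (simp add: uv_def)
	moreover have "\<one>P \<otimes>P lf i 0 = lf i 0" using lf_Lam[OF i, of 0] by simp
	ultimately show ?thesis by (simp add: uv_add uv_0)
qed

lemma tor_one: "tor a \<one>P = \<one>P"
	by (rule rh1[OF tor_hom])

lemma gi_XY: assumes i: "i < n" shows "gi i GenX \<otimes>T gi i GenY = mi (lf i (- 1)) 0"
proof -
	have "gi i GenX \<otimes>T gi i GenY = mi (lf i (- 1) \<otimes>P tor (uv i (- 1)) \<one>P) (uv i (- 1) + uv i 1)"
		unfolding gi_def by (simp add: mi_mult[OF lf_Lam[OF i] Lam_one uv_words[OF i] uv_words[OF i]])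
	moreover have "lf i (- 1) \<otimes>P \<one>P = lf i (- 1)" using lf_Lam[OF i, of "- 1"] by simp
	ultimately show ?thesis by (simp add: uv_add uv_0 tor_one)
qed

lemma lf_relation: assumes i: "i < n" shows "lf i 0 = const q \<otimes>P lf i (- 1) \<oplus>P \<one>P"
proof -
	have z: "zv i:cP" using zv_Lam[OF i] by simp
	have h: "q \<otimes> h0:carrier k" using q(1) h0_closed by simp
	note [simp] = const_closed[OF q(1)] const_closed[OF qz_closed] const_closed[OF h0_closed] const_closed[OF h] const_closed[OF one_closed]
	have 1: "const q \<otimes>P const (qz (- 1)) = const (qz 0)"
		unfolding const_ring(1)[OF q(1) qz_closed] using qz_add[of 1 "- 1"] by (simp add: qz_1)
	have "const q \<otimes>P lf i (- 1) = (const q \<otimes>P const (qz (- 1))) \<otimes>P zv i \<oplus>P const q \<otimes>P const h0"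
		unfolding lf_def using z by (simp add: P.S.r_distr P.S.m_assoc del: P.add_S)
	then have "const q \<otimes>P lf i (- 1) \<oplus>P \<one>P = const (qz 0) \<otimes>P zv i \<oplus>P (const (q \<otimes> h0) \<oplus>P const \<one>)"
		unfolding 1 const_ring(1)[OF q(1) h0_closed] const_one[symmetric] using z by (simp add: P.S.a_assoc del: P.add_S)
	also have "const (q \<otimes> h0) \<oplus>P const \<one> = const h0"
		unfolding const_ring(2)[OF h one_closed] h0_eq[symmetric] ..
	finally show ?thesis by (simp only: lf_def)
qed

lemma E1_relation: assumes i: "i < n" shows "E1 i rel1 = \<zero>T"
proof -
	interpret T': ring T by (rule T_ring)
	interpret FA: ring FA by (rule FA_ring)
	interpret H: ring_hom_ring FA T "E1 i" by (rule ring_hom_ringI2[OF FA_ring T_ring E1_hom[OF i]])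
	have m: "sgl k \<one> [GenY, GenX]:carrier FA" "sgl k q [GenX, GenY]:carrier FA"
		using FA_single q(1) by auto
	have w: "wv i [GenY, GenX] = mi (lf i 0) 0" "wv i [GenX, GenY] = mi (lf i (- 1)) 0"
		using gi_YX[OF i] gi_XY[OF i] gi_closed[OF i] by (simp_all add: wv_def)
	have l0: "const q \<otimes>P lf i (- 1):Lam" using const_Lam[OF q(1)] lf_Lam[OF i] Lam_mult by blast
	have E: "E1 i (sgl k \<one> [GenY, GenX]) = mi (const q \<otimes>P lf i (- 1)) 0 \<oplus>T \<one>T"
		"E1 i (sgl k q [GenX, GenY]) = mi (const q \<otimes>P lf i (- 1)) 0"
	proof -
		have "E1 i (sgl k \<one> [GenY, GenX]) = mi (lf i 0) 0"
			unfolding E1_single[OF i one_closed] w const_one mi_one using mi_closed[OF lf_Lam[OF i] words_0] by simp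
		then show "E1 i (sgl k \<one> [GenY, GenX]) = mi (const q \<otimes>P lf i (- 1)) 0 \<oplus>T \<one>T"
			unfolding mi_one[symmetric] mi_add[OF l0 Lam_one] lf_relation[OF i] .
		show "E1 i (sgl k q [GenX, GenY]) = mi (const q \<otimes>P lf i (- 1)) 0"
			unfolding E1_single[OF i q(1)] w by (rule uT_mult[OF q(1) lf_Lam[OF i] words_0])
	qed
	have c: "mi (const q \<otimes>P lf i (- 1)) 0:cT" by (rule mi_closed[OF l0 words_0])
	have "E1 i rel1 = (mi (const q \<otimes>P lf i (- 1)) 0 \<oplus>T \<one>T) \<ominus>T mi (const q \<otimes>P lf i (- 1)) 0 \<ominus>T \<one>T"
		unfolding rel1_def a_minus_def using m by (simp add: E[unfolded a_minus_def])
	also have "... = \<zero>T"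
	proof -
		have "(mi (const q \<otimes>P lf i (- 1)) 0 \<oplus>T \<one>T) \<ominus>T mi (const q \<otimes>P lf i (- 1)) 0 = \<one>T"
			using c T'.a_comm[OF c T'.one_closed] by (simp add: a_minus_def T'.a_assoc T'.r_neg)
		then show ?thesis by (simp add: a_minus_def T'.r_neg)
	qed
	finally show ?thesis .
qed

definition ph :: "nat => (wgen list => 'k) set => ('l => 'l) => 'l" where
	"ph i = (SOME g. g:ring_hom B T & (\<forall>f\<in>carrier FA. g (cl1 f) = E1 i f))"

lemma ph: assumes i: "i < n" shows ph_hom: "ph i:ring_hom B T" and ph_cl: "f:carrier FA ==> ph i (cl1 f) = E1 i f"
proof -
	interpret FA: ring FA by (rule FA_ring)
	have "E1 i x = \<zero>T" if "x:weyl1_ideal k q" for x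
	proof (rule FA.genideal_le_kernel[OF T_ring E1_hom[OF i]])
		show "{rel1} \<subseteq> carrier FA" using rel1_closed by simp
		show "x:Idl\<^bsub>FA\<^esub> {rel1}" using that unfolding weyl1_ideal_def rel1_def .
		show "g:{rel1} ==> E1 i g = \<zero>T" for g using E1_relation[OF i] by simp
	qed
	from FA.quotient_hom[OF I1(1) T_ring E1_hom[OF i] this]
	obtain g where "g:ring_hom (FA Quot weyl1_ideal k q) T" "!!a. a:carrier FA ==> g (cl1 a) = E1 i a" by blast
	then have ex: "\<exists>g. g:ring_hom B T & (\<forall>f\<in>carrier FA. g (cl1 f) = E1 i f)" unfolding weyl1_def by blast
	show "ph i:ring_hom B T" "f:carrier FA ==> ph i (cl1 f) = E1 i f"
		using someI_ex[OF ex] unfolding ph_def by blast+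
qed

lemma ph_bc: assumes i: "i < n" and c: "c:carrier k" shows "ph i (bc c) = uT c"
proof -
	interpret T': ring T by (rule T_ring)
	show ?thesis
		unfolding bc_cl ph_cl[OF i FA_single[OF c]] E1_single[OF i c] using uT_closed[OF c] by (simp add: wv_def)
qed

lemma ph_bg: assumes i: "i < n" shows "ph i (bg g) = gi i g"
proof -
	interpret T': ring T by (rule T_ring)
	show ?thesis
		unfolding bg_cl ph_cl[OF i FA_single[OF one_closed]] E1_single[OF i one_closed] const_one mi_one
		using gi_closed[OF i] by (simp add: wv_def)
qed

lemma ph_z: assumes i: "i < n" shows "ph i Q.z = mi (zv i) 0"
proof -
	interpret T': ring T by (rule T_ring)
	interpret H: ring_hom_ring B T "ph i" by (rule ring_hom_ringI2[OF B_ring T_ring ph_hom[OF i]])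
	have z: "zv i:Lam" by (rule zv_Lam[OF i])
	have "lf i 0 = zv i \<oplus>P const h0" unfolding lf_def qz_0 const_one using z by (simp del: P.add_S)
	then have "mi (lf i 0) 0 = mi (zv i) 0 \<oplus>T uT h0" using mi_add[OF z const_Lam[OF h0_closed]] by simp
	moreover have "ph i Q.z \<oplus>T uT h0 = ph i (Q.z \<oplus>B bc h0)"
		using H.hom_add[OF Q.z_closed Q.u_closed[OF h0_closed]] ph_bc[OF i h0_closed] by simp
	moreover have "ph i (Q.z \<oplus>B bc h0) = mi (lf i 0) 0"
		unfolding Q.yx[symmetric] H.hom_mult[OF Q.xy(2) Q.xy(1)] ph_bg[OF i] by (rule gi_YX[OF i])
	ultimately have "ph i Q.z \<oplus>T uT h0 = mi (zv i) 0 \<oplus>T uT h0" by simp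
	then show ?thesis
		by (rule T'.add.r_cancel[OF _ H.hom_closed[OF Q.z_closed] mi_closed[OF z words_0] uT_closed[OF h0_closed]])
qed

lemma mi_pow0: assumes f: "f:Lam" shows "mi f 0 [^]\<^bsub>T\<^esub> (a::nat) = mi (f [^]P a) 0"
proof -
	have p: "f [^]P (m::nat):Lam" for m by (induction m) (simp_all add: Lam_one Lam_mult f)
	interpret T': ring T by (rule T_ring)
	show ?thesis
	proof (induction a)
		case 0
		show ?case by (simp only: T'.nat_pow_0 P.S.nat_pow_0 mi_one)
	next
		case (Suc a)
		show ?case unfolding T'.nat_pow_Suc P.S.nat_pow_Suc Suc mi_mult[OF p f words_0 words_0] tor_0[OF Lam_P[OF f]] add_0_left ..
	qed
qed

definition vf :: "nat => nat => int => expon => 'k" where "vf i a m = zv i [^]P a \<otimes>P pc1 i m"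

lemma zv_pow_Lam: "i < n ==> zv i [^]P (a::nat):Lam"
	by (induction a) (simp_all add: Lam_one Lam_mult zv_Lam)

lemma vf_Lam: "i < n ==> vf i a m:Lam"
	unfolding vf_def by (rule Lam_mult[OF zv_pow_Lam pc1_Lam])

lemma tor_vf: assumes i: "i < n" and b: "b i = 0" shows "tor b (vf i a m) = vf i a m"
proof -
	interpret H: ring_hom_cring P P "tor b"
		by (intro ring_hom_cring.intro ring_hom_cring_axioms.intro P_cring tor_hom)
	have z: "tor b (zv i) = zv i" using tor_zv[OF i, of b] b zv_Lam[OF i] by (simp add: qz_0 const_one)
	have "tor b (zv i [^]P a) = zv i [^]P a" using zv_Lam[OF i] zv_pow_Lam[OF i] by (induction a) (simp_all add: z tor_one)
	moreover have "tor b (pc1 i m) = pc1 i m"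
	proof -
		have c: "(%s. lf i (- 1 - int s)):{..<nat (- m)} \<rightarrow> cP" using lf_Lam[OF i] by auto
		have "tor b (pc1 i m) = (\<Otimes>\<^bsub>P\<^esub>s\<in>{..<nat (- m)}. (tor b \<circ> (%s. lf i (- 1 - int s))) s)"
			unfolding pc1_def by (rule H.hom_finprod[OF c])
		also have "... = pc1 i m" unfolding pc1_def by (rule P.finprod_cong') (use lf_Lam[OF i] tor_lf[OF i] b in auto)
		finally show ?thesis .
	qed
	ultimately show ?thesis
		unfolding vf_def using rhm[OF tor_hom Lam_P[OF zv_pow_Lam[OF i]] Lam_P[OF pc1_Lam[OF i]]] by simp
qed

lemma ph_nf: assumes i: "i < n" shows "ph i (Q.nf a m) = mi (vf i a m) (uv i m)"
proof -
	interpret T': ring T by (rule T_ring)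
	interpret H: ring_hom_ring B T "ph i" by (rule ring_hom_ringI2[OF B_ring T_ring ph_hom[OF i]])
	have Y: "ph i (bg GenY [^]B (l::nat)) = mi \<one>P (uv i (int l))" for l
	proof (induction l)
		case 0
		show ?case by (simp only: Q.B.nat_pow_0 of_nat_0 uv_0 mi_one H.hom_one)
	next
		case (Suc l)
		have "ph i (bg GenY [^]B Suc l) = mi \<one>P (uv i (int l)) \<otimes>T mi \<one>P (uv i 1)"
			using Suc bg_closed by (simp add: ph_bg[OF i] gi_def)
		then show ?case
			unfolding mi_mult[OF Lam_one Lam_one uv_words[OF i] uv_words[OF i]] tor_one uv_add by (simp add: add.commute)
	qed
	have X: "ph i (bg GenX [^]B (l::nat)) = mi (pc1 i (- int l)) (uv i (- int l))" for l
	proof (induction l)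
		case 0
		show ?case by (simp only: Q.B.nat_pow_0 of_nat_0 group_add_class.minus_zero uv_0 mi_one pc1_nonneg[OF order_refl] H.hom_one)
	next
		case (Suc l)
		have "ph i (bg GenX [^]B Suc l) = mi (pc1 i (- int l)) (uv i (- int l)) \<otimes>T mi (lf i (- 1)) (uv i (- 1))"
			using Suc bg_closed by (simp add: ph_bg[OF i] gi_def)
		also have "... = mi (pc1 i (- int l) \<otimes>P lf i (- 1 - int l)) (uv i (- int l + - 1))"
			unfolding mi_mult[OF pc1_Lam[OF i] lf_Lam[OF i] uv_words[OF i] uv_words[OF i]] tor_lf[OF i] uv_add by (simp add: uv_def)
		also have "... = mi (pc1 i (- int (Suc l))) (uv i (- int (Suc l)))" unfolding pc1_Suc[OF i] by (simp add: algebra_simps)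
		finally show ?case .
	qed
	have xy: "ph i (Q.xy_pow m) = mi (pc1 i m) (uv i m)"
	proof (cases "0 \<le> m")
		case True
		then show ?thesis using Y[of "nat m"] by (simp add: Q.xy_pow_def pc1_nonneg)
	next
		case False
		then show ?thesis using X[of "nat (- m)"] by (simp add: Q.xy_pow_def)
	qed
	have zp: "ph i (Q.z [^]B a) = mi (zv i [^]P a) 0"
		unfolding mi_pow0[OF zv_Lam[OF i], symmetric] ph_z[OF i, symmetric] by (induction a) simp_all
	have "ph i (Q.nf a m) = mi (zv i [^]P a) 0 \<otimes>T mi (pc1 i m) (uv i m)"
		unfolding Q.nf_def using zp xy by simp
	then show ?thesis
		unfolding mi_mult[OF zv_pow_Lam[OF i] pc1_Lam[OF i] words_0 uv_words[OF i]] vf_def using pc1_Lam[OF i] by (simp add: tor_0)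
qed

lemma ph_NF: assumes i: "i < n" and g: "g:Q.NF" obtains c a m where "c:carrier k" "ph i g = uT c \<otimes>T mi (vf i a m) (uv i m)"
proof -
	obtain c a m where c: "g = bc c \<otimes>B Q.nf a m" "c:carrier k" using g unfolding Q.NF_def by blast
	then show ?thesis
		using that rhm[OF ph_hom[OF i] Q.u_closed[OF c(2)] Q.nf_closed] ph_bc[OF i c(2)] ph_nf[OF i] by metis
qed

text \<open>The image of slot \<open>i\<close> only scales \<open>z\<^sub>i\<close> and has coefficients in \<open>z\<^sub>i\<close>.\<close>

lemma ph_commute:
	assumes i: "i < n" and j: "j < n" "i ~= j" and b: "b:cB" "b':cB"
	shows "ph i b \<otimes>T ph j b' = ph j b' \<otimes>T ph i b"
proof -
	interpret T': ring T by (rule T_ring)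
	interpret Hi: ring_hom_ring B T "ph i" by (rule ring_hom_ringI2[OF B_ring T_ring ph_hom[OF i]])
	interpret Hj: ring_hom_ring B T "ph j" by (rule ring_hom_ringI2[OF B_ring T_ring ph_hom[OF j(1)]])
	have base: "ph i g \<otimes>T ph j h = ph j h \<otimes>T ph i g" if g: "g:Q.NF" and h: "h:Q.NF" for g h
	proof -
		obtain c a m where g': "c:carrier k" "ph i g = uT c \<otimes>T mi (vf i a m) (uv i m)" by (rule ph_NF[OF i g])
		obtain d e l where h': "d:carrier k" "ph j h = uT d \<otimes>T mi (vf j e l) (uv j l)" by (rule ph_NF[OF j(1) h])
		let ?x = "mi (vf i a m) (uv i m)" and ?y = "mi (vf j e l) (uv j l)"
		note x = mi_closed[OF vf_Lam[OF i] uv_words[OF i], of a m m] and y = mi_closed[OF vf_Lam[OF j(1)] uv_words[OF j(1)], of e l l]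
		have "?x \<otimes>T ?y = mi (vf i a m \<otimes>P vf j e l) (uv i m + uv j l)"
			unfolding mi_mult[OF vf_Lam[OF i] vf_Lam[OF j(1)] uv_words[OF i] uv_words[OF j(1)]]
			using j(2) by (subst tor_vf[OF j(1)]) (simp_all add: uv_def)
		moreover have "?y \<otimes>T ?x = mi (vf j e l \<otimes>P vf i a m) (uv j l + uv i m)"
			unfolding mi_mult[OF vf_Lam[OF j(1)] vf_Lam[OF i] uv_words[OF j(1)] uv_words[OF i]]
			using j(2) by (subst tor_vf[OF i]) (simp_all add: uv_def)
		moreover have "vf i a m \<otimes>P vf j e l = vf j e l \<otimes>P vf i a m" using vf_Lam i j(1) by (intro P.m_comm) auto
		ultimately have xy: "?x \<otimes>T ?y = ?y \<otimes>T ?x" by (simp add: add.commute)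
		note c = uT_closed[OF g'(1)] and d = uT_closed[OF h'(1)]
		have "(uT c \<otimes>T ?x) \<otimes>T (uT d \<otimes>T ?y) = uT c \<otimes>T (uT d \<otimes>T (?x \<otimes>T ?y))"
			using c d x y uT_central[OF h'(1) x] by (simp add: T'.m_assoc[symmetric])
		also have "... = uT d \<otimes>T (uT c \<otimes>T (?y \<otimes>T ?x))"
			unfolding xy using c d x y uT_central[OF h'(1) c] by (simp add: T'.m_assoc[symmetric])
		also have "... = (uT d \<otimes>T ?y) \<otimes>T (uT c \<otimes>T ?x)"
			using c d x y uT_central[OF g'(1) y] by (simp add: T'.m_assoc[symmetric])
		finally show ?thesis unfolding g'(2) h'(2) .
	qed
	have step: "ph i g \<otimes>T ph j b' = ph j b' \<otimes>T ph i g" if g: "g:Q.NF" for g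
		using B_span[OF b(2)]
	proof (induction b' rule: add_closure.induct)
		case (add h x)
		have "g:cB" "h:cB" "x:cB" using g add(1) Q.NF_sub Q.NC_closed[OF add(2)] by auto
		then show ?case using base[OF g add(1)] add(3) by (simp add: T'.r_distr T'.l_distr)
	qed (use g Q.NF_sub in auto)
	show ?thesis
		using B_span[OF b(1)]
	proof (induction b rule: add_closure.induct)
		case (add h x)
		have "h:cB" "x:cB" using add(1) Q.NF_sub Q.NC_closed[OF add(2)] by auto
		then show ?case using step[OF add(1)] add(3) b(2) by (simp add: T'.r_distr T'.l_distr)
	qed (use b(2) in auto)
qed

primrec tp :: "nat => (nat => (wgen list => 'k) set) => ('l => 'l) => 'l" where
	"tp 0 t = \<one>T" | "tp (Suc j) t = tp j t \<otimes>T ph j (t j)"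

lemma ph_closed: "i < n ==> b:cB ==> ph i b:cT"
	by (rule rhc[OF ph_hom])

lemma TM_mem: "t:carrier TM ==> i < n ==> t i:cB"
	unfolding TM_carrier by blast

lemma tp_closed: "t:carrier TM ==> j \<le> n ==> tp j t:cT"
proof (induction j)
	interpret T': ring T by (rule T_ring)
	case (Suc j)
	then show ?case using ph_closed[of j "t j"] TM_mem[of t j] by simp
qed (simp add: ring.ring_simprules(6)[OF T_ring])

lemma tp_commute: "t:carrier TM ==> j \<le> i ==> i < n ==> b:cB ==> tp j t \<otimes>T ph i b = ph i b \<otimes>T tp j t"
proof (induction j)
	case 0
	interpret T': ring T by (rule T_ring)
	show ?case using ph_closed[OF 0(3,4)] by simp
next
	case (Suc j)
	interpret T': ring T by (rule T_ring)
	have j: "j < n" "j ~= i" "j \<le> i" "j \<le> n" using Suc.prems by auto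
	note c = tp_closed[OF Suc.prems(1) j(4)] ph_closed[OF j(1) TM_mem[OF Suc.prems(1) j(1)]] ph_closed[OF Suc.prems(3,4)]
	have "tp j t \<otimes>T ph j (t j) \<otimes>T ph i b = (tp j t \<otimes>T ph i b) \<otimes>T ph j (t j)"
		using c ph_commute[OF j(1) Suc.prems(3) j(2) TM_mem[OF Suc.prems(1) j(1)] Suc.prems(4)] by (simp add: T'.m_assoc)
	then show ?case unfolding Suc.IH[OF Suc.prems(1) j(3) Suc.prems(3,4)] using c by (simp add: T'.m_assoc)
qed

lemma tp_mult: "t:carrier TM ==> s:carrier TM ==> j \<le> n ==> tp j (t \<otimes>\<^bsub>TM\<^esub> s) = tp j t \<otimes>T tp j s"
proof (induction j)
	case 0
	interpret T': ring T by (rule T_ring)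
	show ?case by simp
next
	case (Suc j)
	interpret T': ring T by (rule T_ring)
	have j: "j < n" "j \<le> n" using Suc.prems by auto
	note tj = TM_mem[OF Suc.prems(1) j(1)] and sj = TM_mem[OF Suc.prems(2) j(1)]
	note c = tp_closed[OF Suc.prems(1) j(2)] tp_closed[OF Suc.prems(2) j(2)] ph_closed[OF j(1) tj] ph_closed[OF j(1) sj]
	have "tp (Suc j) (t \<otimes>\<^bsub>TM\<^esub> s) = (tp j t \<otimes>T tp j s) \<otimes>T (ph j (t j) \<otimes>T ph j (s j))"
		using Suc.IH[OF Suc.prems(1,2) j(2)] TM_mult_apply[OF j(1), of t s] rhm[OF ph_hom[OF j(1)] tj sj] by (simp del: mult_product_group)
	also have "... = tp j t \<otimes>T ((tp j s \<otimes>T ph j (t j)) \<otimes>T ph j (s j))" using c by (simp add: T'.m_assoc)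
	also have "... = tp (Suc j) t \<otimes>T tp (Suc j) s"
		unfolding tp_commute[OF Suc.prems(2) order_refl j(1) tj] using c by (simp add: T'.m_assoc)
	finally show ?case .
qed

lemma tp_one: "j \<le> n ==> tp j \<one>\<^bsub>TM\<^esub> = \<one>T"
proof (induction j)
	case (Suc j)
	interpret T': ring T by (rule T_ring)
	show ?case using Suc rh1[OF ph_hom[of j]] by simp
qed simp

lemma tp_upd: "j \<le> i ==> tp j (t(i := b)) = tp j t"
	by (induction j) auto

lemma tp_coord_add:
	assumes t: "t:carrier TM" and i: "i < n" and ab: "a:cB" "b:cB" and j: "i < j" "j \<le> n"
	shows "tp j (t(i := a \<oplus>B b)) = tp j (t(i := a)) \<oplus>T tp j (t(i := b))"
	using j
proof (induction j)
	case (Suc j)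
	interpret T': ring T by (rule T_ring)
	have jn: "j < n" "j \<le> n" using Suc.prems by auto
	have ab': "a \<oplus>B b:cB" using ab by simp
	note m = TM_upd[OF t i ab(1)] TM_upd[OF t i ab(2)]
	show ?case
	proof (cases "i = j")
		case True
		have u: "tp j (t(i := x)) = tp j t" "(t(i := x)) j = x" for x using tp_upd[of j i t] True by simp_all
		note c = tp_closed[OF t jn(2)] ph_closed[OF jn(1) ab(1)] ph_closed[OF jn(1) ab(2)]
		show ?thesis unfolding tp.simps u rha[OF ph_hom[OF jn(1)] ab] by (rule T'.r_distr[OF c(2,3,1)])
	next
		case False
		then have u: "(t(i := x)) j = t j" for x by simp
		have ij: "i < j" using False Suc.prems(1) by simp
		show ?thesis
			unfolding tp.simps u Suc.IH[OF ij jn(2)]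
			by (rule T'.l_distr[OF tp_closed[OF m(1) jn(2)] tp_closed[OF m(2) jn(2)] ph_closed[OF jn(1) TM_mem[OF t jn(1)]]])
	qed
qed simp

lemma tp_coord_smult:
	assumes t: "t:carrier TM" and i: "i < n" and a: "a:cB" and c: "c:carrier k" and j: "i < j" "j \<le> n"
	shows "tp j (t(i := bc c \<otimes>B a)) = uT c \<otimes>T tp j (t(i := a))"
	using j
proof (induction j)
	case (Suc j)
	interpret T': ring T by (rule T_ring)
	have jn: "j < n" "j \<le> n" using Suc.prems by auto
	note u = uT_closed[OF c]
	show ?case
	proof (cases "i = j")
		case True
		have u': "tp j (t(i := x)) = tp j t" "(t(i := x)) j = x" for x using tp_upd[of j i t] True by simp_all
		note c = tp_closed[OF t jn(2)] ph_closed[OF jn(1) a]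
		have "tp j t \<otimes>T (uT c \<otimes>T ph j a) = uT c \<otimes>T (tp j t \<otimes>T ph j a)"
			using c u uT_central[OF \<open>c:carrier k\<close> c(1)] by (simp add: T'.m_assoc[symmetric])
		then show ?thesis
			unfolding tp.simps u' rhm[OF ph_hom[OF jn(1)] Q.u_closed[OF \<open>c:carrier k\<close>] a] ph_bc[OF jn(1) \<open>c:carrier k\<close>] .
	next
		case False
		then have u': "(t(i := x)) j = t j" for x by simp
		have ij: "i < j" using False Suc.prems(1) by simp
		show ?thesis
			unfolding tp.simps u' Suc.IH[OF ij jn(2)]
			by (rule T'.m_assoc[OF u tp_closed[OF TM_upd[OF t i a] jn(2)] ph_closed[OF jn(1) TM_mem[OF t jn(1)]]])
	qed
qed simp

definition E2 :: "((nat => (wgen list => 'k) set) => 'k) => ('l => 'l) => 'l" where "E2 = E.extend T uT (tp n)"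

lemma E2_hom: "E2:ring_hom MP T"
	unfolding E2_def
proof (rule E.extend_hom[OF T_ring uT_hom])
	show "tp n:carrier TM \<rightarrow> cT" using tp_closed by blast
	show "tp n \<one>\<^bsub>TM\<^esub> = \<one>T" by (rule tp_one) simp
	show "tp n (a \<otimes>\<^bsub>TM\<^esub> b) = tp n a \<otimes>T tp n b" if "a:carrier TM" "b:carrier TM" for a b by (rule tp_mult[OF that order_refl])
	show "tp n a \<otimes>T uT r = uT r \<otimes>T tp n a" if "a:carrier TM" "r:carrier k" for a r
		using uT_central[OF that(2) tp_closed[OF that(1) order_refl]] by simp
qed

lemma E2_single: assumes c: "c:carrier k" and t: "t:carrier TM" shows "E2 (sgl k c t) = uT c \<otimes>T tp n t"
proof -
	have 1: "uT:carrier k \<rightarrow> cT" "tp n:carrier TM \<rightarrow> cT" using uT_closed tp_closed by auto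
	show ?thesis unfolding E2_def by (rule E.extend_single[OF T_ring 1(1) rha[OF uT_hom] 1(2) c t])
qed

lemma E2_tgens: assumes "g:tgens" shows "E2 g = \<zero>T"
proof -
	interpret T': ring T by (rule T_ring)
	interpret H: ring_hom_ring MP T E2 by (rule ring_hom_ringI2[OF E.S_ring T_ring E2_hom])
	consider (add) t i a b where "t:carrier TM" "i < n" "a:cB" "b:cB"
				"g = sgl k \<one> (t(i := a \<oplus>B b)) \<ominus>\<^bsub>MP\<^esub> (sgl k \<one> (t(i := a)) \<oplus>\<^bsub>MP\<^esub> sgl k \<one> (t(i := b)))"
		| (smult) t i a c where "t:carrier TM" "i < n" "a:cB" "c:carrier k"
				"g = sgl k \<one> (t(i := bc c \<otimes>B a)) \<ominus>\<^bsub>MP\<^esub> sgl k c (t(i := a))"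
		using assms unfolding tgens_def by blast
	then show ?thesis
	proof cases
		case add
		have ab: "a \<oplus>B b:cB" using add(3,4) by simp
		note m = TM_upd[OF add(1,2)]
		have one: "E2 (sgl k \<one> s) = tp n s" if "s:carrier TM" for s
			unfolding E2_single[OF one_closed that] const_one mi_one using tp_closed[OF that order_refl] by simp
		have s: "sgl k \<one> (t(i := x)):carrier MP" if "x:cB" for x by (rule MP_single[OF one_closed m[OF that]])
		have "E2 g = tp n (t(i := a \<oplus>B b)) \<ominus>T (tp n (t(i := a)) \<oplus>T tp n (t(i := b)))"
			unfolding add(5) a_minus_def one[OF m[OF ab], symmetric] one[OF m[OF add(3)], symmetric] one[OF m[OF add(4)], symmetric]
			using s[OF ab] s[OF add(3)] s[OF add(4)] H.hom_add H.hom_a_inv E.S.a_closed E.S.a_inv_closed by presburger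
		then show ?thesis
			unfolding tp_coord_add[OF add(1,2,3,4,2) order_refl]
			using tp_closed[OF m[OF add(3)] order_refl] tp_closed[OF m[OF add(4)] order_refl] by (simp add: a_minus_def T'.r_neg)
	next
		case smult
		have ca: "bc c \<otimes>B a:cB" using smult(3) Q.u_closed[OF smult(4)] by simp
		note m = TM_upd[OF smult(1,2)]
		have s: "sgl k \<one> (t(i := bc c \<otimes>B a)):carrier MP" "sgl k c (t(i := a)):carrier MP"
			using MP_single m[OF ca] m[OF smult(3)] smult(4) by blast+
		have "E2 g = E2 (sgl k \<one> (t(i := bc c \<otimes>B a))) \<ominus>T E2 (sgl k c (t(i := a)))"
			unfolding smult(5) a_minus_def using s H.hom_add H.hom_a_inv E.S.a_inv_closed by presburger
		also have "E2 (sgl k \<one> (t(i := bc c \<otimes>B a))) = E2 (sgl k c (t(i := a)))"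
			unfolding E2_single[OF one_closed m[OF ca]] E2_single[OF smult(4) m[OF smult(3)]] const_one mi_one
				tp_coord_smult[OF smult(1,2,3,4,2) order_refl]
			using uT_closed[OF smult(4)] tp_closed[OF m[OF smult(3)] order_refl] by simp
		finally show ?thesis unfolding a_minus_def T'.r_neg[OF H.hom_closed[OF s(2)]] .
	qed
qed

definition Ph :: "'k weyl => ('l => 'l) => 'l" where
	"Ph = (SOME g. g:ring_hom A T & (\<forall>f\<in>carrier MP. g (clA f) = E2 f))"

lemma Ph_hom: "Ph:ring_hom A T" and Ph_ts: "c:carrier k ==> t:carrier TM ==> Ph (ts c t) = uT c \<otimes>T tp n t"
proof -
	have "E2 x = \<zero>T" if "x:J" for x
		by (rule E.S.genideal_le_kernel[OF T_ring E2_hom tgens_closed E2_tgens that[unfolded J_eq]])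
	from E.S.quotient_hom[OF J_ideal T_ring E2_hom this]
	obtain g where "g:ring_hom (MP Quot J) T" "!!a. a:carrier MP ==> g (clA a) = E2 a" by blast
	then have ex: "\<exists>g. g:ring_hom A T & (\<forall>f\<in>carrier MP. g (clA f) = E2 f)" unfolding A_eq by blast
	then have Ph: "Ph:ring_hom A T" "\<forall>f\<in>carrier MP. Ph (clA f) = E2 f"
		using someI_ex[OF ex] unfolding Ph_def by blast+
	show "Ph:ring_hom A T" by (rule Ph(1))
	show "c:carrier k ==> t:carrier TM ==> Ph (ts c t) = uT c \<otimes>T tp n t"
		unfolding ts_cl using Ph(2) MP_single E2_single by metis
qed

lemma tp_wtup: "j \<le> n ==> tp j (wtup d) =
		mi (\<Otimes>\<^bsub>P\<^esub>i\<in>{..<j}. vf i (fst (d i)) (snd (d i))) (%i. if i < j then snd (d i) else 0)"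
proof (induction j)
	case 0
	show ?case using mi_one by (simp add: zero_fun_def)
next
	case (Suc j)
	then have j: "j < n" "j \<le> n" by auto
	let ?v = "%i. vf i (fst (d i)) (snd (d i))" and ?a = "%i. if i < j then snd (d i) else 0"
	have v: "?v:{..<l} \<rightarrow> Lam" if "l \<le> n" for l using vf_Lam that by auto
	then have vP: "?v:{..<l} \<rightarrow> cP" if "l \<le> n" for l using that Lam_P by blast
	have aw: "?a:words" using j by (simp add: words_def)
	have "wtup d j = Q.nf (fst (d j)) (snd (d j))" using j by (simp add: wtup_def)
	then have "tp (Suc j) (wtup d) = mi (\<Otimes>\<^bsub>P\<^esub>i\<in>{..<j}. ?v i) ?a \<otimes>T mi (?v j) (uv j (snd (d j)))"
		using Suc.IH[OF j(2)] ph_nf[OF j(1)] by simp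
	also have "... = mi ((\<Otimes>\<^bsub>P\<^esub>i\<in>{..<j}. ?v i) \<otimes>P ?v j) (?a + uv j (snd (d j)))"
		unfolding mi_mult[OF finprod_Lam[OF v[OF j(2)]] vf_Lam[OF j(1)] aw uv_words[OF j(1)]]
		by (subst tor_vf[OF j(1)]) simp_all
	also have "(\<Otimes>\<^bsub>P\<^esub>i\<in>{..<j}. ?v i) \<otimes>P ?v j = (\<Otimes>\<^bsub>P\<^esub>i\<in>{..<Suc j}. ?v i)"
		unfolding lessThan_Suc using P.finprod_insert[of "{..<j}" j ?v] vP[OF j(2)] vf_Lam[OF j(1)] finprod_Lam[OF v[OF j(2)]]
		by (simp add: P.m_comm)
	also have "?a + uv j (snd (d j)) = (%i. if i < Suc j then snd (d i) else 0)" by (auto simp: uv_def fun_eq_iff)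
	finally show ?case .
qed

lemma zv_prod: assumes "j \<le> n" shows "(\<Otimes>\<^bsub>P\<^esub>i\<in>{..<j}. zv i [^]P (a i :: nat)) = single \<one> (%i. if i < j then (a i, 0) else 0)"
	using assms
proof (induction j)
	case 0
	show ?case by (simp add: P.one_S zero_fun_def)
next
	case (Suc j)
	then have j: "j < n" "j \<le> n" by auto
	have p: "zv j [^]P (m::nat) = single \<one> (%i. if i = j then (m, 0) else 0)" for m
	proof (induction m)
		case 0
		have "(%i. if i = j then (0, 0) else 0) = (0 :: expon)" by (auto simp: fun_eq_iff zero_prod_def)
		then show ?case by (simp add: P.one_S)
	next
		case (Suc m)
		have "zv j [^]P Suc m = single \<one> (%i. if i = j then (m, 0) else 0) \<otimes>P single \<one> (%i. if i = j then (1, 0) else 0)"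
			using Suc by (simp add: zv_def)
		also have "... = single (\<one> \<otimes> \<one>) ((%i. if i = j then (m, 0) else 0) \<otimes>\<^bsub>expo n\<^esub> (%i. if i = j then (1, 0) else 0))"
			by (rule P.single_mult) (use j in \<open>auto simp: zero_prod_def\<close>)
		also have "(%i. if i = j then (m, 0) else 0) \<otimes>\<^bsub>expo n\<^esub> (%i. if i = j then (1, 0) else 0) = (%i. if i = j then (Suc m, 0) else (0 :: nat \<times> int))"
			by (auto simp: fun_eq_iff)
		finally show ?case by simp
	qed
	have zP: "(%i. zv i [^]P a i):{..<j} \<rightarrow> cP" "zv j [^]P a j:cP" using zv_pow_Lam j by auto
	have "(\<Otimes>\<^bsub>P\<^esub>i\<in>{..<Suc j}. zv i [^]P a i) = zv j [^]P a j \<otimes>P (\<Otimes>\<^bsub>P\<^esub>i\<in>{..<j}. zv i [^]P a i)"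
		unfolding lessThan_Suc using P.finprod_insert[of "{..<j}" j "%i. zv i [^]P a i"] zP by simp
	also have "... = single \<one> (%i. if i = j then (a j, 0) else 0) \<otimes>P single \<one> (%i. if i < j then (a i, 0) else 0)"
		using Suc.IH[OF j(2)] p by simp
	also have "... = single (\<one> \<otimes> \<one>) ((%i. if i = j then (a j, 0) else 0) \<otimes>\<^bsub>expo n\<^esub> (%i. if i < j then (a i, 0) else 0))"
		by (rule P.single_mult) (use j in \<open>auto simp: zero_prod_def\<close>)
	also have "(%i. if i = j then (a j, 0) else 0) \<otimes>\<^bsub>expo n\<^esub> (%i. if i < j then (a i, 0) else 0) = (%i. if i < Suc j then (a i, 0) else (0 :: nat \<times> int))"
		by (auto simp: fun_eq_iff less_Suc_eq)
	finally show ?case by simp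
qed

text \<open>The map \<open>Th False\<close> on coefficients is the representation in the monomial basis.\<close>

lemma Ph_Ps: assumes g: "g:cP" shows "Ph (Ps g) = Th False g"
proof (rule P.additive_eqI[OF ring.is_abelian_group[OF T_ring] g, where F = "%g. Ph (Ps g)" and G = "Th False"])
	fix f g assume "f:cP" "g:cP"
	then show "Ph (Ps (f \<oplus>P g)) = Ph (Ps f) \<oplus>T Ph (Ps g)" "Th False (f \<oplus>P g) = Th False f \<oplus>T Th False g"
		using Ps_add Ps_closed rha[OF Ph_hom] Th_add by auto
next
	fix c d assume cd: "c:carrier k" "d:carrier (expo n)"
	interpret T': ring T by (rule T_ring)
	define a where "a = (%i. snd (d i))"
	have aw: "a:words" using cd(2) by (simp add: a_def words_def)
	have d0: "d i = 0" if "\<not> i < n" for i using cd(2) that by simp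
	have zP: "(%i. zv i [^]P fst (d i)):{..<n} \<rightarrow> cP" "(%i. pc1 i (a i)):{..<n} \<rightarrow> cP"
		using zv_pow_Lam pc1_Lam by auto
	have e1: "(%i. if i < n then (fst (d i), 0) else 0) = (%i. (fst (d i), 0))" using d0 by (auto simp: fun_eq_iff zero_prod_def)
	have "(\<Otimes>\<^bsub>P\<^esub>i\<in>{..<n}. vf i (fst (d i)) (a i)) = (\<Otimes>\<^bsub>P\<^esub>i\<in>{..<n}. zv i [^]P fst (d i)) \<otimes>P pc a"
		unfolding vf_def pc_def by (rule P.finprod_multf[OF zP])
	also have "(\<Otimes>\<^bsub>P\<^esub>i\<in>{..<n}. zv i [^]P fst (d i)) = single \<one> (%i. (fst (d i), 0))"
		unfolding zv_prod[OF order_refl] e1 ..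
	finally have v: "(\<Otimes>\<^bsub>P\<^esub>i\<in>{..<n}. vf i (fst (d i)) (a i)) = single \<one> (%i. (fst (d i), 0)) \<otimes>P pc a" .
	have e2: "(%i. if i < n then a i else 0) = a" using aw by (auto simp: words_def fun_eq_iff)
	have sL: "single r (%i. (fst (d i), 0)):Lam" if "r:carrier k" for r
		by (rule single_Lam) (use that d0 in \<open>auto simp: zero_prod_def\<close>)
	have L: "single \<one> (%i. (fst (d i), 0)) \<otimes>P pc a:Lam" using sL pc_Lam Lam_mult by simp
	have cs: "const c \<otimes>P single \<one> (%i. (fst (d i), 0)) = single c (%i. (fst (d i), 0))"
		using cd(1) Lam_P[OF sL[OF one_closed]] by (simp add: const_mult) (auto simp: skew_single_def)
	have "tp n (wtup d) = mi (single \<one> (%i. (fst (d i), 0)) \<otimes>P pc a) a"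
		using tp_wtup[OF order_refl, of d] v e2 unfolding a_def by simp
	then have "Ph (Ps (single c d)) = mi (const c \<otimes>P (single \<one> (%i. (fst (d i), 0)) \<otimes>P pc a)) a"
		unfolding Ps_single[OF cd] Ph_ts[OF cd(1) wtup_TM] using uT_mult[OF cd(1) L aw] by simp
	also have "const c \<otimes>P (single \<one> (%i. (fst (d i), 0)) \<otimes>P pc a) = single c (%i. (fst (d i), 0)) \<otimes>P pc a"
		unfolding cs[symmetric] using const_closed[OF cd(1)] Lam_P[OF sL[OF one_closed]] Lam_P[OF pc_Lam] by (simp add: P.S.m_assoc)
	also have "mi ... a = Th False (single c d)"
	proof (rule T_eqI[OF mi_closed[OF Lam_mult[OF sL[OF cd(1)] pc_Lam] aw] Th_closed[OF P.single_closed[OF cd]]])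
		fix b assume b: "b:words"
		have t: "tws False b = 0" by (simp add: tws_def)
		show "mi (single c (%i. (fst (d i), 0)) \<otimes>P pc a) a (tr b) = Th False (single c d) (tr b)"
		proof (cases "b = a")
			case True
			then show ?thesis unfolding Th_tr[OF b] t slice_single using Lam_P[OF sL[OF cd(1)]] by (simp add: mi_def skew_single_def[of L] a_def tor_0)
		next
			case False
			then have "tr b ~= tr a" using tr_inj[OF b aw] by blast
			then show ?thesis
				unfolding Th_tr[OF b] t slice_single using False Lam_P[OF pc_Lam] by (simp add: mi_def skew_single_def[of L] a_def tor_zero io_zero)
		qed
	qed
	finally show "Ph (Ps (single c d)) = Th False (single c d)" .
qed

lemma Ps_inj: "f:cP ==> g:cP ==> Ps f = Ps g ==> f = g"
	using Th_inj Ph_Ps by metis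

lemma Ph_inj: assumes "x:cA" "y:cA" "Ph x = Ph y" shows "x = y"
proof -
	obtain f g where fg: "f:cP" "Ps f = x" "g:cP" "Ps g = y" using Ps_surj assms(1,2) by metis
	then have "Th False f = Th False g" using assms(3) Ph_Ps by metis
	then show ?thesis using Th_inj fg by blast
qed

lemma weyl_inv_Ps: "weyl_inv k q n = Ps ` Inv"
proof (intro equalityI subsetI)
	fix x assume x: "x:weyl_inv k q n"
	then have xA: "x:cA" by (simp add: weyl_inv_def)
	obtain g where g: "g:cP" "Ps g = x" by (rule Ps_surj[OF xA])
	have "g:Inv"
	proof (rule InvI[OF g(1)])
		fix p assume p: "p permutes {..<n}"
		have "Ps (permP p g) = Ps g" using weyl_perm_Ps[OF p g(1)] x p g(2) by (simp add: weyl_inv_def)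
		then show "permP p g = g" by (rule Ps_inj[OF permP_closed[OF p g(1)] g(1)])
	qed
	then show "x:Ps ` Inv" using g by blast
next
	fix x assume "x:Ps ` Inv"
	then obtain g where g: "g:Inv" "x = Ps g" by blast
	have "weyl_perm p x = x" if "p permutes {..<n}" for p
		unfolding g(2) weyl_perm_Ps[OF that Inv_P[OF g(1)]] Inv_perm[OF g(1) that] ..
	then show "x:weyl_inv k q n" using g Ps_closed by (simp add: weyl_inv_def)
qed

lemma Ph_weyl_inv: "Ph ` weyl_inv k q n = U"
	unfolding weyl_inv_Ps U_def image_image using Ph_Ps by (intro image_cong) auto

end

section \<open>Generators of the invariants\<close>

lemma (in abelian_monoid) finsum_swap:
	assumes I: "finite I" and J: "finite J" and f: "!!i j. i:I ==> j:J ==> f i j:carrier G"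
	shows "(\<Oplus>i\<in>I. \<Oplus>j\<in>J. f i j) = (\<Oplus>j\<in>J. \<Oplus>i\<in>I. f i j)"
	using I f
proof (induction I)
	case (insert x I)
	have c: "(%i. \<Oplus>j\<in>J. f i j):I \<rightarrow> carrier G" "(\<Oplus>j\<in>J. f x j):carrier G" using insert.prems by (auto intro!: finsum_closed)
	have "(\<Oplus>i\<in>insert x I. \<Oplus>j\<in>J. f i j) = (\<Oplus>j\<in>J. f x j) \<oplus> (\<Oplus>j\<in>J. \<Oplus>i\<in>I. f i j)"
		using finsum_insert[OF insert.hyps c] insert.IH insert.prems by simp
	also have "... = (\<Oplus>j\<in>J. f x j \<oplus> (\<Oplus>i\<in>I. f i j))"
		by (rule finsum_addf[symmetric]) (use insert.prems in \<open>auto intro!: finsum_closed\<close>)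
	also have "... = (\<Oplus>j\<in>J. \<Oplus>i\<in>insert x I. f i j)"
		by (rule finsum_cong') (use insert in \<open>auto intro!: finsum_closed finsum_insert[symmetric]\<close>)
	finally show ?case .
qed simp

lemma (in ring) subring_finsum:
	assumes H: "subring H R" and f: "f:I \<rightarrow> H" shows "finsum R f I:H"
	using f
proof (induction I rule: infinite_finite_induct)
	case (insert i I)
	have "f:I \<rightarrow> H" "f i:H" using insert.prems by auto
	then show ?case
		using insert subringE(1)[OF H] subringE(7)[OF H] finsum_insert[OF insert.hyps, of f] by (auto simp: subset_iff Pi_iff)
qed (use subringE(2)[OF H] in simp_all)

context qweyl_relation
begin

lemma pow_z:
	assumes w: "w:carrier B" and e: "w \<otimes>\<^bsub>B\<^esub> z = u (qz e) \<otimes>\<^bsub>B\<^esub> (z \<otimes>\<^bsub>B\<^esub> w)"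
	shows "w [^]\<^bsub>B\<^esub> (l::nat) \<otimes>\<^bsub>B\<^esub> z = u (qz (e * int l)) \<otimes>\<^bsub>B\<^esub> (z \<otimes>\<^bsub>B\<^esub> w [^]\<^bsub>B\<^esub> l)"
proof (induction l)
	case 0
	then show ?case by (simp add: qz_0 u_one)
next
	case (Suc l)
	let ?w = "w [^]\<^bsub>B\<^esub> l" and ?c = "qz (e * int l)"
	have uc: "u (qz d):carrier B" for d using u_closed[OF qz_closed] .
	have "(?w \<otimes>\<^bsub>B\<^esub> w) \<otimes>\<^bsub>B\<^esub> z = (?w \<otimes>\<^bsub>B\<^esub> u (qz e)) \<otimes>\<^bsub>B\<^esub> (z \<otimes>\<^bsub>B\<^esub> w)"
		using w uc by (simp add: B.m_assoc e)
	also have "... = u (qz e) \<otimes>\<^bsub>B\<^esub> ((?w \<otimes>\<^bsub>B\<^esub> z) \<otimes>\<^bsub>B\<^esub> w)"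
		using w uc central[OF qz_closed, of ?w e] by (simp add: B.m_assoc[symmetric])
	also have "... = (u (qz e) \<otimes>\<^bsub>B\<^esub> u ?c) \<otimes>\<^bsub>B\<^esub> (z \<otimes>\<^bsub>B\<^esub> (?w \<otimes>\<^bsub>B\<^esub> w))"
		unfolding Suc using w uc by (simp add: B.m_assoc)
	also have "u (qz e) \<otimes>\<^bsub>B\<^esub> u ?c = u (qz (e * int (Suc l)))"
		using u_mult[OF qz_closed qz_closed] qz_add[of e "e * int l"] by (simp add: algebra_simps)
	finally show ?case by simp
qed

lemma xy_pow_z: "xy_pow m \<otimes>\<^bsub>B\<^esub> z [^]\<^bsub>B\<^esub> (a::nat) = u (qz (m * int a)) \<otimes>\<^bsub>B\<^esub> (z [^]\<^bsub>B\<^esub> a \<otimes>\<^bsub>B\<^esub> xy_pow m)"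
proof (rule commute_pow[OF xy_pow_closed])
	have y: "y \<otimes>\<^bsub>B\<^esub> z = u (qz 1) \<otimes>\<^bsub>B\<^esub> (z \<otimes>\<^bsub>B\<^esub> y)" using yz by (simp add: qz_1)
	show "xy_pow m \<otimes>\<^bsub>B\<^esub> z = u (qz m) \<otimes>\<^bsub>B\<^esub> (z \<otimes>\<^bsub>B\<^esub> xy_pow m)"
		using pow_z[OF xy(2) y, of "nat m"] pow_z[OF xy(1) xz, of "nat (- m)"] unfolding xy_pow_def by (cases "0 \<le> m") simp_all
qed

end

context galois_laurent
begin

sublocale AR: ring A
	by (rule A_ring)

abbreviation "AI == weyl_inv k q n"
abbreviation "AG == weyl_Gamma k q n"

abbreviation ts1 :: "(nat => (wgen list => 'k) set) => 'k weyl" where "ts1 == ts \<one>"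

definition slot :: "nat => (wgen list => 'k) set => 'k weyl" where "slot i b = ts1 (\<one>\<^bsub>TM\<^esub>(i := b))"

lemma B_ops: "a:cB ==> b:cB ==> a \<otimes>B b:cB" "a:cB ==> b:cB ==> a \<oplus>B b:cB"
	"\<one>B:cB" "b:cB ==> \<one>B \<otimes>B b = b" "b:cB ==> b \<otimes>B \<one>B = b"
	"b:cB ==> b [^]B (m::nat):cB"
proof -
	show "a:cB ==> b:cB ==> a \<otimes>B b:cB" "a:cB ==> b:cB ==> a \<oplus>B b:cB"
		"\<one>B:cB" "b:cB ==> \<one>B \<otimes>B b = b" "b:cB ==> b \<otimes>B \<one>B = b"
		"b:cB ==> b [^]B (m::nat):cB"
		by simp_all
qed

lemma TM_one_upd: "i < n ==> b:cB ==> \<one>\<^bsub>TM\<^esub>(i := b):carrier TM"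
	by (rule TM_upd[OF TM_one])

lemma TM_one_apply: "i < n ==> \<one>\<^bsub>TM\<^esub> i = \<one>B"
	by simp

lemma ts1_closed: "t:carrier TM ==> ts1 t:cA"
	by (rule ts_closed[OF one_closed])

lemma slot_closed: "i < n ==> b:cB ==> slot i b:cA"
	unfolding slot_def by (rule ts1_closed[OF TM_one_upd])

lemma ts1_slot: assumes t: "t:carrier TM" and i: "i < n" and b: "b:cB"
	shows "ts1 t \<otimes>A slot i b = ts1 (t(i := t i \<otimes>B b))"
proof -
	have "t \<otimes>\<^bsub>TM\<^esub> (\<one>\<^bsub>TM\<^esub>(i := b)) = t(i := t i \<otimes>B b)"
		using t i B_ops(5) unfolding TM_carrier by (auto simp: fun_eq_iff restrict_def)
	then show ?thesis unfolding slot_def using ts_mult[OF one_closed one_closed t TM_one_upd[OF i b]] by simp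
qed

lemma slot_mult: assumes i: "i < n" and b: "b:cB" "b':cB" shows "slot i b \<otimes>A slot i b' = slot i (b \<otimes>B b')"
	using ts1_slot[OF TM_one_upd[OF i b(1)] i b(2)] unfolding slot_def by simp

lemma slot_comm: assumes i: "i < n" "j < n" "i ~= j" and b: "b:cB" "b':cB"
	shows "slot i b \<otimes>A slot j b' = slot j b' \<otimes>A slot i b"
proof -
	have "slot i b \<otimes>A slot j b' = ts1 ((\<one>\<^bsub>TM\<^esub>(i := b))(j := b'))"
		using ts1_slot[OF TM_one_upd[OF i(1) b(1)] i(2) b(2)] TM_one_apply[OF i(2)] i(3) B_ops(4)[OF b(2)] unfolding slot_def by (simp del: one_product_group)
	moreover have "slot j b' \<otimes>A slot i b = ts1 ((\<one>\<^bsub>TM\<^esub>(j := b'))(i := b))"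
		using ts1_slot[OF TM_one_upd[OF i(2) b(2)] i(1) b(1)] TM_one_apply[OF i(1)] i(3) B_ops(4)[OF b(1)] unfolding slot_def by (simp del: one_product_group)
	ultimately show ?thesis using fun_upd_twist[OF i(3), of "\<one>\<^bsub>TM\<^esub>" b b'] by metis
qed

lemma slot_add: "i < n ==> a:cB ==> b:cB ==> slot i (a \<oplus>B b) = slot i a \<oplus>A slot i b"
	unfolding slot_def by (rule ts_coord_add[OF one_closed TM_one])

lemma wc_closed: "c:carrier k ==> wc c:cA"
	by (rule rhc[OF wc_hom])

lemma slot_smult: assumes i: "i < n" and c: "c:carrier k" and b: "b:cB" shows "slot i (bc c \<otimes>B b) = wc c \<otimes>A slot i b"
	unfolding slot_def ts_coord_smult[OF one_closed c TM_one i b] using wc_mult(1)[OF c one_closed TM_one_upd[OF i b]] c by simp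

lemma slot_one: "i < n ==> slot i \<one>B = \<one>A"
proof -
	assume "i < n"
	then have "\<one>\<^bsub>TM\<^esub>(i := \<one>B) = \<one>\<^bsub>TM\<^esub>" by (intro fun_upd_idem TM_one_apply)
	then show ?thesis unfolding slot_def A_one by simp
qed

definition pw :: "(wgen list => 'k) set => 'k weyl" where "pw b = (\<Oplus>\<^bsub>A\<^esub>i\<in>{..<n}. slot i b)"

lemma slotF: "b:cB ==> (%i. slot i b):{..<n} \<rightarrow> cA"
	using slot_closed by auto

lemma pw_closed: "b:cB ==> pw b:cA"
	unfolding pw_def by (rule AR.finsum_closed[OF slotF])

lemma pw_add: assumes "a:cB" "b:cB" shows "pw (a \<oplus>B b) = pw a \<oplus>A pw b"
proof -
	have "pw (a \<oplus>B b) = (\<Oplus>\<^bsub>A\<^esub>i\<in>{..<n}. slot i a \<oplus>A slot i b)"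
		unfolding pw_def by (rule AR.finsum_cong') (use slot_add slot_closed assms in auto)
	then show ?thesis unfolding pw_def using AR.finsum_addf[OF slotF slotF] assms by simp
qed

lemma pw_smult: assumes c: "c:carrier k" and b: "b:cB" shows "pw (bc c \<otimes>B b) = wc c \<otimes>A pw b"
proof -
	have "pw (bc c \<otimes>B b) = (\<Oplus>\<^bsub>A\<^esub>i\<in>{..<n}. wc c \<otimes>A slot i b)"
		unfolding pw_def by (rule AR.finsum_cong') (use slot_smult slot_closed wc_closed c b in auto)
	then show ?thesis unfolding pw_def using AR.finsum_rdistr[OF finite_lessThan wc_closed[OF c] slotF[OF b]] by simp
qed

lemma pw_zero: "pw \<zero>B = \<zero>A"
proof -
	have "pw \<zero>B \<oplus>A pw \<zero>B = pw \<zero>B" using pw_add[OF Q.B.zero_closed Q.B.zero_closed] by simp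
	then show ?thesis using AR.add.r_cancel_one[OF pw_closed[OF Q.B.zero_closed] pw_closed[OF Q.B.zero_closed]] by simp
qed

text \<open>Different slots commute, so commutators of power sums are power sums of commutators.\<close>

lemma pw_commutator: assumes b: "b:cB" "b':cB" "c:cB" and c: "b \<otimes>B b' = c \<oplus>B b' \<otimes>B b"
	shows "pw b \<otimes>A pw b' = pw c \<oplus>A pw b' \<otimes>A pw b"
proof -
	let ?N = "{..<n}"
	let ?d = "%i j. if i = j then slot i c else \<zero>A"
	note cl = slot_closed[OF _ b(1)] slot_closed[OF _ b(2)] slot_closed[OF _ b(3)]
	have prod: "pw x \<otimes>A pw y = (\<Oplus>\<^bsub>A\<^esub>i\<in>?N. \<Oplus>\<^bsub>A\<^esub>j\<in>?N. slot i x \<otimes>A slot j y)" if xy: "x:cB" "y:cB" for x y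
	proof -
		have "pw x \<otimes>A pw y = (\<Oplus>\<^bsub>A\<^esub>i\<in>?N. slot i x \<otimes>A pw y)"
			unfolding pw_def[of x] by (rule AR.finsum_ldistr[OF finite_lessThan pw_closed[OF xy(2)] slotF[OF xy(1)]])
		also have "... = (\<Oplus>\<^bsub>A\<^esub>i\<in>?N. \<Oplus>\<^bsub>A\<^esub>j\<in>?N. slot i x \<otimes>A slot j y)"
		proof (rule AR.finsum_cong')
			show "(%i. \<Oplus>\<^bsub>A\<^esub>j\<in>?N. slot i x \<otimes>A slot j y):?N \<rightarrow> cA"
				using slot_closed xy by (auto intro!: AR.finsum_closed)
			show "slot i x \<otimes>A pw y = (\<Oplus>\<^bsub>A\<^esub>j\<in>?N. slot i x \<otimes>A slot j y)" if "i:?N" for i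
				unfolding pw_def using that by (intro AR.finsum_rdistr slotF xy slot_closed) auto
		qed simp
		finally show ?thesis .
	qed
	have i: "(\<Oplus>\<^bsub>A\<^esub>j\<in>?N. slot i b \<otimes>A slot j b') = slot i c \<oplus>A (\<Oplus>\<^bsub>A\<^esub>j\<in>?N. slot j b' \<otimes>A slot i b)" if i: "i:?N" for i
	proof -
		have "(\<Oplus>\<^bsub>A\<^esub>j\<in>?N. slot i b \<otimes>A slot j b') = (\<Oplus>\<^bsub>A\<^esub>j\<in>?N. ?d i j \<oplus>A slot j b' \<otimes>A slot i b)"
		proof (rule AR.finsum_cong')
			show "(%j. ?d i j \<oplus>A slot j b' \<otimes>A slot i b):?N \<rightarrow> cA" using cl i by auto
			fix j assume j: "j:?N"
			show "slot i b \<otimes>A slot j b' = ?d i j \<oplus>A slot j b' \<otimes>A slot i b"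
			proof (cases "i = j")
				case True
				then show ?thesis using i slot_mult b c slot_add[of i c "b' \<otimes>B b"] B_ops(1) by simp
			next
				case False
				then show ?thesis using i j slot_comm[of i j b b'] b cl by simp
			qed
		qed simp
		also have "... = (\<Oplus>\<^bsub>A\<^esub>j\<in>?N. ?d i j) \<oplus>A (\<Oplus>\<^bsub>A\<^esub>j\<in>?N. slot j b' \<otimes>A slot i b)"
			by (rule AR.finsum_addf) (use cl i in auto)
		also have "(\<Oplus>\<^bsub>A\<^esub>j\<in>?N. ?d i j) = slot i c"
			using AR.finsum_singleton[OF i finite_lessThan, of "%j. slot i c"] cl i by simp
		finally show ?thesis .
	qed
	have "pw b \<otimes>A pw b' = (\<Oplus>\<^bsub>A\<^esub>i\<in>?N. slot i c \<oplus>A (\<Oplus>\<^bsub>A\<^esub>j\<in>?N. slot j b' \<otimes>A slot i b))"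
		unfolding prod[OF b(1,2)]
		by (rule AR.finsum_cong') (use i cl in \<open>auto intro!: AR.finsum_closed AR.a_closed\<close>)
	also have "... = pw c \<oplus>A (\<Oplus>\<^bsub>A\<^esub>i\<in>?N. \<Oplus>\<^bsub>A\<^esub>j\<in>?N. slot j b' \<otimes>A slot i b)"
		unfolding pw_def by (rule AR.finsum_addf) (use cl in \<open>auto intro!: AR.finsum_closed\<close>)
	also have "(\<Oplus>\<^bsub>A\<^esub>i\<in>?N. \<Oplus>\<^bsub>A\<^esub>j\<in>?N. slot j b' \<otimes>A slot i b) = pw b' \<otimes>A pw b"
		unfolding prod[OF b(2,1)] by (rule AR.finsum_swap) (use cl in auto)
	finally show ?thesis .
qed

lemma fun_upd_perm: "p permutes {..<n} ==> (t(i := a)) \<circ> pinv p = (t \<circ> pinv p)(p i := a)"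
	using permutes_inverses[of p "{..<n}"] by (auto simp: fun_eq_iff)

lemma weyl_perm_slot: assumes p: "p:Per" and i: "i < n" and b: "b:cB" shows "weyl_perm p (slot i b) = slot (p i) b"
	unfolding slot_def weyl_perm_ts[OF Per_perm[OF p] one_closed TM_one_upd[OF i b]] fun_upd_perm[OF Per_perm[OF p]]
		TM_mult_perm(2)[OF permutes_inv[OF Per_perm[OF p]]] ..

lemma weyl_perm_finsum: assumes p: "p:Per" and f: "f:I \<rightarrow> cA" shows "weyl_perm p (finsum A f I) = (\<Oplus>\<^bsub>A\<^esub>i\<in>I. weyl_perm p (f i))"
proof -
	interpret H: ring_hom_ring A A "weyl_perm p"
		by (rule ring_hom_ringI2[OF A_ring A_ring weyl_perm_hom[OF Per_perm[OF p]]])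
	show ?thesis
		by (rule AR.additive_finsum[OF AR.abelian_monoid_axioms _ _ _ f]) simp_all
qed

lemma weyl_perm_pw: assumes p: "p:Per" and b: "b:cB" shows "weyl_perm p (pw b) = pw b"
proof -
	have "weyl_perm p (pw b) = (\<Oplus>\<^bsub>A\<^esub>i\<in>{..<n}. slot (p i) b)"
		unfolding pw_def weyl_perm_finsum[OF p slotF[OF b]]
		by (rule AR.finsum_cong') (use weyl_perm_slot[OF p] slot_closed[OF Per_less[OF p]] b in auto)
	also have "... = (\<Oplus>\<^bsub>A\<^esub>i\<in>p ` {..<n}. slot i b)"
		by (rule AR.finsum_reindex[symmetric]) (use slot_closed Per_less[OF p] b permutes_inj_on[OF Per_perm[OF p]] in auto)
	also have "... = pw b" unfolding pw_def permutes_image[OF Per_perm[OF p]] ..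
	finally show ?thesis .
qed

definition Qs :: "(nat => (wgen list => 'k) set) => 'k weyl" where "Qs t = (\<Oplus>\<^bsub>A\<^esub>p\<in>Per. ts1 (t \<circ> p))"

lemma TM_Per: "t:carrier TM ==> p:Per ==> t \<circ> p:carrier TM"
	using TM_perm Per_perm by blast

lemma Qs_closed: "t:carrier TM ==> Qs t:cA"
	unfolding Qs_def by (rule AR.finsum_closed) (use TM_Per ts1_closed in auto)

lemma Per_image: assumes r: "r:Per" shows Per_image_left: "(\<circ>) r ` Per = Per" and Per_image_right: "(%p. p \<circ> r) ` Per = Per"
	using image_compose_permutations_left[OF Per_perm[OF r]] image_compose_permutations_right[OF Per_perm[OF r]]
	unfolding Per_def setcompr_eq_image by simp_all

lemma Qs_perm: assumes r: "r:Per" and t: "t:carrier TM" shows "Qs (t \<circ> r) = Qs t"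
proof -
	have inj: "inj_on ((\<circ>) r) Per"
		by (rule inj_on_inverseI[of _ "(\<circ>) (pinv r)"]) (simp add: o_assoc permutes_inv_o(2)[OF Per_perm[OF r]])
	have "Qs t = (\<Oplus>\<^bsub>A\<^esub>p\<in>(\<circ>) r ` Per. ts1 (t \<circ> p))" unfolding Qs_def Per_image_left[OF r] ..
	also have "... = (\<Oplus>\<^bsub>A\<^esub>p\<in>Per. ts1 (t \<circ> (r \<circ> p)))"
		by (rule AR.finsum_reindex[OF _ inj]) (use TM_Per[OF t] Per_comp[OF r] ts1_closed in auto)
	finally show ?thesis unfolding Qs_def by (simp add: o_assoc)
qed

lemma Qs_inv: assumes t: "t:carrier TM" shows "Qs t:AI"
proof -
	have "weyl_perm p (Qs t) = Qs t" if p': "p permutes {..<n}" for p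
	proof -
		have p: "p:Per" using p' by (simp add: Per_def)
		have i: "pinv p:Per" by (rule Per_inv[OF p])
		have inj: "inj_on (%r. r \<circ> pinv p) Per"
			by (rule inj_on_inverseI[of _ "%r. r \<circ> p"]) (simp add: o_assoc[symmetric] permutes_inv_o(2)[OF p'])
		have "weyl_perm p (Qs t) = (\<Oplus>\<^bsub>A\<^esub>r\<in>Per. weyl_perm p (ts1 (t \<circ> r)))"
			unfolding Qs_def by (rule weyl_perm_finsum[OF p]) (use TM_Per[OF t] ts1_closed in auto)
		also have "... = (\<Oplus>\<^bsub>A\<^esub>r\<in>Per. ts1 (t \<circ> (r \<circ> pinv p)))"
		proof (rule AR.finsum_cong')
			show "(%r. ts1 (t \<circ> (r \<circ> pinv p))):Per \<rightarrow> cA" using ts1_closed[OF TM_Per[OF t Per_comp[OF _ i]]] by (intro Pi_I)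
			show "weyl_perm p (ts1 (t \<circ> r)) = ts1 (t \<circ> (r \<circ> pinv p))" if "r:Per" for r
				using weyl_perm_ts[OF p' one_closed TM_Per[OF t that]] by (simp only: o_assoc)
		qed simp
		also have "... = (\<Oplus>\<^bsub>A\<^esub>r\<in>(%r. r \<circ> pinv p) ` Per. ts1 (t \<circ> r))"
			by (rule AR.finsum_reindex[OF _ inj, symmetric]) (use TM_Per[OF t] Per_comp i ts1_closed in auto)
		also have "... = Qs t" unfolding Per_image_right[OF i] Qs_def ..
		finally show ?thesis .
	qed
	then show ?thesis unfolding weyl_inv_def using Qs_closed[OF t] by blast
qed

lemma Qs_slot: assumes i: "i < n" "j < n" and b: "b:cB" and t: "t:carrier TM" "t i = t j" shows "Qs (t(i := b)) = Qs (t(j := b))"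
proof -
	have r: "Transposition.transpose i j:Per" unfolding Per_def using permutes_swap_id[of i "{..<n}" j] i by simp
	have "t(i := b) = (t(j := b)) \<circ> Transposition.transpose i j"
		using t(2) by (auto simp: fun_eq_iff Transposition.transpose_def)
	then show ?thesis using Qs_perm[OF r TM_upd[OF t(1) i(2) b]] by simp
qed

text \<open>Slot \<open>i\<close> of \<open>t \<circ> p\<close> is slot \<open>p i\<close> of \<open>t\<close>, so the power sum multiplies each slot of \<open>t\<close> in turn.\<close>

lemma Qs_pw: assumes t: "t:carrier TM" and b: "b:cB"
	shows "Qs t \<otimes>A pw b = (\<Oplus>\<^bsub>A\<^esub>j\<in>{..<n}. Qs (t(j := t j \<otimes>B b)))"
proof -
	let ?N = "{..<n}"
	define s where "s j = t(j := t j \<otimes>B b)" for j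
	have s: "s j:carrier TM" if "j < n" for j unfolding s_def by (rule TM_upd[OF t that B_ops(1)[OF TM_mem[OF t that] b]])
	have row: "ts1 (t \<circ> p) \<otimes>A pw b = (\<Oplus>\<^bsub>A\<^esub>j\<in>?N. ts1 (s j \<circ> p))" if p: "p:Per" for p
	proof -
		note tp = TM_Per[OF t p]
		have sp: "(t \<circ> p)(i := (t \<circ> p) i \<otimes>B b) = s (p i) \<circ> p" for i
			using permutes_inj[OF Per_perm[OF p]] by (auto simp: s_def fun_eq_iff inj_def)
		have "ts1 (t \<circ> p) \<otimes>A pw b = (\<Oplus>\<^bsub>A\<^esub>i\<in>?N. ts1 (t \<circ> p) \<otimes>A slot i b)"
			unfolding pw_def by (rule AR.finsum_rdistr[OF finite_lessThan ts1_closed[OF tp] slotF[OF b]])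
		also have "... = (\<Oplus>\<^bsub>A\<^esub>i\<in>?N. ts1 (s (p i) \<circ> p))"
		proof (rule AR.finsum_cong')
			show "(%i. ts1 (s (p i) \<circ> p)):?N \<rightarrow> cA" using ts1_closed TM_Per[OF s[OF Per_less[OF p]] p] by auto
			show "ts1 (t \<circ> p) \<otimes>A slot i b = ts1 (s (p i) \<circ> p)" if "i:?N" for i
				using ts1_slot[OF tp _ b, of i] sp[of i] that by simp
		qed simp
		also have "... = (\<Oplus>\<^bsub>A\<^esub>j\<in>p ` ?N. ts1 (s j \<circ> p))"
			by (rule AR.finsum_reindex[symmetric]) (use ts1_closed TM_Per[OF s p] Per_less[OF p] permutes_inj_on[OF Per_perm[OF p]] in auto)
		finally show ?thesis unfolding permutes_image[OF Per_perm[OF p]] .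
	qed
	have "Qs t \<otimes>A pw b = (\<Oplus>\<^bsub>A\<^esub>p\<in>Per. ts1 (t \<circ> p) \<otimes>A pw b)"
		unfolding Qs_def by (rule AR.finsum_ldistr[OF Per_finite pw_closed[OF b]]) (use ts1_closed TM_Per[OF t] in auto)
	also have "... = (\<Oplus>\<^bsub>A\<^esub>p\<in>Per. \<Oplus>\<^bsub>A\<^esub>j\<in>?N. ts1 (s j \<circ> p))"
		by (rule AR.finsum_cong') (use row ts1_closed TM_Per s in \<open>auto intro!: AR.finsum_closed\<close>)
	also have "... = (\<Oplus>\<^bsub>A\<^esub>j\<in>?N. Qs (s j))"
		unfolding Qs_def by (rule AR.finsum_swap[OF Per_finite finite_lessThan]) (use ts1_closed TM_Per s in auto)
	finally show ?thesis unfolding s_def .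
qed

lemma nat_smult_wc: fixes m :: nat assumes x: "x:cA" shows "[m] \<cdot>\<^bsub>A\<^esub> x = wc ([m] \<cdot>\<^bsub>k\<^esub> \<one>) \<otimes>A x"
proof (induction m)
	case 0
	have "wc \<zero> = \<zero>A" by (rule rh0[OF wc_hom ring_axioms A_ring])
	then show ?case using x by simp
next
	case (Suc m)
	have c: "[m] \<cdot>\<^bsub>k\<^esub> \<one>:carrier k" by simp
	have "wc ([Suc m] \<cdot>\<^bsub>k\<^esub> \<one>) = wc ([m] \<cdot>\<^bsub>k\<^esub> \<one>) \<oplus>A \<one>A"
		using rha[OF wc_hom c one_closed] rh1[OF wc_hom] by simp
	then show ?case using Suc x wc_closed[OF c] by (simp add: AR.l_distr)
qed

definition rep :: "(wgen list => 'k) set => nat => nat => (wgen list => 'k) set" where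
	"rep w d = (\<lambda>i\<in>{..<n}. if i < d then w else \<one>B)"

lemma rep_TM: "w:cB ==> rep w d:carrier TM"
	unfolding TM_carrier rep_def using B_ops(3) by simp

context
	fixes R :: "'k weyl set"
	assumes char0: "\<forall>m::nat. m > 0 \<longrightarrow> [m] \<cdot>\<^bsub>k\<^esub> \<one> ~= \<zero>" and R: "subring R A" and R_Gam: "AG \<subseteq> R"
begin

lemma wc_R: assumes c: "c:carrier k" shows "wc c:R"
proof -
	have "weyl_perm p (wc c) = wc c" if p: "p permutes {..<n}" for p
		unfolding wc_ts weyl_perm_ts[OF p c TM_one] TM_mult_perm(2)[OF permutes_inv[OF p]] ..
	moreover have "wc c:generate_ring A (wc ` carrier k \<union> weyl_h k q n ` {..<n})" using c by (intro generate_ring.incl) blast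
	ultimately show ?thesis using R_Gam unfolding weyl_Gamma_def by blast
qed

lemma R_div: fixes m :: nat assumes m: "m > 0" and x: "x:cA" "[m] \<cdot>\<^bsub>A\<^esub> x:R" shows "x:R"
proof -
	have c: "[m] \<cdot>\<^bsub>k\<^esub> \<one>:carrier k - {\<zero>}" using char0 m by simp
	note i = nz_inv[OF c]
	have ck: "[m] \<cdot>\<^bsub>k\<^esub> \<one>:carrier k" by simp
	have "wc (inv ([m] \<cdot>\<^bsub>k\<^esub> \<one>)) \<otimes>A ([m] \<cdot>\<^bsub>A\<^esub> x) = (wc (inv ([m] \<cdot>\<^bsub>k\<^esub> \<one>)) \<otimes>A wc ([m] \<cdot>\<^bsub>k\<^esub> \<one>)) \<otimes>A x"
		unfolding nat_smult_wc[OF x(1)] by (rule AR.m_assoc[symmetric, OF wc_closed[OF i(1)] wc_closed[OF ck] x(1)])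
	also have "... = x"
		unfolding rhm[OF wc_hom i(1) ck, symmetric] i(2) rh1[OF wc_hom] using x(1) by simp
	finally show ?thesis using subringE(6)[OF R wc_R[OF i(1)] x(2)] by simp
qed

lemma R_diff: assumes "x \<oplus>A y:R" "y:R" "x:cA" shows "x:R"
proof -
	have y: "y:cA" using assms subringE(1)[OF R] by blast
	have "(x \<oplus>A y) \<oplus>A (\<ominus>A y) = x" using assms(3) y by (simp add: AR.a_assoc AR.r_neg)
	then show ?thesis using subringE(7)[OF R assms(1) subringE(5)[OF R assms(2)]] by simp
qed

text \<open>For one nontrivial slot the orbit sum is a multiple of the power sum, which can be read off by multiplying with the orbit sum of the unit.\<close>

lemma Qs_one_pw: assumes n: "0 < n" and b: "b:cB" and R: "Qs (\<one>\<^bsub>TM\<^esub>(0 := b)):R" shows "pw b:R"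
proof -
	have c: "Qs (\<one>\<^bsub>TM\<^esub>(0 := b)):cA" using Qs_closed[OF TM_one_upd[OF n b]] .
	have "Qs \<one>\<^bsub>TM\<^esub> = (\<Oplus>\<^bsub>A\<^esub>p\<in>Per. \<one>A)"
		unfolding Qs_def by (rule AR.finsum_cong') (use TM_mult_perm(2)[OF Per_perm] in \<open>simp_all add: A_one[symmetric] del: one_product_group\<close>)
	also have "... = [(fact n :: nat)] \<cdot>\<^bsub>A\<^esub> \<one>A"
		using AR.add.finprod_const[OF AR.one_closed, of Per] card_permutations[of "{..<n}" n] by (simp add: Per_def)
	finally have Q1: "Qs \<one>\<^bsub>TM\<^esub> = [(fact n :: nat)] \<cdot>\<^bsub>A\<^esub> \<one>A" .
	have 1: "Qs \<one>\<^bsub>TM\<^esub> \<otimes>A pw b = [(fact n :: nat)] \<cdot>\<^bsub>A\<^esub> pw b"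
		unfolding Q1 nat_smult_wc[OF AR.one_closed] nat_smult_wc[OF pw_closed[OF b]]
		using pw_closed[OF b] wc_closed[of "[(fact n :: nat)] \<cdot>\<^bsub>k\<^esub> \<one>"] by simp
	have "Qs \<one>\<^bsub>TM\<^esub> \<otimes>A pw b = (\<Oplus>\<^bsub>A\<^esub>j\<in>{..<n}. Qs (\<one>\<^bsub>TM\<^esub>(0 := b)))"
		unfolding Qs_pw[OF TM_one b]
	proof (rule AR.finsum_cong')
		fix j assume "j:{..<n}"
		then have j: "j < n" by simp
		show "Qs (\<one>\<^bsub>TM\<^esub>(j := \<one>\<^bsub>TM\<^esub> j \<otimes>B b)) = Qs (\<one>\<^bsub>TM\<^esub>(0 := b))"
			unfolding TM_one_apply[OF j] B_ops(4)[OF b] using TM_one_apply[OF j] TM_one_apply[OF n] by (intro Qs_slot[OF j n b TM_one]) simp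
	qed (use c in auto)
	also have "...:R" by (rule AR.subring_finsum[OF \<open>subring R A\<close>]) (use R in auto)
	finally have "[(fact n :: nat)] \<cdot>\<^bsub>A\<^esub> pw b:R" by (simp only: 1)
	then show ?thesis by (intro R_div[OF _ pw_closed[OF b]]) simp_all
qed

text \<open>Newton's identities, in the form of a recursion for the orbit sums of \<open>w \<otimes> \<dots> \<otimes> w \<otimes> w\<^sup>j\<close>.\<close>

lemma newton: assumes n: "0 < n" and w: "w:cB" and S: "!!d. d \<le> n ==> Qs (rep w d):R"
	shows "0 < l ==> pw (w [^]B (l::nat)):R"
proof (induction l rule: less_induct)
	case (less l)
	define Y where "Y d j = Qs ((rep w d)(d := w [^]B (j::nat)))" for d j
	note wp = B_ops(6)[OF w]
	have Yc: "Y d j:cA" if "d < n" for d j unfolding Y_def by (rule Qs_closed[OF TM_upd[OF rep_TM[OF w] that wp]])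
	have step: "Qs (rep w (Suc d)) \<otimes>A pw (w [^]B (j::nat)) = [Suc d] \<cdot>\<^bsub>A\<^esub> Y d (Suc j) \<oplus>A (\<Oplus>\<^bsub>A\<^esub>i\<in>{Suc d..<n}. Y (Suc d) j)"
		if d: "d < n" for d j
	proof -
		let ?t = "rep w (Suc d)" and ?f = "%i. Qs ((rep w (Suc d))(i := rep w (Suc d) i \<otimes>B w [^]B j))"
		note t = rep_TM[OF w, of "Suc d"]
		have lo: "?f i = Y d (Suc j)" if i: "i < Suc d" for i
		proof -
			have i': "i < n" "?t i = w" "?t d = w" using i d by (simp_all add: rep_def)
			have "w \<otimes>B w [^]B j = w [^]B Suc j" using Q.B.nat_pow_Suc2[OF w, of j] by simp
			then have "?f i = Qs (?t(i := w [^]B Suc j))" unfolding i'(2) by simp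
			also have "... = Qs (?t(d := w [^]B Suc j))" by (rule Qs_slot[OF i'(1) d wp t]) (simp add: i'(2,3))
			also have "?t(d := w [^]B Suc j) = (rep w d)(d := w [^]B Suc j)"
				by (auto simp: rep_def fun_eq_iff restrict_def)
			finally show ?thesis unfolding Y_def .
		qed
		have hi: "?f i = Y (Suc d) j" if i: "Suc d \<le> i" "i < n" for i
		proof -
			have d': "Suc d < n" "?t i = \<one>B" "?t (Suc d) = \<one>B" using i by (simp_all add: rep_def)
			have "?f i = Qs (?t(i := w [^]B j))" unfolding d'(2) B_ops(4)[OF wp] ..
			also have "... = Y (Suc d) j" unfolding Y_def by (rule Qs_slot[OF i(2) d'(1) wp t]) (simp add: d'(2,3))
			finally show ?thesis .
		qed
		have f: "?f:{..<n} \<rightarrow> cA" using Qs_closed[OF TM_upd[OF t _ B_ops(1)[OF TM_mem[OF t] wp]]] by auto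
		have U: "{..<n} = {..<Suc d} \<union> {Suc d..<n}" using d by auto
		have f12: "?f:{..<Suc d} \<rightarrow> cA" "?f:{Suc d..<n} \<rightarrow> cA" using f d by auto
		have "finsum A ?f {..<n} = finsum A ?f {..<Suc d} \<oplus>A finsum A ?f {Suc d..<n}"
			unfolding U by (rule AR.finsum_Un_disjoint[OF finite_lessThan finite_atLeastLessThan _ f12]) auto
		also have "finsum A ?f {..<Suc d} = (\<Oplus>\<^bsub>A\<^esub>i\<in>{..<Suc d}. Y d (Suc j))"
			by (rule AR.finsum_cong') (use lo Yc[OF d] in auto)
		also have "... = [Suc d] \<cdot>\<^bsub>A\<^esub> Y d (Suc j)" using AR.add.finprod_const[OF Yc[OF d, of "Suc j"], of "{..<Suc d}"] by simp
		also have "finsum A ?f {Suc d..<n} = (\<Oplus>\<^bsub>A\<^esub>i\<in>{Suc d..<n}. Y (Suc d) j)"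
			by (rule AR.finsum_cong') (use hi Yc in auto)
		finally show ?thesis unfolding Qs_pw[OF t wp] .
	qed
	have chain: "d < n ==> d < l ==> Y d (l - d):R" for d
	proof (induction "n - d" arbitrary: d rule: less_induct)
		case (less d)
		show ?case
		proof (cases "Suc d = l")
			case True
			have "(rep w d)(d := w) = rep w l" using True less.prems by (auto simp: rep_def fun_eq_iff restrict_def)
			moreover have "w [^]B (1::nat) = w" using B_ops(4)[OF w] by simp
			ultimately show ?thesis using S[of l] True less.prems by (auto simp: Y_def)
		next
			case False
			then have dJ: "Suc d < l" "l - d = Suc (l - Suc d)" using less.prems by auto
			have "pw (w [^]B (l - Suc d)):R" by (rule \<open>!!y. y < l ==> 0 < y ==> pw (w [^]B y):R\<close>) (use dJ in auto)
			moreover have "Qs (rep w (Suc d)):R" by (rule S) (use less.prems in simp)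
			ultimately have "Qs (rep w (Suc d)) \<otimes>A pw (w [^]B (l - Suc d)):R" using subringE(6)[OF R] by blast
			then have sum: "[Suc d] \<cdot>\<^bsub>A\<^esub> Y d (l - d) \<oplus>A (\<Oplus>\<^bsub>A\<^esub>i\<in>{Suc d..<n}. Y (Suc d) (l - Suc d)):R"
				unfolding step[OF less.prems(1)] dJ(2) .
			have "(\<Oplus>\<^bsub>A\<^esub>i\<in>{Suc d..<n}. Y (Suc d) (l - Suc d)):R"
				by (rule AR.subring_finsum[OF R]) (use less.hyps[of "Suc d"] dJ in auto)
			then have "[Suc d] \<cdot>\<^bsub>A\<^esub> Y d (l - d):R"
				by (rule R_diff[OF sum]) (simp add: Yc[OF less.prems(1)])
			then show ?thesis by (rule R_div[OF zero_less_Suc Yc[OF less.prems(1)]])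
		qed
	qed
	have "rep w 0 = \<one>\<^bsub>TM\<^esub>" by (auto simp: rep_def fun_eq_iff restrict_def)
	then have "Qs (\<one>\<^bsub>TM\<^esub>(0 := w [^]B l)):R" using chain[OF n less.prems] unfolding Y_def by simp
	then show ?case by (rule Qs_one_pw[OF n wp])
qed

lemma pw_z_pow: "pw (Q.z [^]B (a::nat)):R"
proof -
	let ?G = "generate_ring A (wc ` carrier k \<union> weyl_h k q n ` {..<n})"
	have GA: "wc ` carrier k \<union> weyl_h k q n ` {..<n} \<subseteq> cA"
	proof -
		have "weyl_h k q n i:cA" if "i < n" for i
			unfolding weyl_h_def weyl_gen_def by (intro AR.m_closed ts1_closed TM_one_upd[OF that] bg_closed)
		then show ?thesis using wc_closed by auto
	qed
	have Gs: "subring ?G A" by (rule AR.generate_ring_is_subring[OF GA])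
	have "slot i (Q.z [^]B a):?G" if i: "i < n" for i
	proof (induction a)
		case 0
		show ?case using slot_one[OF i] generate_ring.one[of A] by simp
	next
		case (Suc a)
		have h: "weyl_h k q n i = slot i Q.z \<oplus>A wc h0"
		proof -
			have "weyl_h k q n i = slot i (bg GenY) \<otimes>A slot i (bg GenX)"
				by (simp only: weyl_h_def weyl_gen_def slot_def)
			also have "... = slot i (Q.z \<oplus>B bc h0 \<otimes>B \<one>B)"
				unfolding slot_mult[OF i bg_closed bg_closed] Q.yx using B_ops(5)[OF Q.u_closed[OF h0_closed]] by simp
			also have "... = slot i Q.z \<oplus>A wc h0"
				unfolding slot_add[OF i Q.z_closed B_ops(1)[OF Q.u_closed[OF h0_closed] B_ops(3)]] slot_smult[OF i h0_closed B_ops(3)] slot_one[OF i]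
				using wc_closed[OF h0_closed] by simp
			finally show ?thesis .
		qed
		have hG: "weyl_h k q n i:?G" "wc h0:?G" using i h0_closed by (auto intro!: generate_ring.incl)
		have "slot i Q.z = weyl_h k q n i \<oplus>A (\<ominus>A wc h0)"
			unfolding h using slot_closed[OF i Q.z_closed] wc_closed[OF h0_closed] by (simp add: AR.a_assoc AR.r_neg)
		then have "slot i Q.z:?G" using subringE(7)[OF Gs hG(1) subringE(5)[OF Gs hG(2)]] by simp
		then have "slot i (Q.z [^]B a) \<otimes>A slot i Q.z:?G" using subringE(6)[OF Gs Suc] by blast
		then show ?case using slot_mult[OF i B_ops(6)[OF Q.z_closed] Q.z_closed] by simp
	qed
	then have "pw (Q.z [^]B a):?G" unfolding pw_def by (intro AR.subring_finsum[OF Gs]) auto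
	moreover have "weyl_perm p (pw (Q.z [^]B a)) = pw (Q.z [^]B a)" if "p permutes {..<n}" for p
		by (rule weyl_perm_pw[OF _ B_ops(6)[OF Q.z_closed]]) (simp add: Per_def that)
	ultimately show ?thesis using R_Gam unfolding weyl_Gamma_def by blast
qed

lemma pw_R: assumes n: "0 < n" and S: "!!g d. d \<le> n ==> Qs (rep (bg g) d):R" and b: "b:cB" shows "pw b:R"
proof -
	have xy: "pw (Q.xy_pow m):R" for m
	proof -
		consider "m = 0" | "0 < m" | "m < 0" by linarith
		then show ?thesis
		proof cases
			case 1
			then show ?thesis using pw_z_pow[of 0] by (simp add: Q.xy_pow_def)
		next
			case 2
			then show ?thesis using newton[OF n bg_closed[of GenY] S, of "nat m"] by (simp add: Q.xy_pow_def)
		next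
			case 3
			then show ?thesis using newton[OF n bg_closed[of GenX] S, of "nat (- m)"] by (simp add: Q.xy_pow_def)
		qed
	qed
	have nf: "pw (Q.nf a m):R" for a m
	proof (cases "m * int a = 0")
		case True
		then show ?thesis
		proof (cases "m = 0")
			case True
			then have "Q.nf a m = Q.z [^]B a" by (simp add: Q.nf_def Q.xy_pow_def)
			then show ?thesis using pw_z_pow by simp
		next
			case False
			then have "Q.nf a m = Q.xy_pow m" using True by (simp add: Q.nf_def)
			then show ?thesis using xy by simp
		qed
	next
		case False
		let ?s = "qz (m * int a)"
		have s: "?s:carrier k" by (rule qz_closed)
		have d: "\<one> \<ominus> ?s:carrier k - {\<zero>}" using False qz_one_iff[of "m * int a"] s by auto
		note i = nz_inv[OF d]
		have dk: "\<one> \<ominus> ?s:carrier k" using d by blast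
		have z: "Q.z [^]B a:cB" by simp
		have "\<one> = (\<one> \<ominus> ?s) \<oplus> ?s" using s by (simp add: a_minus_def a_assoc l_neg)
		then have "bc \<one> = bc (\<one> \<ominus> ?s) \<oplus>B bc ?s" using Q.u_add[OF dk s] by simp
		then have u1: "bc (\<one> \<ominus> ?s) \<oplus>B bc ?s = \<one>B" unfolding Q.u_one by (rule sym)
		have "Q.nf a m = bc (\<one> \<ominus> ?s) \<otimes>B Q.nf a m \<oplus>B bc ?s \<otimes>B Q.nf a m"
			using Q.B.l_distr[OF Q.u_closed[OF dk] Q.u_closed[OF s] Q.nf_closed[of a m]] unfolding u1 B_ops(4)[OF Q.nf_closed] .
		then have "Q.z [^]B a \<otimes>B Q.xy_pow m = bc (\<one> \<ominus> ?s) \<otimes>B Q.nf a m \<oplus>B Q.xy_pow m \<otimes>B Q.z [^]B a"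
			unfolding Q.xy_pow_z Q.nf_def[symmetric] .
		from pw_commutator[OF z Q.xy_pow_closed _ this]
		have e: "pw (Q.z [^]B a) \<otimes>A pw (Q.xy_pow m) = wc (\<one> \<ominus> ?s) \<otimes>A pw (Q.nf a m) \<oplus>A pw (Q.xy_pow m) \<otimes>A pw (Q.z [^]B a)"
			using pw_smult[OF dk Q.nf_closed] Q.B.m_closed[OF Q.u_closed[OF dk] Q.nf_closed] by simp
		have c: "wc (\<one> \<ominus> ?s) \<otimes>A pw (Q.nf a m):cA" using wc_closed[OF dk] pw_closed[OF Q.nf_closed] by simp
		have l: "wc (\<one> \<ominus> ?s) \<otimes>A pw (Q.nf a m) \<oplus>A pw (Q.xy_pow m) \<otimes>A pw (Q.z [^]B a):R"
			unfolding e[symmetric] by (rule subringE(6)[OF R pw_z_pow xy])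
		have "wc (\<one> \<ominus> ?s) \<otimes>A pw (Q.nf a m):R"
			by (rule R_diff[OF l subringE(6)[OF R xy pw_z_pow] c])
		then have "wc (inv (\<one> \<ominus> ?s)) \<otimes>A (wc (\<one> \<ominus> ?s) \<otimes>A pw (Q.nf a m)):R"
			by (rule subringE(6)[OF R wc_R[OF i(1)]])
		moreover have "wc (inv (\<one> \<ominus> ?s)) \<otimes>A (wc (\<one> \<ominus> ?s) \<otimes>A pw (Q.nf a m)) = (wc (inv (\<one> \<ominus> ?s)) \<otimes>A wc (\<one> \<ominus> ?s)) \<otimes>A pw (Q.nf a m)"
			by (rule AR.m_assoc[symmetric, OF wc_closed[OF i(1)] wc_closed[OF dk] pw_closed[OF Q.nf_closed]])
		moreover have "wc (inv (\<one> \<ominus> ?s)) \<otimes>A wc (\<one> \<ominus> ?s) = \<one>A"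
			unfolding rhm[OF wc_hom i(1) dk, symmetric] i(2) by (rule rh1[OF wc_hom])
		ultimately show ?thesis using pw_closed[OF Q.nf_closed[of a m]] by simp
	qed
	show ?thesis
		using B_span[OF b]
	proof (induction b rule: add_closure.induct)
		case zero
		show ?case unfolding pw_zero by (rule subringE(2)[OF R])
	next
		case (add g x)
		obtain c a m where g: "g = bc c \<otimes>B Q.nf a m" "c:carrier k" using add(1) unfolding Q.NF_def by blast
		have gB: "g:cB" "x:cB" using add(1) Q.NF_sub Q.NC_closed[OF add(2)] by auto
		have "pw g:R" unfolding g(1) pw_smult[OF g(2) Q.nf_closed] by (rule subringE(6)[OF R wc_R[OF g(2)] nf])
		then show ?case unfolding pw_add[OF gB] using subringE(7)[OF R] add(3) by blast
	qed
qed

text \<open>Polarization: orbit sums of tensors with \<open>r\<close> nontrivial slots are built from power sums.\<close>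

lemma Qs_R: assumes pw: "!!b. b:cB ==> pw b:R"
	shows "r \<le> n ==> t:carrier TM ==> (!!j. r \<le> j ==> j < n ==> t j = \<one>B) ==> Qs t:R"
proof (induction r arbitrary: t)
	case 0
	have "t j = \<one>\<^bsub>TM\<^esub> j" for j using "0.prems"(3)[of j] "0.prems"(2) unfolding TM_carrier by (cases "j < n") auto
	then have t: "t = \<one>\<^bsub>TM\<^esub>" by blast
	have "\<one>\<^bsub>TM\<^esub> \<circ> p = \<one>\<^bsub>TM\<^esub>" if "p:Per" for p by (rule TM_mult_perm(2)[OF Per_perm[OF that]])
	then have "ts1 (t \<circ> p):R" if "p:Per" for p unfolding t using that subringE(3)[OF R] A_one by metis
	then show ?case unfolding Qs_def by (intro AR.subring_finsum[OF R]) auto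
next
	case (Suc r)
	have r: "r < n" using Suc.prems by simp
	define b where "b = t r"
	define s where "s = t(r := \<one>B)"
	have b: "b:cB" unfolding b_def by (rule TM_mem[OF Suc.prems(2) r])
	have s: "s:carrier TM" unfolding s_def by (rule TM_upd[OF Suc.prems(2) r B_ops(3)])
	have s1: "s j = \<one>B" if "r \<le> j" "j < n" for j using Suc.prems(3)[of j] that unfolding s_def by (cases "j = r") auto
	let ?f = "%j. Qs (s(j := s j \<otimes>B b))"
	have f: "?f:{..<n} \<rightarrow> cA" using Qs_closed[OF TM_upd[OF s _ B_ops(1)[OF TM_mem[OF s] b]]] by auto
	have lo: "?f j:R" if j: "j < r" for j
	proof (rule Suc.IH)
		show "s(j := s j \<otimes>B b):carrier TM" by (rule TM_upd[OF s _ B_ops(1)[OF TM_mem[OF s] b]]) (use j r in simp_all)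
		show "(s(j := s j \<otimes>B b)) i = \<one>B" if "r \<le> i" "i < n" for i using s1[OF that] that j by simp
	qed (use r in simp)
	have t: "s(r := b) = t" by (simp add: s_def b_def)
	have hi: "?f j = Qs t" if j: "r \<le> j" "j < n" for j
	proof -
		have "?f j = Qs (s(j := b))" unfolding s1[OF j] B_ops(4)[OF b] ..
		also have "... = Qs (s(r := b))" by (rule Qs_slot[OF j(2) r b s]) (simp add: s1[OF j] s1[OF order_refl r])
		finally show ?thesis unfolding t .
	qed
	note tA = Qs_closed[OF Suc.prems(2)]
	have V: "{..<n} = {r..<n} \<union> {..<r}" using r by auto
	have f12: "?f:{r..<n} \<rightarrow> cA" "?f:{..<r} \<rightarrow> cA" using f r by auto
	have "finsum A ?f {..<n} = finsum A ?f {r..<n} \<oplus>A finsum A ?f {..<r}"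
		unfolding V by (rule AR.finsum_Un_disjoint[OF finite_atLeastLessThan finite_lessThan _ f12]) auto
	also have "finsum A ?f {r..<n} = (\<Oplus>\<^bsub>A\<^esub>j\<in>{r..<n}. Qs t)" by (rule AR.finsum_cong') (use hi tA in auto)
	also have "... = [(n - r)] \<cdot>\<^bsub>A\<^esub> Qs t" using AR.add.finprod_const[OF tA, of "{r..<n}"] by simp
	finally have e: "Qs s \<otimes>A pw b = [(n - r)] \<cdot>\<^bsub>A\<^esub> Qs t \<oplus>A finsum A ?f {..<r}" unfolding Qs_pw[OF s b] .
	have "Qs s:R" by (rule Suc.IH[OF _ s s1]) (use r in simp_all)
	then have "[(n - r)] \<cdot>\<^bsub>A\<^esub> Qs t \<oplus>A finsum A ?f {..<r}:R" unfolding e[symmetric] using subringE(6)[OF R _ pw[OF b]] by blast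
	moreover have "finsum A ?f {..<r}:R" by (rule AR.subring_finsum[OF R]) (use lo in auto)
	ultimately have D: "[(n - r)] \<cdot>\<^bsub>A\<^esub> Qs t:R" by (rule R_diff) (simp add: tA)
	show ?case by (rule R_div[OF _ tA D]) (use r in simp)
qed

text \<open>An invariant element is a multiple of its sum over all permutations, and these sums are combinations of orbit sums.\<close>

lemma weyl_inv_generated: assumes n: "0 < n" and S: "!!g d. d \<le> n ==> Qs (rep (bg g) d):R" shows "AI \<subseteq> R"
proof
	fix x assume x: "x:AI"
	then have xA: "x:cA" and inv: "!!p. p:Per ==> weyl_perm p x = x" by (auto simp: weyl_inv_def Per_def)
	have pc: "weyl_perm p y:cA" if "p:Per" "y:cA" for p y
		by (rule rhc[OF weyl_perm_hom[OF Per_perm[OF that(1)]] that(2)])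
	have avg: "(\<Oplus>\<^bsub>A\<^esub>p\<in>Per. weyl_perm p y):R" if "y:cA" for y
		using that
	proof (induction y rule: A_induct)
		case zero
		have "weyl_perm p \<zero>A = \<zero>A" if "p:Per" for p by (rule rh0[OF weyl_perm_hom[OF Per_perm[OF that]] A_ring A_ring])
		then show ?case using subringE(2)[OF R] by (intro AR.subring_finsum[OF R]) auto
	next
		case (add c t y)
		have inj: "inj_on pinv Per"
			by (rule inj_on_inverseI[of _ pinv]) (use permutes_inv_inv[OF Per_perm] in blast)
		have im: "pinv ` Per = Per"
		proof (intro equalityI subsetI)
			fix p assume "p:Per"
			then have "p = pinv (pinv p)" "pinv p:Per" using permutes_inv_inv[OF Per_perm, of p] Per_inv by auto
			then show "p:pinv ` Per" by blast
		qed (use Per_inv in blast)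
		have w: "weyl_perm p (ts c t \<oplus>A y) = wc c \<otimes>A ts1 (t \<circ> pinv p) \<oplus>A weyl_perm p y" if p: "p:Per" for p
		proof -
			have "ts c (t \<circ> pinv p) = wc c \<otimes>A ts1 (t \<circ> pinv p)"
				using wc_mult(1)[OF add(1) one_closed TM_Per[OF add(2) Per_inv[OF p]]] add(1) by simp
			then show ?thesis
				using rha[OF weyl_perm_hom[OF Per_perm[OF p]] ts_closed[OF add(1,2)] add(3)] weyl_perm_ts[OF Per_perm[OF p] add(1,2)] by simp
		qed
		have tc: "ts1 (t \<circ> pinv p):cA" if "p:Per" for p by (rule ts1_closed[OF TM_Per[OF add(2) Per_inv[OF that]]])
		note cA = wc_closed[OF add(1)]
		have "(\<Oplus>\<^bsub>A\<^esub>p\<in>Per. weyl_perm p (ts c t \<oplus>A y)) = (\<Oplus>\<^bsub>A\<^esub>p\<in>Per. wc c \<otimes>A ts1 (t \<circ> pinv p) \<oplus>A weyl_perm p y)"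
			by (rule AR.finsum_cong') (use w tc cA pc add(3) in auto)
		also have "... = (\<Oplus>\<^bsub>A\<^esub>p\<in>Per. wc c \<otimes>A ts1 (t \<circ> pinv p)) \<oplus>A (\<Oplus>\<^bsub>A\<^esub>p\<in>Per. weyl_perm p y)"
			by (rule AR.finsum_addf) (use tc cA pc add(3) in auto)
		also have "(\<Oplus>\<^bsub>A\<^esub>p\<in>Per. wc c \<otimes>A ts1 (t \<circ> pinv p)) = wc c \<otimes>A (\<Oplus>\<^bsub>A\<^esub>p\<in>Per. ts1 (t \<circ> pinv p))"
			by (rule AR.finsum_rdistr[OF Per_finite cA, symmetric]) (use tc in auto)
		also have "(\<Oplus>\<^bsub>A\<^esub>p\<in>Per. ts1 (t \<circ> pinv p)) = (\<Oplus>\<^bsub>A\<^esub>p\<in>pinv ` Per. ts1 (t \<circ> p))"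
			by (rule AR.finsum_reindex[OF _ inj, symmetric]) (use tc in auto)
		also have "... = Qs t" unfolding im Qs_def ..
		finally have e: "(\<Oplus>\<^bsub>A\<^esub>p\<in>Per. weyl_perm p (ts c t \<oplus>A y)) = wc c \<otimes>A Qs t \<oplus>A (\<Oplus>\<^bsub>A\<^esub>p\<in>Per. weyl_perm p y)" .
		have "Qs t:R" by (rule Qs_R[OF pw_R[OF n S] order_refl add(2)]) auto
		then have "wc c \<otimes>A Qs t:R" using subringE(6)[OF R wc_R[OF add(1)]] by blast
		then show ?case unfolding e using subringE(7)[OF R] add(4) by blast
	qed
	have "(\<Oplus>\<^bsub>A\<^esub>p\<in>Per. weyl_perm p x) = (\<Oplus>\<^bsub>A\<^esub>p\<in>Per. x)" by (rule AR.finsum_cong') (use inv xA in auto)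
	also have "... = [(fact n :: nat)] \<cdot>\<^bsub>A\<^esub> x"
		using AR.add.finprod_const[OF xA, of Per] card_permutations[of "{..<n}" n] by (simp add: Per_def)
	finally have "[(fact n :: nat)] \<cdot>\<^bsub>A\<^esub> x:R" using avg[OF xA] by simp
	then show "x:R" by (rule R_div[OF fact_gt_zero xA])
qed

end

end

section \<open>The Galois order of invariants\<close>

lemma ring_image:
	assumes R: "ring R" and S: "ring S" and H: "H \<subseteq> carrier R" "subring H R"
		and h: "h:H \<rightarrow> carrier S" "inj_on h H"
			"!!x y. x:H ==> y:H ==> h (x \<otimes>\<^bsub>R\<^esub> y) = h x \<otimes>\<^bsub>S\<^esub> h y"
			"!!x y. x:H ==> y:H ==> h (x \<oplus>\<^bsub>R\<^esub> y) = h x \<oplus>\<^bsub>S\<^esub> h y" "h \<one>\<^bsub>R\<^esub> = \<one>\<^bsub>S\<^esub>" "h \<zero>\<^bsub>R\<^esub> = \<zero>\<^bsub>S\<^esub>"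
	shows "domain (R\<lparr>carrier := H\<rparr>) ==> domain (S\<lparr>carrier := h ` H\<rparr>)"
		and "field (R\<lparr>carrier := H\<rparr>) ==> field (S\<lparr>carrier := h ` H\<rparr>)"
proof -
	have iso: "h:ring_iso (R\<lparr>carrier := H\<rparr>) (S\<lparr>carrier := h ` H\<rparr>)"
	proof (rule ring_iso_memI)
		fix x y assume "x:carrier (R\<lparr>carrier := H\<rparr>)" "y:carrier (R\<lparr>carrier := H\<rparr>)"
		then have xy: "x:H" "y:H" by simp_all
		show "h x:carrier (S\<lparr>carrier := h ` H\<rparr>)" using xy by simp
		show "h (x \<otimes>\<^bsub>R\<lparr>carrier := H\<rparr>\<^esub> y) = h x \<otimes>\<^bsub>S\<lparr>carrier := h ` H\<rparr>\<^esub> h y" using h(3)[OF xy] by simp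
		show "h (x \<oplus>\<^bsub>R\<lparr>carrier := H\<rparr>\<^esub> y) = h x \<oplus>\<^bsub>S\<lparr>carrier := h ` H\<rparr>\<^esub> h y" using h(4)[OF xy] by simp
	next
		show "h \<one>\<^bsub>R\<lparr>carrier := H\<rparr>\<^esub> = \<one>\<^bsub>S\<lparr>carrier := h ` H\<rparr>\<^esub>" using h(5) by simp
		show "bij_betw h (carrier (R\<lparr>carrier := H\<rparr>)) (carrier (S\<lparr>carrier := h ` H\<rparr>))" using h(2) by (simp add: bij_betw_def)
	qed
	have e: "S\<lparr>carrier := h ` H, zero := h \<zero>\<^bsub>R\<lparr>carrier := H\<rparr>\<^esub>\<rparr> = S\<lparr>carrier := h ` H\<rparr>"
		using h(6) by simp
	show "domain (S\<lparr>carrier := h ` H\<rparr>)" if d: "domain (R\<lparr>carrier := H\<rparr>)"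
		using domain.ring_iso_imp_img_domain[OF d iso] unfolding e .
	show "field (S\<lparr>carrier := h ` H\<rparr>)" if d: "field (R\<lparr>carrier := H\<rparr>)"
		using field.ring_iso_imp_img_field[OF d iso] unfolding e .
qed

context galois_laurent
begin

sublocale TR: ring T
	by (rule T_ring)

lemma Ps_const: assumes c: "c:carrier k" shows "Ps (const c) = wc c"
proof -
	have "wtup 0 = \<one>\<^bsub>TM\<^esub>"
		by (auto simp: wtup_def fun_eq_iff restrict_def Q.nf_def Q.xy_pow_def zero_prod_def)
	then show ?thesis unfolding const_def using Ps_single[OF c, of 0] by (simp add: wc_ts del: one_product_group)
qed

lemma Ps_one: "Ps \<one>P = \<one>A"
	using Ps_const[OF one_closed] rh1[OF wc_hom] unfolding const_one by simp

lemma Ps_zero: "Ps \<zero>P = \<zero>A"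
proof -
	have "Ps \<zero>P \<oplus>A Ps \<zero>P = Ps \<zero>P" using Ps_add[of "\<zero>P" "\<zero>P"] P.S.l_zero[OF P.S.zero_closed] by simp
	then show ?thesis using AR.add.r_cancel_one[OF Ps_closed[OF P.S.zero_closed] Ps_closed[OF P.S.zero_closed]] by simp
qed

lemma Ph_Ps_Lam: assumes c: "c:Lam" shows "Ph (Ps c) = emb (io c)"
proof -
	have "Th False \<one>P = \<one>T" using Ph_Ps[of "\<one>P"] Ps_one rh1[OF Ph_hom] by simp
	moreover have "Th False (c \<otimes>P \<one>P) = emb (io c) \<otimes>T Th False \<one>P"
		using Th_smult[OF c, of "\<one>P" False] by (simp add: sided_mult_def)
	ultimately show ?thesis using Ph_Ps[OF Lam_P[OF c]] emb_closed[OF io_closed[OF c]] Lam_P[OF c] by simp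
qed

lemma Ps_mult: assumes c: "c:Lam" and g: "g:cP" shows "Ps (c \<otimes>P g) = Ps c \<otimes>A Ps g"
proof (rule Ph_inj)
	note cg = Ps_closed[OF Lam_P[OF c]] Ps_closed[OF g]
	show "Ps (c \<otimes>P g):cA" using Ps_closed c g by simp
	show "Ps c \<otimes>A Ps g:cA" using cg by simp
	show "Ph (Ps (c \<otimes>P g)) = Ph (Ps c \<otimes>A Ps g)"
		unfolding rhm[OF Ph_hom cg] Ph_Ps_Lam[OF c] Ph_Ps[OF g]
		using Ph_Ps[of "c \<otimes>P g"] Th_smult[OF c g, of False] c g by (simp add: sided_mult_def)
qed

lemma Ps_neg: assumes f: "f:cP" shows "Ps (\<ominus>P f) = \<ominus>A Ps f"
proof (rule AR.minus_equality[symmetric])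
	show "Ps (\<ominus>P f) \<oplus>A Ps f = \<zero>A"
		unfolding Ps_add[OF P.S.a_inv_closed[OF f] f, symmetric] P.S.l_neg[OF f] by (rule Ps_zero)
qed (use Ps_closed f in auto)

lemma tp_unit: assumes i: "i < n" and b: "b:cB" shows "i < j ==> j \<le> n ==> tp j (\<one>\<^bsub>TM\<^esub>(i := b)) = ph i b"
proof (induction j)
	case (Suc j)
	have jn: "j < n" "j \<le> n" using Suc.prems by auto
	show ?case
	proof (cases "i = j")
		case True
		then show ?thesis
			using tp_upd[of j i "\<one>\<^bsub>TM\<^esub>" b] tp_one[OF jn(2)] ph_closed[OF i b] by (simp only: tp.simps fun_upd_same) simp
	next
		case False
		then have u: "(\<one>\<^bsub>TM\<^esub>(i := b)) j = \<one>B" using TM_one_apply[OF jn(1)] by (simp only: fun_upd_other not_sym)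
		have ij: "i < j" using False Suc.prems(1) by simp
		show ?thesis unfolding tp.simps u Suc.IH[OF ij jn(2)] rh1[OF ph_hom[OF jn(1)]] by (rule TR.r_one[OF ph_closed[OF i b]])
	qed
qed simp

lemma weyl_h_Ps: assumes i: "i < n" shows "weyl_h k q n i = Ps (lf i 0)"
proof (rule Ph_inj)
	have h: "weyl_h k q n i = slot i (bg GenY \<otimes>B bg GenX)"
		unfolding slot_mult[OF i bg_closed bg_closed, symmetric] by (simp only: weyl_h_def weyl_gen_def slot_def)
	have b: "bg GenY \<otimes>B bg GenX:cB" by (rule B_ops(1)[OF bg_closed bg_closed])
	show "weyl_h k q n i:cA" unfolding h by (rule slot_closed[OF i b])
	show "Ps (lf i 0):cA" by (rule Ps_closed[OF Lam_P[OF lf_Lam[OF i]]])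
	have "Ph (slot i (bg GenY \<otimes>B bg GenX)) = ph i (bg GenY \<otimes>B bg GenX)"
		unfolding slot_def Ph_ts[OF one_closed TM_one_upd[OF i b]] const_one mi_one tp_unit[OF i b i order_refl]
		by (rule TR.l_one[OF ph_closed[OF i b]])
	also have "... = mi (lf i 0) 0"
		unfolding rhm[OF ph_hom[OF i] bg_closed bg_closed] ph_bg[OF i] by (rule gi_YX[OF i])
	finally show "Ph (weyl_h k q n i) = Ph (Ps (lf i 0))" unfolding h Ph_Ps_Lam[OF lf_Lam[OF i]] mi_emb .
qed

lemma Ps_Lam_subring: "subring (Ps ` Lam) A"
proof (rule AR.subringI)
	show "Ps ` Lam \<subseteq> cA" using Ps_closed Lam_P by blast
	show "\<one>A:Ps ` Lam" using Ps_one[symmetric] Lam_one by (rule image_eqI)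
	fix x assume "x:Ps ` Lam"
	then obtain f where f: "f:Lam" "x = Ps f" by blast
	show "\<ominus>A x:Ps ` Lam" unfolding f(2) Ps_neg[OF Lam_P[OF f(1)], symmetric] using subringE(5)[OF Lam_subring f(1)] by blast
	fix y assume "y:Ps ` Lam"
	then obtain g where g: "g:Lam" "y = Ps g" by blast
	show "x \<otimes>A y:Ps ` Lam" unfolding f(2) g(2) Ps_mult[OF f(1) Lam_P[OF g(1)], symmetric] using Lam_mult[OF f(1) g(1)] by blast
	show "x \<oplus>A y:Ps ` Lam" unfolding f(2) g(2) Ps_add[OF Lam_P[OF f(1)] Lam_P[OF g(1)], symmetric] using Lam_add[OF f(1) g(1)] by blast
qed

lemma generated_by_h: "generate_ring A (wc ` carrier k \<union> weyl_h k q n ` {..<n}) = Ps ` Lam" (is "?G = _")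
proof (intro equalityI subsetI)
	have H: "wc ` carrier k \<union> weyl_h k q n ` {..<n} \<subseteq> Ps ` Lam"
	proof -
		have "wc c:Ps ` Lam" if c: "c:carrier k" for c unfolding Ps_const[OF c, symmetric] using const_Lam[OF c] by blast
		moreover have "weyl_h k q n i:Ps ` Lam" if i: "i < n" for i unfolding weyl_h_Ps[OF i] using lf_Lam[OF i] by blast
		ultimately show ?thesis by blast
	qed
	then have HA: "wc ` carrier k \<union> weyl_h k q n ` {..<n} \<subseteq> cA" using subringE(1)[OF Ps_Lam_subring] by blast
	show "x:Ps ` Lam" if "x:?G" for x
		using AR.generate_ring_min_subring1[OF HA Ps_Lam_subring H] that by blast
	have Gs: "subring ?G A" by (rule AR.generate_ring_is_subring[OF HA])
	have "Ps f:?G" if "f:Lam" for f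
		using that
	proof (induction f rule: Lam_generated)
		case (cst c)
		then show ?case unfolding Ps_const[OF cst] by (intro generate_ring.incl) blast
	next
		case (var i)
		note z = zv_Lam[OF var]
		have c: "const h0:Lam" by (rule const_Lam[OF h0_closed])
		have "lf i 0 = zv i \<oplus>P const h0" unfolding lf_def qz_0 const_one using z by (simp del: P.add_S)
		then have h: "weyl_h k q n i = Ps (zv i) \<oplus>A wc h0"
			unfolding weyl_h_Ps[OF var] using Ps_add[OF Lam_P[OF z] Lam_P[OF c]] Ps_const[OF h0_closed] by simp
		have m: "weyl_h k q n i:?G" "wc h0:?G" using var h0_closed by (auto intro!: generate_ring.incl)
		have "Ps (zv i) = weyl_h k q n i \<oplus>A (\<ominus>A wc h0)"
			unfolding h using Ps_closed[OF Lam_P[OF z]] wc_closed[OF h0_closed] by (simp add: AR.a_assoc AR.r_neg)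
		then show ?case using subringE(7)[OF Gs m(1) subringE(5)[OF Gs m(2)]] by simp
	next
		case (add f g)
		then show ?case using subringE(7)[OF Gs] Ps_add[of f g] by simp
	next
		case (mult f g)
		then show ?case using subringE(6)[OF Gs] Ps_mult[of f g] by simp
	qed
	then show "x:?G" if "x:Ps ` Lam" for x using that by blast
qed

lemma weyl_Gamma_Ps: "AG = Ps ` Gam"
proof (intro equalityI subsetI)
	fix x assume x: "x:AG"
	then obtain f where f: "f:Lam" "x = Ps f" unfolding weyl_Gamma_def generated_by_h by blast
	have "f:Inv"
	proof (rule InvI[OF Lam_P[OF f(1)]])
		fix p assume p: "p permutes {..<n}"
		have "Ps (permP p f) = Ps f" using weyl_perm_Ps[OF p Lam_P[OF f(1)]] x p f(2) by (simp add: weyl_Gamma_def)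
		then show "permP p f = f" by (rule Ps_inj[OF permP_closed[OF p Lam_P[OF f(1)]] Lam_P[OF f(1)]])
	qed
	then show "x:Ps ` Gam" using GamI[OF f(1)] f(2) by blast
next
	fix x assume "x:Ps ` Gam"
	then obtain f where f: "f:Gam" "x = Ps f" by blast
	have "weyl_perm p x = x" if "p permutes {..<n}" for p
		unfolding f(2) weyl_perm_Ps[OF that Inv_P[OF Gam_Inv[OF f(1)]]] Inv_perm[OF Gam_Inv[OF f(1)] that] ..
	then show "x:AG" unfolding weyl_Gamma_def generated_by_h using f Gam_Lam by blast
qed

lemma weyl_inv_subring: "subring (AI) A"
proof (rule AR.subringI)
	have h: "weyl_perm p:ring_hom A A" if "p permutes {..<n}" for p by (rule weyl_perm_hom[OF that])
	show "AI \<subseteq> cA" by (auto simp: weyl_inv_def)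
	show "\<one>A:AI" using rh1[OF h] by (simp add: weyl_inv_def)
	fix x assume x: "x:AI"
	then obtain f where f: "f:Inv" "x = Ps f" unfolding weyl_inv_Ps by blast
	show "\<ominus>A x:AI"
		unfolding weyl_inv_Ps f(2) Ps_neg[OF Inv_P[OF f(1)], symmetric] using subringE(5)[OF Inv_subring f(1)] by blast
	fix y assume y: "y:AI"
	show "x \<otimes>A y:AI" "x \<oplus>A y:AI"
		using x y rhm[OF h] rha[OF h] by (auto simp: weyl_inv_def)
qed

lemma U_subring: "subring U T"
proof -
	interpret H: ring_hom_ring A T Ph by (rule ring_hom_ringI2[OF A_ring T_ring Ph_hom])
	show ?thesis unfolding Ph_weyl_inv[symmetric] by (rule H.img_is_subring[OF weyl_inv_subring])
qed

lemma Gamma_inv: "AG \<subseteq> AI"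
	unfolding weyl_Gamma_Ps weyl_inv_Ps using Gam_Inv by blast

lemma U_generated:
	assumes char0: "\<forall>m::nat. m > 0 \<longrightarrow> [m] \<cdot>\<^bsub>k\<^esub> \<one> ~= \<zero>" and n: "0 < n"
	shows "\<exists>S. finite S & S \<subseteq> U & generate_ring T (emb ` io ` Gam \<union> S) = U"
proof -
	interpret H: ring_hom_ring A T Ph by (rule ring_hom_ringI2[OF A_ring T_ring Ph_hom])
	define S where "S = (%(g, d). Qs (rep (bg g) d)) ` ({GenX, GenY} \<times> {..n})"
	have S: "Qs (rep (bg g) d):S" if "d \<le> n" for g d using that by (cases g) (auto simp: S_def)
	have SI: "S \<subseteq> AI" unfolding S_def using Qs_inv[OF rep_TM[OF bg_closed]] by auto
	have finS: "finite (Ph ` S)" by (simp add: S_def)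
	have SU: "Ph ` S \<subseteq> U" using SI unfolding Ph_weyl_inv[symmetric] by blast
	have GU: "emb ` io ` Gam \<subseteq> U"
	proof
		fix x assume "x:emb ` io ` Gam"
		then obtain c where c: "c:Gam" "x = emb (io c)" by blast
		have "x = Ph (Ps c)" using c Ph_Ps_Lam[OF Gam_Lam[OF c(1)]] by simp
		then show "x:U" unfolding Ph_weyl_inv[symmetric] weyl_inv_Ps using Gam_Inv[OF c(1)] by blast
	qed
	let ?E = "emb ` io ` Gam \<union> Ph ` S"
	have EU: "?E \<subseteq> U" using SU GU by blast
	then have ET: "?E \<subseteq> cT" using subringE(1)[OF U_subring] by blast
	have gs: "subring (generate_ring T ?E) T" by (rule TR.generate_ring_is_subring[OF ET])
	define R where "R = {x:carrier A. Ph x:generate_ring T ?E}"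
	have R: "subring R A"
	proof (rule AR.subringI)
		show "\<one>A:R" using subringE(3)[OF gs] by (simp add: R_def)
		show "\<ominus>A x:R" if "x:R" for x using that subringE(5)[OF gs] by (simp add: R_def)
		show "x \<otimes>A y:R" "x \<oplus>A y:R" if "x:R" "y:R" for x y
			using that subringE(6)[OF gs] subringE(7)[OF gs] by (simp_all add: R_def)
	qed (auto simp: R_def)
	have "AG \<subseteq> R"
	proof
		fix x assume "x:AG"
		then obtain c where c: "c:Gam" "x = Ps c" unfolding weyl_Gamma_Ps by blast
		have "Ph x:?E" unfolding c(2) Ph_Ps_Lam[OF Gam_Lam[OF c(1)]] using c(1) by blast
		then show "x:R" using Ps_closed[OF Lam_P[OF Gam_Lam[OF c(1)]]] c(2) by (auto simp: R_def intro: generate_ring.incl)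
	qed
	moreover have "Qs (rep (bg g) d):R" if "d \<le> n" for g d
		using S[OF that, of g] Qs_closed[OF rep_TM[OF bg_closed]] by (auto simp: R_def intro: generate_ring.incl)
	ultimately have sub: "AI \<subseteq> R" by (intro weyl_inv_generated[OF char0 R _ n])
	have "generate_ring T ?E = U"
	proof (intro equalityI)
		show "generate_ring T ?E \<subseteq> U" by (rule TR.generate_ring_min_subring1[OF ET U_subring EU])
		show "U \<subseteq> generate_ring T ?E" using sub unfolding Ph_weyl_inv[symmetric] R_def by blast
	qed
	then show ?thesis using finS SU by blast
qed

text \<open>Collects the finite generation, the two spans and the order conditions.\<close>

lemma galois_order_U:
	assumes char0: "\<forall>m::nat. m > 0 \<longrightarrow> [m] \<cdot>\<^bsub>k\<^esub> \<one> ~= \<zero>" and n: "0 < n"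
	shows "galois_order L Cst (io ` Gam) Mon U"
proof -
	have GU: "emb ` io ` Gam \<subseteq> U"
	proof
		fix x assume "x:emb ` io ` Gam"
		then obtain c where c: "c:Gam" "x = emb (io c)" by blast
		have "x = Ph (Ps c)" using c Ph_Ps_Lam[OF Gam_Lam[OF c(1)]] by simp
		then show "x:U" unfolding Ph_weyl_inv[symmetric] weyl_inv_Ps using Gam_Inv[OF c(1)] by blast
	qed
	have USI: "U \<subseteq> SI" using U_iff by blast
	have "galois_ring L Cst (io ` Gam) Mon U"
		unfolding galois_ring_def by (intro conjI setting U_subring GU USI U_generated[OF char0 n] prod_spans)
	moreover have "fg_module (T\<lparr>carrier := emb ` io ` Gam\<rparr>) (left_module T (W \<inter> U))"
		if "W \<subseteq> SI & fin_dim_space (T\<lparr>carrier := emb ` K\<rparr>) (left_module T W)" for W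
		using order_condition[of W False] that unfolding sided_module_def by simp
	moreover have "fg_module (T\<lparr>carrier := emb ` io ` Gam\<rparr>) (right_module T (W \<inter> U))"
		if "W \<subseteq> SI & fin_dim_space (T\<lparr>carrier := emb ` K\<rparr>) (right_module T W)" for W
		using order_condition[of W True] that unfolding sided_module_def by simp
	ultimately show ?thesis
		unfolding galois_order_def left_galois_order_def right_galois_order_def by blast
qed

lemma Gamma_domain: "domain (A\<lparr>carrier := AG\<rparr>)"
	unfolding weyl_Gamma_Ps
proof (rule ring_image(1)[OF P.S.ring_axioms A_ring _ Gam_subring])
	show "Gam \<subseteq> cP" using Gam_Lam Lam_P by blast
	show "Ps:Gam \<rightarrow> cA" using Ps_closed Gam_Lam Lam_P by blast
	show "inj_on Ps Gam" by (rule inj_onI, rule Ps_inj) simp_all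
	show "Ps (x \<otimes>P y) = Ps x \<otimes>A Ps y" if "x:Gam" "y:Gam" for x y using Ps_mult[of x y] that by simp
	show "Ps (x \<oplus>P y) = Ps x \<oplus>A Ps y" if "x:Gam" "y:Gam" for x y using Ps_add[of x y] that by simp
	show "domain (P\<lparr>carrier := Gam\<rparr>)" by (rule P.subring_is_domain[OF Gam_subring])
qed (rule Ps_one Ps_zero)+

lemma const_field: "field (A\<lparr>carrier := wc ` carrier k\<rparr>)"
proof (rule ring_image(2)[OF ring_axioms A_ring order_refl carrier_is_subring])
	show "wc:carrier k \<rightarrow> cA" using wc_closed by blast
	show "inj_on wc (carrier k)"
	proof (rule inj_onI)
		fix c d assume cd: "c:carrier k" "d:carrier k" "wc c = wc d"
		then have "const c = const d" using Ps_inj[of "const c" "const d"] const_closed Ps_const by simp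
		from fun_cong[OF this, of 0] show "c = d" by (simp add: const_def skew_single_def)
	qed
	show "field (k\<lparr>carrier := carrier k\<rparr>)" using field_axioms by simp
qed (use rhm[OF wc_hom] rha[OF wc_hom] rh1[OF wc_hom] rh0[OF wc_hom ring_axioms A_ring] in auto)

lemma wc_central: assumes c: "c:carrier k" and x: "x:cA" shows "wc c \<otimes>A x = x \<otimes>A wc c"
proof (rule Ph_inj)
	note w = wc_closed[OF c]
	have "Ph (wc c) = uT c" unfolding Ps_const[OF c, symmetric] Ph_Ps_Lam[OF const_Lam[OF c]] mi_emb ..
	then show "Ph (wc c \<otimes>A x) = Ph (x \<otimes>A wc c)"
		unfolding rhm[OF Ph_hom w x] rhm[OF Ph_hom x w] using uT_central[OF c rhc[OF Ph_hom x]] by simp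
	show "wc c \<otimes>A x:cA" "x \<otimes>A wc c:cA" using w x by simp_all
qed

lemma const_Gamma: "wc ` carrier k \<subseteq> AG"
proof -
	have "wc c:Ps ` Gam" if c: "c:carrier k" for c unfolding Ps_const[OF c, symmetric] using const_Gam[OF c] by blast
	then show ?thesis unfolding weyl_Gamma_Ps by blast
qed

lemma invariants_isomorphism:
	obtains io' where "io':ring_hom (A\<lparr>carrier := AG\<rparr>) L" "inj_on io' (AG)"
		"io' ` wc ` carrier k = Cst" "io' ` AG = io ` Gam"
		"Ph:ring_iso (A\<lparr>carrier := AI\<rparr>) (T\<lparr>carrier := U\<rparr>)"
		"\<forall>g\<in>AG. Ph g = emb (io' g)"
proof -
	define io' where "io' x = io (inv_into Lam Ps x)" for x
	have inj: "inj_on Ps Lam" by (rule inj_onI, rule Ps_inj) simp_all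
	have e: "io' (Ps c) = io c" if "c:Lam" for c unfolding io'_def using inv_into_f_f[OF inj that] by simp
	have "io':ring_hom (A\<lparr>carrier := AG\<rparr>) L"
	proof (rule ring_hom_memI)
		fix x y assume "x:carrier (A\<lparr>carrier := AG\<rparr>)" "y:carrier (A\<lparr>carrier := AG\<rparr>)"
		then obtain c d where cd: "c:Gam" "x = Ps c" "d:Gam" "y = Ps d" unfolding weyl_Gamma_Ps by auto
		have L: "c:Lam" "d:Lam" using cd by simp_all
		have m: "x \<otimes>A y = Ps (c \<otimes>P d)" "x \<oplus>A y = Ps (c \<oplus>P d)"
			unfolding cd(2,4) Ps_mult[OF L(1) Lam_P[OF L(2)]] Ps_add[OF Lam_P[OF L(1)] Lam_P[OF L(2)]] by (rule refl)+
		have s: "io' x = io c" "io' y = io d" unfolding cd(2,4) using e L by blast+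
		show "io' x:cL" unfolding s using io_closed L by blast
		show "io' (x \<otimes>\<^bsub>A\<lparr>carrier := AG\<rparr>\<^esub> y) = io' x \<otimes>L io' y"
			using m(1) e[OF Lam_mult[OF L]] io_mult[OF L] s by simp
		show "io' (x \<oplus>\<^bsub>A\<lparr>carrier := AG\<rparr>\<^esub> y) = io' x \<oplus>L io' y"
			using m(2) e[OF Lam_add[OF L]] io_add[OF L] s by (simp del: P.add_S)
	next
		show "io' \<one>\<^bsub>A\<lparr>carrier := AG\<rparr>\<^esub> = \<one>L" using e[OF Lam_one] Ps_one io_one by simp
	qed
	moreover have "inj_on io' (AG)"
	proof (rule inj_onI)
		fix x y assume "x:AG" "y:AG" "io' x = io' y"
		then obtain c d where cd: "c:Gam" "x = Ps c" "d:Gam" "y = Ps d" "io' (Ps c) = io' (Ps d)" unfolding weyl_Gamma_Ps by blast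
		have "io c = io d" using cd(5) unfolding e[OF Gam_Lam[OF cd(1)]] e[OF Gam_Lam[OF cd(3)]] .
		then show "x = y" using io_eq[OF Gam_Lam[OF cd(1)] Gam_Lam[OF cd(3)]] cd(2,4) by simp
	qed
	moreover have "io' ` wc ` carrier k = Cst"
		unfolding image_image
	proof (rule image_cong)
		show "io' (wc c) = io (const c)" if "c:carrier k" for c using e[OF const_Lam[OF that]] unfolding Ps_const[OF that] .
	qed simp
	moreover have "io' ` AG = io ` Gam"
		unfolding weyl_Gamma_Ps image_image by (rule image_cong) (use e in auto)
	moreover have "Ph:ring_iso (A\<lparr>carrier := AI\<rparr>) (T\<lparr>carrier := U\<rparr>)"
	proof (rule ring_iso_memI)
		have s: "x:cA" if "x:AI" for x using that by (simp add: weyl_inv_def)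
		fix x y assume "x:carrier (A\<lparr>carrier := AI\<rparr>)" "y:carrier (A\<lparr>carrier := AI\<rparr>)"
		then have xy: "x:AI" "y:AI" by simp_all
		show "Ph x:carrier (T\<lparr>carrier := U\<rparr>)" using xy Ph_weyl_inv by auto
		show "Ph (x \<otimes>\<^bsub>A\<lparr>carrier := AI\<rparr>\<^esub> y) = Ph x \<otimes>\<^bsub>T\<lparr>carrier := U\<rparr>\<^esub> Ph y"
			using rhm[OF Ph_hom s[OF xy(1)] s[OF xy(2)]] by simp
		show "Ph (x \<oplus>\<^bsub>A\<lparr>carrier := AI\<rparr>\<^esub> y) = Ph x \<oplus>\<^bsub>T\<lparr>carrier := U\<rparr>\<^esub> Ph y"
			using rha[OF Ph_hom s[OF xy(1)] s[OF xy(2)]] by simp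
	next
		show "Ph \<one>\<^bsub>A\<lparr>carrier := AI\<rparr>\<^esub> = \<one>\<^bsub>T\<lparr>carrier := U\<rparr>\<^esub>" using rh1[OF Ph_hom] by simp
		have "inj_on Ph (AI)" by (rule inj_onI, rule Ph_inj) (simp_all add: weyl_inv_def)
		then show "bij_betw Ph (carrier (A\<lparr>carrier := AI\<rparr>)) (carrier (T\<lparr>carrier := U\<rparr>))"
			using Ph_weyl_inv by (simp add: bij_betw_def)
	qed
	moreover have "\<forall>g\<in>AG. Ph g = emb (io' g)"
	proof
		fix g assume "g:AG"
		then obtain c where c: "c:Gam" "g = Ps c" unfolding weyl_Gamma_Ps by blast
		show "Ph g = emb (io' g)" unfolding c(2) Ph_Ps_Lam[OF Gam_Lam[OF c(1)]] e[OF Gam_Lam[OF c(1)]] ..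
	qed
	ultimately show ?thesis using that by blast
qed

text \<open>The basis of the symmetric elements of \<open>P\<close> is transported along \<open>Th s\<close>, once for each side.\<close>

lemma invariants_free: "free_module (A\<lparr>carrier := AG\<rparr>) (sided_module s A (AI))"
proof -
	let ?W = "AI" and ?G = "AG"
	have WA: "x:cA" if "x:?W" for x using that by (simp add: weyl_inv_def)
	define F where "F g = inv_into ?W Ph (Th s g)" for g
	have F: "F g:?W" "Ph (F g) = Th s g" if "g:Inv" for g
	proof -
		have "Th s g:Ph ` ?W" using that unfolding Ph_weyl_inv U_Th[of s] by blast
		then show "F g:?W" "Ph (F g) = Th s g" unfolding F_def by (rule inv_into_into, rule f_inv_into_f)
	qed
	have Feq: "F g = x" if "g:Inv" "x:?W" "Th s g = Ph x" for g x
		using Ph_inj[OF WA[OF F(1)[OF that(1)]] WA[OF that(2)]] F(2)[OF that(1)] that(3) by simp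
	have mod: "module (A\<lparr>carrier := ?G\<rparr>) (sided_module s A ?W)"
	proof (rule AR.sided_module_module)
		show "?W \<subseteq> cA" using WA by blast
		show "\<zero>A:?W" "!!x y. x:?W ==> y:?W ==> x \<oplus>A y:?W" "!!x. x:?W ==> \<ominus>A x:?W"
			using subringE[OF weyl_inv_subring] by blast+
		show "?G \<subseteq> cA" using Gamma_inv WA by blast
		show "cring (A\<lparr>carrier := ?G\<rparr>)" by (rule domain.axioms(1)[OF Gamma_domain])
		show "sided_mult s A g x:?W" if "g:?G" "x:?W" for g x
			using that Gamma_inv subringE(6)[OF weyl_inv_subring] unfolding sided_mult_def by (cases s) auto
	qed
	have basis: "basis \<subseteq> Inv" "module_span PGam (left_module P Inv) basis = Inv" "module_indep PGam (left_module P Inv) basis"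
		using Inv_free unfolding module_basis_def by (simp_all add: left_module_def)
	have lm: "carrier (left_module P Inv) = Inv" "(\<oplus>\<^bsub>left_module P Inv\<^esub>) = (\<oplus>P)" "\<zero>\<^bsub>left_module P Inv\<^esub> = \<zero>P" "!!c v. c \<odot>\<^bsub>left_module P Inv\<^esub> v = c \<otimes>P v"
		by (simp_all add: left_module_def)
	have I0: "\<zero>P:Inv" by (rule subringE(2)[OF Inv_subring])
	have Fadd: "F (v \<oplus>P w) = F v \<oplus>A F w" if v: "v:Inv" and w: "w:Inv" for v w
	proof (rule Feq)
		show "v \<oplus>P w:Inv" by (rule subringE(7)[OF Inv_subring v w])
		show "F v \<oplus>A F w:?W" by (rule subringE(7)[OF weyl_inv_subring F(1)[OF v] F(1)[OF w]])
		show "Th s (v \<oplus>P w) = Ph (F v \<oplus>A F w)"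
			unfolding rha[OF Ph_hom WA[OF F(1)[OF v]] WA[OF F(1)[OF w]]] F(2)[OF v] F(2)[OF w]
			by (rule Th_add[OF Inv_P[OF v] Inv_P[OF w]])
	qed
	have F0: "F \<zero>P = \<zero>A"
	proof -
		have "F \<zero>P \<oplus>A F \<zero>P = F \<zero>P" using Fadd[OF I0 I0] P.S.l_zero[OF P.S.zero_closed] by simp
		then show ?thesis using AR.add.r_cancel_one[OF WA[OF F(1)[OF I0]] WA[OF F(1)[OF I0]]] by simp
	qed
	have Flin: "F (c \<otimes>P v) = sided_mult s A (Ps c) (F v)" if c: "c:Gam" and v: "v:Inv" for c v
	proof (rule Feq)
		have cG: "Ps c:?W" using Gamma_inv c unfolding weyl_Gamma_Ps by blast
		show "c \<otimes>P v:Inv" by (rule Gam_Inv_mult[OF c v])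
		show "sided_mult s A (Ps c) (F v):?W"
			using subringE(6)[OF weyl_inv_subring] cG F(1)[OF v] unfolding sided_mult_def by (cases s) auto
		have "Ph (sided_mult s A (Ps c) (F v)) = sided_mult s T (emb (io c)) (Th s v)"
			using rhm[OF Ph_hom] WA[OF cG] WA[OF F(1)[OF v]] F(2)[OF v] Ph_Ps_Lam[OF Gam_Lam[OF c]]
			unfolding sided_mult_def by (cases s) simp_all
		then show "Th s (c \<otimes>P v) = Ph (sided_mult s A (Ps c) (F v))" using Th_smult[OF Gam_Lam[OF c] Inv_P[OF v]] by simp
	qed
	have Finj: "inj_on F Inv"
	proof (rule inj_onI)
		fix v w assume vw: "v:Inv" "w:Inv" "F v = F w"
		then have "Th s v = Th s w" using F(2) by metis
		then show "v = w" by (rule Th_inj[OF Inv_P[OF vw(1)] Inv_P[OF vw(2)]])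
	qed
	have Ps0: "Ps c = \<zero>A \<longleftrightarrow> c = \<zero>P" if "c:Gam" for c
		using Ps_inj[OF Lam_P[OF Gam_Lam[OF that]] P.S.zero_closed] Ps_zero by metis
	have c1: "!!v. v:carrier (left_module P Inv) ==> F v:carrier (sided_module s A ?W)"
		and c2: "inj_on F (carrier (left_module P Inv))" and c3: "F \<zero>\<^bsub>left_module P Inv\<^esub> = \<zero>\<^bsub>sided_module s A ?W\<^esub>"
		and c4: "!!v w. v:carrier (left_module P Inv) ==> w:carrier (left_module P Inv) ==> F (v \<oplus>\<^bsub>left_module P Inv\<^esub> w) = F v \<oplus>\<^bsub>sided_module s A ?W\<^esub> F w"
		and c8: "basis \<subseteq> carrier (left_module P Inv)"
		unfolding lm sided_module_simps using F(1) Finj F0 Fadd basis(1) by blast+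
	have c5: "Ps ` carrier PGam = carrier (A\<lparr>carrier := ?G\<rparr>)" by (simp add: weyl_Gamma_Ps)
	have c6: "!!c. c:carrier PGam ==> Ps c = \<zero>\<^bsub>A\<lparr>carrier := ?G\<rparr>\<^esub> \<longleftrightarrow> c = \<zero>\<^bsub>PGam\<^esub>" using Ps0 by simp
	have c7: "!!c v. c:carrier PGam ==> v:carrier (left_module P Inv) ==> F (c \<odot>\<^bsub>left_module P Inv\<^esub> v) = Ps c \<odot>\<^bsub>sided_module s A ?W\<^esub> F v"
		unfolding lm sided_module_simps using Flin by simp
	note sb = semilinear_span_basis[OF Inv_module mod c1 c2 c3 c4 c5 c6 c7 c8]
	have span: "module_span (A\<lparr>carrier := ?G\<rparr>) (sided_module s A ?W) (F ` basis) = F ` module_span PGam (left_module P Inv) basis"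
		by (rule sb(1)) assumption+
	have ind: "module_indep (A\<lparr>carrier := ?G\<rparr>) (sided_module s A ?W) (F ` basis)"
		by (rule sb(2)) (assumption | rule basis(3))+
	have surj: "F ` Inv = ?W"
	proof (intro equalityI subsetI)
		fix x assume x: "x:?W"
		then have "Ph x:Th s ` Inv" unfolding U_Th[of s, symmetric] Ph_weyl_inv[symmetric] by blast
		then obtain g where g: "g:Inv" "Ph x = Th s g" by blast
		have "F g = x" by (rule Feq[OF g(1) x g(2)[symmetric]])
		then show "x:F ` Inv" using g(1) by blast
	qed (use F(1) in blast)
	have "module_basis (A\<lparr>carrier := ?G\<rparr>) (sided_module s A ?W) (F ` basis)"
		unfolding module_basis_def span basis(2) surj using ind basis(1) F(1) by auto
	then show ?thesis unfolding free_module_def using mod by blast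
qed

end

text \<open>The functions on \<open>expon\<close> embed into the type that carries the Weyl algebra.\<close>

lemma expon_functions_embed: "\<exists>j :: (expon => 'k) => 'k weyl. inj j"
proof -
	define enc :: "expon => nat => (wgen list => 'k) set" where
		"enc d m = (if \<exists>i. m = to_nat (i, d i) then UNIV else {})" for d m
	have "inj enc"
	proof (rule injI)
		fix d d' :: expon assume "enc d = enc d'"
		then have e: "enc d m = enc d' m" for m by simp
		show "d = d'"
		proof
			fix i
			have "\<exists>l. to_nat (i, d i) = to_nat (l, d' l)"
				using e[of "to_nat (i, d i)"] by (auto simp: enc_def split: if_splits)
			then show "d i = d' i" by simp
		qed
	qed
	then have dec: "inv_into UNIV enc (enc d) = d" for d by (rule inv_f_f)
	have "inj (%f :: expon => 'k. {%t. f (inv_into UNIV enc t)})"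
	proof (rule injI)
		fix f g :: "expon => 'k" assume "{%t. f (inv_into UNIV enc t)} = {%t. g (inv_into UNIV enc t)}"
		then have "(%t. f (inv_into UNIV enc t)) = (%t. g (inv_into UNIV enc t))" by blast
		then have e: "f (inv_into UNIV enc t) = g (inv_into UNIV enc t)" for t by (rule fun_cong)
		show "f = g"
		proof
			fix d
			show "f d = g d" using e[of "enc d"] unfolding dec .
		qed
	qed
	then show ?thesis by blast
qed

theorem theorem8:
  fixes k :: "('k, 'r) ring_scheme" and q :: 'k and n :: nat
  assumes "algebraically_closed k"
    and "\<forall>m::nat. m > 0 \<longrightarrow> [m] \<cdot>\<^bsub>k\<^esub> \<one>\<^bsub>k\<^esub> \<noteq> \<zero>\<^bsub>k\<^esub>"
    and "q \<in> carrier k" and "q \<noteq> \<zero>\<^bsub>k\<^esub>"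
    and "\<forall>m::nat. m > 0 \<longrightarrow> q [^]\<^bsub>k\<^esub> m \<noteq> \<one>\<^bsub>k\<^esub>"
    and "n \<ge> 1"
  shows "galois_order_over ((weyl k q n)\<lparr>carrier := weyl_inv k q n\<rparr>)
           (weyl_const k q n ` carrier k) (weyl_Gamma k q n)
       \<and> free_module ((weyl k q n)\<lparr>carrier := weyl_Gamma k q n\<rparr>)
           (left_module (weyl k q n) (weyl_inv k q n))
       \<and> free_module ((weyl k q n)\<lparr>carrier := weyl_Gamma k q n\<rparr>)
           (right_module (weyl k q n) (weyl_inv k q n))"
proof -
	interpret k: algebraically_closed k by (rule assms(1))
	interpret ql: qlaurent k n q
		by (intro qlaurent.intro laurent.intro qlaurent_axioms.intro k.field_axioms assms(3-5))
	let ?P = "monoid_algebra k (expo n)" and ?Lam = "laurent.Lam k n"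
	obtain j :: "(expon => 'k) => 'k weyl" where j: "inj j" using expon_functions_embed by blast
	have dom: "domain (?P\<lparr>carrier := ?Lam\<rparr>)" by (rule ql.P.subring_is_domain[OF ql.Lam_subring])
	interpret fc: fraction_classes "?P\<lparr>carrier := ?Lam\<rparr>" j
		by (intro fraction_classes.intro dom fraction_classes_axioms.intro inj_on_subset[OF j]) simp
	let ?L = "fc.FF" and ?io = "%a. fc.cls a \<one>\<^bsub>?P\<lparr>carrier := ?Lam\<rparr>\<^esub>"
	interpret gl: galois_laurent k n q ?L ?io
		by (intro galois_laurent.intro ql.qlaurent_axioms fc.fractions_FF)
	have n: "0 < n" using assms(6) by simp
	let ?A = "weyl k q n" and ?W = "weyl_inv k q n" and ?C = "weyl_const k q n ` carrier k" and ?G = "weyl_Gamma k q n"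
	let ?AW = "?A\<lparr>carrier := ?W\<rparr>"
	have ringW: "ring ?AW" by (rule gl.AR.subring_is_ring[OF gl.weyl_inv_subring])
	have CG: "?C \<subseteq> ?G" by (rule gl.const_Gamma)
	have GW: "?G \<subseteq> ?W" by (rule gl.Gamma_inv)
	have subC: "subfield ?C ?AW"
		by (rule ring.subfield_iff(1)[OF ringW]) (use gl.const_field CG GW in auto)
	have subG: "subdomain ?G ?AW"
		using ring.subdomain_iff[OF ringW, of ?G] gl.Gamma_domain GW by simp
	have central: "\<forall>c\<in>?C. \<forall>a\<in>carrier ?AW. c \<otimes>\<^bsub>?AW\<^esub> a = a \<otimes>\<^bsub>?AW\<^esub> c"
		using gl.wc_central by (auto simp: weyl_inv_def)
	obtain io' where io': "io':ring_hom (?A\<lparr>carrier := ?G\<rparr>) ?L" "inj_on io' ?G" "io' ` ?C = gl.Cst" "io' ` ?G = ?io ` ql.Gam"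
		"gl.Ph:ring_iso ?AW ((aut_skew_ring ?L gl.Mon)\<lparr>carrier := gl.U\<rparr>)" "\<forall>g\<in>?G. gl.Ph g = skew_embed ?L (io' g)"
		by (rule gl.invariants_isomorphism)
	have order: "galois_order ?L (io' ` ?C) (io' ` ?G) gl.Mon gl.U"
		unfolding io'(3,4) by (rule gl.galois_order_U[OF assms(2) n])
	have "galois_order_over ?AW ?C ?G"
		unfolding galois_order_over_def
	proof (intro conjI ringW subC central subG CG exI)
		show "io':ring_hom (?AW\<lparr>carrier := ?G\<rparr>) ?L" using io'(1) by simp
		show "\<forall>g\<in>?G. gl.Ph g = skew_embed ?L (io' g)" by (rule io'(6))
	qed (rule io' order)+
	then show ?thesis
		using gl.invariants_free[of False] gl.invariants_free[of True] unfolding sided_module_def by simp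
qed

end
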